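(* Let $I=[s_1,s_2]$ be an interval with $s_1>0$, and let $D=B(0,1)\subset\mathbb{R}^3$. For any $m>0$, any $\alpha>2m$ and any real $\sigma_1,\sigma_2$ there are constants $\beta>0$ and $N>0$ such that for any real-valued $v_0\in C^m(D)$ with $\|v_0\|_{L^\infty(D)}\le N$ and $\operatorname{supp} v_0\subset B(0,1/2)$, and any $\epsilon\in(0,N)$, there are real-valued potentials $v_1,v_2\in C^m(D)$, also supported in $B(0,1/2)$, such that $$\sup_{s\in I}\|f_1(\cdot,\cdot,s)-f_2(\cdot,\cdot,s)\|_{\sigma_1,\sigma_2}\le \exp\left(-\epsilon^{-1/\alpha}\right),$$ $$\|v_1-v_2\|_{L^\infty(D)}\ge\epsilon,$$ $$\|v_i-v_0\|_{L^\infty(D)}\le\epsilon,\qquad i=1,2,$$ $$\|v_i-v_0\|_{C^m(D)}\le\beta,\qquad i=1,2,$$ where $f_1,f_2$ are the scattering amplitudes for $v_1,v_2$, respectively, for the Schrödinger equation $-\Delta\psi+v\psi=E\psi$ on $\mathbb{R}^3$ (with $E=s^2$).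
   Context: $B(x,r)$ is the open ball in $\mathbb{R}^3$ of radius $r$ centered at $x$. Potentials supported in $D$ are extended by $0$ to $\mathbb{R}^3$. Scattering amplitude. Let $v\in L^\infty(\mathbb{R}^3)$ be real-valued with $v(x)=O(|x|^{-3-\varepsilon})$ as $|x|\to\infty$ for some $\varepsilon>0$ (in particular this holds for bounded $v$ supported in $D$). For every $k\in\mathbb{R}^3\setminus\{0\}$ the equation $-\Delta\psi+v(x)\psi=E\psi$, $x\in\mathbb{R}^3$, with $E=k^2=|k|^2$, has a unique continuous solution $\psi^+(x,k)$ with asymptotics $$\psi^+(x,k)=e^{ik\cdot x}-2\pi^2\frac{e^{i|k||x|}}{|x|}f\left(\frac{k}{|k|},\frac{x}{|x|},|k|\right)+o\left(\frac1{|x|}\right)\quad\text{as }|x|\to\infty,$$ uniformly in $x/|x|$, where for fixed $k$ the function $f(k/|k|,\omega,|k|)$ is continuous in $\omega\in S^2$. The function $f(\theta,\omega,s)$, $\theta,\omega\in S^2$, $s>0$, is called the scattering amplitude for $v$. Norm. Let $\{Y_j^p: j\ge0,\ 1\le p\le 2j+1\}$ be an orthonormal basis of $L^2(S^2)$ consisting of spherical harmonics, $Y_j^p$ being of degree $j$. For a function $f(\theta,\omega,s)$ expand $$f(\theta,\omega,s)=\sum_{j_1,p_1,j_2,p_2}a_{j_1p_1j_2p_2}(s)\,Y_{j_1}^{p_1}(\theta)\,Y_{j_2}^{p_2}(\omega),$$ the sum being over $j_1,j_2\ge0$, $1\le p_1\le 2j_1+1$, $1\le p_2\le 2j_2+1$.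 For real $\sigma_1,\sigma_2$ and $s>0$ put $$\|f(\cdot,\cdot,s)\|_{\sigma_1,\sigma_2}=\left\{\sum_{j_1,p_1,j_2,p_2}\left(\frac{2j_1+1}{es}\right)^{2j_1+2\sigma_1}\left(\frac{2j_2+1}{es}\right)^{2j_2+2\sigma_2}|a_{j_1p_1j_2p_2}(s)|^2\right\}^{1/2},$$ where $e$ is the base of natural logarithms. $C^m$ denotes the usual space of functions with bounded continuous derivatives up to order $m$ with its standard norm (understood in the Hölder sense if $m$ is not an integer). *)

theory Defs
  imports "HOL-Probability.Probability" "HOL-Library.Landau_Symbols"
begin

section \<open>Smoothness, Hoelder norms and supports\<close>

definition partial_deriv ::
    "3 \<Rightarrow> (real^3 \<Rightarrow> 'b::real_normed_vector) \<Rightarrow> real^3 \<Rightarrow> 'b" where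
  "partial_deriv i f x = frechet_derivative f (at x) (axis i 1)"

primrec iter_partial ::
    "3 list \<Rightarrow> (real^3 \<Rightarrow> 'b::real_normed_vector) \<Rightarrow> real^3 \<Rightarrow> 'b" where
  "iter_partial [] f = f"
| "iter_partial (i # is) f = partial_deriv i (iter_partial is f)"

definition laplacian :: "(real^3 \<Rightarrow> 'b::real_normed_vector) \<Rightarrow> real^3 \<Rightarrow> 'b" where
  "laplacian f x = (\<Sum>i\<in>UNIV. iter_partial [i, i] f x)"

text \<open>The next two definitions are meant for open D. Lists of indices stand for multi-indices: for
  functions of class \<open>C^k\<close> the order of differentiation is immaterial, so that the suprema over
  lists below agree with those over multi-indices.\<close>

definition C_k_on :: "nat \<Rightarrow> (real^3) set \<Rightarrow> (real^3 \<Rightarrow> 'b::real_normed_vector) \<Rightarrow> bool" where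
  "C_k_on k D f \<longleftrightarrow>
     (\<forall>is. length is < k \<longrightarrow> (\<forall>x\<in>D. iter_partial is f differentiable (at x))) \<and>
     (\<forall>is. length is \<le> k \<longrightarrow> continuous_on D (iter_partial is f))"

text \<open>With k the integer part of m: the sup-norm of all derivatives of order at most k, plus, if m is
  not an integer, the Hoelder seminorm with exponent \<open>m - k\<close> of the derivatives of order k.\<close>

definition C_m_norm :: "real \<Rightarrow> (real^3) set \<Rightarrow> (real^3 \<Rightarrow> real) \<Rightarrow> ennreal" where
  "C_m_norm m D f =
     (SUP is\<in>{is. length is \<le> nat \<lfloor>m\<rfloor>}. SUP x\<in>D. ennreal \<bar>iter_partial is f x\<bar>) +
     (if frac m = 0 then 0
      else SUP is\<in>{is. length is = nat \<lfloor>m\<rfloor>}. SUP (x, y)\<in>{(x, y). x \<in> D \<and> y \<in> D \<and> x \<noteq> y}.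
             ennreal (\<bar>iter_partial is f x - iter_partial is f y\<bar> / dist x y powr frac m))"

definition C_m :: "real \<Rightarrow> (real^3) set \<Rightarrow> (real^3 \<Rightarrow> real) set" where
  "C_m m D = {f. C_k_on (nat \<lfloor>m\<rfloor>) D f \<and> C_m_norm m D f < \<infinity>}"

definition Linf_norm :: "(real^3) set \<Rightarrow> (real^3 \<Rightarrow> real) \<Rightarrow> ereal" where
  "Linf_norm D f = esssup (lebesgue_on D) (\<lambda>x. ereal \<bar>f x\<bar>)"

text \<open>Potentials are total functions on the whole space; a potential supported in an open ball inside
  D, in the sense of this closed support, vanishes outside D.\<close>

definition supp :: "(real^3 \<Rightarrow> 'b::zero) \<Rightarrow> (real^3) set" where
  "supp f = closure {x. f x \<noteq> 0}"

section \<open>The scattering amplitude\<close>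

definition test_function :: "(real^3 \<Rightarrow> real) \<Rightarrow> bool" where
  "test_function \<phi> \<longleftrightarrow> (\<forall>k. C_k_on k UNIV \<phi>) \<and> compact (supp \<phi>)"

text \<open>Potentials are merely bounded in general, so \<open>-\<Delta>\<psi> + v\<psi> = E\<psi>\<close> is understood in the sense of
  distributions.\<close>

definition schroedinger_solution ::
    "(real^3 \<Rightarrow> real) \<Rightarrow> real \<Rightarrow> (real^3 \<Rightarrow> complex) \<Rightarrow> bool" where
  "schroedinger_solution v E \<psi> \<longleftrightarrow>
     (\<forall>\<phi>. test_function \<phi> \<longrightarrow>
        has_bochner_integral lebesgue
          (\<lambda>x. \<psi> x * complex_of_real (- laplacian \<phi> x + v x * \<phi> x - E * \<phi> x)) 0)"

text \<open>\<open>f \<theta> \<omega> s\<close> is only meaningful, and uniquely determined by v, for unit vectors \<theta>, \<omega> and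
  \<open>s > 0\<close>. The remainder along \<^const>\<open>at_infinity\<close> is uniform in the direction of x; note that
  \<open>sgn x\<close> is \<open>x / |x|\<close>.\<close>

definition scattering_amplitude ::
    "(real^3 \<Rightarrow> real) \<Rightarrow> (real^3 \<Rightarrow> real^3 \<Rightarrow> real \<Rightarrow> complex) \<Rightarrow> bool" where
  "scattering_amplitude v f \<longleftrightarrow>
     (\<forall>k::real^3. k \<noteq> 0 \<longrightarrow>
        continuous_on (sphere 0 1) (\<lambda>\<omega>. f (sgn k) \<omega> (norm k)) \<and>
        (\<exists>\<psi>. continuous_on UNIV \<psi> \<and>
             schroedinger_solution v ((norm k)\<^sup>2) \<psi> \<and>
             (\<lambda>x. \<psi> x - (exp (\<i> * complex_of_real (k \<bullet> x)) -
                     2 * complex_of_real pi ^ 2 *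
                     (exp (\<i> * complex_of_real (norm k * norm x)) / complex_of_real (norm x)) *
                     f (sgn k) (sgn x) (norm k)))
               \<in> o[at_infinity](\<lambda>x. complex_of_real (1 / norm x))))"

section \<open>Spherical harmonics and the weighted norm\<close>

text \<open>The surface measure of a set A of unit vectors is three times the volume of the cone
  \<open>{r x | x \<in> A, 0 < r < 1}\<close>; the total mass is \<open>4\<pi>\<close>.\<close>

definition sphere_measure :: "(real^3) measure" where
  "sphere_measure =
     scale_measure 3
       (distr (restrict_space lborel (ball 0 1 - {0})) (restrict_space borel (sphere 0 1)) sgn)"

definition homogeneous_polynomial :: "nat \<Rightarrow> (real^3 \<Rightarrow> complex) \<Rightarrow> bool" where
  "homogeneous_polynomial j P \<longleftrightarrow>
     (\<exists>c. \<forall>x. P x = (\<Sum>a\<le>j. \<Sum>b\<le>j - a.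
        c a b * complex_of_real ((x $ 1) ^ a * (x $ 2) ^ b * (x $ 3) ^ (j - a - b))))"

definition spherical_harmonic :: "nat \<Rightarrow> (real^3 \<Rightarrow> complex) \<Rightarrow> bool" where
  "spherical_harmonic j Y \<longleftrightarrow>
     (\<exists>P. homogeneous_polynomial j P \<and> (\<forall>x. laplacian P x = 0) \<and> (\<forall>x\<in>sphere 0 1. Y x = P x))"

text \<open>\<open>Y j p\<close> is relevant for \<open>1 \<le> p \<le> 2 j + 1\<close> only. The last clause says that the orthonormal
  system is complete in \<open>L\<^sup>2\<close> of the sphere.\<close>

definition spherical_harmonic_basis :: "(nat \<Rightarrow> nat \<Rightarrow> real^3 \<Rightarrow> complex) \<Rightarrow> bool" where
  "spherical_harmonic_basis Y \<longleftrightarrow>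
     (\<forall>j. \<forall>p\<in>{1..2*j+1}. spherical_harmonic j (Y j p)) \<and>
     (\<forall>j. \<forall>p\<in>{1..2*j+1}. \<forall>j'. \<forall>p'\<in>{1..2*j'+1}.
        (LINT x|sphere_measure. Y j p x * cnj (Y j' p' x)) = (if j = j' \<and> p = p' then 1 else 0)) \<and>
     (\<forall>g \<in> borel_measurable sphere_measure.
        integrable sphere_measure (\<lambda>x. (cmod (g x))\<^sup>2) \<longrightarrow>
        (\<forall>j. \<forall>p\<in>{1..2*j+1}. (LINT x|sphere_measure. g x * cnj (Y j p x)) = 0) \<longrightarrow>
        (AE x in sphere_measure. g x = 0))"

definition sph_coeff ::
    "(nat \<Rightarrow> nat \<Rightarrow> real^3 \<Rightarrow> complex) \<Rightarrow> (real^3 \<Rightarrow> real^3 \<Rightarrow> complex) \<Rightarrow>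
       nat \<Rightarrow> nat \<Rightarrow> nat \<Rightarrow> nat \<Rightarrow> complex" where
  "sph_coeff Y g j\<^sub>1 p\<^sub>1 j\<^sub>2 p\<^sub>2 =
     (LINT (\<theta>, \<omega>)|(sphere_measure \<Otimes>\<^sub>M sphere_measure).
        g \<theta> \<omega> * cnj (Y j\<^sub>1 p\<^sub>1 \<theta>) * cnj (Y j\<^sub>2 p\<^sub>2 \<omega>))"

text \<open>\<open>amp_norm Y \<sigma>\<^sub>1 \<sigma>\<^sub>2 s g\<close> is the norm of the function \<open>g = f(\<cdot>,\<cdot>,s)\<close>; the weights depend on s. The
  value is infinite if g is not square integrable or the series diverges.\<close>

definition amp_norm ::
    "(nat \<Rightarrow> nat \<Rightarrow> real^3 \<Rightarrow> complex) \<Rightarrow> real \<Rightarrow> real \<Rightarrow> real \<Rightarrow>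
       (real^3 \<Rightarrow> real^3 \<Rightarrow> complex) \<Rightarrow> ennreal" where
  "amp_norm Y \<sigma>\<^sub>1 \<sigma>\<^sub>2 s g =
     (let J = {(j\<^sub>1, p\<^sub>1, j\<^sub>2, p\<^sub>2). p\<^sub>1 \<in> {1..2*j\<^sub>1+1} \<and> p\<^sub>2 \<in> {1..2*j\<^sub>2+1}};
          w = (\<lambda>(j\<^sub>1, p\<^sub>1, j\<^sub>2, p\<^sub>2).
                 (real (2*j\<^sub>1+1) / (exp 1 * s)) powr (2 * real j\<^sub>1 + 2 * \<sigma>\<^sub>1) *
                 (real (2*j\<^sub>2+1) / (exp 1 * s)) powr (2 * real j\<^sub>2 + 2 * \<sigma>\<^sub>2) *
                 (cmod (sph_coeff Y g j\<^sub>1 p\<^sub>1 j\<^sub>2 p\<^sub>2))\<^sup>2)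
      in if case_prod g \<in> borel_measurable (sphere_measure \<Otimes>\<^sub>M sphere_measure) \<and>
            integrable (sphere_measure \<Otimes>\<^sub>M sphere_measure) (\<lambda>(\<theta>, \<omega>). (cmod (g \<theta> \<omega>))\<^sup>2) \<and>
            w summable_on J
         then ennreal (sqrt (\<Sum>\<^sub>\<infinity>i\<in>J. w i)) else \<infinity>)"

end

theory Submission
  imports Defs "HOL-Complex_Analysis.Complex_Analysis"
begin

text \<open>The proof compares numbers of potentials and of amplitudes. Adding to \<open>v\<^sub>0\<close> bumps of height \<open>\<epsilon>\<close> on
  an arbitrary subset of the cells of a grid of mesh about \<open>\<epsilon> powr (1 / m)\<close> gives
  \<open>2 ^ (M ^ 3)\<close> potentials with M about \<open>\<epsilon> powr (- 1 / m)\<close>; they are bounded in \<open>C\<^sup>m\<close> and pairwise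
  at distance \<open>\<epsilon>\<close>. For small potentials the Born series converges, the harmonic
  coefficients of the amplitude extend holomorphically to complex frequencies near \<open>[s\<^sub>1, s\<^sub>2]\<close>, and
  they decay so fast in the degrees that the weighted norm of the tail is geometrically small. Up to
  an error \<open>exp (- X)\<close> an amplitude is therefore determined by about \<open>X ^ 5\<close> Taylor coefficients
  rounded to about X bits. With \<open>X = \<epsilon> powr (- 1 / \<alpha>)\<close> and \<open>\<alpha> > 2 * m\<close> the exponent \<open>X ^ 6\<close> is
  smaller than \<open>M ^ 3\<close>, so two of the potentials share all rounded coefficients.\<close>

section \<open>Integration by parts\<close>

text \<open>The obstacle is the weight of the norm: in a degree j its square root is about
  \<open>((2*j+1)/(e*s))^j\<close>, of factorial growth, so analyticity of the amplitude on the
  sphere alone would not tame the tail. What does is that the potentials live in the ball of radius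
  1/2, while the weight is calibrated to radius 1. A moment of degree j of the plane wave with phase
  \<tau> \<theta>.y, where |y| < 1/2, is of size \<open>(|\<tau>|/4)^j / j!\<close>; against the
  weight at s = |\<tau>| this leaves about \<open>2^(-j)\<close>. The surplus pays for complex
  frequencies near a real centre, for the powers of j coming from the exponents \<sigma>, and for
  the \<open>2*j+1\<close> harmonics of degree j. Hence the care taken over a factor
  \<open>2^(-j)\<close> in approximating powers by polynomials. The exponent 5 in the count is 2 + 2
  + 1: there are n^2 harmonics of degree below n on each of the two spheres, and n Taylor
  coefficients at each of finitely many centres. With O(n) bits for each, two potentials collide
  once n^6, of order \<open>\<epsilon> powr (-6/\<alpha>)\<close>, is below
  \<open>\<epsilon> powr (-3/m)\<close>; this is the condition \<alpha> > 2m.\<close>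

lemma line_derivative_shift:
  fixes f :: "'a::real_normed_vector \<Rightarrow> 'b::real_normed_vector"
  assumes deriv: "\<And>x. ((\<lambda>t. f (x + t *\<^sub>R e)) has_vector_derivative f' x) (at 0)"
  shows "((\<lambda>t. f (x + t *\<^sub>R e)) has_vector_derivative f' (x + t *\<^sub>R e)) (at t)"
proof -
  have "((\<lambda>u. f ((x + t *\<^sub>R e) + u *\<^sub>R e)) has_vector_derivative f' (x + t *\<^sub>R e)) (at (t - t))"
    using deriv by simp
  moreover have "((\<lambda>r. r - t) has_vector_derivative 1) (at t)"
    by (auto intro!: derivative_eq_intros simp: has_real_derivative_iff_has_vector_derivative[symmetric])
  ultimately have "(((\<lambda>u. f ((x + t *\<^sub>R e) + u *\<^sub>R e)) \<circ> (\<lambda>r. r - t)) has_vector_derivative 1 *\<^sub>R f' (x + t *\<^sub>R e)) (at t)"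
    by (intro vector_diff_chain_at) auto
  then show ?thesis by (simp add: o_def algebra_simps)
qed

text \<open>The steps 1/(n+1) turn the derivative into a limit of a sequence, the form in which
  dominated convergence consumes it.\<close>

lemma line_difference_quotient:
  fixes f :: "'a::real_normed_vector \<Rightarrow> 'b::real_normed_vector"
  assumes "((\<lambda>t. f (x + t *\<^sub>R e)) has_vector_derivative D) (at 0)"
  shows "(\<lambda>n. real (Suc n) *\<^sub>R (f (x + (1 / real (Suc n)) *\<^sub>R e) - f x)) \<longlonglongrightarrow> D"
proof -
  have A: "((\<lambda>h. norm (f (x + h *\<^sub>R e) - f x - h *\<^sub>R D) / norm h) \<longlongrightarrow> 0) (at 0)"
    using assms unfolding has_vector_derivative_def has_derivative_at by simp
  have "filterlim (\<lambda>n. 1 / real (Suc n)) (at 0) sequentially"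
    unfolding filterlim_at using LIMSEQ_inverse_real_of_nat by (auto simp: inverse_eq_divide)
  from filterlim_compose[OF A this]
  have "(\<lambda>n. norm (f (x + (1 / real (Suc n)) *\<^sub>R e) - f x - (1 / real (Suc n)) *\<^sub>R D)
      / norm (1 / real (Suc n))) \<longlonglongrightarrow> 0" by simp
  moreover have "norm (f (x + (1 / real (Suc n)) *\<^sub>R e) - f x - (1 / real (Suc n)) *\<^sub>R D) / norm (1 / real (Suc n))
     = norm (real (Suc n) *\<^sub>R (f (x + (1 / real (Suc n)) *\<^sub>R e) - f x) - D)" for n
  proof -
    have "real (Suc n) *\<^sub>R (f (x + (1 / real (Suc n)) *\<^sub>R e) - f x) - D
      = real (Suc n) *\<^sub>R (f (x + (1 / real (Suc n)) *\<^sub>R e) - f x - (1 / real (Suc n)) *\<^sub>R D)"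
      by (simp add: scaleR_right_diff_distrib del: of_nat_Suc)
    then show ?thesis by (simp del: of_nat_Suc)
  qed
  ultimately have "(\<lambda>n. norm (real (Suc n) *\<^sub>R (f (x + (1 / real (Suc n)) *\<^sub>R e) - f x) - D)) \<longlonglongrightarrow> 0"
    by (simp only:)
  then show ?thesis
    by (simp only: tendsto_norm_zero_iff LIM_zero_iff)
qed

section \<open>Compactly supported integrands; translation and dilation of Lebesgue measure\<close>

lemma integrable_compact_support:
  fixes f :: "'a::euclidean_space \<Rightarrow> 'b::{banach,second_countable_topology}"
  assumes "continuous_on UNIV f" "\<And>x. R < norm x \<Longrightarrow> f x = 0"
  shows "integrable lborel f"
proof -
  have "integrable lborel (\<lambda>x. indicator (cball 0 R) x *\<^sub>R f x)"
    by (intro borel_integrable_compact continuous_on_subset[OF assms(1)]) auto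
  moreover have "(\<lambda>x. indicator (cball 0 R) x *\<^sub>R f x) = f"
    using assms(2) by (auto simp: indicator_def not_le fun_eq_iff)
  ultimately show ?thesis by simp
qed

lemma compact_support_bounded:
  fixes f :: "'a::euclidean_space \<Rightarrow> 'b::real_normed_vector"
  assumes "continuous_on UNIV f" "\<And>x. R < norm x \<Longrightarrow> f x = 0"
  obtains B where "B \<ge> 0" "\<And>x. norm (f x) \<le> B"
proof -
  obtain B where B: "\<And>x. x \<in> cball 0 R \<Longrightarrow> norm (f x) \<le> B"
    using compact_imp_bounded[OF compact_continuous_image[OF continuous_on_subset[OF assms(1)] compact_cball]]
    unfolding bounded_iff by (metis image_eqI subset_UNIV)
  have "norm (f x) \<le> max 0 B" for x
    using B[of x] assms(2)[of x] by (cases "norm x \<le> R") (auto simp: le_max_iff_disj)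
  then show ?thesis using that[of "max 0 B"] by simp
qed

lemma integral_lborel_shift:
  fixes f :: "'a::euclidean_space \<Rightarrow> 'b::{banach,second_countable_topology}"
  assumes [measurable]: "f \<in> borel_measurable borel"
  shows "(LINT x|lborel. f (c + x)) = (LINT x|lborel. f x)"
    and "integrable lborel (\<lambda>x. f (c + x)) \<longleftrightarrow> integrable lborel f"
proof -
  have "(LINT x|lborel. f x) = (LINT x|distr lborel borel ((+) c). f x)"
    by (simp add: lborel_distr_plus)
  also have "\<dots> = (LINT x|lborel. f (c + x))"
    by (subst integral_distr) auto
  finally show "(LINT x|lborel. f (c + x)) = (LINT x|lborel. f x)" by simp
  have "integrable lborel f \<longleftrightarrow> integrable (distr lborel borel ((+) c)) f"
    by (simp add: lborel_distr_plus)
  also have "\<dots> \<longleftrightarrow> integrable lborel (\<lambda>x. f (c + x))"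
    by (subst integrable_distr_eq) auto
  finally show "integrable lborel (\<lambda>x. f (c + x)) \<longleftrightarrow> integrable lborel f" by simp
qed

lemma integral_lborel_scale:
  fixes f :: "real^3 \<Rightarrow> 'b::{banach,second_countable_topology}"
  assumes [measurable]: "f \<in> borel_measurable borel" and c: "c > 0"
  shows "(LINT x|lborel. f x) = c ^ 3 *\<^sub>R (LINT x|lborel. f (c *\<^sub>R x))"
    and "integrable lborel (\<lambda>x. f (c *\<^sub>R x)) \<longleftrightarrow> integrable lborel f"
proof -
  have eq: "lborel = density (distr lborel borel (\<lambda>x::real^3. 0 + c *\<^sub>R x)) (\<lambda>_. \<bar>c\<bar>^DIM(real^3))"
    using c by (intro lborel_affine) auto
  have "(LINT x|lborel. f x) = (LINT x|density (distr lborel borel (\<lambda>x::real^3. 0 + c *\<^sub>R x)) (\<lambda>_. \<bar>c\<bar>^DIM(real^3)). f x)"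
    by (subst eq) (rule refl)
  also have "\<dots> = c ^ 3 *\<^sub>R (LINT x|lborel. f (c *\<^sub>R x))"
    using c by (subst integral_density) (auto simp: integral_distr)
  finally show "(LINT x|lborel. f x) = c ^ 3 *\<^sub>R (LINT x|lborel. f (c *\<^sub>R x))" .
  have "integrable lborel f \<longleftrightarrow> integrable (density (distr lborel borel (\<lambda>x::real^3. 0 + c *\<^sub>R x)) (\<lambda>_. \<bar>c\<bar>^DIM(real^3))) f"
    by (subst eq) (rule refl)
  also have "\<dots> \<longleftrightarrow> integrable lborel (\<lambda>x. c ^ 3 *\<^sub>R f (c *\<^sub>R x))"
    using c by (subst integrable_density) (auto simp: integrable_distr_eq)
  also have "\<dots> \<longleftrightarrow> integrable lborel (\<lambda>x. f (c *\<^sub>R x))"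
    using integrable_scaleR_right[of "1 / c ^ 3" lborel "\<lambda>x. c ^ 3 *\<^sub>R f (c *\<^sub>R x)"] c by auto
  finally show "integrable lborel (\<lambda>x. f (c *\<^sub>R x)) \<longleftrightarrow> integrable lborel f" by simp
qed

text \<open>The difference quotients of f have integral zero by translation invariance, and they
  converge pointwise to f'. Dominated convergence then gives the claim without iterated integrals.
  The second claim holds because f vanishes near every point outside the closed ball.\<close>

lemma integral_line_derivative_zero:
  fixes f f' :: "real^3 \<Rightarrow> complex" and e :: "real^3"
  assumes deriv: "\<And>x. ((\<lambda>t. f (x + t *\<^sub>R e)) has_vector_derivative f' x) (at 0)"
    and contf: "continuous_on UNIV f" and cont: "continuous_on UNIV f'"
    and supp: "\<And>x. R < norm x \<Longrightarrow> f x = 0"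
  shows "(LINT x|lborel. f' x) = 0" and "\<And>x. R < norm x \<Longrightarrow> f' x = 0"
proof -
  show supp': "f' x = 0" if "R < norm x" for x
  proof -
    have "((\<lambda>t. norm (x + t *\<^sub>R e)) \<longlongrightarrow> norm (x + 0 *\<^sub>R e)) (at 0)"
      by (intro tendsto_intros)
    then have "\<forall>\<^sub>F t in at 0. R < norm (x + t *\<^sub>R e)"
      using that by (simp add: order_tendstoD(1))
    then have ev: "\<forall>\<^sub>F t in at 0. f (x + t *\<^sub>R e) = 0"
      by eventually_elim (use supp in auto)
    have "((\<lambda>t. f (x + t *\<^sub>R e)) has_vector_derivative 0) (at 0)"
      unfolding has_vector_derivative_def
      by (rule has_derivative_transform_eventually[of "\<lambda>_. 0"])
        (use ev supp[OF that] in \<open>auto elim: eventually_mono\<close>)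
    with deriv[of x] show ?thesis
      by (rule vector_derivative_unique_at)
  qed
  obtain B where B0: "B \<ge> 0" and B: "\<And>x. norm (f' x) \<le> B"
    using compact_support_bounded[OF cont supp'] by blast
  \<comment> \<open>The mean value inequality bounds all difference quotients by the supremum B of
    f', uniformly in the step.\<close>
  have quot: "norm (f (x + t *\<^sub>R e) - f x) \<le> B * t" if "t > 0" for x t
  proof -
    have "onorm (\<lambda>s. s *\<^sub>R f' (x + r *\<^sub>R e)) \<le> B" for r
      by (rule onorm_le) (use B in \<open>auto simp: mult.commute[of B] intro: mult_left_mono\<close>)
    then show ?thesis
      using differentiable_bound[of "{0..t}" "\<lambda>t. f (x + t *\<^sub>R e)" "\<lambda>r s. s *\<^sub>R f' (x + r *\<^sub>R e)" B t 0]
        has_vector_derivative_at_within[OF line_derivative_shift[OF deriv], unfolded has_vector_derivative_def] that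
      by auto
  qed
  have bm[measurable]: "f \<in> borel_measurable borel" "f' \<in> borel_measurable borel"
    using contf cont by (auto intro: borel_measurable_continuous_onI)
  define q where "q n x = real (Suc n) *\<^sub>R (f (x + (1 / real (Suc n)) *\<^sub>R e) - f x)" for n x
  \<comment> \<open>All steps have length at most \<open>norm e\<close>, so no quotient reaches
    beyond this larger ball.\<close>
  let ?b = "\<lambda>x. B * indicator (cball 0 (R + norm e)) x :: real"
  have qb: "norm (q n x) \<le> ?b x" for n x
  proof (cases "x \<in> cball 0 (R + norm e)")
    case True
    have "norm (q n x) = real (Suc n) * norm (f (x + (1 / real (Suc n)) *\<^sub>R e) - f x)"
      unfolding q_def by (simp del: of_nat_Suc)
    also have "\<dots> \<le> real (Suc n) * (B * (1 / real (Suc n)))"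
      by (intro mult_left_mono quot) auto
    finally show ?thesis using True by simp
  next
    case False
    then have "norm x > R + norm e" by simp
    moreover have "norm ((1 / real (Suc n)) *\<^sub>R e) \<le> 1 * norm e"
      unfolding norm_scaleR by (intro mult_right_mono) auto
    ultimately have "norm (x + (1 / real (Suc n)) *\<^sub>R e) > R" "norm x > R"
      using norm_diff_ineq[of x "(1 / real (Suc n)) *\<^sub>R e"] norm_ge_zero[of e] by linarith+
    then show ?thesis using False supp by (simp add: q_def)
  qed
  have ib: "integrable lborel ?b"
    by (intro integrable_mult_right integrable_real_indicator) (auto simp: emeasure_lborel_cball_finite[unfolded infinity_ennreal_def])
  have fi: "integrable lborel f"
    by (rule integrable_compact_support[OF contf supp])
  have [measurable]: "q n \<in> borel_measurable borel" for n
    unfolding q_def[abs_def] by measurable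
  have "(\<lambda>n. LINT x|lborel. q n x) \<longlonglongrightarrow> (LINT x|lborel. f' x)"
    by (rule integral_dominated_convergence[where w = ?b])
      (use ib qb line_difference_quotient[OF deriv] in \<open>auto simp: q_def\<close>)
  moreover have "(LINT x|lborel. q n x) = 0" for n
  proof -
    have "integrable lborel (\<lambda>x. f (x + (1 / real (Suc n)) *\<^sub>R e))"
      using integral_lborel_shift(2)[of f "(1 / real (Suc n)) *\<^sub>R e"] fi by (simp add: add.commute)
    then show ?thesis
      using integral_lborel_shift(1)[of f "(1 / real (Suc n)) *\<^sub>R e"] fi
      unfolding q_def by (subst integral_scaleR_right) (simp add: add.commute)
  qed
  ultimately show "(LINT x|lborel. f' x) = 0"
    by (simp add: LIMSEQ_const_iff)
qed

text \<open>Green's second identity for the Laplacian needs no mixed derivatives.\<close>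

definition axis_C2 ::
    "(real^3 \<Rightarrow> complex) \<Rightarrow> (3 \<Rightarrow> real^3 \<Rightarrow> complex) \<Rightarrow> (3 \<Rightarrow> real^3 \<Rightarrow> complex) \<Rightarrow> bool" where
  "axis_C2 f f1 f2 \<longleftrightarrow> continuous_on UNIV f \<and>
     (\<forall>i. continuous_on UNIV (f1 i) \<and> continuous_on UNIV (f2 i) \<and>
        (\<forall>x. ((\<lambda>t. f (x + t *\<^sub>R axis i 1)) has_vector_derivative f1 i x) (at 0) \<and>
             ((\<lambda>t. f1 i (x + t *\<^sub>R axis i 1)) has_vector_derivative f2 i x) (at 0)))"

lemma axis_C2D:
  assumes "axis_C2 f f1 f2"
  shows "continuous_on UNIV f" "continuous_on UNIV (f1 i)" "continuous_on UNIV (f2 i)"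
    "((\<lambda>t. f (x + t *\<^sub>R axis i 1)) has_vector_derivative f1 i x) (at 0)"
    "((\<lambda>t. f1 i (x + t *\<^sub>R axis i 1)) has_vector_derivative f2 i x) (at 0)"
  using assms unfolding axis_C2_def by blast+

lemma axis_C2_support:
  assumes "axis_C2 f f1 f2" "\<And>x. R < norm x \<Longrightarrow> f x = 0"
  shows "R < norm x \<Longrightarrow> f1 i x = 0" "R < norm x \<Longrightarrow> f2 i x = 0"
proof -
  show A: "f1 i x = 0" if "R < norm x" for x
    by (rule integral_line_derivative_zero(2)[of f "axis i 1" "f1 i" R])
      (use axis_C2D[OF assms(1)] assms(2) that in auto)
  show "f2 i x = 0" if "R < norm x" for x
    by (rule integral_line_derivative_zero(2)[of "f1 i" "axis i 1" "f2 i" R])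
      (use axis_C2D[OF assms(1)] A that in auto)
qed

text \<open>The integrand is the divergence of W (f grad g - g grad f), and each of its three
  summands is a line derivative with integral zero. The weight serves radial cut-offs later on; W =
  1 is Green's identity. Compact support may come from W or from g.\<close>

lemma green_weighted:
  fixes W :: "real^3 \<Rightarrow> real" and W1 :: "3 \<Rightarrow> real^3 \<Rightarrow> real" and f g :: "real^3 \<Rightarrow> complex"
  assumes A: "axis_C2 f f1 f2" and B: "axis_C2 g g1 g2"
    and W: "continuous_on UNIV W" "\<And>i. continuous_on UNIV (W1 i)"
      "\<And>i x. ((\<lambda>t. W (x + t *\<^sub>R axis i 1)) has_real_derivative W1 i x) (at 0)"
    and supp: "\<And>x. R < norm x \<Longrightarrow> W x = 0 \<or> g x = 0 \<and> (\<forall>i. g1 i x = 0)"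
  shows "(LINT x|lborel. complex_of_real (W x) * (f x * (\<Sum>i\<in>UNIV. g2 i x) - g x * (\<Sum>i\<in>UNIV. f2 i x)) +
           (\<Sum>i\<in>UNIV. complex_of_real (W1 i x) * (f x * g1 i x - g x * f1 i x))) = 0"
proof -
  define F where "F i x = of_real (W x) * (f x * g1 i x - g x * f1 i x)" for i x
  define F' where "F' i x = of_real (W x) * (f x * g2 i x - g x * f2 i x)
      + of_real (W1 i x) * (f x * g1 i x - g x * f1 i x)" for i x
  have d: "((\<lambda>t. F i (x + t *\<^sub>R axis i 1)) has_vector_derivative F' i x) (at 0)" for i x
    unfolding F_def F'_def
    using has_vector_derivative_mult[OF has_vector_derivative_of_real[where 'a = complex, OF W(3)[where i=i and x=x]]
        has_vector_derivative_diff[OF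
          has_vector_derivative_mult[OF axis_C2D(4)[OF A, where x=x and i=i] axis_C2D(5)[OF B, where x=x and i=i]]
          has_vector_derivative_mult[OF axis_C2D(4)[OF B, where x=x and i=i] axis_C2D(5)[OF A, where x=x and i=i]]]]
    by (simp add: algebra_simps)
  have c: "continuous_on UNIV (F i)" "continuous_on UNIV (F' i)" for i
    unfolding F_def[abs_def] F'_def[abs_def]
    by (intro continuous_intros axis_C2D[OF A] axis_C2D[OF B] W)+
  have s: "F i x = 0" if "R < norm x" for i x
    using supp[OF that] unfolding F_def by auto
  have s': "F' i x = 0" if "R < norm x" for i x
    by (rule integral_line_derivative_zero(2)[OF d c s that])
  have "(LINT x|lborel. (\<Sum>i\<in>UNIV. F' i x)) = 0"
    by (subst Bochner_Integration.integral_sum)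
      (auto simp: integral_line_derivative_zero(1)[OF d c s] intro: integrable_compact_support[OF c(2) s'])
  moreover have "(\<Sum>i\<in>UNIV. F' i x) = complex_of_real (W x) * (f x * (\<Sum>i\<in>UNIV. g2 i x) - g x * (\<Sum>i\<in>UNIV. f2 i x)) +
           (\<Sum>i\<in>UNIV. complex_of_real (W1 i x) * (f x * g1 i x - g x * f1 i x))" for x
    unfolding F'_def by (simp add: sum.distrib sum_subtractf flip: sum_distrib_left)
  ultimately show ?thesis by simp
qed

lemma green:
  assumes A: "axis_C2 f f1 f2" and B: "axis_C2 g g1 g2" and supp: "\<And>x. R < norm x \<Longrightarrow> g x = 0"
  shows "(LINT x|lborel. f x * (\<Sum>i\<in>UNIV. g2 i x)) = (LINT x|lborel. g x * (\<Sum>i\<in>UNIV. f2 i x))"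
proof -
  note s = axis_C2_support[OF B supp]
  have "(LINT x|lborel. complex_of_real 1 * (f x * (\<Sum>i\<in>UNIV. g2 i x) - g x * (\<Sum>i\<in>UNIV. f2 i x)) +
           (\<Sum>i\<in>UNIV. complex_of_real 0 * (f x * g1 i x - g x * f1 i x))) = 0"
    by (rule green_weighted[OF A B, where ?W1.0 = "\<lambda>_ _. 0" and R = R]) (use supp s in auto)
  moreover have "integrable lborel (\<lambda>x. f x * (\<Sum>i\<in>UNIV. g2 i x))"
    by (rule integrable_compact_support[where R=R])
      (use s in \<open>auto intro!: continuous_intros axis_C2D[OF A] axis_C2D[OF B]\<close>)
  moreover have "integrable lborel (\<lambda>x. g x * (\<Sum>i\<in>UNIV. f2 i x))"
    by (rule integrable_compact_support[where R=R])
      (use supp in \<open>auto intro!: continuous_intros axis_C2D[OF A] axis_C2D[OF B]\<close>)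
  ultimately show ?thesis by simp
qed

lemma differentiable_line_derivative:
  fixes f :: "real^3 \<Rightarrow> 'b::real_normed_vector"
  assumes "f differentiable (at x)"
  shows "((\<lambda>t. f (x + t *\<^sub>R axis i 1)) has_vector_derivative partial_deriv i f x) (at 0)"
proof -
  have "(f has_derivative frechet_derivative f (at x)) (at (x + 0 *\<^sub>R axis i 1))"
    using assms frechet_derivative_works by auto
  moreover have "((\<lambda>t. x + t *\<^sub>R axis i 1) has_vector_derivative axis i 1) (at 0)"
    by (auto intro!: derivative_eq_intros simp: has_vector_derivative_def)
  ultimately show ?thesis
    unfolding partial_deriv_def
    using vector_derivative_diff_chain_within[of "\<lambda>t. x + t *\<^sub>R axis i 1" "axis i 1" 0 UNIV f "frechet_derivative f (at x)"]
    by (auto simp: o_def has_derivative_at_withinI)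
qed

lemma C2_axis_C2:
  assumes "C_k_on 2 UNIV f"
  shows "axis_C2 f (\<lambda>i. iter_partial [i] f) (\<lambda>i. iter_partial [i, i] f)"
proof -
  have "f differentiable (at x)" "partial_deriv i f differentiable (at x)" 
     "continuous_on UNIV f" "continuous_on UNIV (partial_deriv i f)" 
     "continuous_on UNIV (partial_deriv i (partial_deriv i f))" for i x
    using assms unfolding C_k_on_def
    by (force dest: spec[of _ "[]"] spec[of _ "[i]"] spec[of _ "[i,i]"])+
  then show ?thesis
    unfolding axis_C2_def by (auto intro: differentiable_line_derivative)
qed

section \<open>The outgoing fundamental solution\<close>

text \<open>This takes the place of polar coordinates: F is majorised by the series of
  \<open>c k\<close> times the indicator of the ball of radius \<open>r k\<close>, which integrates
  to the volume of the unit ball times the sum of \<open>c k * r k ^ 3\<close>. Shrinking radii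
  handle a singularity at 0, growing radii the decay at infinity.\<close>

lemma integrable_by_balls:
  fixes F :: "real^3 \<Rightarrow> real"
  assumes [measurable]: "F \<in> borel_measurable borel"
    and F: "\<And>z. F z \<noteq> 0 \<Longrightarrow> \<exists>k. norm z < r k \<and> \<bar>F z\<bar> \<le> c k"
    and c: "\<And>k. c k \<ge> 0" and r: "\<And>k. r k \<ge> 0"
    and sm: "summable (\<lambda>k. c k * r k ^ 3)"
  shows "integrable lborel F"
proof (rule integrableI_bounded)
  define V where "V = unit_ball_vol (real DIM(real^3))"
  have V: "V \<ge> 0" unfolding V_def by simp
  have "(\<integral>\<^sup>+ z. ennreal (norm (F z)) \<partial>lborel) \<le> (\<integral>\<^sup>+ z. (\<Sum>k. ennreal (c k) * indicator (ball (0::real^3) (r k)) z) \<partial>lborel)"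
  proof (intro nn_integral_mono)
    fix z :: "real^3"
    show "ennreal (norm (F z)) \<le> (\<Sum>k. ennreal (c k) * indicator (ball (0::real^3) (r k)) z)"
    proof (cases "F z = 0")
      case False
      then obtain k where k: "norm z < r k" "\<bar>F z\<bar> \<le> c k" using F by blast
      have "ennreal (norm (F z)) \<le> ennreal (c k) * indicator (ball (0::real^3) (r k)) z"
        using k by (simp add: ennreal_leI)
      also have "\<dots> \<le> (\<Sum>k. ennreal (c k) * indicator (ball (0::real^3) (r k)) z)"
      proof -
        let ?f = "\<lambda>k. ennreal (c k) * indicator (ball (0::real^3) (r k)) z"
        have "sum ?f {k} \<le> suminf ?f" by (rule sum_le_suminf) auto
        moreover have "sum ?f {k} = ?f k" by (subst sum.insert) auto
        ultimately show ?thesis by (simp only:)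
      qed
      finally show ?thesis .
    qed simp
  qed
  also have "\<dots> = (\<Sum>k. ennreal (c k) * emeasure lborel (ball (0::real^3) (r k)))"
  proof (subst nn_integral_suminf)
    show "(\<lambda>z. ennreal (c i) * indicator (ball (0::real^3) (r i)) z) \<in> borel_measurable lborel" for i
      by (intro borel_measurable_times_ennreal borel_measurable_const borel_measurable_indicator) simp
  qed (simp add: nn_integral_cmult_indicator)
  also have "\<dots> = (\<Sum>k. ennreal (V * (c k * r k ^ 3)))"
  proof -
    have "ennreal (c k) * emeasure lborel (ball (0::real^3) (r k)) = ennreal (V * (c k * r k ^ 3))" for k
    proof -
      have "emeasure lborel (ball (0::real^3) (r k)) = ennreal (V * r k ^ 3)"
        unfolding V_def using emeasure_ball[OF r, of "0::real^3"] by simp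
      then show ?thesis using c[of k] by (simp add: ennreal_mult'[symmetric] mult.left_commute)
    qed
    then show ?thesis by simp
  qed
  also have "\<dots> = ennreal (\<Sum>k. V * (c k * r k ^ 3))"
    using c r V sm by (intro suminf_ennreal2 summable_mult) auto
  also have "\<dots> < \<infinity>" by simp
  finally show "(\<integral>\<^sup>+ z. ennreal (norm (F z)) \<partial>lborel) < \<infinity>" .
qed simp

lemma integrable_newton_ball: "integrable lborel (\<lambda>z::real^3. indicator (ball 0 1) z / norm z)"
proof (rule integrable_by_balls[where r = "\<lambda>k. (1/2) ^ k" and c = "\<lambda>k. 2 * 2 ^ k"])
  fix z :: "real^3" assume "indicator (ball 0 1) z / norm z \<noteq> 0"
  then have z: "0 < norm z" "norm z < 1" by (auto simp: indicator_def split: if_splits)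
  obtain n where n: "(1/2) ^ n < norm z" using real_arch_pow_inv[of "norm z" "1/2"] z by auto
  \<comment> \<open>The first dyadic radius not exceeding |z|. The radius before it is larger than
    |z|, so z lies in that open ball; the price is the factor 2 in the bound for 1/|z|.\<close>
  define k where "k = (LEAST n. (1/2) ^ n \<le> norm z)"
  have k: "(1/2) ^ k \<le> norm z" unfolding k_def by (rule LeastI[of _ n]) (use n in simp)
  with z have "k \<noteq> 0" by (cases k) auto
  then obtain j where j: "k = Suc j" by (cases k) auto
  have "\<not> (1/2) ^ j \<le> norm z" using not_less_Least[of j "\<lambda>n. (1/2) ^ n \<le> norm z"] j unfolding k_def by simp
  then have "norm z < (1/2) ^ j" by simp
  moreover have "1 / norm z \<le> 2 * 2 ^ j"
  proof -
    have "1 / norm z \<le> 1 / (1/2) ^ k" using k z by (intro frac_le) auto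
    also have "\<dots> = 2 ^ k" by (simp add: power_one_over)
    finally show ?thesis by (simp add: j)
  qed
  ultimately show "\<exists>k. norm z < (1/2) ^ k \<and> \<bar>indicator (ball 0 1) z / norm z\<bar> \<le> 2 * 2 ^ k"
    using z by auto
next
  have "(\<lambda>k. 2 * 2 ^ k * ((1/2) ^ k) ^ 3) = (\<lambda>k. 2 * (1/4::real) ^ k)"
  proof
    fix k
    have "(2::real) ^ k * (1/2) ^ k = 1" unfolding power_mult_distrib[symmetric] by simp
    moreover have "((1/2) ^ k) ^ 2 = (1/4 :: real) ^ k"
      unfolding power_mult[symmetric] mult.commute[of k 2] unfolding power_mult by (simp add: power2_eq_square)
    moreover have "2 * 2 ^ k * ((1/2) ^ k) ^ 3 = 2 * (2 ^ k * (1/2) ^ k) * (((1/2) ^ k) ^ 2 :: real)"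
      unfolding power3_eq_cube power2_eq_square by (simp only: mult_ac)
    ultimately show "2 * 2 ^ k * ((1/2) ^ k) ^ 3 = 2 * (1/4::real) ^ k" by (simp only: mult_1_right)
  qed
  then show "summable (\<lambda>k. 2 * 2 ^ k * ((1/2) ^ k) ^ 3 :: real)"
    by (simp only:) (intro summable_mult summable_geometric, simp)
  show "(\<lambda>z::real^3. indicat_real (ball 0 1) z / norm z) \<in> borel_measurable borel"
    by (intro borel_measurable_divide borel_measurable_indicator borel_measurable_norm) auto
qed auto

lemma integrable_bracket: "integrable lborel (\<lambda>z::real^3. 1 / (1 + (norm z)\<^sup>2)\<^sup>2)"
proof (rule integrable_by_balls[where r = "\<lambda>k. 2 ^ k" and c = "\<lambda>k. 16 * (1/16) ^ k"])
  fix z :: "real^3"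
  obtain n where n: "norm z < 2 ^ n" using real_arch_pow[of 2 "norm z"] by auto
  \<comment> \<open>For k > 0 minimality gives |z| \<ge> 2^(k-1), so the integrand is at most
    (2^(k-1))^(-4), whence the factor 16. For k = 0 the trivial bound 1 is enough.\<close>
  define k where "k = (LEAST n. norm z < 2 ^ n)"
  have k: "norm z < 2 ^ k" unfolding k_def by (rule LeastI[of _ n]) (use n in simp)
  have "1 / (1 + (norm z)\<^sup>2)\<^sup>2 \<le> 16 * (1/16) ^ k"
  proof (cases k)
    case 0
    have "1 / (1 + (norm z)\<^sup>2)\<^sup>2 \<le> 1 / 1" by (intro frac_le one_le_power) auto
    then show ?thesis using 0 by simp
  next
    case (Suc j)
    have "\<not> norm z < 2 ^ j" using not_less_Least[of j "\<lambda>n. norm z < 2 ^ n"] Suc unfolding k_def by simp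
    then have "(2 ^ j)\<^sup>2 \<le> (norm z)\<^sup>2" by (intro power_mono) auto
    then have "(2 ^ j)\<^sup>2 \<le> 1 + (norm z)\<^sup>2" by linarith
    then have "((2 ^ j)\<^sup>2)\<^sup>2 \<le> (1 + (norm z)\<^sup>2)\<^sup>2" by (intro power_mono) auto
    moreover have "((2 ^ j)\<^sup>2)\<^sup>2 = (16::real) ^ j"
      by (simp add: power_mult[symmetric] power_mult mult.commute[of j])
    ultimately have "1 / (1 + (norm z)\<^sup>2)\<^sup>2 \<le> 1 / 16 ^ j"
      by (intro frac_le) auto
    then show ?thesis using Suc by (simp add: power_one_over)
  qed
  then show "\<exists>k. norm z < 2 ^ k \<and> \<bar>1 / (1 + (norm z)\<^sup>2)\<^sup>2\<bar> \<le> 16 * (1/16) ^ k"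
    using k by auto
next
  have "(\<lambda>k. 16 * (1/16) ^ k * (2 ^ k) ^ 3) = (\<lambda>k. 16 * (1/2::real) ^ k)"
  proof
    fix k
    have "(2 ^ k) ^ 3 = (8::real) ^ k"
      unfolding power_mult[symmetric] mult.commute[of k 3] unfolding power_mult by simp
    moreover have "(1/16) ^ k * 8 ^ k = (1/2::real) ^ k" unfolding power_mult_distrib[symmetric] by simp
    ultimately show "16 * (1/16) ^ k * (2 ^ k) ^ 3 = 16 * (1/2::real) ^ k"
      by (simp only: mult.assoc)
  qed
  then show "summable (\<lambda>k. 16 * (1/16) ^ k * (2 ^ k) ^ 3 :: real)"
    by (simp only:) (intro summable_mult summable_geometric, simp)
qed auto

lemma integrable_div_norm:
  fixes F :: "real^3 \<Rightarrow> complex"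
  assumes [measurable]: "F \<in> borel_measurable borel" and "\<And>x. norm (F x) \<le> B" "\<And>x. R < norm x \<Longrightarrow> F x = 0"
  shows "integrable lborel (\<lambda>x. F x / of_real (norm x))"
proof (rule Bochner_Integration.integrable_bound)
  show "integrable lborel (\<lambda>x::real^3. B * (indicator (ball 0 1) x / norm x) + B * indicator (cball 0 R) x)"
    by (intro Bochner_Integration.integrable_add integrable_mult_right integrable_newton_ball integrable_real_indicator)
       (auto simp: emeasure_lborel_cball_finite[unfolded infinity_ennreal_def])
  have B: "B \<ge> 0" using assms(2)[of 0] norm_ge_zero order_trans by blast
  have "norm (F x / of_real (norm x)) \<le> B * (indicator (ball 0 1) x / norm x) + B * indicator (cball 0 R) x" for x
  proof (cases "norm x < 1")
    case True
    then show ?thesis using assms(2)[of x] B by (simp add: norm_divide divide_right_mono add_increasing2)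
  next
    case False
    have "norm (F x) / norm x \<le> norm (F x) / 1" using False by (intro divide_left_mono) auto
    also have "\<dots> \<le> B * indicator (cball 0 R) x" using assms(2)[of x] assms(3)[of x] by (auto simp: indicator_def)
    finally show ?thesis using False by (simp add: norm_divide)
  qed
  then have "norm (F x / of_real (norm x)) \<le> norm (B * (indicator (ball 0 1) x / norm x) + B * indicator (cball 0 R) x)" for x
    unfolding real_norm_def by (rule order_trans[OF _ abs_ge_self])
  then show "AE x in lborel. norm (F x / of_real (norm x)) \<le>
      norm (B * (indicator (ball 0 1) x / norm x) + B * indicator (cball 0 R) x)"
    by simp
qed simp

text \<open>The integrand is minus the Laplacian of \<open>1 / sqrt (1 + |z|\<^sup>2)\<close>. The value of the constant is
  \<open>1 / (4 * pi)\<close>, which is never needed.\<close>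

definition newton_const :: real where
  "newton_const = 1 / (LINT z|(lborel :: (real^3) measure). 3 / sqrt (1 + (norm z)\<^sup>2) ^ 5)"

lemma integrable_kernel: "integrable lborel (\<lambda>z::real^3. 3 / sqrt (1 + (norm z)\<^sup>2) ^ 5)"
proof (rule Bochner_Integration.integrable_bound)
  show "integrable lborel (\<lambda>z::real^3. 3 * (1 / (1 + (norm z)\<^sup>2)\<^sup>2))"
    by (intro integrable_mult_right integrable_bracket)
  have "3 / sqrt (1 + (norm z)\<^sup>2) ^ 5 \<le> 3 * (1 / (1 + (norm z)\<^sup>2)\<^sup>2)" for z :: "real^3"
  proof -
    define w where "w = sqrt (1 + (norm z)\<^sup>2)"
    have w: "w \<ge> 1" "w\<^sup>2 = 1 + (norm z)\<^sup>2" unfolding w_def by simp_all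
    have "w ^ 4 \<le> w ^ 5" by (rule power_increasing) (use w(1) in auto)
    moreover have "0 < w ^ 4" using w(1) by simp
    ultimately have "3 / w ^ 5 \<le> 3 * (1 / w ^ 4)" by (simp add: frac_le)
    moreover have "w ^ 4 = (1 + (norm z)\<^sup>2)\<^sup>2" unfolding w(2)[symmetric] by simp
    ultimately have "3 / w ^ 5 \<le> 3 * (1 / (1 + (norm z)\<^sup>2)\<^sup>2)" by (simp only:)
    then show ?thesis unfolding w_def .
  qed
  then show "AE z in lborel. norm (3 / sqrt (1 + (norm z)\<^sup>2) ^ 5) \<le> norm (3 * (1 / (1 + (norm (z::real^3))\<^sup>2)\<^sup>2))"
    by simp
qed simp

lemma newton_const_pos: "newton_const > 0"
proof -
  have "(LINT z|(lborel :: (real^3) measure). 3 / sqrt (1 + (norm z)\<^sup>2) ^ 5) \<noteq> 0"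
  proof
    assume "(LINT z|(lborel :: (real^3) measure). 3 / sqrt (1 + (norm z)\<^sup>2) ^ 5) = 0"
    then have "AE z in (lborel :: (real^3) measure). 3 / sqrt (1 + (norm z)\<^sup>2) ^ 5 = 0"
      by (subst (asm) integral_nonneg_eq_0_iff_AE[OF integrable_kernel]) auto
    moreover have "3 / sqrt (1 + (norm (z::real^3))\<^sup>2) ^ 5 \<noteq> 0" for z
      using zero_le_power2[of "norm z"] by (simp add: add_nonneg_eq_0_iff)
    ultimately have "AE z in (lborel :: (real^3) measure). False" by simp
    then show False by (simp add: eventually_False ae_filter_eq_bot_iff)
  qed
  moreover have "(LINT z|(lborel :: (real^3) measure). 3 / sqrt (1 + (norm z)\<^sup>2) ^ 5) \<ge> 0"
    by (intro Bochner_Integration.integral_nonneg) auto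
  ultimately have "(LINT z|(lborel :: (real^3) measure). 3 / sqrt (1 + (norm z)\<^sup>2) ^ 5) > 0"
    by linarith
  then show ?thesis unfolding newton_const_def by (rule divide_pos_pos[OF zero_less_one])
qed

text \<open>A smooth substitute for |x|: with it exp(i s r)/r is twice differentiable at the origin
  too, and Green's identity applies without cutting out a ball.\<close>

definition reg_norm :: "real \<Rightarrow> real^3 \<Rightarrow> real" where
  "reg_norm \<eta> x = sqrt (x \<bullet> x + \<eta>\<^sup>2)"

lemma reg_norm_pos: "\<eta> > 0 \<Longrightarrow> reg_norm \<eta> x > 0"
  unfolding reg_norm_def by (simp add: add_nonneg_pos)

lemma reg_norm_deriv:
  assumes "\<eta> > 0"
  shows "((\<lambda>t. reg_norm \<eta> (x + t *\<^sub>R axis i 1)) has_vector_derivative x $ i / reg_norm \<eta> x) (at 0)"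
proof -
  have "x \<bullet> x + \<eta>\<^sup>2 > 0" using assms by (simp add: add_nonneg_pos)
  then show ?thesis
    unfolding reg_norm_def has_real_derivative_iff_has_vector_derivative[symmetric]
    by (auto intro!: derivative_eq_intros simp: inner_add_left inner_add_right inner_axis inner_commute[of "axis i 1"] field_simps)
qed

lemma reg_norm_cont: "continuous_on UNIV (reg_norm \<eta>)"
  unfolding reg_norm_def[abs_def] by (intro continuous_intros)

text \<open>\<open>H r\<close> is 1/r times the derivative of exp(i s r)/r. As the partial
  derivative of r is x_i/r, the factors r cancel in the first derivatives x_i H(r);
  \<open>H'\<close> is the derivative of \<open>H\<close>.\<close>

lemma axis_C2_regularised:
  fixes s :: real and H H' :: "complex \<Rightarrow> complex"
  assumes "\<eta> > 0"
  defines "H \<equiv> \<lambda>r::complex. (\<i> * s / r ^ 2 - 1 / r ^ 3) * exp (\<i> * s * r)"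
    and "H' \<equiv> \<lambda>r::complex. (3 / r ^ 4 - 3 * \<i> * s / r ^ 3 - s\<^sup>2 / r\<^sup>2) * exp (\<i> * s * r)"
  shows "axis_C2 (\<lambda>x. exp (\<i> * s * reg_norm \<eta> x) / reg_norm \<eta> x)
     (\<lambda>i x. x $ i * H (of_real (reg_norm \<eta> x)))
     (\<lambda>i x. H (of_real (reg_norm \<eta> x)) + (complex_of_real (x $ i))\<^sup>2 / reg_norm \<eta> x * H' (of_real (reg_norm \<eta> x)))"
proof -
  note pos = reg_norm_pos[OF assms(1)]
  then have nz: "reg_norm \<eta> x \<noteq> 0" for x by (simp add: less_imp_neq[symmetric])
  have d1: "((\<lambda>r. exp (\<i> * s * of_real r) / of_real r) has_vector_derivative of_real r * H (of_real r)) (at r)" if "r \<noteq> 0" for r :: real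
  proof (rule has_vector_derivative_real_field)
    define c where "c = complex_of_real r"
    have c: "c \<noteq> 0" using that c_def by simp
    have "((\<lambda>z. exp (\<i> * s * z) * inverse z) has_field_derivative
        exp (\<i> * s * c) * (\<i> * s) * inverse c + - (inverse c * inverse c) * exp (\<i> * s * c)) (at c)"
      by (auto intro!: derivative_eq_intros simp: c)
    also have "exp (\<i> * s * c) * (\<i> * s) * inverse c + - (inverse c * inverse c) * exp (\<i> * s * c) = c * H c"
      unfolding H_def using c by (simp add: divide_simps) (simp add: algebra_simps eval_nat_numeral)
    finally show "((\<lambda>z. exp (\<i> * s * z) / z) has_field_derivative complex_of_real r * H (complex_of_real r)) (at (complex_of_real r))"
      unfolding c_def by (simp add: divide_inverse)
  qed
  have d2: "((\<lambda>r. H (of_real r)) has_vector_derivative H' (of_real r)) (at r)" if "r \<noteq> 0" for r :: real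
  proof (rule has_vector_derivative_real_field)
    define c where "c = complex_of_real r"
    have c: "c \<noteq> 0" using that c_def by simp
    let ?q = "inverse c"
    have "((\<lambda>z. (\<i> * s * inverse z ^ 2 - inverse z ^ 3) * exp (\<i> * s * z)) has_field_derivative
        (\<i> * s * (2 * ?q * (- (?q * ?q))) - 3 * ?q ^ 2 * (- (?q * ?q))) * exp (\<i> * s * c)
        + exp (\<i> * s * c) * (\<i> * s) * (\<i> * s * ?q ^ 2 - ?q ^ 3)) (at c)"
      by (rule derivative_eq_intros refl | simp add: c)+
    also have "(\<i> * s * (2 * ?q * (- (?q * ?q))) - 3 * ?q ^ 2 * (- (?q * ?q))) * exp (\<i> * s * c)
        + exp (\<i> * s * c) * (\<i> * s) * (\<i> * s * ?q ^ 2 - ?q ^ 3) = (3 * ?q ^ 4 - 3 * \<i> * s * ?q ^ 3 - s ^ 2 * ?q ^ 2) * exp (\<i> * s * c)"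
      by (simp add: algebra_simps eval_nat_numeral)
    also have "\<dots> = H' c" unfolding H'_def by (simp add: divide_inverse power_inverse)
    finally show "(H has_field_derivative H' (complex_of_real r)) (at (complex_of_real r))"
      unfolding H_def c_def by (simp add: divide_inverse power_inverse)
  qed
  have g1: "((\<lambda>t. exp (\<i> * s * of_real (reg_norm \<eta> (x + t *\<^sub>R axis i 1))) / of_real (reg_norm \<eta> (x + t *\<^sub>R axis i 1)))
      has_vector_derivative complex_of_real (x $ i) * H (of_real (reg_norm \<eta> x))) (at 0)" for x i
  proof -
    have "(x $ i / reg_norm \<eta> x) *\<^sub>R (of_real (reg_norm \<eta> x) * H (of_real (reg_norm \<eta> x)))
        = complex_of_real (x $ i) * H (of_real (reg_norm \<eta> x))"
      using nz[of x] by (simp add: scaleR_conv_of_real)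
    note eq = this
    have d: "((\<lambda>r. exp (\<i> * s * of_real r) / of_real r) has_vector_derivative
        of_real (reg_norm \<eta> x) * H (of_real (reg_norm \<eta> x))) (at (reg_norm \<eta> (x + 0 *\<^sub>R axis i 1)))"
      using d1[OF nz[of x]] by simp
    show ?thesis
      using vector_diff_chain_at[OF reg_norm_deriv[OF assms(1), of x i] d] unfolding o_def eq .
  qed
  have g2: "((\<lambda>t. H (of_real (reg_norm \<eta> (x + t *\<^sub>R axis i 1))))
      has_vector_derivative (x $ i / reg_norm \<eta> x) *\<^sub>R H' (of_real (reg_norm \<eta> x))) (at 0)" for x i
    using vector_diff_chain_at[OF reg_norm_deriv[OF assms(1), of x i], of "\<lambda>r. H (of_real r)"]
      d2[OF nz[of x]] by (simp add: o_def)
  have g3: "((\<lambda>t. complex_of_real ((x + t *\<^sub>R axis i 1) $ i)) has_vector_derivative 1) (at 0)" for x :: "real^3" and i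
  proof -
    have "((\<lambda>t. (x + t *\<^sub>R axis i 1) $ i) has_real_derivative 1) (at 0)"
      by (auto intro!: derivative_eq_intros)
    from has_vector_derivative_of_real[where 'a = complex, OF this] show ?thesis by simp
  qed
  have g4: "((\<lambda>t. complex_of_real ((x + t *\<^sub>R axis i 1) $ i) * H (of_real (reg_norm \<eta> (x + t *\<^sub>R axis i 1))))
      has_vector_derivative H (of_real (reg_norm \<eta> x)) + (complex_of_real (x $ i))\<^sup>2 / reg_norm \<eta> x * H' (of_real (reg_norm \<eta> x))) (at 0)" for x i
  proof -
    have "complex_of_real ((x + 0 *\<^sub>R axis i 1) $ i) * ((x $ i / reg_norm \<eta> x) *\<^sub>R H' (of_real (reg_norm \<eta> x)))
        + 1 * H (of_real (reg_norm \<eta> (x + 0 *\<^sub>R axis i 1)))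
      = H (of_real (reg_norm \<eta> x)) + (complex_of_real (x $ i))\<^sup>2 / reg_norm \<eta> x * H' (of_real (reg_norm \<eta> x))"
      by (simp add: scaleR_conv_of_real power2_eq_square)
    note eq = this
    show ?thesis
      using has_vector_derivative_mult[OF g3[of x i] g2[of x i]] unfolding eq .
  qed
  have c: "continuous_on UNIV (\<lambda>x. H (of_real (reg_norm \<eta> x)))" "continuous_on UNIV (\<lambda>x. H' (of_real (reg_norm \<eta> x)))"
    unfolding H_def H'_def using nz by (auto intro!: continuous_intros reg_norm_cont)
  show ?thesis
    unfolding axis_C2_def
    using g1 g4 c nz by (auto intro!: continuous_intros reg_norm_cont)
qed


text \<open>Away from regularisation exp(i s r)/r solves the Helmholtz equation. Here the squares of
  the coordinates sum to r^2 - \<eta>^2 instead of r^2, and exactly this defect survives: a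
  remainder with the factor \<eta>^2, concentrated at the scale \<eta> around the origin, which
  approximates a multiple of the delta distribution.\<close>

lemma green_regularised:
  fixes s :: real and g :: "real^3 \<Rightarrow> complex" and g1 g2 :: "3 \<Rightarrow> real^3 \<Rightarrow> complex"
  assumes \<eta>: "\<eta> > 0" and g: "axis_C2 g g1 g2" and supp: "\<And>x. R < norm x \<Longrightarrow> g x = 0"
  shows "(LINT x|lborel. exp (\<i> * s * reg_norm \<eta> x) / reg_norm \<eta> x * (- (\<Sum>i\<in>UNIV. g2 i x) - s\<^sup>2 * g x)) =
    (LINT x|lborel. g x * (\<eta>\<^sup>2 * exp (\<i> * s * reg_norm \<eta> x) *
      (3 / reg_norm \<eta> x ^ 5 - 3 * \<i> * s / reg_norm \<eta> x ^ 4 - s\<^sup>2 / reg_norm \<eta> x ^ 3)))"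
proof -
  let ?r = "\<lambda>x. complex_of_real (reg_norm \<eta> x)"
  let ?G = "\<lambda>x. exp (\<i> * s * ?r x) / ?r x"
  define L where "L x = (\<Sum>i\<in>UNIV. (\<i> * s / ?r x ^ 2 - 1 / ?r x ^ 3) * exp (\<i> * s * ?r x) +
    (complex_of_real (x $ i))\<^sup>2 / ?r x * ((3 / ?r x ^ 4 - 3 * \<i> * s / ?r x ^ 3 - s\<^sup>2 / (?r x)\<^sup>2) * exp (\<i> * s * ?r x)))" for x :: "real^3"
  note ac = axis_C2_regularised[OF \<eta>, of s]
  have pos: "reg_norm \<eta> x \<noteq> 0" for x using reg_norm_pos[OF \<eta>, of x] by simp
  have sq: "(\<Sum>i\<in>UNIV. (complex_of_real (x $ i))\<^sup>2) = (?r x)\<^sup>2 - \<eta>\<^sup>2" for x :: "real^3"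
  proof -
    have "x \<bullet> x = (\<Sum>i\<in>UNIV. (x $ i)\<^sup>2)" by (simp add: inner_vec_def power2_eq_square)
    moreover have "(reg_norm \<eta> x)\<^sup>2 = x \<bullet> x + \<eta>\<^sup>2" unfolding reg_norm_def by simp
    ultimately have "(\<Sum>i\<in>UNIV. (x $ i)\<^sup>2) = (reg_norm \<eta> x)\<^sup>2 - \<eta>\<^sup>2" by simp
    then have "complex_of_real (\<Sum>i\<in>UNIV. (x $ i)\<^sup>2) = complex_of_real ((reg_norm \<eta> x)\<^sup>2 - \<eta>\<^sup>2)" by simp
    then show ?thesis by simp
  qed
  have L: "- L x - s\<^sup>2 * ?G x = \<eta>\<^sup>2 * exp (\<i> * s * ?r x) * (3 / ?r x ^ 5 - 3 * \<i> * s / ?r x ^ 4 - s\<^sup>2 / ?r x ^ 3)" for x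
  proof -
    have "L x = 3 * ((\<i> * s / ?r x ^ 2 - 1 / ?r x ^ 3) * exp (\<i> * s * ?r x)) +
      ((?r x)\<^sup>2 - \<eta>\<^sup>2) / ?r x * ((3 / ?r x ^ 4 - 3 * \<i> * s / ?r x ^ 3 - s\<^sup>2 / (?r x)\<^sup>2) * exp (\<i> * s * ?r x))"
    proof -
      have "(\<Sum>i\<in>UNIV. A + q i / r * B) = 3 * A + (\<Sum>i\<in>UNIV. q i) / r * B" for A B r :: complex and q :: "3 \<Rightarrow> complex"
        by (simp add: sum.distrib sum_distrib_right sum_divide_distrib)
      then show ?thesis unfolding L_def by (simp only: sq)
    qed
    also have "\<dots> = exp (\<i> * s * ?r x) * (3 * (\<i> * s / ?r x ^ 2 - 1 / ?r x ^ 3) +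
      ((?r x)\<^sup>2 - \<eta>\<^sup>2) / ?r x * (3 / ?r x ^ 4 - 3 * \<i> * s / ?r x ^ 3 - s\<^sup>2 / (?r x)\<^sup>2))"
    proof -
      have "3 * (A * E) + p / r * (B * E) = E * (3 * A + p / r * B)" for A B E p r :: complex
        by (simp add: algebra_simps)
      then show ?thesis .
    qed
    also have "3 * (\<i> * s / ?r x ^ 2 - 1 / ?r x ^ 3) +
      ((?r x)\<^sup>2 - \<eta>\<^sup>2) / ?r x * (3 / ?r x ^ 4 - 3 * \<i> * s / ?r x ^ 3 - s\<^sup>2 / (?r x)\<^sup>2)
      = - s\<^sup>2 / ?r x - \<eta>\<^sup>2 * (3 / ?r x ^ 5 - 3 * \<i> * s / ?r x ^ 4 - s\<^sup>2 / ?r x ^ 3)"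
      using pos[of x] by (simp add: divide_simps) (simp add: algebra_simps power2_eq_square eval_nat_numeral)
    finally have Leq: "L x = exp (\<i> * s * ?r x) * (- s\<^sup>2 / ?r x - \<eta>\<^sup>2 * (3 / ?r x ^ 5 - 3 * \<i> * s / ?r x ^ 4 - s\<^sup>2 / ?r x ^ 3))" .
    have "- (E * (- a / r - h * C)) - a * (E / r) = h * E * C" for E a r h C :: complex
      by (simp add: algebra_simps diff_divide_distrib)
    then show ?thesis unfolding Leq by simp
  qed
  have "continuous_on UNIV L"
    unfolding L_def using axis_C2D(3)[OF ac] by (intro continuous_on_sum) simp
  have gr: "(LINT x|lborel. ?G x * (\<Sum>i\<in>UNIV. g2 i x)) = (LINT x|lborel. g x * L x)"
    using green[OF ac g supp] unfolding L_def by simp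
  note s2 = axis_C2_support(2)[OF g supp]
  have i1: "integrable lborel (\<lambda>x. ?G x * (\<Sum>i\<in>UNIV. g2 i x))"
    by (rule integrable_compact_support[where R=R])
      (use s2 in \<open>auto intro!: continuous_intros axis_C2D[OF ac] axis_C2D[OF g] reg_norm_cont simp: pos\<close>)
  have i2: "integrable lborel (\<lambda>x. g x * L x)"
    by (rule integrable_compact_support[where R=R])
      (use supp \<open>continuous_on UNIV L\<close> in \<open>auto intro!: continuous_on_mult axis_C2D[OF g]\<close>)
  have i3: "integrable lborel (\<lambda>x. g x * ?G x)"
    by (rule integrable_compact_support[where R=R, OF continuous_on_mult[OF axis_C2D(1)[OF g] axis_C2D(1)[OF ac]]])
      (use supp in simp)
  have "(LINT x|lborel. ?G x * (- (\<Sum>i\<in>UNIV. g2 i x) - s\<^sup>2 * g x)) =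
      (LINT x|lborel. - (?G x * (\<Sum>i\<in>UNIV. g2 i x)) - s\<^sup>2 * (g x * ?G x))"
    by (intro Bochner_Integration.integral_cong) (auto simp: algebra_simps)
  also have "\<dots> = - (LINT x|lborel. g x * L x) - (LINT x|lborel. s\<^sup>2 * (g x * ?G x))"
    by (subst Bochner_Integration.integral_diff[OF integrable_minus[OF i1] integrable_mult_right[OF i3]])
      (simp only: Bochner_Integration.integral_minus gr)
  also have "\<dots> = (LINT x|lborel. - (g x * L x) - s\<^sup>2 * (g x * ?G x))"
    by (subst Bochner_Integration.integral_diff[OF integrable_minus[OF i2] integrable_mult_right[OF i3]])
      (simp only: Bochner_Integration.integral_minus)
  also have "\<dots> = (LINT x|lborel. g x * (- L x - s\<^sup>2 * ?G x))"
    by (intro Bochner_Integration.integral_cong) (auto simp: algebra_simps)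
  finally show ?thesis unfolding L by simp
qed

text \<open>Let \<eta> tend to 0 in the regularised identity. On the left |F|/|x| dominates. On the
  right the substitution x = \<eta> z fixes the scale of the remainder: its first term tends to g(0)
  times the integrand that defines \<open>newton_const\<close>, and the two other terms carry
  factors \<eta> and \<eta>^2.\<close>

lemma newton_fundamental_origin:
  fixes s :: real and g :: "real^3 \<Rightarrow> complex" and g1 g2 :: "3 \<Rightarrow> real^3 \<Rightarrow> complex"
  assumes g: "axis_C2 g g1 g2" and supp: "\<And>x. R < norm x \<Longrightarrow> g x = 0"
  shows "newton_const * (LINT x|lborel. exp (\<i> * s * norm x) / norm x * (- (\<Sum>i\<in>UNIV. g2 i x) - s\<^sup>2 * g x)) = g 0"
proof -
  define F where "F x = - (\<Sum>i\<in>UNIV. g2 i x) - s\<^sup>2 * g x" for x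
  have contF: "continuous_on UNIV F"
    unfolding F_def[abs_def] by (intro continuous_intros axis_C2D[OF g])
  have suppF: "F x = 0" if "R < norm x" for x
    unfolding F_def using axis_C2_support(2)[OF g supp that] supp[OF that] by simp
  obtain B where B: "B \<ge> 0" "\<And>x. norm (F x) \<le> B" using compact_support_bounded[OF contF suppF] by blast
  obtain Bg where Bg: "Bg \<ge> 0" "\<And>x. norm (g x) \<le> Bg" using compact_support_bounded[OF axis_C2D(1)[OF g] supp] by blast
  define \<eta> where "\<eta> n = 1 / real (Suc n)" for n
  have \<eta>: "\<eta> n > 0" "\<eta> n \<le> 1" for n unfolding \<eta>_def by auto
  have \<eta>0: "\<eta> \<longlonglongrightarrow> 0" unfolding \<eta>_def[abs_def] using LIMSEQ_inverse_real_of_nat by (simp add: inverse_eq_divide)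
  have [measurable]: "F \<in> borel_measurable borel" "g \<in> borel_measurable borel" "reg_norm e \<in> borel_measurable borel" for e
    using contF axis_C2D(1)[OF g] reg_norm_cont by (auto intro: borel_measurable_continuous_onI)
  have nz: "reg_norm (\<eta> n) x \<noteq> 0" for n x using reg_norm_pos[OF \<eta>(1)[of n], of x] by simp
  have ge: "reg_norm (\<eta> n) x \<ge> norm x" for n x
    unfolding reg_norm_def norm_eq_sqrt_inner by simp
  have ne: "norm (exp (\<i> * complex_of_real a * complex_of_real b)) = 1" for a b by simp
  have l1: "(\<lambda>n. LINT x|lborel. exp (\<i> * s * reg_norm (\<eta> n) x) / reg_norm (\<eta> n) x * F x) \<longlonglongrightarrow>
      (LINT x|lborel. exp (\<i> * s * norm x) / norm x * F x)"
  proof (rule integral_dominated_convergence[where w = "\<lambda>x. norm (F x / of_real (norm x))"])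
    show "integrable lborel (\<lambda>x. norm (F x / of_real (norm x)))"
      using integrable_div_norm[OF _ B(2) suppF] by simp
    have "AE x in lborel. x \<noteq> (0::real^3)" by (rule AE_lborel_singleton)
    then show "AE x in lborel. (\<lambda>n. exp (\<i> * s * reg_norm (\<eta> n) x) / reg_norm (\<eta> n) x * F x) \<longlonglongrightarrow>
        exp (\<i> * s * norm x) / norm x * F x"
    proof eventually_elim
      case (elim x)
      have "(\<lambda>n. reg_norm (\<eta> n) x) \<longlonglongrightarrow> sqrt (x \<bullet> x + 0\<^sup>2)"
        unfolding reg_norm_def by (intro tendsto_intros \<eta>0)
      then have "(\<lambda>n. reg_norm (\<eta> n) x) \<longlonglongrightarrow> norm x" by (simp add: norm_eq_sqrt_inner)
      then show ?case using elim by (intro tendsto_intros) auto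
    qed
    show "AE x in lborel. norm (exp (\<i> * s * reg_norm (\<eta> n) x) / reg_norm (\<eta> n) x * F x) \<le> norm (F x / of_real (norm x))" for n
      using AE_lborel_singleton[of "0::real^3"]
    proof eventually_elim
      case (elim x)
      then show ?case using ge[of x n] reg_norm_pos[OF \<eta>(1)[of n], of x]
        by (simp add: norm_mult norm_divide ne divide_left_mono)
    qed
  qed measurable
  define w where "w z = sqrt (1 + (norm z)\<^sup>2)" for z :: "real^3"
  have w1: "w z \<ge> 1" "w z \<ge> norm z" "w z \<noteq> 0" "w z > 0" for z
  proof -
    show "w z \<ge> 1" unfolding w_def by simp
    then show "w z \<noteq> 0" "w z > 0" by auto
    show "w z \<ge> norm z" unfolding w_def by (rule real_le_rsqrt) simp
  qed
  have [measurable]: "w \<in> borel_measurable borel" unfolding w_def[abs_def] by measurable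
  have scale: "reg_norm e (e *\<^sub>R z) = e * w z" if "e > 0" for e z
  proof -
    have "(e *\<^sub>R z) \<bullet> (e *\<^sub>R z) + e\<^sup>2 = e\<^sup>2 * (1 + (norm z)\<^sup>2)"
      unfolding power2_norm_eq_inner by (simp add: power2_eq_square algebra_simps)
    then show ?thesis unfolding reg_norm_def w_def using that by (simp add: real_sqrt_mult)
  qed
  define K where "K n z = g (\<eta> n *\<^sub>R z) * exp (\<i> * s * (\<eta> n * w z)) * (3 / w z ^ 5 - 3 * \<i> * s * \<eta> n / w z ^ 4 - s\<^sup>2 * (\<eta> n)\<^sup>2 / w z ^ 3)" for n z
  have eqK: "(LINT x|lborel. exp (\<i> * s * reg_norm (\<eta> n) x) / reg_norm (\<eta> n) x * F x) = (LINT z|lborel. K n z)" for n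
  proof -
    have "(LINT x|lborel. exp (\<i> * s * reg_norm (\<eta> n) x) / reg_norm (\<eta> n) x * F x) =
      (LINT x|lborel. g x * ((\<eta> n)\<^sup>2 * exp (\<i> * s * reg_norm (\<eta> n) x) *
      (3 / reg_norm (\<eta> n) x ^ 5 - 3 * \<i> * s / reg_norm (\<eta> n) x ^ 4 - s\<^sup>2 / reg_norm (\<eta> n) x ^ 3)))"
      unfolding F_def using green_regularised[OF \<eta>(1) g supp] by simp
    also have "\<dots> = (LINT z|lborel. \<eta> n ^ 3 *\<^sub>R (g (\<eta> n *\<^sub>R z) * ((\<eta> n)\<^sup>2 * exp (\<i> * s * (\<eta> n * w z)) *
      (3 / (\<eta> n * w z) ^ 5 - 3 * \<i> * s / (\<eta> n * w z) ^ 4 - s\<^sup>2 / (\<eta> n * w z) ^ 3))))"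
      by (subst integral_lborel_scale(1)[OF _ \<eta>(1)[of n]]) (auto simp: scale[OF \<eta>(1)])
    \<comment> \<open>The volume factor \<eta>^3 and the factor \<eta>^2 of the remainder cancel the
      leading power (\<eta> w)^(-5) exactly.\<close>
    also have "\<dots> = (LINT z|lborel. K n z)"
    proof (rule Bochner_Integration.integral_cong[OF refl])
      fix z
      have "complex_of_real (\<eta> n) \<noteq> 0" "complex_of_real (w z) \<noteq> 0" using \<eta>(1)[of n] w1(3)[of z] by auto
      then have "\<eta> n ^ 3 * ((\<eta> n)\<^sup>2 * (3 / (\<eta> n * w z) ^ 5 - 3 * \<i> * s / (\<eta> n * w z) ^ 4 - s\<^sup>2 / (\<eta> n * w z) ^ 3))
         = (3 / w z ^ 5 - 3 * \<i> * s * \<eta> n / w z ^ 4 - s\<^sup>2 * (\<eta> n)\<^sup>2 / w z ^ 3)"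
        by (simp add: field_simps eval_nat_numeral)
      then have "g (\<eta> n *\<^sub>R z) * exp (\<i> * s * (\<eta> n * w z)) * (\<eta> n ^ 3 * ((\<eta> n)\<^sup>2 * (3 / (\<eta> n * w z) ^ 5 - 3 * \<i> * s / (\<eta> n * w z) ^ 4 - s\<^sup>2 / (\<eta> n * w z) ^ 3)))
         = K n z" unfolding K_def by (simp only:)
      then show "\<eta> n ^ 3 *\<^sub>R (g (\<eta> n *\<^sub>R z) * ((\<eta> n)\<^sup>2 * exp (\<i> * s * (\<eta> n * w z)) *
      (3 / (\<eta> n * w z) ^ 5 - 3 * \<i> * s / (\<eta> n * w z) ^ 4 - s\<^sup>2 / (\<eta> n * w z) ^ 3))) = K n z"
        by (simp add: scaleR_conv_of_real mult_ac)
    qed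
    finally show ?thesis .
  qed
  \<comment> \<open>The last term of K decays only like w^(-3), which is not integrable at infinity.
    But where g(\<eta> z) is nonzero, \<eta> w is at most 1 + |R|, and one of the two factors \<eta>
    is spent to gain the missing power of w.\<close>
  define C where "C = Bg * (3 + 3 * \<bar>s\<bar> + s\<^sup>2 * (1 + \<bar>R\<bar>))"
  have l2: "(\<lambda>n. LINT z|lborel. K n z) \<longlonglongrightarrow> (LINT z|lborel. g 0 * of_real (3 / w z ^ 5))"
  proof (rule integral_dominated_convergence[where w = "\<lambda>z. C * (1 / (1 + (norm z)\<^sup>2)\<^sup>2)"])
    show "integrable lborel (\<lambda>z::real^3. C * (1 / (1 + (norm z)\<^sup>2)\<^sup>2))"
      by (intro integrable_mult_right integrable_bracket)
    show "K n \<in> borel_measurable lborel" for n unfolding K_def[abs_def] by measurable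
    show "AE z in lborel. (\<lambda>n. K n z) \<longlonglongrightarrow> g 0 * of_real (3 / w z ^ 5)"
    proof (intro AE_I2)
      fix z :: "real^3"
      have "(\<lambda>n. \<eta> n *\<^sub>R z) \<longlonglongrightarrow> 0 *\<^sub>R z" by (intro tendsto_intros \<eta>0)
      then have "(\<lambda>n. g (\<eta> n *\<^sub>R z)) \<longlonglongrightarrow> g 0"
        using axis_C2D(1)[OF g] by (auto intro!: isCont_tendsto_compose[of _ g] simp: continuous_on_eq_continuous_at)
      then have "(\<lambda>n. K n z) \<longlonglongrightarrow> g 0 * exp (\<i> * s * (of_real 0 * w z)) * (3 / w z ^ 5 - 3 * \<i> * s * of_real 0 / w z ^ 4 - s\<^sup>2 * (of_real 0)\<^sup>2 / w z ^ 3)"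
        unfolding K_def by (intro tendsto_intros \<eta>0) (use w1(3) \<eta>0 in auto)
      then show "(\<lambda>n. K n z) \<longlonglongrightarrow> g 0 * of_real (3 / w z ^ 5)" by simp
    qed
    show "AE z in lborel. norm (K n z) \<le> C * (1 / (1 + (norm z)\<^sup>2)\<^sup>2)" for n
    proof (intro AE_I2)
      fix z :: "real^3"
      have w4: "(1 + (norm z)\<^sup>2)\<^sup>2 = w z ^ 4"
      proof -
        have "(w z)\<^sup>2 = 1 + (norm z)\<^sup>2" unfolding w_def by simp
        moreover have "w z ^ 4 = ((w z)\<^sup>2)\<^sup>2" by simp
        ultimately show ?thesis by simp
      qed
      show "norm (K n z) \<le> C * (1 / (1 + (norm z)\<^sup>2)\<^sup>2)"
      proof (cases "g (\<eta> n *\<^sub>R z) = 0")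
        case True
        then show ?thesis using Bg unfolding K_def C_def by simp
      next
        case False
        then have "norm (\<eta> n *\<^sub>R z) \<le> R" using supp not_le by blast
        then have r: "\<eta> n * norm z \<le> \<bar>R\<bar>" using \<eta>(1)[of n] by simp
        have "w z \<le> 1 + norm z" unfolding w_def by (rule real_le_lsqrt) (auto simp: power2_eq_square algebra_simps)
        then have "\<eta> n * w z \<le> \<eta> n * (1 + norm z)" using \<eta>(1)[of n] by (intro mult_left_mono) auto
        also have "\<dots> \<le> 1 + \<bar>R\<bar>" using r \<eta>(2)[of n] by (simp add: algebra_simps)
        finally have ew: "\<eta> n * w z \<le> 1 + \<bar>R\<bar>" .
        have t1: "norm (3 / complex_of_real (w z) ^ 5) \<le> 3 / w z ^ 4"
          using w1[of z] by (simp add: norm_divide norm_power) (intro divide_left_mono power_increasing, auto)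
        have t2: "norm (3 * \<i> * s * \<eta> n / w z ^ 4) \<le> 3 * \<bar>s\<bar> / w z ^ 4"
          using w1[of z] \<eta>[of n] by (simp add: norm_divide norm_power norm_mult) (intro divide_right_mono mult_left_le, auto)
        have t3: "norm (complex_of_real (s\<^sup>2) * (\<eta> n)\<^sup>2 / w z ^ 3) \<le> s\<^sup>2 * (1 + \<bar>R\<bar>) / w z ^ 4"
        proof -
          have "norm (complex_of_real (s\<^sup>2) * (\<eta> n)\<^sup>2 / w z ^ 3) = s\<^sup>2 * (\<eta> n * (\<eta> n * w z)) / w z ^ 4"
            using w1[of z] \<eta>[of n] by (simp add: norm_divide norm_power norm_mult divide_simps eval_nat_numeral)
          also have "\<dots> \<le> s\<^sup>2 * (1 * (1 + \<bar>R\<bar>)) / w z ^ 4"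
            using ew w1[of z] \<eta>[of n] by (intro divide_right_mono mult_left_mono mult_mono) auto
          finally show ?thesis by simp
        qed
        have "norm (K n z) = norm (g (\<eta> n *\<^sub>R z)) * norm (3 / complex_of_real (w z) ^ 5 - 3 * \<i> * s * \<eta> n / w z ^ 4 - s\<^sup>2 * (\<eta> n)\<^sup>2 / w z ^ 3)"
          unfolding K_def norm_mult by (simp flip: of_real_mult)
        also have "\<dots> \<le> Bg * (3 / w z ^ 4 + 3 * \<bar>s\<bar> / w z ^ 4 + s\<^sup>2 * (1 + \<bar>R\<bar>) / w z ^ 4)"
          using t1 t2 t3
          by (intro mult_mono Bg norm_ge_zero order_trans[OF norm_triangle_ineq4] add_mono) (auto simp: Bg)
        also have "\<dots> = C * (1 / (1 + (norm z)\<^sup>2)\<^sup>2)"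
          unfolding C_def w4 by (simp add: add_divide_distrib[symmetric] distrib_left[symmetric])
        finally show ?thesis .
      qed
    qed
  qed measurable
  have "(LINT x|lborel. exp (\<i> * s * norm x) / norm x * F x) = (LINT z|lborel. g 0 * of_real (3 / w z ^ 5))"
    using l1 l2 unfolding eqK by (rule LIMSEQ_unique)
  also have "\<dots> = g 0 * of_real (1 / newton_const)"
  proof -
    have "(LINT z|lborel. g 0 * of_real (3 / w z ^ 5)) = g 0 * of_real (LINT z|lborel. 3 / w z ^ 5)"
      by (simp only: integral_mult_right_zero integral_complex_of_real)
    moreover have "(LINT z|lborel. 3 / w z ^ 5) = 1 / newton_const"
      unfolding newton_const_def w_def by simp
    ultimately show ?thesis by (simp only:)
  qed
  finally show ?thesis using newton_const_pos unfolding F_def by simp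
qed

lemma axis_C2_shift:
  fixes y :: "real^3"
  assumes "axis_C2 g g1 g2"
  shows "axis_C2 (\<lambda>x. g (y + x)) (\<lambda>i x. g1 i (y + x)) (\<lambda>i x. g2 i (y + x))"
  unfolding axis_C2_def
  using axis_C2D(4,5)[OF assms, where x = "y + _"]
  by (auto intro!: continuous_on_compose2[OF axis_C2D(1)[OF assms]] continuous_on_compose2[OF axis_C2D(2)[OF assms]]
     continuous_on_compose2[OF axis_C2D(3)[OF assms]] continuous_intros simp: add.assoc)

lemma newton_fundamental:
  fixes s :: real and g :: "real^3 \<Rightarrow> complex" and g1 g2 :: "3 \<Rightarrow> real^3 \<Rightarrow> complex" and y :: "real^3"
  assumes g: "axis_C2 g g1 g2" and supp: "\<And>x. R < norm x \<Longrightarrow> g x = 0"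
  shows "newton_const * (LINT x|lborel. exp (\<i> * s * norm (x - y)) / norm (x - y) *
    (- (\<Sum>i\<in>UNIV. g2 i x) - s\<^sup>2 * g x)) = g y"
proof -
  have [measurable]: "g \<in> borel_measurable borel" "g2 i \<in> borel_measurable borel" for i
    using axis_C2D[OF g] by (auto intro: borel_measurable_continuous_onI)
  have "g (y + x) = 0" if "R + norm y < norm x" for x
    using that norm_triangle_ineq4[of "y + x" y] by (intro supp) auto
  from newton_fundamental_origin[OF axis_C2_shift[OF g, of y] this, where s = s]
  have "newton_const * (LINT x|lborel. exp (\<i> * s * norm (y + x - y)) / norm (y + x - y) *
    (- (\<Sum>i\<in>UNIV. g2 i (y + x)) - s\<^sup>2 * g (y + x))) = g y" by simp
  then show ?thesis
    by (subst (asm) integral_lborel_shift(1)) auto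
qed

section \<open>Integrals depending on a parameter\<close>

lemma continuous_on_integral_bounded:
  fixes F :: "'b::{first_countable_topology,t2_space} \<Rightarrow> 'a \<Rightarrow> complex"
  assumes "finite_measure M" and m: "\<And>p. p \<in> S \<Longrightarrow> F p \<in> borel_measurable M"
    and c: "\<And>x. x \<in> space M \<Longrightarrow> continuous_on S (\<lambda>p. F p x)"
    and b: "\<And>p x. p \<in> S \<Longrightarrow> x \<in> space M \<Longrightarrow> norm (F p x) \<le> B"
  shows "continuous_on S (\<lambda>p. LINT x|M. F p x)"
  unfolding continuous_on_sequentially
proof (intro allI ballI impI, elim conjE)
  fix X :: "nat \<Rightarrow> 'b" and a assume a: "a \<in> S" "\<forall>n. X n \<in> S" "X \<longlonglongrightarrow> a"
  interpret finite_measure M by fact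
  have "(\<lambda>n. LINT x|M. F (X n) x) \<longlonglongrightarrow> (LINT x|M. F a x)"
  proof (rule integral_dominated_convergence[where w = "\<lambda>_. B"])
    show "AE x in M. (\<lambda>n. F (X n) x) \<longlonglongrightarrow> F a x"
    proof (intro AE_I2)
      fix x assume "x \<in> space M"
      from c[OF this] have "((\<lambda>p. F p x) \<circ> X) \<longlonglongrightarrow> F a x"
        unfolding continuous_on_sequentially using a by blast
      then show "(\<lambda>n. F (X n) x) \<longlonglongrightarrow> F a x" by (simp add: o_def)
    qed
  qed (use a m b in auto)
  then show "((\<lambda>p. LINT x|M. F p x) \<circ> X) \<longlonglongrightarrow> (LINT x|M. F a x)" by (simp add: o_def)
qed

text \<open>A uniform bound on the integrand is enough: Cauchy's inequality bounds its derivative,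
  hence its difference quotients, by the constant B/r, and constants are integrable for a finite
  measure. The derivative is measurable as a limit of difference quotients.\<close>

lemma holomorphic_on_integral_bounded:
  fixes F :: "complex \<Rightarrow> 'a \<Rightarrow> complex"
  assumes S: "open S" and fm: "finite_measure M" and m: "\<And>z. z \<in> S \<Longrightarrow> F z \<in> borel_measurable M"
    and h: "\<And>x. x \<in> space M \<Longrightarrow> (\<lambda>z. F z x) holomorphic_on S"
    and b: "\<And>z x. z \<in> S \<Longrightarrow> x \<in> space M \<Longrightarrow> norm (F z x) \<le> B"
  shows "(\<lambda>z. LINT x|M. F z x) holomorphic_on S"
proof -
  interpret finite_measure M by fact
  have "\<exists>D. ((\<lambda>z. LINT x|M. F z x) has_field_derivative D) (at z)" if z: "z \<in> S" for z
  proof -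
    obtain R where R: "R > 0" "cball z R \<subseteq> S" using S z open_contains_cball by blast
    \<comment> \<open>Half the radius, so that discs of radius r around points of the disc of radius
      r about z stay inside S.\<close>
    define r where "r = R / 2"
    have r: "r > 0" "\<And>u. u \<in> ball z r \<Longrightarrow> cball u r \<subseteq> S"
    proof -
      show "r > 0" using R unfolding r_def by simp
      fix u assume "u \<in> ball z r"
      have "cball u r \<subseteq> cball z R"
      proof
        fix y assume "y \<in> cball u r"
        then show "y \<in> cball z R"
          using dist_triangle[of z y u] \<open>u \<in> ball z r\<close> unfolding r_def by simp
      qed
      then show "cball u r \<subseteq> S" using R by blast
    qed
    have lip: "norm (F w x - F z x) \<le> B / r * norm (w - z)" if w: "w \<in> ball z r" and x: "x \<in> space M" for w x
    proof (rule field_differentiable_bound[of "ball z r" "\<lambda>z. F z x" "deriv (\<lambda>z. F z x)"])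
      fix u assume u: "u \<in> ball z r"
      then have uS: "cball u r \<subseteq> S" using r by blast
      then have "u \<in> S" using r(1) by auto
      then show "((\<lambda>z. F z x) has_field_derivative deriv (\<lambda>z. F z x) u) (at u within ball z r)"
        using holomorphic_derivI[OF h[OF x] S] has_field_derivative_at_within by blast
      have "norm ((deriv ^^ 1) (\<lambda>z. F z x) u) \<le> fact 1 * B / r ^ 1"
      proof (rule Cauchy_inequality)
        show "(\<lambda>z. F z x) holomorphic_on ball u r"
          by (rule holomorphic_on_subset[OF h[OF x]]) (use uS ball_subset_cball in blast)
        show "continuous_on (cball u r) (\<lambda>z. F z x)"
          by (rule continuous_on_subset[OF holomorphic_on_imp_continuous_on[OF h[OF x]] uS])
        show "norm (F y x) \<le> B" if "norm (u - y) = r" for y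
          using that uS by (intro b x) (auto simp: dist_norm subset_iff)
      qed (use r in auto)
      then show "norm (deriv (\<lambda>z. F z x) u) \<le> B / r" by simp
    qed (use w r in auto)
    define D where "D x = deriv (\<lambda>z. F z x) z" for x
    have lim: "(\<lambda>n. (F (X n) x - F z x) / (X n - z)) \<longlonglongrightarrow> D x"
      if "x \<in> space M" "\<forall>n. X n \<noteq> z" "X \<longlonglongrightarrow> z" for x X
    proof -
      have "((\<lambda>z. F z x) has_field_derivative D x) (at z)"
        unfolding D_def using holomorphic_derivI[OF h[OF that(1)] S z] .
      then have "((\<lambda>w. (F w x - F z x) / (w - z)) \<longlongrightarrow> D x) (at z)"
        by (simp add: has_field_derivative_iff)
      from this[unfolded tendsto_at_iff_sequentially] that(2,3) show ?thesis
        by (auto simp: o_def)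
    qed
    have "((\<lambda>w. ((LINT x|M. F w x) - (LINT x|M. F z x)) / (w - z)) \<longlongrightarrow> (LINT x|M. D x)) (at z)"
      unfolding tendsto_at_iff_sequentially
    proof (intro allI impI)
      fix X assume X: "\<forall>i. X i \<in> UNIV - {z}" "X \<longlonglongrightarrow> z"
      have "\<forall>\<^sub>F n in sequentially. X n \<in> ball z r"
        using topological_tendstoD[OF X(2) open_ball] r(1) by auto
      then obtain k where k: "\<And>n. n \<ge> k \<Longrightarrow> X n \<in> ball z r" unfolding eventually_sequentially by blast
      \<comment> \<open>The domination must hold for every index, so the terms of the sequence
        outside the small disc are dropped.\<close>
      define Y where "Y n = X (n + k)" for n
      have Y: "Y n \<noteq> z" "Y n \<in> ball z r" for n unfolding Y_def using X k by auto
      have YS: "Y n \<in> S" for n using r(2)[OF Y(2)[of n]] r(1) by auto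
      have Yl: "Y \<longlonglongrightarrow> z" unfolding Y_def using X(2) by (rule LIMSEQ_ignore_initial_segment)
      have "(\<lambda>n. LINT x|M. (F (Y n) x - F z x) / (Y n - z)) \<longlonglongrightarrow> (LINT x|M. D x)"
      proof (rule integral_dominated_convergence[where w = "\<lambda>_. B / r"])
        show mq: "(\<lambda>x. (F (Y n) x - F z x) / (Y n - z)) \<in> borel_measurable M" for n
          using m[OF YS] m[OF z] by measurable
        show "D \<in> borel_measurable M"
          by (rule borel_measurable_LIMSEQ_metric[where f = "\<lambda>n x. (F (Y n) x - F z x) / (Y n - z)", OF mq])
            (use lim Y Yl in auto)
        show "AE x in M. (\<lambda>n. (F (Y n) x - F z x) / (Y n - z)) \<longlonglongrightarrow> D x"
          by (intro AE_I2 lim) (use Y Yl in auto)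
        show "AE x in M. norm ((F (Y n) x - F z x) / (Y n - z)) \<le> B / r" for n
        proof (intro AE_I2)
          fix x assume "x \<in> space M"
          from lip[OF Y(2)[of n] this] Y(1)[of n] show "norm ((F (Y n) x - F z x) / (Y n - z)) \<le> B / r"
            by (simp add: norm_divide pos_divide_le_eq)
        qed
      qed simp
      moreover have "(LINT x|M. (F (Y n) x - F z x) / (Y n - z)) = ((LINT x|M. F (Y n) x) - (LINT x|M. F z x)) / (Y n - z)" for n
      proof -
        have "integrable M (F w)" if "w \<in> S" for w
          by (rule integrable_const_bound[of _ B]) (use that m b in auto)
        then show ?thesis using YS z by simp
      qed
      ultimately have "(\<lambda>n. ((LINT x|M. F (Y n) x) - (LINT x|M. F z x)) / (Y n - z)) \<longlonglongrightarrow> (LINT x|M. D x)" by (simp only:)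
      then have "(\<lambda>n. (\<lambda>n. ((LINT x|M. F (X n) x) - (LINT x|M. F z x)) / (X n - z)) (n + k)) \<longlonglongrightarrow> (LINT x|M. D x)"
        unfolding Y_def .
      from LIMSEQ_offset[where f = "\<lambda>n. ((LINT x|M. F (X n) x) - (LINT x|M. F z x)) / (X n - z)" and k = k, OF this]
      show "((\<lambda>w. ((LINT x|M. F w x) - (LINT x|M. F z x)) / (w - z)) \<circ> X) \<longlonglongrightarrow> (LINT x|M. D x)"
        unfolding o_def .
    qed
    then show ?thesis unfolding has_field_derivative_iff by blast
  qed
  then show ?thesis using S by (auto simp: holomorphic_on_open)
qed

lemma integral_lborel_reflect:
  fixes f :: "'a::euclidean_space \<Rightarrow> 'b::{banach,second_countable_topology}"
  assumes [measurable]: "f \<in> borel_measurable borel"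
  shows "(LINT x|lborel. f (c - x)) = (LINT x|lborel. f x)"
    and "integrable lborel (\<lambda>x. f (c - x)) \<longleftrightarrow> integrable lborel f"
proof -
  have eq: "lborel = distr lborel borel (\<lambda>x::'a. c - x)"
    using lborel_affine[of "-1" c] by (simp add: density_1)
  have "(LINT x|lborel. f x) = (LINT x|distr lborel borel (\<lambda>x::'a. c - x). f x)"
    by (subst eq) (rule refl)
  also have "\<dots> = (LINT x|lborel. f (c - x))"
    by (subst integral_distr) auto
  finally show "(LINT x|lborel. f (c - x)) = (LINT x|lborel. f x)" by simp
  have "integrable lborel f \<longleftrightarrow> integrable (distr lborel borel (\<lambda>x::'a. c - x)) f"
    by (subst eq) (rule refl)
  also have "\<dots> \<longleftrightarrow> integrable lborel (\<lambda>x. f (c - x))"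
    by (subst integrable_distr_eq) auto
  finally show "integrable lborel (\<lambda>x. f (c - x)) \<longleftrightarrow> integrable lborel f" by simp
qed

text \<open>Moving the singularity 1/|z| into the measure keeps the measure finite and leaves
  bounded continuous integrands, as the lemmas on parameter integrals require. Radius 1 is the right
  cut-off because two points of the ball of radius 1/2 differ by less than 1.\<close>

definition newton_measure :: "(real^3) measure" where
  "newton_measure = density (restrict_space lborel (ball 0 1)) (\<lambda>z. ennreal (1 / norm z))"

definition newton_mass :: real where
  "newton_mass = measure newton_measure (space newton_measure)"

lemma space_newton_measure [simp]: "space newton_measure = ball 0 1"
  by (simp add: newton_measure_def space_restrict_space)

lemma sets_newton_measure [measurable_cong]: "sets newton_measure = sets (restrict_space borel (ball 0 1))"
  by (simp add: newton_measure_def sets_restrict_space)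

lemma measurable_newton_measure: "f \<in> borel_measurable borel \<Longrightarrow> f \<in> borel_measurable newton_measure"
  by (simp add: measurable_cong_sets[OF sets_newton_measure refl] measurable_restrict_space1)

lemma integral_newton_measure:
  fixes f :: "real^3 \<Rightarrow> complex"
  assumes [measurable]: "f \<in> borel_measurable borel"
  shows "(LINT z|newton_measure. f z) = (LINT z|lborel. indicator (ball 0 1) z *\<^sub>R ((1 / norm z) *\<^sub>R f z))"
proof -
  have "(LINT z|newton_measure. f z) = (LINT z|restrict_space lborel (ball 0 1). (1 / norm z) *\<^sub>R f z)"
    unfolding newton_measure_def by (subst integral_density) (auto intro!: measurable_restrict_space1)
  also have "\<dots> = (LINT z|lborel. indicator (ball 0 1) z *\<^sub>R ((1 / norm z) *\<^sub>R f z))"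
    by (subst integral_restrict_space) auto
  finally show ?thesis .
qed

lemma finite_newton_measure: "finite_measure newton_measure"
proof
  have "emeasure newton_measure (space newton_measure) = (\<integral>\<^sup>+ z. ennreal (1 / norm z) \<partial>restrict_space lborel (ball (0::real^3) 1))"
  proof -
    let ?R = "restrict_space lborel (ball (0::real^3) 1)"
    have "emeasure (density ?R (\<lambda>z. ennreal (1 / norm z))) (space ?R) = (\<integral>\<^sup>+ z. ennreal (1 / norm z) * indicator (space ?R) z \<partial>?R)"
      by (rule emeasure_density[OF _ sets.top]) (auto intro!: measurable_restrict_space1)
    also have "\<dots> = (\<integral>\<^sup>+ z. ennreal (1 / norm z) \<partial>?R)"
      by (rule nn_integral_cong) simp
    finally show ?thesis unfolding newton_measure_def space_density .
  qed
  also have "\<dots> = (\<integral>\<^sup>+ z. ennreal (indicator (ball 0 1) z / norm z) \<partial>(lborel :: (real^3) measure))"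
    by (subst nn_integral_restrict_space) (auto intro!: nn_integral_cong simp: indicator_def)
  also have "\<dots> < \<infinity>"
    using integrable_newton_ball unfolding integrable_iff_bounded by (simp add: less_top)
  finally show "emeasure newton_measure (space newton_measure) \<noteq> \<infinity>" by simp
qed

interpretation newton: finite_measure newton_measure by (rule finite_newton_measure)

lemma newton_integral_bound:
  fixes f :: "real^3 \<Rightarrow> complex"
  assumes "\<And>z. norm z < 1 \<Longrightarrow> norm (f z) \<le> B" "B \<ge> 0"
  shows "norm (LINT z|newton_measure. f z) \<le> B * newton_mass"
proof (cases "f \<in> borel_measurable newton_measure")
  case True
  have "integrable newton_measure f"
    by (rule newton.integrable_const_bound[of _ B]) (use assms True in auto)
  then have "norm (LINT z|newton_measure. f z) \<le> (LINT z|newton_measure. B)"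
    by (intro Bochner_Integration.integral_norm_bound_integral) (use assms in auto)
  then show ?thesis by (simp add: newton_mass_def mult.commute)
next
  case False
  \<comment> \<open>By convention the Bochner integral of a function that is not integrable is
    0.\<close>
  then have "(LINT z|newton_measure. f z) = 0" using not_integrable_integral_eq borel_measurable_integrable by blast
  then show ?thesis using assms(2) by (simp add: newton_mass_def)
qed

section \<open>The Neumann series of a weak potential\<close>

text \<open>Frequencies are complex so that Cauchy's inequality applies to the amplitude.\<close>

definition strip :: "complex set" where "strip = {\<tau>. \<bar>Im \<tau>\<bar> < 1/2}"

lemma open_strip: "open strip"
proof -
  have eq: "strip = Im -` {-1/2<..<1/2}" unfolding strip_def by auto
  show ?thesis
    unfolding eq by (intro open_vimage open_greaterThanLessThan continuous_on_Im continuous_on_id)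
qed

text \<open>The half-width 1/2 of the strip is chosen so that \<open>exp (1/2)\<close> is at most 2:
  throughout, a phase at a complex frequency costs a factor 2.\<close>

lemma exp_strip_bound:
  assumes "\<tau> \<in> strip" "\<bar>r\<bar> \<le> 1"
  shows "norm (exp (\<i> * \<tau> * complex_of_real r)) \<le> 2"
proof -
  have "norm (exp (\<i> * \<tau> * complex_of_real r)) = exp (- Im \<tau> * r)" by simp
  also have "\<dots> \<le> exp (1/2)"
  proof -
    have "\<bar>Im \<tau> * r\<bar> \<le> 1/2 * 1" unfolding abs_mult using assms by (intro mult_mono) (auto simp: strip_def)
    then show ?thesis by simp
  qed
  also have "\<dots> \<le> 1 + 1/2 + (1/2)\<^sup>2" by (rule exp_bound) auto
  also have "\<dots> \<le> (2::real)" by (simp add: power2_eq_square)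
  finally show ?thesis .
qed

text \<open>The successive terms of the Born series for \<open>v * psi\<close>, with psi the scattering solution of
  incident direction \<open>\<theta>\<close> at the complex frequency \<open>\<tau>\<close>.\<close>

primrec born_term :: "(real^3 \<Rightarrow> real) \<Rightarrow> nat \<Rightarrow> complex \<Rightarrow> real^3 \<Rightarrow> real^3 \<Rightarrow> complex" where
  "born_term v 0 = (\<lambda>\<tau> \<theta> x. complex_of_real (v x) * exp (\<i> * \<tau> * complex_of_real (\<theta> \<bullet> x)))"
| "born_term v (Suc n) = (\<lambda>\<tau> \<theta> x. - complex_of_real (newton_const * v x) *
     (LINT z|newton_measure. exp (\<i> * \<tau> * complex_of_real (norm z)) * born_term v n \<tau> \<theta> (x - z)))"

text \<open>The smallness condition is a contraction condition. One Born iteration costs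
  \<open>newton_const * N\<close>, a factor 2 for the complex phase and the mass of the kernel,
  altogether at most 1/2.\<close>

locale weak_potential =
  fixes v :: "real^3 \<Rightarrow> real" and N :: real
  assumes v_cont: "continuous_on UNIV v"
    and v_supp: "\<And>x. 1/2 \<le> norm x \<Longrightarrow> v x = 0"
    and v_bound: "\<And>x. \<bar>v x\<bar> \<le> N"
    and N_small: "4 * newton_const * newton_mass * N \<le> 1"
begin

lemma N_nonneg: "N \<ge> 0" using v_bound[of 0] by simp

abbreviation born where "born \<equiv> born_term v"

abbreviation params :: "(complex \<times> (real^3) \<times> (real^3)) set" where
  "params \<equiv> strip \<times> sphere 0 1 \<times> UNIV"

lemma born_supp: "1/2 \<le> norm x \<Longrightarrow> born n \<tau> \<theta> x = 0"
  using v_supp[of x] by (cases n) simp_all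

lemma born_bound:
  assumes "\<tau> \<in> strip" "\<theta> \<in> sphere 0 1"
  shows "norm (born n \<tau> \<theta> x) \<le> 2 * N * (1/2) ^ n"
proof (induction n arbitrary: x)
  case 0
  show ?case
  proof (cases "norm x < 1/2")
    case True
    have "\<bar>\<theta> \<bullet> x\<bar> \<le> norm \<theta> * norm x" by (rule Cauchy_Schwarz_ineq2)
    then have "\<bar>\<theta> \<bullet> x\<bar> \<le> 1" using True assms(2) by simp
    from exp_strip_bound[OF assms(1) this] have "\<bar>v x\<bar> * norm (exp (\<i> * \<tau> * (\<theta> \<bullet> x))) \<le> N * 2"
      using v_bound[of x] by (intro mult_mono) auto
    then show ?thesis by (simp add: norm_mult)
  qed (use v_supp[of x] N_nonneg in auto)
next
  case (Suc n)
  have "norm (exp (\<i> * \<tau> * norm z) * born n \<tau> \<theta> (x - z)) \<le> 2 * (2 * N * (1/2) ^ n)" if "norm z < 1" for z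
    unfolding norm_mult using that by (intro mult_mono Suc exp_strip_bound assms) auto
  then have "norm (LINT z|newton_measure. exp (\<i> * \<tau> * norm z) * born n \<tau> \<theta> (x - z)) \<le> (2 * (2 * N * (1/2) ^ n)) * newton_mass"
    by (rule newton_integral_bound) (use N_nonneg in auto)
  then have "newton_const * \<bar>v x\<bar> * norm (LINT z|newton_measure. exp (\<i> * \<tau> * norm z) * born n \<tau> \<theta> (x - z))
    \<le> newton_const * N * ((2 * (2 * N * (1/2) ^ n)) * newton_mass)"
    using newton_const_pos v_bound[of x] by (intro mult_mono) auto
  also have "\<dots> = (4 * newton_const * newton_mass * N) * (N * (1/2) ^ n)" by simp
  also have "\<dots> \<le> 1 * (N * (1/2) ^ n)" by (intro mult_right_mono N_small) (use N_nonneg in auto)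
  finally show ?case using newton_const_pos by (simp add: norm_mult)
qed

text \<open>Continuity is joint in frequency, direction and position because the measurability on
  product spaces needed for Fubini is derived from it.\<close>

lemma born_continuous: "continuous_on params (\<lambda>(\<tau>, \<theta>, x). born n \<tau> \<theta> x)"
proof (induction n)
  case 0
  show ?case
    unfolding born_term.simps split_beta
    by (intro continuous_intros continuous_on_compose2[OF v_cont]) auto
next
  case (Suc n)
  have "continuous_on params (\<lambda>p. LINT z|newton_measure. exp (\<i> * fst p * norm z) * born n (fst p) (fst (snd p)) (snd (snd p) - z))"
  proof (rule continuous_on_integral_bounded[where B = "2 * (2 * N * (1/2) ^ n)"])
    fix p :: "complex \<times> (real^3) \<times> (real^3)" assume p: "p \<in> params"
    have "continuous_on UNIV (\<lambda>z. born n (fst p) (fst (snd p)) (snd (snd p) - z))"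
      using p by (intro continuous_on_compose2[OF Suc, of UNIV "\<lambda>z. (fst p, fst (snd p), snd (snd p) - z)", simplified]
        continuous_intros) auto
    then show "(\<lambda>z. exp (\<i> * fst p * norm z) * born n (fst p) (fst (snd p)) (snd (snd p) - z)) \<in> borel_measurable newton_measure"
      by (intro measurable_newton_measure borel_measurable_continuous_onI continuous_intros) auto
  next
    fix z :: "real^3" assume "z \<in> space newton_measure"
    have "continuous_on params (\<lambda>p. (\<lambda>(\<tau>, \<theta>, x). born n \<tau> \<theta> x) (fst p, fst (snd p), snd (snd p) - z))"
      by (intro continuous_on_compose2[OF Suc] continuous_intros) auto
    then show "continuous_on params (\<lambda>p. exp (\<i> * fst p * norm z) * born n (fst p) (fst (snd p)) (snd (snd p) - z))"
      by (intro continuous_intros) auto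
  next
    fix p :: "complex \<times> (real^3) \<times> (real^3)" and z assume "p \<in> params" "z \<in> space newton_measure"
    then show "norm (exp (\<i> * fst p * norm z) * born n (fst p) (fst (snd p)) (snd (snd p) - z)) \<le> 2 * (2 * N * (1/2) ^ n)"
      unfolding norm_mult by (intro mult_mono born_bound exp_strip_bound) auto
  qed (rule finite_newton_measure)
  then show ?case
    unfolding born_term.simps split_beta
    by (intro continuous_intros continuous_on_compose2[OF v_cont]) auto
qed

lemma born_continuous_x:
  assumes "\<tau> \<in> strip" "\<theta> \<in> sphere 0 1"
  shows "continuous_on UNIV (born n \<tau> \<theta>)"
proof -
  have "continuous_on UNIV (\<lambda>x. (\<lambda>(\<tau>, \<theta>, x). born n \<tau> \<theta> x) (\<tau>, \<theta>, x))"
    by (rule continuous_on_compose2[OF born_continuous]) (use assms in \<open>auto intro!: continuous_intros\<close>)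
  then show ?thesis by simp
qed

lemma born_holomorphic:
  assumes "\<theta> \<in> sphere 0 1"
  shows "(\<lambda>\<tau>. born n \<tau> \<theta> x) holomorphic_on strip"
proof (induction n arbitrary: x)
  case 0
  show ?case by (auto intro!: holomorphic_intros)
next
  case (Suc n)
  have "(\<lambda>\<tau>. LINT z|newton_measure. exp (\<i> * \<tau> * norm z) * born n \<tau> \<theta> (x - z)) holomorphic_on strip"
  proof (rule holomorphic_on_integral_bounded[where B = "2 * (2 * N * (1/2) ^ n)"])
    fix \<tau> assume "\<tau> \<in> strip"
    then show "(\<lambda>z. exp (\<i> * \<tau> * norm z) * born n \<tau> \<theta> (x - z)) \<in> borel_measurable newton_measure"
      using assms by (intro measurable_newton_measure borel_measurable_continuous_onI continuous_intros
        continuous_on_compose2[OF born_continuous_x]) auto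
  next
    fix \<tau> z assume "\<tau> \<in> strip" "z \<in> space newton_measure"
    then show "norm (exp (\<i> * \<tau> * norm z) * born n \<tau> \<theta> (x - z)) \<le> 2 * (2 * N * (1/2) ^ n)"
      unfolding norm_mult using assms by (intro mult_mono born_bound exp_strip_bound) auto
  qed (auto intro!: holomorphic_intros Suc open_strip finite_newton_measure)
  then show ?case by (auto intro!: holomorphic_intros)
qed

section \<open>Summation of the Born series\<close>

definition born_sum :: "complex \<Rightarrow> real^3 \<Rightarrow> real^3 \<Rightarrow> complex" where
  "born_sum \<tau> \<theta> x = (\<Sum>n. born n \<tau> \<theta> x)"

lemma summable_majorant: "summable (\<lambda>n. 2 * N * (1/2::real) ^ n)"
  by (intro summable_mult summable_geometric) auto

lemma born_sum_uniform:
  "uniform_limit params (\<lambda>n (\<tau>, \<theta>, x). \<Sum>i<n. born i \<tau> \<theta> x) (\<lambda>(\<tau>, \<theta>, x). born_sum \<tau> \<theta> x) sequentially"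
proof -
  have "uniform_limit params (\<lambda>n p. \<Sum>i<n. (\<lambda>(\<tau>, \<theta>, x). born i \<tau> \<theta> x) p) (\<lambda>p. \<Sum>i. (\<lambda>(\<tau>, \<theta>, x). born i \<tau> \<theta> x) p) sequentially"
    by (rule Weierstrass_m_test[OF _ summable_majorant]) (use born_bound in auto)
  then show ?thesis by (simp add: case_prod_beta' born_sum_def)
qed

lemma born_sum_continuous: "continuous_on params (\<lambda>(\<tau>, \<theta>, x). born_sum \<tau> \<theta> x)"
proof (rule uniform_limit_theorem[OF _ born_sum_uniform])
  show "\<forall>\<^sub>F n in sequentially. continuous_on params (\<lambda>(\<tau>, \<theta>, x). \<Sum>i<n. born i \<tau> \<theta> x)"
    using born_continuous by (auto simp: split_beta intro!: always_eventually continuous_intros)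
qed simp

lemma born_sum_continuous_x:
  assumes "\<tau> \<in> strip" "\<theta> \<in> sphere 0 1"
  shows "continuous_on UNIV (born_sum \<tau> \<theta>)"
proof -
  have "continuous_on UNIV (\<lambda>x. (\<lambda>(\<tau>, \<theta>, x). born_sum \<tau> \<theta> x) (\<tau>, \<theta>, x))"
    by (rule continuous_on_compose2[OF born_sum_continuous]) (use assms in \<open>auto intro!: continuous_intros\<close>)
  then show ?thesis by simp
qed

lemma born_sum_holomorphic:
  assumes "\<theta> \<in> sphere 0 1"
  shows "(\<lambda>\<tau>. born_sum \<tau> \<theta> x) holomorphic_on strip"
proof (rule holomorphic_uniform_sequence[OF open_strip])
  show "(\<lambda>\<tau>. \<Sum>i<n. born i \<tau> \<theta> x) holomorphic_on strip" for n
    by (intro holomorphic_intros born_holomorphic assms)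
  fix \<tau> assume "\<tau> \<in> strip"
  then obtain d where d: "d > 0" "cball \<tau> d \<subseteq> strip" using open_strip open_contains_cball by blast
  have "uniform_limit (cball \<tau> d) (\<lambda>n \<tau>. \<Sum>i<n. born i \<tau> \<theta> x) (\<lambda>\<tau>. \<Sum>i. born i \<tau> \<theta> x) sequentially"
    by (rule Weierstrass_m_test[OF _ summable_majorant]) (use born_bound assms d in auto)
  then show "\<exists>d>0. cball \<tau> d \<subseteq> strip \<and> uniform_limit (cball \<tau> d) (\<lambda>n \<tau>. \<Sum>i<n. born i \<tau> \<theta> x) (\<lambda>\<tau>. born_sum \<tau> \<theta> x) sequentially"
    unfolding born_sum_def using d by blast
qed

lemma born_summable:
  assumes "\<tau> \<in> strip" "\<theta> \<in> sphere 0 1"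
  shows "summable (\<lambda>n. norm (born n \<tau> \<theta> x))" "summable (\<lambda>n. born n \<tau> \<theta> x)"
proof -
  show "summable (\<lambda>n. norm (born n \<tau> \<theta> x))"
    by (rule summable_comparison_test'[OF summable_majorant, of 0]) (use born_bound[OF assms] in auto)
  then show "summable (\<lambda>n. born n \<tau> \<theta> x)" by (rule summable_norm_cancel)
qed

lemma born_sum_bound:
  assumes "\<tau> \<in> strip" "\<theta> \<in> sphere 0 1"
  shows "norm (born_sum \<tau> \<theta> x) \<le> 4 * N"
proof -
  have "norm (born_sum \<tau> \<theta> x) \<le> (\<Sum>n. norm (born n \<tau> \<theta> x))"
    unfolding born_sum_def by (rule summable_norm[OF born_summable(1)[OF assms]])
  also have "\<dots> \<le> (\<Sum>n. 2 * N * (1/2) ^ n)"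
    by (intro suminf_le born_bound assms born_summable summable_majorant)
  also have "\<dots> = 4 * N" by (simp add: suminf_mult suminf_geometric)
  finally show ?thesis .
qed

lemma born_sum_supp: "1/2 \<le> norm x \<Longrightarrow> born_sum \<tau> \<theta> x = 0"
  unfolding born_sum_def by (simp add: born_supp)

text \<open>The Lippmann-Schwinger equation for psi multiplied by v, with v psi as the unknown. In
  this form the unknown has compact support, and outside the ball of radius 1/2, where the truncated
  kernel would be wrong, both sides vanish.\<close>

lemma born_sum_equation:
  assumes "\<tau> \<in> strip" "\<theta> \<in> sphere 0 1"
  shows "born_sum \<tau> \<theta> x = v x * (exp (\<i> * \<tau> * (\<theta> \<bullet> x)) -
    newton_const * (LINT z|newton_measure. exp (\<i> * \<tau> * norm z) * born_sum \<tau> \<theta> (x - z)))"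
proof -
  let ?f = "\<lambda>n z. exp (\<i> * \<tau> * norm z) * born n \<tau> \<theta> (x - z)"
  have fb: "norm (?f n z) \<le> 2 * (2 * N * (1/2) ^ n)" if "norm z < 1" for n z
    unfolding norm_mult using that assms by (intro mult_mono born_bound exp_strip_bound) auto
  have mf: "?f n \<in> borel_measurable newton_measure" for n
    using assms by (intro measurable_newton_measure borel_measurable_continuous_onI continuous_intros
        continuous_on_compose2[OF born_continuous_x]) auto
  have fi: "integrable newton_measure (?f n)" for n
    by (rule newton.integrable_const_bound[of _ "2 * (2 * N * (1/2) ^ n)"]) (use fb mf in auto)
  have s2: "summable (\<lambda>n. 2 * (2 * N * (1/2::real) ^ n) * newton_mass)"
    by (intro summable_mult2 summable_mult summable_majorant)
  have "(\<lambda>n. LINT z|newton_measure. ?f n z) sums (LINT z|newton_measure. (\<Sum>n. ?f n z))"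
  proof (rule sums_integral[OF fi])
    show "AE z in newton_measure. summable (\<lambda>n. norm (?f n z))"
      using born_summable(1)[OF assms] by (auto simp: norm_mult summable_mult)
    show "summable (\<lambda>n. LINT z|newton_measure. norm (?f n z))"
    proof (rule summable_comparison_test'[OF s2, of 0])
      fix n
      have "norm (LINT z|newton_measure. complex_of_real (norm (?f n z))) \<le> 2 * (2 * N * (1/2) ^ n) * newton_mass"
        by (rule newton_integral_bound) (use fb N_nonneg in auto)
      then show "norm (LINT z|newton_measure. norm (?f n z)) \<le> 2 * (2 * N * (1/2) ^ n) * newton_mass"
        by (simp only: integral_complex_of_real norm_of_real real_norm_def)
    qed
  qed
  then have a: "(\<lambda>n. LINT z|newton_measure. ?f n z) sums (LINT z|newton_measure. exp (\<i> * \<tau> * norm z) * born_sum \<tau> \<theta> (x - z))"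
    unfolding born_sum_def by (simp add: suminf_mult born_summable[OF assms])
  have "born_sum \<tau> \<theta> x = born 0 \<tau> \<theta> x + (\<Sum>n. born (Suc n) \<tau> \<theta> x)"
    unfolding born_sum_def using suminf_split_head[OF born_summable(2)[OF assms]] by simp
  also have "(\<Sum>n. born (Suc n) \<tau> \<theta> x) = - newton_const * v x *
      (LINT z|newton_measure. exp (\<i> * \<tau> * norm z) * born_sum \<tau> \<theta> (x - z))"
    unfolding born_term.simps using sums_mult[OF a, of "- complex_of_real (newton_const * v x)"]
    by (intro sums_unique[symmetric]) simp
  finally show ?thesis by (simp add: algebra_simps)
qed

end

section \<open>The scattering amplitude of a weak potential\<close>

lemma iexp_diff_bound: "norm (exp (\<i> * complex_of_real a) - exp (\<i> * complex_of_real b)) \<le> \<bar>a - b\<bar>"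
proof -
  have "exp (\<i> * complex_of_real a) - exp (\<i> * complex_of_real b) =
      exp (\<i> * complex_of_real b) * (exp (\<i> * complex_of_real (a - b)) - 1)"
    by (simp add: algebra_simps flip: exp_add)
  moreover have "norm (exp (\<i> * complex_of_real (a - b)) - 1) \<le> \<bar>a - b\<bar>"
    using iexp_approx1[of "a - b" 0] by simp
  ultimately show ?thesis by (simp add: norm_mult)
qed

definition unit_ball :: "(real^3) measure" where
  "unit_ball = restrict_space lborel (ball 0 1)"

lemma space_unit_ball [simp]: "space unit_ball = ball 0 1"
  by (simp add: unit_ball_def space_restrict_space)

lemma measurable_unit_ball: "f \<in> borel_measurable borel \<Longrightarrow> f \<in> borel_measurable unit_ball"
  unfolding unit_ball_def by (rule measurable_restrict_space1) simp

lemma finite_unit_ball: "finite_measure unit_ball"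
proof
  show "emeasure unit_ball (space unit_ball) \<noteq> \<infinity>"
    using emeasure_lborel_ball_finite[of "0::real^3" 1]
    by (simp add: unit_ball_def emeasure_restrict_space space_restrict_space)
qed

interpretation unit_ball: finite_measure unit_ball by (rule finite_unit_ball)

lemma integral_unit_ball:
  fixes f :: "real^3 \<Rightarrow> complex"
  assumes "\<And>x. 1 \<le> norm x \<Longrightarrow> f x = 0"
  shows "(LINT x|unit_ball. f x) = (LINT x|lborel. f x)"
proof -
  have "(LINT x|unit_ball. f x) = (LINT x|lborel. indicator (ball 0 1) x *\<^sub>R f x)"
    unfolding unit_ball_def by (subst integral_restrict_space) auto
  also have "(\<lambda>x. indicator (ball 0 1) x *\<^sub>R f x) = f"
    using assms by (auto simp: indicator_def fun_eq_iff not_less)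
  finally show ?thesis .
qed

section \<open>The outgoing potential of a compactly supported source\<close>

definition newton_potential :: "real \<Rightarrow> (real^3 \<Rightarrow> complex) \<Rightarrow> real^3 \<Rightarrow> complex" where
  "newton_potential s w x =
     (LINT y|lborel. exp (\<i> * complex_of_real (s * norm (x - y))) / complex_of_real (norm (x - y)) * w y)"

context
  fixes w :: "real^3 \<Rightarrow> complex" and s :: real
  assumes w_cont: "continuous_on UNIV w" and w_supp: "\<And>x. 1/2 \<le> norm x \<Longrightarrow> w x = 0"
begin

lemma w_measurable [measurable]: "w \<in> borel_measurable borel"
  using w_cont by (rule borel_measurable_continuous_onI)

lemma w_supp': "1/2 < norm x \<Longrightarrow> w x = 0" using w_supp by simp

lemma newton_potential_reflect:
  "newton_potential s w x = (LINT z|lborel. exp (\<i> * complex_of_real (s * norm z)) / complex_of_real (norm z) * w (x - z))"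
  unfolding newton_potential_def
  using integral_lborel_reflect(1)[of "\<lambda>y. exp (\<i> * complex_of_real (s * norm (x - y))) / complex_of_real (norm (x - y)) * w y" x]
  by simp

lemma newton_potential_integrable:
  "integrable lborel (\<lambda>y. exp (\<i> * complex_of_real (s * norm (x - y))) / complex_of_real (norm (x - y)) * w y)"
proof -
  obtain B where B: "B \<ge> 0" "\<And>x. norm (w x) \<le> B" using compact_support_bounded[OF w_cont w_supp'] by blast
  have [measurable]: "(\<lambda>z. exp (\<i> * complex_of_real (s * norm z)) * w (x - z)) \<in> borel_measurable borel"
    by (intro borel_measurable_continuous_onI continuous_intros continuous_on_compose2[OF w_cont]) auto
  have "integrable lborel (\<lambda>z. (exp (\<i> * complex_of_real (s * norm z)) * w (x - z)) / complex_of_real (norm z))"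
  proof (rule integrable_div_norm[where B = B and R = "norm x + 1/2"])
    show "norm (exp (\<i> * complex_of_real (s * norm z)) * w (x - z)) \<le> B" for z
      using B by (simp add: norm_mult del: of_real_mult)
    show "exp (\<i> * complex_of_real (s * norm z)) * w (x - z) = 0" if "norm x + 1/2 < norm z" for z
      using w_supp[of "x - z"] that norm_triangle_ineq2[of z x] by (simp add: norm_minus_commute)
  qed simp
  then have "integrable lborel (\<lambda>z. exp (\<i> * complex_of_real (s * norm z)) / complex_of_real (norm z) * w (x - z))"
    by simp
  then show ?thesis
    using integral_lborel_reflect(2)[of "\<lambda>y. exp (\<i> * complex_of_real (s * norm (x - y))) / complex_of_real (norm (x - y)) * w y" x]
    by simp
qed

text \<open>After reflection the singularity stays at z = 0 and x occurs only in the continuous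
  source. Along a convergent sequence the shifted supports remain in one ball, on which a multiple
  of 1/|z| dominates.\<close>

lemma newton_potential_continuous: "continuous_on UNIV (newton_potential s w)"
  unfolding continuous_on_sequentially
proof (intro allI ballI impI, elim conjE)
  fix X and a :: "real^3" assume "X \<longlonglongrightarrow> a"
  obtain B where B: "B \<ge> 0" "\<And>x. norm (w x) \<le> B" using compact_support_bounded[OF w_cont w_supp'] by blast
  obtain R where R: "\<And>n. norm (X n) \<le> R"
    using convergent_imp_Bseq[OF convergentI[OF \<open>X \<longlonglongrightarrow> a\<close>]] by (auto simp: Bseq_def)
  have "(\<lambda>n. newton_potential s w (X n)) \<longlonglongrightarrow> newton_potential s w a"
    unfolding newton_potential_reflect
  proof (rule integral_dominated_convergence[where w = "\<lambda>z. norm (complex_of_real (B * indicator (cball 0 (R + 1/2)) z) / complex_of_real (norm z))"])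
    have bb: "(\<lambda>z::real^3. complex_of_real (B * indicator (cball 0 (R + 1/2)) z)) \<in> borel_measurable borel"
    proof -
      have [measurable]: "cball (0::real^3) (R + 1/2) \<in> sets borel" by simp
      show ?thesis by measurable
    qed
    show "integrable lborel (\<lambda>z::real^3. norm (complex_of_real (B * indicator (cball 0 (R + 1/2)) z) / complex_of_real (norm z)))"
      by (intro integrable_norm integrable_div_norm[OF bb, where B = B and R = "R + 1/2"])
        (auto simp: indicator_def B norm_mult)
    show "AE z in lborel. (\<lambda>n. exp (\<i> * complex_of_real (s * norm z)) / complex_of_real (norm z) * w (X n - z)) \<longlonglongrightarrow>
        exp (\<i> * complex_of_real (s * norm z)) / complex_of_real (norm z) * w (a - z)"
    proof (intro AE_I2 tendsto_mult tendsto_const)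
      fix z
      have "(\<lambda>n. X n - z) \<longlonglongrightarrow> a - z" by (intro tendsto_intros \<open>X \<longlonglongrightarrow> a\<close>)
      then show "(\<lambda>n. w (X n - z)) \<longlonglongrightarrow> w (a - z)"
        using w_cont by (auto intro!: isCont_tendsto_compose[of _ w] simp: continuous_on_eq_continuous_at)
    qed
    show "AE z in lborel. norm (exp (\<i> * complex_of_real (s * norm z)) / complex_of_real (norm z) * w (X n - z))
        \<le> norm (complex_of_real (B * indicator (cball 0 (R + 1/2)) z) / complex_of_real (norm z))" for n
    proof (intro AE_I2)
      fix z
      have "norm (w (X n - z)) \<le> B * indicator (cball 0 (R + 1/2)) z"
      proof (cases "norm z \<le> R + 1/2")
        case False
        then have "1/2 \<le> norm (X n - z)" using R[of n] norm_triangle_ineq2[of z "X n"] by (simp add: norm_minus_commute)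
        then show ?thesis using w_supp B by simp
      qed (use B in auto)
      then show "norm (exp (\<i> * complex_of_real (s * norm z)) / complex_of_real (norm z) * w (X n - z))
        \<le> norm (complex_of_real (B * indicator (cball 0 (R + 1/2)) z) / complex_of_real (norm z))"
        using B(1) by (simp add: norm_mult norm_divide divide_right_mono del: of_real_mult)
    qed
  qed (measurable)
  then show "(newton_potential s w \<circ> X) \<longlonglongrightarrow> newton_potential s w a" by (simp add: o_def)
qed

text \<open>If |x| < 1/2 and |z| \<ge> 1, then |x - z| > 1/2 and the source vanishes at x - z;
  truncating the kernel at radius 1 loses nothing.\<close>

lemma newton_potential_near:
  assumes "norm x < 1/2"
  shows "newton_potential s w x = (LINT z|newton_measure. exp (\<i> * complex_of_real s * complex_of_real (norm z)) * w (x - z))"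
proof -
  have "(LINT z|newton_measure. exp (\<i> * complex_of_real s * complex_of_real (norm z)) * w (x - z)) =
    (LINT z|lborel. indicator (ball 0 1) z *\<^sub>R ((1 / norm z) *\<^sub>R (exp (\<i> * complex_of_real s * complex_of_real (norm z)) * w (x - z))))"
    by (rule integral_newton_measure) measurable
  also have "\<dots> = newton_potential s w x"
    unfolding newton_potential_reflect
  proof (rule Bochner_Integration.integral_cong[OF refl])
    fix z
    show "indicator (ball 0 1) z *\<^sub>R ((1 / norm z) *\<^sub>R (exp (\<i> * complex_of_real s * complex_of_real (norm z)) * w (x - z)))
      = exp (\<i> * complex_of_real (s * norm z)) / complex_of_real (norm z) * w (x - z)"
    proof (cases "norm z < 1")
      case True
      then show ?thesis by (simp add: scaleR_conv_of_real divide_inverse mult_ac)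
    next
      case False
      then have "w (x - z) = 0"
        using w_supp[of "x - z"] assms norm_triangle_ineq2[of z x] by (simp add: norm_minus_commute)
      then show ?thesis by simp
    qed
  qed
  finally show ?thesis by simp
qed

text \<open>Write r = |x|, d = |x - y| and let a be the component of y along x. Replacing 1/d by 1/r
  costs 1/r^2, and replacing the phase s d by s (r - a) costs s/r times the amplitude 1/r. Both
  estimates are uniform in the direction of x.\<close>

lemma newton_potential_far:
  assumes x: "norm x \<ge> 1" and "s \<ge> 0"
  shows "norm (newton_potential s w x - exp (\<i> * complex_of_real (s * norm x)) / complex_of_real (norm x) *
      (LINT y|lborel. exp (- \<i> * complex_of_real (s * (sgn x \<bullet> y))) * w y))
    \<le> (1 + s) / (norm x)\<^sup>2 * (LINT y|lborel. norm (w y))"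
proof -
  have wi: "integrable lborel w" using w_cont w_supp' by (rule integrable_compact_support)
  let ?K = "\<lambda>y. exp (\<i> * complex_of_real (s * norm (x - y))) / complex_of_real (norm (x - y)) * w y"
  let ?E = "\<lambda>y. exp (\<i> * complex_of_real (s * norm x)) / complex_of_real (norm x) * (exp (- \<i> * complex_of_real (s * (sgn x \<bullet> y))) * w y)"
  have "integrable lborel (\<lambda>y. exp (- \<i> * complex_of_real (s * (sgn x \<bullet> y))) * w y)"
    by (rule integrable_compact_support[OF _ , where R = "1/2"])
      (use w_supp' in \<open>auto intro!: continuous_intros w_cont\<close>)
  then have Ei: "integrable lborel ?E" by (rule integrable_mult_right)
  have "newton_potential s w x - exp (\<i> * complex_of_real (s * norm x)) / complex_of_real (norm x) *
      (LINT y|lborel. exp (- \<i> * complex_of_real (s * (sgn x \<bullet> y))) * w y)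
    = (LINT y|lborel. ?K y - ?E y)"
    unfolding newton_potential_def
    by (subst Bochner_Integration.integral_diff[OF newton_potential_integrable Ei]) (simp only: integral_mult_right_zero)
  also have "norm \<dots> \<le> (LINT y|lborel. (1 + s) / (norm x)\<^sup>2 * norm (w y))"
  proof (rule Bochner_Integration.integral_norm_bound_integral)
    show "integrable lborel (\<lambda>y. ?K y - ?E y)"
      by (rule Bochner_Integration.integrable_diff[OF newton_potential_integrable Ei])
    show "integrable lborel (\<lambda>y. (1 + s) / (norm x)\<^sup>2 * norm (w y))"
      using wi by (intro integrable_mult_right integrable_norm)
    fix y
    show "norm (?K y - ?E y) \<le> (1 + s) / (norm x)\<^sup>2 * norm (w y)"
    proof (cases "norm y < 1/2")
      case True
      define a where "a = sgn x \<bullet> y"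
      define r where "r = norm x"
      define d where "d = norm (x - y)"
      have r: "r \<ge> 1" using x r_def by simp
      have "norm x \<noteq> 0" using x by linarith
      then have xs: "x = r *\<^sub>R sgn x" unfolding r_def by (simp add: sgn_div_norm)
      have nsgn: "norm (sgn x) = 1" using x by (auto simp: norm_sgn)
      have a: "\<bar>a\<bar> \<le> norm y"
        using Cauchy_Schwarz_ineq2[of "sgn x" y] nsgn unfolding a_def by simp
      have "x \<bullet> y = r * a" unfolding a_def by (subst xs) simp
      then have d2: "d\<^sup>2 = r\<^sup>2 - 2 * r * a + (norm y)\<^sup>2"
        unfolding d_def r_def power2_norm_eq_inner by (simp add: inner_diff_left inner_diff_right inner_commute)
      have d: "d \<ge> r - 1/2" unfolding d_def r_def using norm_triangle_ineq2[of x y] True by linarith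
      have d': "\<bar>d - r\<bar> \<le> norm y" unfolding d_def r_def
        using norm_triangle_ineq3[of "x - y" x] by simp
      have dp: "d \<ge> r / 2" "d > 0" using d r by auto
      have ra: "r - a \<ge> r / 2" using a True r by auto
      \<comment> \<open>This is d^2 = (r - a)^2 + |y|^2 - a^2 factored. The right side is bounded by
        1 and the second factor is at least r, so the first is at most 1/r.\<close>
      have "(d - (r - a)) * (d + (r - a)) = (norm y)\<^sup>2 - a\<^sup>2"
        using d2 by (simp add: algebra_simps power2_eq_square)
      moreover have "\<bar>(norm y)\<^sup>2 - a\<^sup>2\<bar> \<le> 1"
      proof -
        have "a\<^sup>2 \<le> (norm y)\<^sup>2" using power_mono[of "\<bar>a\<bar>" "norm y" 2] a by simp
        moreover have "(norm y)\<^sup>2 \<le> 1" using power_mono[of "norm y" 1 2] True by simp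
        ultimately show ?thesis by (intro abs_leI) (use zero_le_power2[of a] in linarith)+
      qed
      ultimately have "\<bar>d - (r - a)\<bar> * \<bar>d + (r - a)\<bar> \<le> 1" by (simp flip: abs_mult)
      moreover have "\<bar>d - (r - a)\<bar> * r \<le> \<bar>d - (r - a)\<bar> * \<bar>d + (r - a)\<bar>"
        using dp ra r by (intro mult_left_mono) auto
      ultimately have phase: "\<bar>d - (r - a)\<bar> \<le> 1 / r" using r by (simp add: pos_le_divide_eq)
      have inv: "\<bar>1 / d - 1 / r\<bar> \<le> 1 / r\<^sup>2"
      proof -
        have "\<bar>1 / d - 1 / r\<bar> = \<bar>d - r\<bar> / (d * r)"
          using dp r by (simp add: divide_simps abs_if)
        also have "\<dots> \<le> (1/2) / ((r / 2) * r)"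
          using d' dp r True by (intro frac_le mult_right_mono) auto
        finally show ?thesis by (simp add: power2_eq_square)
      qed
      \<comment> \<open>First the amplitude is changed, then the phase; each error is multiplied by
        something already bounded.\<close>
      have "?K y - ?E y = ((complex_of_real (1 / d - 1 / r)) * exp (\<i> * complex_of_real (s * d)) +
          complex_of_real (1 / r) * (exp (\<i> * complex_of_real (s * d)) - exp (\<i> * complex_of_real (s * (r - a))))) * w y"
      proof -
        have "exp (\<i> * complex_of_real (s * (r - a))) = exp (\<i> * complex_of_real (s * r)) * exp (- \<i> * complex_of_real (s * a))"
          by (simp add: algebra_simps flip: exp_add)
        moreover have "E1 / D * W - E2 / R * (E3 * W) = ((1 / D - 1 / R) * E1 + 1 / R * (E1 - E2 * E3)) * W"
          for E1 E2 E3 D R W :: complex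
          by (simp add: algebra_simps)
        ultimately show ?thesis unfolding d_def[symmetric] r_def[symmetric] a_def[symmetric]
          by (simp only: of_real_diff of_real_divide of_real_1)
      qed
      also have "norm \<dots> \<le> (1 / r\<^sup>2 * 1 + 1 / r * (s * (1 / r))) * norm (w y)"
      proof -
        have "norm (exp (\<i> * complex_of_real (s * d)) - exp (\<i> * complex_of_real (s * (r - a)))) \<le> \<bar>s * d - s * (r - a)\<bar>"
          by (rule iexp_diff_bound)
        also have "\<dots> = s * \<bar>d - (r - a)\<bar>" using \<open>s \<ge> 0\<close> by (simp add: abs_mult flip: right_diff_distrib)
        also have "\<dots> \<le> s * (1 / r)" using \<open>s \<ge> 0\<close> phase by (intro mult_left_mono)
        finally have e: "norm (exp (\<i> * complex_of_real (s * d)) - exp (\<i> * complex_of_real (s * (r - a)))) \<le> s * (1 / r)" .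
        have "norm (complex_of_real (1 / d - 1 / r)) * norm (exp (\<i> * complex_of_real (s * d))) \<le> 1 / r\<^sup>2 * 1"
          using inv by (intro mult_mono) (auto simp only: norm_of_real norm_exp_i_times)
        moreover have "norm (complex_of_real (1 / r)) * norm (exp (\<i> * complex_of_real (s * d)) - exp (\<i> * complex_of_real (s * (r - a)))) \<le> 1 / r * (s * (1 / r))"
        proof -
          have "1 / r \<ge> 0" "\<bar>1 / r\<bar> = 1 / r" using r by auto
          then show ?thesis using e by (simp only: norm_of_real) (rule mult_left_mono)
        qed
        ultimately have "norm (complex_of_real (1 / d - 1 / r) * exp (\<i> * complex_of_real (s * d)) +
          complex_of_real (1 / r) * (exp (\<i> * complex_of_real (s * d)) - exp (\<i> * complex_of_real (s * (r - a)))))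
          \<le> 1 / r\<^sup>2 * 1 + 1 / r * (s * (1 / r))"
          by (intro order_trans[OF norm_triangle_ineq] add_mono) (simp_all only: norm_mult)
        then show ?thesis
          by (subst norm_mult) (rule mult_right_mono[OF _ norm_ge_zero])
      qed
      also have "1 / r\<^sup>2 * 1 + 1 / r * (s * (1 / r)) = (1 + s) / r\<^sup>2"
        by (simp add: power2_eq_square add_divide_distrib)
      finally show ?thesis unfolding r_def .
    next
      case False
      then show ?thesis using w_supp[of y] by simp
    qed
  qed
  also have "\<dots> = (1 + s) / (norm x)\<^sup>2 * (LINT y|lborel. norm (w y))" by simp
  finally show ?thesis .
qed

end

section \<open>Test functions and plane waves as input to Green's identity\<close>

lemma has_bochner_integral_lebesgue:
  fixes f :: "'a::euclidean_space \<Rightarrow> 'b::{banach,second_countable_topology}"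
  assumes "has_bochner_integral lborel f x"
  shows "has_bochner_integral lebesgue f x"
proof -
  have "f \<in> borel_measurable lborel" "integrable lborel f" "integral\<^sup>L lborel f = x"
    using assms by (auto simp: has_bochner_integral_iff)
  then show ?thesis
    by (simp add: has_bochner_integral_iff integrable_completion integral_completion)
qed

lemma axis_C2_of_real:
  fixes \<phi> :: "real^3 \<Rightarrow> real"
  assumes "C_k_on 2 UNIV \<phi>"
  shows "axis_C2 (\<lambda>x. of_real (\<phi> x)) (\<lambda>i x. of_real (iter_partial [i] \<phi> x)) (\<lambda>i x. of_real (iter_partial [i, i] \<phi> x))"
proof -
  have "\<phi> differentiable (at x)" "partial_deriv i \<phi> differentiable (at x)"
     "continuous_on UNIV \<phi>" "continuous_on UNIV (partial_deriv i \<phi>)"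
     "continuous_on UNIV (partial_deriv i (partial_deriv i \<phi>))" for i x
    using assms unfolding C_k_on_def
    by (force dest: spec[of _ "[]"] spec[of _ "[i]"] spec[of _ "[i,i]"])+
  then show ?thesis
    unfolding axis_C2_def
    by (auto intro!: continuous_on_of_real has_vector_derivative_of_real differentiable_line_derivative
      simp: has_real_derivative_iff_has_vector_derivative)
qed

lemma axis_C2_plane_wave:
  fixes k :: "real^3"
  shows "axis_C2 (\<lambda>x. exp (\<i> * complex_of_real (k \<bullet> x))) (\<lambda>i x. \<i> * complex_of_real (k $ i) * exp (\<i> * complex_of_real (k \<bullet> x)))
    (\<lambda>i x. - complex_of_real ((k $ i)\<^sup>2) * exp (\<i> * complex_of_real (k \<bullet> x)))"
proof -
  have d: "((\<lambda>t. c * exp (\<i> * complex_of_real (k \<bullet> (x + t *\<^sub>R axis i 1)))) has_vector_derivative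
      c * (\<i> * complex_of_real (k $ i) * exp (\<i> * complex_of_real (k \<bullet> x)))) (at 0)" for c :: complex and x i
  proof -
    have "((\<lambda>z. c * exp (\<i> * (complex_of_real (k \<bullet> x) + z * complex_of_real (k $ i)))) has_field_derivative
       c * (\<i> * complex_of_real (k $ i) * exp (\<i> * complex_of_real (k \<bullet> x)))) (at (complex_of_real 0))"
      by (auto intro!: derivative_eq_intros)
    from has_vector_derivative_real_field[OF this] show ?thesis
      by (simp add: inner_add_right inner_axis)
  qed
  have "((\<lambda>t. \<i> * complex_of_real (k $ i) * exp (\<i> * complex_of_real (k \<bullet> (x + t *\<^sub>R axis i 1)))) has_vector_derivative
      - complex_of_real ((k $ i)\<^sup>2) * exp (\<i> * complex_of_real (k \<bullet> x))) (at 0)" for x i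
  proof -
    have "\<i> * complex_of_real (k $ i) * (\<i> * complex_of_real (k $ i) * exp (\<i> * complex_of_real (k \<bullet> x))) =
       - complex_of_real ((k $ i)\<^sup>2) * exp (\<i> * complex_of_real (k \<bullet> x))"
    proof -
      have "\<i> * a * (\<i> * a * b) = (\<i> * \<i>) * (a * a * b)" for a b :: complex by (simp only: mult_ac)
      then show ?thesis by (simp add: power2_eq_square)
    qed
    then show ?thesis using d[of "\<i> * complex_of_real (k $ i)" x i] by (simp only:)
  qed
  moreover have "((\<lambda>t. exp (\<i> * complex_of_real (k \<bullet> (x + t *\<^sub>R axis i 1)))) has_vector_derivative
      \<i> * complex_of_real (k $ i) * exp (\<i> * complex_of_real (k \<bullet> x))) (at 0)" for x i
    using d[of 1 x i] by (simp only: mult_1_left)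
  ultimately show ?thesis
    unfolding axis_C2_def by (intro conjI allI continuous_intros) (simp_all only:)
qed

context weak_potential begin

text \<open>The Fourier integral of v psi at the outgoing frequency, kept for complex \<tau>. The
  divisor \<open>2 * pi^2\<close> undoes the normalisation in the asymptotics that define the
  amplitude.\<close>

definition far_field :: "complex \<Rightarrow> real^3 \<Rightarrow> real^3 \<Rightarrow> complex" where
  "far_field \<tau> \<theta> \<omega> = newton_const / (2 * pi\<^sup>2) *
     (LINT y|unit_ball. exp (- \<i> * \<tau> * complex_of_real (\<omega> \<bullet> y)) * born_sum \<tau> \<theta> y)"

definition wave :: "real \<Rightarrow> real^3 \<Rightarrow> real^3 \<Rightarrow> complex" where
  "wave s \<theta> x = exp (\<i> * complex_of_real (s * (\<theta> \<bullet> x))) - newton_const * newton_potential s (born_sum (of_real s) \<theta>) x"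

lemma of_real_strip: "complex_of_real s \<in> strip" by (simp add: strip_def)

context
  fixes s :: real and \<theta> :: "real^3"
  assumes s: "s > 0" and \<theta>: "norm \<theta> = 1"
begin

lemma \<theta>_sphere: "\<theta> \<in> sphere 0 1" using \<theta> by simp

lemmas bs_cont = born_sum_continuous_x[OF of_real_strip[of s] \<theta>_sphere]
lemmas bs_supp = born_sum_supp[of _ "of_real s" \<theta>]

lemma wave_continuous: "continuous_on UNIV (wave s \<theta>)"
  unfolding wave_def[abs_def]
  by (intro continuous_intros newton_potential_continuous[OF bs_cont bs_supp])

text \<open>Inside the ball of radius 1/2 the truncated and the full potential coincide, so this is
  the Lippmann-Schwinger equation; outside it both sides are 0.\<close>

lemma potential_times_wave: "v x * wave s \<theta> x = born_sum (of_real s) \<theta> x"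
proof (cases "norm x < 1/2")
  case True
  then show ?thesis
    using born_sum_equation[OF of_real_strip[of s] \<theta>_sphere, of x] newton_potential_near[OF bs_cont bs_supp True, where s = s]
    by (simp add: wave_def mult.assoc)
next
  case False
  then show ?thesis using v_supp[of x] bs_supp[of x] by simp
qed

text \<open>All derivatives stay on the test function. Put F = -\<Delta>\<phi> - s^2 \<phi>. The
  plane wave is orthogonal to F by Green's identity, while Fubini and the fundamental solution turn
  the integral of the potential against F into the integral of w \<phi>. Since w = v psi, this
  cancels the term v psi \<phi>.\<close>

lemma wave_solution: "schroedinger_solution v (s\<^sup>2) (wave s \<theta>)"
  unfolding schroedinger_solution_def
proof (intro allI impI)
  fix \<phi> :: "real^3 \<Rightarrow> real" assume "test_function \<phi>"
  then have ck: "\<And>k. C_k_on k UNIV \<phi>" and "compact (supp \<phi>)" unfolding test_function_def by auto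
  then obtain R where R: "\<And>x. x \<in> supp \<phi> \<Longrightarrow> norm x \<le> R"
    using compact_imp_bounded[OF \<open>compact (supp \<phi>)\<close>] unfolding bounded_iff by blast
  have \<phi>0: "\<phi> x = 0" if "R < norm x" for x
  proof (rule ccontr)
    assume "\<phi> x \<noteq> 0"
    then have "x \<in> supp \<phi>" unfolding supp_def by (intro subsetD[OF closure_subset]) simp
    then show False using R[of x] that by simp
  qed
  define g where "g x = complex_of_real (\<phi> x)" for x
  define g2 where "g2 i x = complex_of_real (iter_partial [i, i] \<phi> x)" for i x
  define g1 where "g1 i x = complex_of_real (iter_partial [i] \<phi> x)" for i x
  have ac: "axis_C2 g g1 g2"
    unfolding g_def[abs_def] g1_def[abs_def] g2_def[abs_def] by (rule axis_C2_of_real[OF ck])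
  have gs: "g x = 0" if "R < norm x" for x
    unfolding g_def using \<phi>0[OF that] by simp
  define F where "F x = - (\<Sum>i\<in>UNIV. g2 i x) - s\<^sup>2 * g x" for x
  have F_cont: "continuous_on UNIV F" unfolding F_def[abs_def] by (intro continuous_intros axis_C2D[OF ac])
  have F_supp: "F x = 0" if "R < norm x" for x
    unfolding F_def using axis_C2_support(2)[OF ac gs that] gs[OF that] by simp
  define w where "w = born_sum (complex_of_real s) \<theta>"
  have w_cont: "continuous_on UNIV w" and w_supp: "\<And>x. 1/2 \<le> norm x \<Longrightarrow> w x = 0"
    unfolding w_def using bs_cont bs_supp by auto
  have [measurable]: "F \<in> borel_measurable borel" "w \<in> borel_measurable borel"
    using F_cont w_cont by (auto intro: borel_measurable_continuous_onI)
  let ?e = "\<lambda>x. exp (\<i> * complex_of_real (s * (\<theta> \<bullet> x)))"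
  let ?K = "\<lambda>x y. exp (\<i> * complex_of_real (s * norm (x - y))) / complex_of_real (norm (x - y))"
  have plane: "(LINT x|lborel. ?e x * F x) = 0"
  proof -
    let ?p = "\<lambda>x. exp (\<i> * complex_of_real ((s *\<^sub>R \<theta>) \<bullet> x))"
    have sq: "(\<Sum>i\<in>UNIV. - complex_of_real (((s *\<^sub>R \<theta>) $ i)\<^sup>2) * ?p x) = - s\<^sup>2 * ?p x" for x
    proof -
      have "(\<Sum>i\<in>UNIV. (\<theta> $ i)\<^sup>2) = 1"
        using \<theta> unfolding norm_eq_sqrt_inner inner_vec_def by (simp add: power2_eq_square)
      moreover have "(\<Sum>i\<in>UNIV. ((s *\<^sub>R \<theta>) $ i)\<^sup>2) = s\<^sup>2 * (\<Sum>i\<in>UNIV. (\<theta> $ i)\<^sup>2)"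
        by (simp add: power_mult_distrib sum_distrib_left)
      ultimately have "(\<Sum>i\<in>UNIV. ((s *\<^sub>R \<theta>) $ i)\<^sup>2) = s\<^sup>2" by simp
      then have "(\<Sum>i\<in>UNIV. complex_of_real (((s *\<^sub>R \<theta>) $ i)\<^sup>2)) = complex_of_real (s\<^sup>2)"
        by (simp only: of_real_sum[symmetric])
      then show ?thesis
        by (simp only: sum_distrib_right[symmetric] sum_negf of_real_minus)
    qed
    have "(LINT x|lborel. ?p x * (\<Sum>i\<in>UNIV. g2 i x)) = (LINT x|lborel. g x * (- s\<^sup>2 * ?p x))"
      using green[OF axis_C2_plane_wave[of "s *\<^sub>R \<theta>"] ac gs] unfolding sq .
    moreover have "integrable lborel (\<lambda>x. ?p x * (\<Sum>i\<in>UNIV. g2 i x))"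
      by (rule integrable_compact_support[where R=R])
        (use axis_C2_support(2)[OF ac gs] in \<open>auto intro!: continuous_intros axis_C2D[OF ac]\<close>)
    moreover have "integrable lborel (\<lambda>x. g x * (- s\<^sup>2 * ?p x))"
      by (rule integrable_compact_support[where R=R])
        (use gs in \<open>auto intro!: continuous_intros axis_C2D(1)[OF ac]\<close>)
    ultimately have "(LINT x|lborel. g x * (- s\<^sup>2 * ?p x) - ?p x * (\<Sum>i\<in>UNIV. g2 i x)) = 0"
      by (subst Bochner_Integration.integral_diff) auto
    also have "(\<lambda>x. g x * (- s\<^sup>2 * ?p x) - ?p x * (\<Sum>i\<in>UNIV. g2 i x)) = (\<lambda>x. ?e x * F x)"
      by (auto simp: F_def fun_eq_iff algebra_simps)
    finally show ?thesis .
  qed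
  have fund: "newton_const * (LINT x|lborel. ?K x y * F x) = g y" for y
    using newton_fundamental[OF ac gs, of R s y] unfolding F_def by (simp add: mult.assoc)
  have swap: "(LINT x|lborel. newton_potential s w x * F x) = (LINT y|lborel. w y * (LINT x|lborel. ?K x y * F x))"
  proof -
    let ?h = "\<lambda>(x, y). ?K x y * w y * F x"
    have [measurable]: "?h \<in> borel_measurable (lborel \<Otimes>\<^sub>M lborel)" by measurable
    have aw: "continuous_on UNIV (\<lambda>y. complex_of_real (norm (w y)))" "\<And>x. 1/2 \<le> norm x \<Longrightarrow> complex_of_real (norm (w x)) = 0"
      using w_cont w_supp by (auto intro!: continuous_intros)
    \<comment> \<open>The inner integral of absolute values is again a potential, that of |w| at
      frequency 0, whose continuity is already known; multiplied by the compactly supported |F| it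
      is integrable.\<close>
    have nh: "(LINT y|lborel. norm (?h (x, y))) = Re (newton_potential 0 (\<lambda>y. complex_of_real (norm (w y))) x) * norm (F x)" for x
    proof -
      have "newton_potential 0 (\<lambda>y. complex_of_real (norm (w y))) x = (LINT y|lborel. complex_of_real (norm (w y) / norm (x - y)))"
        unfolding newton_potential_def by simp
      also have "\<dots> = complex_of_real (LINT y|lborel. norm (w y) / norm (x - y))" by (rule integral_complex_of_real)
      finally have "Re (newton_potential 0 (\<lambda>y. complex_of_real (norm (w y))) x) = (LINT y|lborel. norm (w y) / norm (x - y))"
        by simp
      moreover have "norm (?h (x, y)) = norm (w y) / norm (x - y) * norm (F x)" for y
        by (simp add: norm_mult norm_divide del: of_real_mult)
      ultimately show ?thesis by (simp only: integral_mult_left_zero)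
    qed
    have hi: "integrable (lborel \<Otimes>\<^sub>M lborel) ?h"
    proof (rule lborel_pair.Fubini_integrable)
      show "integrable lborel (\<lambda>x. LINT y|lborel. norm (?h (x, y)))"
        unfolding nh
        by (rule integrable_compact_support[where R=R])
          (use F_supp in \<open>auto intro!: continuous_intros F_cont newton_potential_continuous[OF aw]\<close>)
      show "AE x in lborel. integrable lborel (\<lambda>y. ?h (x, y))"
        unfolding prod.case by (intro AE_I2 integrable_mult_left newton_potential_integrable[OF w_cont w_supp])
    qed measurable
    have "(LINT x|lborel. newton_potential s w x * F x) = (LINT x|lborel. LINT y|lborel. ?h (x, y))"
      by (simp only: newton_potential_def prod.case integral_mult_left_zero)
    also have "\<dots> = (LINT y|lborel. LINT x|lborel. ?h (x, y))"
      by (rule lborel_pair.Fubini_integral[of "\<lambda>x y. ?h (x, y)", symmetric]) (use hi in simp)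
    also have "\<dots> = (LINT y|lborel. w y * (LINT x|lborel. ?K x y * F x))"
    proof (rule Bochner_Integration.integral_cong[OF refl])
      fix y
      show "(LINT x|lborel. ?h (x, y)) = w y * (LINT x|lborel. ?K x y * F x)"
        by (subst integral_mult_right_zero[symmetric]) (simp only: prod.case mult_ac)
    qed
    finally show ?thesis .
  qed
  have gw: "newton_const * (LINT x|lborel. newton_potential s w x * F x) = (LINT y|lborel. w y * g y)"
  proof -
    have "(LINT y|lborel. w y * g y) = (LINT y|lborel. newton_const * (w y * (LINT x|lborel. ?K x y * F x)))"
      by (simp only: fund[symmetric] mult.left_commute)
    then show ?thesis unfolding swap by (simp only: integral_mult_right_zero)
  qed
  have i1: "integrable lborel (\<lambda>x. ?e x * F x)"
    by (rule integrable_compact_support[where R=R]) (use F_supp in \<open>auto intro!: continuous_intros F_cont\<close>)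
  have i2: "integrable lborel (\<lambda>x. newton_const * (newton_potential s w x * F x))"
    by (rule integrable_mult_right, rule integrable_compact_support[where R=R])
      (use F_supp in \<open>auto intro!: continuous_intros F_cont newton_potential_continuous[OF w_cont w_supp]\<close>)
  have i3: "integrable lborel (\<lambda>x. w x * g x)"
    by (rule integrable_compact_support[where R=R]) (use gs in \<open>auto intro!: continuous_intros w_cont axis_C2D(1)[OF ac]\<close>)
  have "has_bochner_integral lborel (\<lambda>x. ?e x * F x - newton_const * (newton_potential s w x * F x) + w x * g x)
     ((LINT x|lborel. ?e x * F x) - (LINT x|lborel. newton_const * (newton_potential s w x * F x)) + (LINT x|lborel. w x * g x))"
    using i1 i2 i3 by (intro has_bochner_integral_add has_bochner_integral_diff has_bochner_integral_integrable)
  moreover have "(\<lambda>x. ?e x * F x - newton_const * (newton_potential s w x * F x) + w x * g x) =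
     (\<lambda>x. wave s \<theta> x * complex_of_real (- laplacian \<phi> x + v x * \<phi> x - s\<^sup>2 * \<phi> x))"
  proof
    fix x
    have eq: "complex_of_real (- laplacian \<phi> x + v x * \<phi> x - s\<^sup>2 * \<phi> x) = F x + v x * g x"
      unfolding F_def g_def g2_def laplacian_def by simp
    have "wave s \<theta> x * complex_of_real (- laplacian \<phi> x + v x * \<phi> x - s\<^sup>2 * \<phi> x) = wave s \<theta> x * F x + (v x * wave s \<theta> x) * g x"
      unfolding eq by (simp add: distrib_left mult_ac)
    then show "?e x * F x - newton_const * (newton_potential s w x * F x) + w x * g x =
      wave s \<theta> x * complex_of_real (- laplacian \<phi> x + v x * \<phi> x - s\<^sup>2 * \<phi> x)"
      unfolding potential_times_wave w_def[symmetric]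
      by (simp only: wave_def w_def[symmetric] left_diff_distrib mult.assoc)
  qed
  moreover have "(LINT x|lborel. ?e x * F x) - (LINT x|lborel. newton_const * (newton_potential s w x * F x)) + (LINT x|lborel. w x * g x) = 0"
    using gw plane by simp
  ultimately have "has_bochner_integral lborel (\<lambda>x. wave s \<theta> x * complex_of_real (- laplacian \<phi> x + v x * \<phi> x - s\<^sup>2 * \<phi> x)) 0"
    by simp
  then show "has_bochner_integral lebesgue (\<lambda>x. wave s \<theta> x * complex_of_real (- laplacian \<phi> x + v x * \<phi> x - s\<^sup>2 * \<phi> x)) 0"
    by (rule has_bochner_integral_lebesgue)
qed

lemma wave_asymptotics:
  "(\<lambda>x. wave s \<theta> x - (exp (\<i> * complex_of_real (s * (\<theta> \<bullet> x))) -
      2 * complex_of_real pi ^ 2 * (exp (\<i> * complex_of_real (s * norm x)) / complex_of_real (norm x)) *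
      far_field (of_real s) \<theta> (sgn x))) \<in> o[at_infinity](\<lambda>x. complex_of_real (1 / norm x))"
proof (rule landau_o.smallI)
  fix c :: real assume c: "c > 0"
  define w where "w = born_sum (complex_of_real s) \<theta>"
  have w_cont: "continuous_on UNIV w" and w_supp: "\<And>x. 1/2 \<le> norm x \<Longrightarrow> w x = 0"
    unfolding w_def using bs_cont bs_supp by auto
  \<comment> \<open>The total error is at most C/|x|^2, which is below c/|x| as soon as |x| \<ge>
    C/c.\<close>
  define C where "C = newton_const * ((1 + s) * (LINT y|lborel. norm (w y)))"
  have C: "C \<ge> 0" unfolding C_def using newton_const_pos s by (intro mult_nonneg_nonneg) auto
  have "norm (wave s \<theta> x - (exp (\<i> * complex_of_real (s * (\<theta> \<bullet> x))) -
      2 * complex_of_real pi ^ 2 * (exp (\<i> * complex_of_real (s * norm x)) / complex_of_real (norm x)) *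
      far_field (of_real s) \<theta> (sgn x))) \<le> c * norm (complex_of_real (1 / norm x))"
    if x: "norm x \<ge> max 1 (C / c)" for x
  proof -
    have "far_field (of_real s) \<theta> (sgn x) = newton_const / (2 * pi\<^sup>2) * (LINT y|lborel. exp (- \<i> * complex_of_real (s * (sgn x \<bullet> y))) * w y)"
      unfolding far_field_def using integral_unit_ball[of "\<lambda>y. exp (- \<i> * complex_of_real (s * (sgn x \<bullet> y))) * w y"] w_supp
      by (simp add: w_def mult.assoc)
    then have "2 * complex_of_real pi ^ 2 * (exp (\<i> * complex_of_real (s * norm x)) / complex_of_real (norm x)) * far_field (of_real s) \<theta> (sgn x)
      = newton_const * (exp (\<i> * complex_of_real (s * norm x)) / complex_of_real (norm x) * (LINT y|lborel. exp (- \<i> * complex_of_real (s * (sgn x \<bullet> y))) * w y))"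
      by simp
    then have "wave s \<theta> x - (exp (\<i> * complex_of_real (s * (\<theta> \<bullet> x))) -
      2 * complex_of_real pi ^ 2 * (exp (\<i> * complex_of_real (s * norm x)) / complex_of_real (norm x)) *
      far_field (of_real s) \<theta> (sgn x)) = - newton_const * (newton_potential s w x -
      exp (\<i> * complex_of_real (s * norm x)) / complex_of_real (norm x) * (LINT y|lborel. exp (- \<i> * complex_of_real (s * (sgn x \<bullet> y))) * w y))"
      unfolding wave_def w_def[symmetric] by (simp add: algebra_simps)
    also have "norm \<dots> \<le> newton_const * ((1 + s) / (norm x)\<^sup>2 * (LINT y|lborel. norm (w y)))"
      using newton_potential_far[OF w_cont w_supp, of x s] s x newton_const_pos
      unfolding norm_mult by (intro mult_mono) auto
    also have "\<dots> = C / norm x * (1 / norm x)" unfolding C_def by (simp add: power2_eq_square)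
    also have "\<dots> \<le> c * (1 / norm x)"
      using x c by (intro mult_right_mono) (auto simp: divide_le_eq mult.commute)
    finally show ?thesis by (simp add: norm_divide)
  qed
  then show "\<forall>\<^sub>F x in at_infinity. norm (wave s \<theta> x - (exp (\<i> * complex_of_real (s * (\<theta> \<bullet> x))) -
      2 * complex_of_real pi ^ 2 * (exp (\<i> * complex_of_real (s * norm x)) / complex_of_real (norm x)) *
      far_field (of_real s) \<theta> (sgn x))) \<le> c * norm (complex_of_real (1 / norm x))"
    unfolding eventually_at_infinity by blast
qed

end

lemma far_field_continuous: "continuous_on (strip \<times> sphere 0 1 \<times> sphere 0 1) (\<lambda>(\<tau>, \<theta>, \<omega>). far_field \<tau> \<theta> \<omega>)"
proof -
  have "continuous_on (strip \<times> sphere 0 1 \<times> sphere 0 1) (\<lambda>p. LINT y|unit_ball.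
     exp (- \<i> * fst p * complex_of_real (snd (snd p) \<bullet> y)) * born_sum (fst p) (fst (snd p)) y)"
  proof (rule continuous_on_integral_bounded[where B = "2 * (4 * N)"])
    fix p :: "complex \<times> (real^3) \<times> (real^3)" assume p: "p \<in> strip \<times> sphere 0 1 \<times> sphere 0 1"
    then have *: "fst p \<in> strip" "fst (snd p) \<in> sphere 0 1" "norm (snd (snd p)) = 1" by auto
    show "(\<lambda>y. exp (- \<i> * fst p * complex_of_real (snd (snd p) \<bullet> y)) * born_sum (fst p) (fst (snd p)) y) \<in> borel_measurable unit_ball"
      by (intro measurable_unit_ball borel_measurable_continuous_onI continuous_intros born_sum_continuous_x *)
    fix y assume y: "y \<in> space unit_ball"
    have "\<bar>- (snd (snd p) \<bullet> y)\<bar> \<le> norm (snd (snd p)) * norm y" unfolding abs_minus_cancel by (rule Cauchy_Schwarz_ineq2)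
    then have "\<bar>- (snd (snd p) \<bullet> y)\<bar> \<le> 1" using * y by simp
    from exp_strip_bound[OF *(1) this]
    have "norm (exp (- \<i> * fst p * complex_of_real (snd (snd p) \<bullet> y))) \<le> 2" by simp
    then show "norm (exp (- \<i> * fst p * complex_of_real (snd (snd p) \<bullet> y)) * born_sum (fst p) (fst (snd p)) y) \<le> 2 * (4 * N)"
      unfolding norm_mult by (intro mult_mono born_sum_bound *) auto
  next
    fix y :: "real^3"
    have "continuous_on (strip \<times> sphere 0 1 \<times> sphere 0 1) (\<lambda>p. (\<lambda>(\<tau>, \<theta>, x). born_sum \<tau> \<theta> x) (fst p, fst (snd p), y))"
      by (rule continuous_on_compose2[OF born_sum_continuous]) (auto intro!: continuous_intros)
    then show "continuous_on (strip \<times> sphere 0 1 \<times> sphere 0 1) (\<lambda>p. exp (- \<i> * fst p * complex_of_real (snd (snd p) \<bullet> y)) * born_sum (fst p) (fst (snd p)) y)"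
      by (intro continuous_intros) auto
  qed (rule finite_unit_ball)
  then show ?thesis
    unfolding far_field_def by (simp add: case_prod_beta') (intro continuous_intros, assumption, auto)
qed

theorem scattering_amplitude_far_field: "scattering_amplitude v (\<lambda>\<theta> \<omega> s. far_field (of_real s) \<theta> \<omega>)"
  unfolding scattering_amplitude_def
proof (intro allI impI conjI)
  fix k :: "real^3" assume k: "k \<noteq> 0"
  have s: "norm k > 0" and t: "norm (sgn k) = 1" using k by (auto simp: norm_sgn)
  have ip: "norm k * (sgn k \<bullet> x) = k \<bullet> x" for x using k by (simp add: sgn_div_norm)
  have "continuous_on (sphere 0 1) (\<lambda>\<omega>. (\<lambda>(\<tau>, \<theta>, \<omega>). far_field \<tau> \<theta> \<omega>) (of_real (norm k), sgn k, \<omega>))"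
    by (rule continuous_on_compose2[OF far_field_continuous])
      (use t in \<open>auto intro!: continuous_intros simp: of_real_strip\<close>)
  then show "continuous_on (sphere 0 1) (\<lambda>\<omega>. far_field (of_real (norm k)) (sgn k) \<omega>)" by simp
  show "\<exists>\<psi>. continuous_on UNIV \<psi> \<and> schroedinger_solution v ((norm k)\<^sup>2) \<psi> \<and>
     (\<lambda>x. \<psi> x - (exp (\<i> * complex_of_real (k \<bullet> x)) -
                     2 * complex_of_real pi ^ 2 *
                     (exp (\<i> * complex_of_real (norm k * norm x)) / complex_of_real (norm x)) *
                     far_field (of_real (norm k)) (sgn k) (sgn x)))
               \<in> o[at_infinity](\<lambda>x. complex_of_real (1 / norm x))"
    using wave_continuous[OF s t] wave_solution[OF s t] wave_asymptotics[OF s t] unfolding ip by blast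
qed

end

section \<open>Iterated partial derivatives\<close>

text \<open>The recursion of \<open>iter_partial\<close> exposes the outermost derivative, whereas
  inductions over the order of smoothness peel off the innermost one.\<close>

lemma iter_partial_snoc: "iter_partial (is @ [i]) f = iter_partial is (partial_deriv i f)"
  by (induction "is") auto

lemma C_k_on_Suc_iff:
  "C_k_on (Suc k) UNIV f \<longleftrightarrow> (\<forall>x. f differentiable (at x)) \<and> (\<forall>i. C_k_on k UNIV (partial_deriv i f))"
proof (intro iffI conjI allI)
  assume f: "C_k_on (Suc k) UNIV f"
  then show "f differentiable (at x)" for x
    unfolding C_k_on_def by (auto dest: spec[of _ "[]"])
  fix i
  have "iter_partial is (partial_deriv i f) differentiable (at x)" if "length is < k" for "is" x
    using f that unfolding C_k_on_def iter_partial_snoc[symmetric] by simp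
  moreover have "continuous_on UNIV (iter_partial is (partial_deriv i f))" if "length is \<le> k" for "is"
    using f that unfolding C_k_on_def iter_partial_snoc[symmetric] by simp
  ultimately show "C_k_on k UNIV (partial_deriv i f)" unfolding C_k_on_def by blast
next
  assume a: "(\<forall>x. f differentiable (at x)) \<and> (\<forall>i. C_k_on k UNIV (partial_deriv i f))"
  have "iter_partial is f differentiable (at x)" if "length is < Suc k" for "is" x
    using that a by (cases "is" rule: rev_cases) (auto simp: iter_partial_snoc C_k_on_def)
  moreover have "continuous_on UNIV (iter_partial is f)" if "length is \<le> Suc k" for "is"
  proof (cases "is" rule: rev_cases)
    case Nil
    then show ?thesis using a by (auto intro!: continuous_at_imp_continuous_on differentiable_imp_continuous_within)
  next
    case (snoc js i)
    then show ?thesis using that a by (auto simp: iter_partial_snoc C_k_on_def)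
  qed
  ultimately show "C_k_on (Suc k) UNIV f" unfolding C_k_on_def by blast
qed

lemma C_k_on_0_iff: "C_k_on 0 D f \<longleftrightarrow> continuous_on D f"
  unfolding C_k_on_def by auto

lemma C_k_on_SucI:
  assumes "\<And>x. (f has_derivative f' x) (at x)" "\<And>i. C_k_on k UNIV (\<lambda>x. f' x (axis i 1))"
  shows "C_k_on (Suc k) UNIV f"
proof -
  have "partial_deriv i f = (\<lambda>x. f' x (axis i 1))" for i
    unfolding partial_deriv_def using frechet_derivative_at[OF assms(1)] by auto
  then show ?thesis unfolding C_k_on_Suc_iff using assms by (auto simp: differentiable_def)
qed

lemma C_k_on_const: "C_k_on k UNIV (\<lambda>x. c)"
proof (induction k arbitrary: c)
  case (Suc k)
  show ?case by (rule C_k_on_SucI[where f' = "\<lambda>_ _. 0"]) (use Suc in auto)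
qed (simp add: C_k_on_0_iff)

lemma C_k_on_mono: "C_k_on k D f \<Longrightarrow> l \<le> k \<Longrightarrow> C_k_on l D f"
  unfolding C_k_on_def by auto

lemma has_derivative_frechet: "f differentiable (at x) \<Longrightarrow> (f has_derivative frechet_derivative f (at x)) (at x)"
  using frechet_derivative_works by blast

lemma C_k_on_add: "C_k_on k UNIV f \<Longrightarrow> C_k_on k UNIV g \<Longrightarrow> C_k_on k UNIV (\<lambda>x. f x + g x)"
proof (induction k arbitrary: f g)
  case (Suc k)
  then have "\<And>x. f differentiable (at x)" "\<And>x. g differentiable (at x)"
    "\<And>i. C_k_on k UNIV (partial_deriv i f)" "\<And>i. C_k_on k UNIV (partial_deriv i g)"
    unfolding C_k_on_Suc_iff by auto
  note fg = this
  show ?case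
  proof (rule C_k_on_SucI[where f' = "\<lambda>x h. frechet_derivative f (at x) h + frechet_derivative g (at x) h"])
    show "C_k_on k UNIV (\<lambda>x. frechet_derivative f (at x) (axis i 1) + frechet_derivative g (at x) (axis i 1))" for i
      using Suc.IH[OF fg(3,4)] unfolding partial_deriv_def .
  qed (intro has_derivative_add has_derivative_frechet fg)
qed (auto simp: C_k_on_0_iff intro!: continuous_intros)

lemma C_k_on_mult:
  fixes f g :: "real^3 \<Rightarrow> 'b::real_normed_algebra"
  shows "C_k_on k UNIV f \<Longrightarrow> C_k_on k UNIV g \<Longrightarrow> C_k_on k UNIV (\<lambda>x. f x * g x)"
proof (induction k arbitrary: f g)
  case (Suc k)
  then have d: "\<And>x. f differentiable (at x)" "\<And>x. g differentiable (at x)"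
    and p: "\<And>i. C_k_on k UNIV (partial_deriv i f)" "\<And>i. C_k_on k UNIV (partial_deriv i g)"
    unfolding C_k_on_Suc_iff by auto
  have c: "C_k_on k UNIV f" "C_k_on k UNIV g" using Suc.prems C_k_on_mono[of "Suc k" UNIV _ k] by auto
  show ?case
  proof (rule C_k_on_SucI[where f' = "\<lambda>x h. f x * frechet_derivative g (at x) h + frechet_derivative f (at x) h * g x"])
    show "((\<lambda>x. f x * g x) has_derivative (\<lambda>h. f x * frechet_derivative g (at x) h + frechet_derivative f (at x) h * g x)) (at x)" for x
      by (intro has_derivative_mult has_derivative_frechet d)
    show "C_k_on k UNIV (\<lambda>x. f x * frechet_derivative g (at x) (axis i 1) + frechet_derivative f (at x) (axis i 1) * g x)" for i
      using C_k_on_add[OF Suc.IH[OF c(1) p(2)[of i]] Suc.IH[OF p(1)[of i] c(2)]] unfolding partial_deriv_def .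
  qed
qed (auto simp: C_k_on_0_iff intro!: continuous_intros)

lemma C_k_on_sum: "(\<And>a. a \<in> A \<Longrightarrow> C_k_on k UNIV (f a)) \<Longrightarrow> C_k_on k UNIV (\<lambda>x. \<Sum>a\<in>A. f a x)"
  by (induction A rule: infinite_finite_induct) (auto intro!: C_k_on_const C_k_on_add)

lemma C_k_on_power:
  fixes f :: "real^3 \<Rightarrow> 'b::real_normed_algebra_1"
  shows "C_k_on k UNIV f \<Longrightarrow> C_k_on k UNIV (\<lambda>x. f x ^ n)"
  by (induction n) (auto intro!: C_k_on_const C_k_on_mult)

lemma C_k_on_component: "C_k_on k UNIV (\<lambda>x. of_real (x $ i) :: 'b::real_normed_algebra_1)"
proof (cases k)
  case (Suc l)
  have "((\<lambda>x. of_real (x $ i) :: 'b) has_derivative (\<lambda>h. of_real (h $ i))) (at x)" for x :: "real^3"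
    by (auto intro!: derivative_eq_intros bounded_linear_imp_has_derivative bounded_linear_of_real bounded_linear_compose[OF bounded_linear_of_real]
       bounded_linear_vec_nth)
  then show ?thesis unfolding Suc by (rule C_k_on_SucI) (rule C_k_on_const)
qed (auto simp: C_k_on_0_iff intro!: continuous_intros)

lemma homogeneous_polynomial_C_k_on:
  assumes "homogeneous_polynomial j P"
  shows "C_k_on k UNIV P"
proof -
  obtain c where "\<And>x. P x = (\<Sum>a\<le>j. \<Sum>b\<le>j - a. c a b * complex_of_real ((x $ 1) ^ a * (x $ 2) ^ b * (x $ 3) ^ (j - a - b)))"
    using assms unfolding homogeneous_polynomial_def by blast
  then have "P = (\<lambda>x. \<Sum>a\<le>j. \<Sum>b\<le>j - a. c a b * (of_real (x $ 1) ^ a * of_real (x $ 2) ^ b * of_real (x $ 3) ^ (j - a - b)))"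
    by (auto simp: fun_eq_iff)
  then show ?thesis
    by (simp only:) (intro C_k_on_sum C_k_on_mult C_k_on_const C_k_on_power C_k_on_component)
qed

lemma homogeneous_polynomial_scale:
  assumes "homogeneous_polynomial j P"
  shows "P (t *\<^sub>R x) = of_real t ^ j * P x"
proof -
  obtain c where P: "\<And>x. P x = (\<Sum>a\<le>j. \<Sum>b\<le>j - a. c a b * complex_of_real ((x $ 1) ^ a * (x $ 2) ^ b * (x $ 3) ^ (j - a - b)))"
    using assms unfolding homogeneous_polynomial_def by blast
  have "(t * p) ^ a * (t * q) ^ b * (t * r) ^ (j - a - b) = t ^ j * (p ^ a * q ^ b * r ^ (j - a - b))"
    if "a \<le> j" "b \<le> j - a" for a b and p q r :: real
  proof -
    have "t ^ j = t ^ a * t ^ b * t ^ (j - a - b)" using that by (simp flip: power_add)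
    then show ?thesis by (simp add: power_mult_distrib)
  qed
  note K = this
  show ?thesis
    unfolding P sum_distrib_left
  proof (rule sum.cong[OF refl], rule sum.cong[OF refl])
    fix a b assume ab: "a \<in> {..j}" "b \<in> {..j - a}"
    have "complex_of_real (((t *\<^sub>R x) $ 1) ^ a * ((t *\<^sub>R x) $ 2) ^ b * ((t *\<^sub>R x) $ 3) ^ (j - a - b)) =
      complex_of_real (t ^ j * (x $ 1 ^ a * x $ 2 ^ b * x $ 3 ^ (j - a - b)))"
      using K[of a b "x $ 1" "x $ 2" "x $ 3"] ab by simp
    then show "c a b * complex_of_real (((t *\<^sub>R x) $ 1) ^ a * ((t *\<^sub>R x) $ 2) ^ b * ((t *\<^sub>R x) $ 3) ^ (j - a - b)) =
      of_real t ^ j * (c a b * complex_of_real (x $ 1 ^ a * x $ 2 ^ b * x $ 3 ^ (j - a - b)))"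
      by (simp only:) (simp add: mult_ac)
  qed
qed

text \<open>Euler's identity, by differentiating P((1 + t) x) = (1 + t)^j P(x) at t = 0 in two
  ways.\<close>

lemma homogeneous_polynomial_euler:
  assumes "homogeneous_polynomial j P"
  shows "(\<Sum>i\<in>UNIV. of_real (x $ i) * partial_deriv i P x) = of_nat j * P x"
proof -
  let ?D = "frechet_derivative P (at x)"
  have d: "(P has_derivative ?D) (at x)"
    using homogeneous_polynomial_C_k_on[OF assms, of 1] C_k_on_Suc_iff[of 0 P] by (auto intro: has_derivative_frechet)
  then interpret D: bounded_linear ?D by (rule has_derivative_bounded_linear)
  have "x = (\<Sum>i\<in>UNIV. (x $ i) *\<^sub>R axis i 1)"
    by (simp add: vec_eq_iff axis_def if_distrib cong: if_cong)
  then have "?D x = ?D (\<Sum>i\<in>UNIV. (x $ i) *\<^sub>R axis i 1)" by (rule arg_cong)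
  also have "\<dots> = (\<Sum>i\<in>UNIV. (x $ i) *\<^sub>R ?D (axis i 1))"
    by (simp only: D.sum D.scaleR)
  finally have "?D x = (\<Sum>i\<in>UNIV. (x $ i) *\<^sub>R ?D (axis i 1))" .
  then have e1: "?D x = (\<Sum>i\<in>UNIV. of_real (x $ i) * partial_deriv i P x)"
    unfolding partial_deriv_def by (simp add: scaleR_conv_of_real)
  have "((\<lambda>t. (1 + t) *\<^sub>R x) has_derivative (\<lambda>t. t *\<^sub>R x)) (at 0)"
    by (auto intro!: derivative_eq_intros)
  then have "((\<lambda>t. P ((1 + t) *\<^sub>R x)) has_derivative (\<lambda>t. ?D (t *\<^sub>R x))) (at 0)"
    using has_derivative_compose[of "\<lambda>t. (1 + t) *\<^sub>R x" _ 0 UNIV P ?D] d by simp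
  then have "((\<lambda>t. P ((1 + t) *\<^sub>R x)) has_vector_derivative ?D x) (at 0)"
    unfolding has_vector_derivative_def by (simp add: D.scaleR)
  moreover have "((\<lambda>t. of_real (1 + t) ^ j * P x) has_vector_derivative of_nat j * P x) (at (0::real))"
  proof -
    have "((\<lambda>z. (1 + z) ^ j * P x) has_field_derivative of_nat j * P x) (at (of_real 0))"
      by (auto intro!: derivative_eq_intros)
    from has_vector_derivative_real_field[OF this] show ?thesis by simp
  qed
  ultimately show ?thesis
    unfolding homogeneous_polynomial_scale[OF assms] e1[symmetric] by (rule vector_derivative_unique_at)
qed

section \<open>Orthogonality of spherical harmonics to polynomials of lower degree\<close>

text \<open>For n < 2 the truncated exponents do not matter: the factors n and n - 1 make the
  corresponding terms vanish.\<close>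

lemma axis_C2_inner_power:
  fixes u :: "real^3"
  shows "axis_C2 (\<lambda>x. of_real ((x \<bullet> u) ^ n)) (\<lambda>i x. of_real (real n * (x \<bullet> u) ^ (n - 1) * u $ i))
     (\<lambda>i x. of_real (real n * real (n - 1) * (x \<bullet> u) ^ (n - 2) * (u $ i)\<^sup>2))"
proof -
  have d: "((\<lambda>t. c * ((x + t *\<^sub>R axis i 1) \<bullet> u) ^ n) has_real_derivative c * (real n * (x \<bullet> u) ^ (n - 1) * u $ i)) (at 0)" for c x i n
  proof -
    have "(x + t *\<^sub>R axis i 1) \<bullet> u = x \<bullet> u + t * u $ i" for t by (simp add: inner_add_left inner_axis')
    then show ?thesis by (auto intro!: derivative_eq_intros)
  qed
  have "((\<lambda>t. real n * ((x + t *\<^sub>R axis i 1) \<bullet> u) ^ (n - 1) * u $ i) has_real_derivative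
      real n * real (n - 1) * (x \<bullet> u) ^ (n - 2) * (u $ i)\<^sup>2) (at 0)" for x i
  proof -
    have "real n * u $ i * (real (n - 1) * (x \<bullet> u) ^ (n - 1 - 1) * u $ i) = real n * real (n - 1) * (x \<bullet> u) ^ (n - 2) * (u $ i)\<^sup>2"
      by (simp add: power2_eq_square numeral_2_eq_2)
    moreover have "(\<lambda>t. real n * ((x + t *\<^sub>R axis i 1) \<bullet> u) ^ (n - 1) * u $ i) =
        (\<lambda>t. real n * u $ i * ((x + t *\<^sub>R axis i 1) \<bullet> u) ^ (n - 1))"
      by (simp only: fun_eq_iff mult_ac) simp
    ultimately show ?thesis using d[where c = "real n * u $ i" and x = x and i = i and n = "n - 1"] by (simp only:)
  qed
  note d2 = this
  have d1: "((\<lambda>t. ((x + t *\<^sub>R axis i 1) \<bullet> u) ^ n) has_real_derivative real n * (x \<bullet> u) ^ (n - 1) * u $ i) (at 0)" for x i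
    using d[where c = 1 and x = x and i = i and n = n] by (simp only: mult_1_left)
  show ?thesis
    unfolding axis_C2_def
    by (intro conjI allI continuous_intros has_vector_derivative_of_real d1 d2)
qed

text \<open>The antiderivative is normalised to vanish from 1 on, so that \<phi>(|x|^2) is a
  compactly supported weight with gradient 2 \<psi>(|x|^2) x.\<close>

lemma radial_antiderivative:
  fixes \<psi> :: "real \<Rightarrow> real"
  assumes "continuous_on UNIV \<psi>" "\<And>r. r \<ge> 1 \<Longrightarrow> \<psi> r = 0"
  obtains \<phi> where "\<And>r. r \<ge> 0 \<Longrightarrow> (\<phi> has_real_derivative \<psi> r) (at r)" "\<And>r. r \<ge> 1 \<Longrightarrow> \<phi> r = 0"
proof -
  \<comment> \<open>The interval extends beyond both 0 and 1 so that the derivatives there are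
    two-sided. Beyond 1 the function is constant, which permits the later gluing with 0 at the point
    2.\<close>
  obtain g where g: "\<And>x. x \<in> {-1..2} \<Longrightarrow> (g has_vector_derivative \<psi> x) (at x within {-1..2})"
    using antiderivative_continuous[OF continuous_on_subset[OF assms(1)], of "-1" 2] by auto
  have g': "(g has_real_derivative \<psi> x) (at x)" if "x \<in> {-1<..<2}" for x
    using g[of x] that at_within_interior[of x "{-1..2}"] by (simp add: has_real_derivative_iff_has_vector_derivative)
  define \<phi> where "\<phi> r = (if r < 2 then g r - g 1 else 0)" for r
  have z: "\<phi> r = 0" if "r \<ge> 1" for r
  proof (cases "r < 2 \<and> r \<noteq> 1")
    case True
    then have "1 < r" using that by simp
    from MVT2[OF this, of g \<psi>] g' True obtain y where "1 < y" "g r - g 1 = (r - 1) * \<psi> y" by auto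
    then show ?thesis using assms(2)[of y] True by (simp add: \<phi>_def)
  qed (auto simp: \<phi>_def)
  have "(\<phi> has_real_derivative \<psi> r) (at r)" if "r \<ge> 0" for r
  proof (cases "r < 2")
    case True
    have "((\<lambda>r. g r - g 1) has_real_derivative \<psi> r) (at r)"
      using g'[of r] True that by (auto intro!: derivative_eq_intros)
    then show ?thesis
      by (rule has_field_derivative_transform_within_open[of _ _ _ "{..<2}"]) (use True in \<open>auto simp: \<phi>_def\<close>)
  next
    case False
    have "((\<lambda>r. 0) has_real_derivative \<psi> r) (at r)" using assms(2)[of r] False by simp
    then show ?thesis
      by (rule has_field_derivative_transform_within_open[of _ _ _ "{1<..}"]) (use False z in auto)
  qed
  then show ?thesis using z that by blast
qed

text \<open>Green's identity for P and Q = (x.u)^n with the weight \<phi>(|x|^2), where \<phi>' =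
  \<psi>. As P is harmonic, the Laplacians leave only n (n - 1) |u|^2 times the integral of \<phi> P
  (x.u)^(n-2), which vanishes by induction with \<phi> as the new weight. The gradient of the weight
  is radial, so Euler's identity turns the first order terms into 2 (n - j) times the wanted
  integral, and n differs from j.\<close>

lemma solid_harmonic_orthogonal:
  fixes P :: "real^3 \<Rightarrow> complex" and u :: "real^3" and \<psi> :: "real \<Rightarrow> real"
  assumes P: "homogeneous_polynomial j P" "\<And>x. laplacian P x = 0"
    and \<psi>: "continuous_on UNIV \<psi>" "\<And>r. r \<ge> 1 \<Longrightarrow> \<psi> r = 0" and n: "n < j"
  shows "(LINT x|lborel. of_real (\<psi> (x \<bullet> x)) * (P x * of_real ((x \<bullet> u) ^ n))) = 0"
  using \<psi> n
proof (induction n arbitrary: \<psi> rule: less_induct)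
  case (less n)
  note acP = C2_axis_C2[OF homogeneous_polynomial_C_k_on[OF P(1), of 2]]
  note acQ = axis_C2_inner_power[of u n]
  obtain \<phi> where \<phi>: "\<And>r. r \<ge> 0 \<Longrightarrow> (\<phi> has_real_derivative \<psi> r) (at r)" "\<And>r. r \<ge> 1 \<Longrightarrow> \<phi> r = 0"
    using radial_antiderivative[OF less.prems(1,2)] by blast
  have \<phi>c: "continuous_on UNIV (\<lambda>x::real^3. \<phi> (x \<bullet> x))"
  proof (rule continuous_on_compose2[of "{0..}" \<phi>])
    show "continuous_on {0..} \<phi>"
      using \<phi>(1) by (intro continuous_at_imp_continuous_on) (auto intro: DERIV_isCont)
  qed (auto intro!: continuous_intros)
  have \<psi>c: "continuous_on UNIV (\<lambda>x::real^3. \<psi> (x \<bullet> x))"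
    by (rule continuous_on_compose2[OF less.prems(1)]) (auto intro!: continuous_intros)
  have far: "x \<bullet> x \<ge> 1" if "1 < norm x" for x :: "real^3"
    using that unfolding norm_eq_sqrt_inner by simp
  let ?Q = "\<lambda>n x. complex_of_real ((x \<bullet> u) ^ n)"
  have "(LINT x|lborel. complex_of_real (\<phi> (x \<bullet> x)) * (P x * (\<Sum>i\<in>UNIV. of_real (real n * real (n - 1) * (x \<bullet> u) ^ (n - 2) * (u $ i)\<^sup>2))
       - ?Q n x * (\<Sum>i\<in>UNIV. iter_partial [i, i] P x)) +
      (\<Sum>i\<in>UNIV. complex_of_real (2 * \<psi> (x \<bullet> x) * x $ i) * (P x * of_real (real n * (x \<bullet> u) ^ (n - 1) * u $ i) - ?Q n x * iter_partial [i] P x))) = 0"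
  proof (rule green_weighted[OF acP acQ, where R = 1])
    show "((\<lambda>t. \<phi> ((x + t *\<^sub>R axis i 1) \<bullet> (x + t *\<^sub>R axis i 1))) has_real_derivative 2 * \<psi> (x \<bullet> x) * x $ i) (at 0)" for x :: "real^3" and i
    proof -
      have "((\<lambda>t. (x + t *\<^sub>R axis i 1) \<bullet> (x + t *\<^sub>R axis i 1)) has_real_derivative 2 * x $ i) (at 0)"
      proof -
        have "(x + t *\<^sub>R axis i 1) \<bullet> (x + t *\<^sub>R axis i 1) = x \<bullet> x + 2 * t * x $ i + t\<^sup>2" for t
          by (simp add: inner_add_left inner_add_right inner_axis inner_axis' power2_eq_square algebra_simps)
        then show ?thesis by (auto intro!: derivative_eq_intros)
      qed
      moreover have "(\<phi> has_real_derivative \<psi> (x \<bullet> x)) (at ((x + 0 *\<^sub>R axis i 1) \<bullet> (x + 0 *\<^sub>R axis i 1)))"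
        using \<phi>(1)[of "x \<bullet> x"] by simp
      ultimately show ?thesis
        using DERIV_chain2[of \<phi> "\<psi> (x \<bullet> x)" "\<lambda>t. (x + t *\<^sub>R axis i 1) \<bullet> (x + t *\<^sub>R axis i 1)" 0 "2 * x $ i" UNIV] by (simp add: mult_ac)
    qed
    show "\<phi> (x \<bullet> x) = 0 \<or> ?Q n x = 0 \<and> (\<forall>i. complex_of_real (real n * (x \<bullet> u) ^ (n - 1) * u $ i) = 0)" if "1 < norm x" for x
      using \<phi>(2)[OF far[OF that]] by simp
  qed (auto intro!: continuous_intros \<phi>c \<psi>c)
  also have "(\<lambda>x. complex_of_real (\<phi> (x \<bullet> x)) * (P x * (\<Sum>i\<in>UNIV. of_real (real n * real (n - 1) * (x \<bullet> u) ^ (n - 2) * (u $ i)\<^sup>2))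
       - ?Q n x * (\<Sum>i\<in>UNIV. iter_partial [i, i] P x)) +
      (\<Sum>i\<in>UNIV. complex_of_real (2 * \<psi> (x \<bullet> x) * x $ i) * (P x * of_real (real n * (x \<bullet> u) ^ (n - 1) * u $ i) - ?Q n x * iter_partial [i] P x)))
     = (\<lambda>x. of_real (real n * real (n - 1) * (u \<bullet> u)) * (of_real (\<phi> (x \<bullet> x)) * (P x * ?Q (n - 2) x))
        + of_real (2 * (real n - real j)) * (of_real (\<psi> (x \<bullet> x)) * (P x * ?Q n x)))"
  proof
    fix x
    have "(\<Sum>i\<in>UNIV. iter_partial [i, i] P x) = 0" using P(2)[of x] unfolding laplacian_def .
    moreover have "(\<Sum>i\<in>UNIV. complex_of_real (real n * real (n - 1) * (x \<bullet> u) ^ (n - 2) * (u $ i)\<^sup>2))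
        = of_real (real n * real (n - 1) * (u \<bullet> u)) * ?Q (n - 2) x"
    proof -
      have "(\<Sum>i\<in>UNIV. real n * real (n - 1) * (x \<bullet> u) ^ (n - 2) * (u $ i)\<^sup>2) = real n * real (n - 1) * (u \<bullet> u) * (x \<bullet> u) ^ (n - 2)"
        unfolding sum_distrib_left[symmetric] by (simp add: inner_vec_def power2_eq_square)
      then show ?thesis by (simp only: of_real_sum[symmetric] of_real_mult[symmetric])
    qed
    moreover have "(\<Sum>i\<in>UNIV. complex_of_real (2 * \<psi> (x \<bullet> x) * x $ i) * (P x * of_real (real n * (x \<bullet> u) ^ (n - 1) * u $ i) - ?Q n x * iter_partial [i] P x))
      = of_real (2 * \<psi> (x \<bullet> x)) * (P x * (of_real (real n * (x \<bullet> u) ^ (n - 1)) * (\<Sum>i\<in>UNIV. of_real (x $ i * u $ i))) - ?Q n x * (\<Sum>i\<in>UNIV. of_real (x $ i) * partial_deriv i P x))"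
      by (simp add: sum_distrib_left sum_subtractf right_diff_distrib mult_ac)
    moreover have "complex_of_real (real n * (x \<bullet> u) ^ (n - 1)) * (\<Sum>i\<in>UNIV. of_real (x $ i * u $ i)) = of_nat n * ?Q n x"
    proof -
      have "(\<Sum>i\<in>UNIV. x $ i * u $ i) = x \<bullet> u" by (simp add: inner_vec_def)
      moreover have "real n * (x \<bullet> u) ^ (n - 1) * (x \<bullet> u) = real n * (x \<bullet> u) ^ n" by (cases n) auto
      ultimately have A: "real n * (x \<bullet> u) ^ (n - 1) * (\<Sum>i\<in>UNIV. x $ i * u $ i) = real n * (x \<bullet> u) ^ n" by simp
      have B: "complex_of_real (real n * (x \<bullet> u) ^ (n - 1)) * (\<Sum>i\<in>UNIV. of_real (x $ i * u $ i)) =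
        complex_of_real (real n * (x \<bullet> u) ^ (n - 1) * (\<Sum>i\<in>UNIV. x $ i * u $ i))"
        by (simp only: of_real_mult of_real_sum)
      show ?thesis unfolding B A by simp
    qed
    ultimately show "complex_of_real (\<phi> (x \<bullet> x)) * (P x * (\<Sum>i\<in>UNIV. of_real (real n * real (n - 1) * (x \<bullet> u) ^ (n - 2) * (u $ i)\<^sup>2))
       - ?Q n x * (\<Sum>i\<in>UNIV. iter_partial [i, i] P x)) +
      (\<Sum>i\<in>UNIV. complex_of_real (2 * \<psi> (x \<bullet> x) * x $ i) * (P x * of_real (real n * (x \<bullet> u) ^ (n - 1) * u $ i) - ?Q n x * iter_partial [i] P x))
     = of_real (real n * real (n - 1) * (u \<bullet> u)) * (of_real (\<phi> (x \<bullet> x)) * (P x * ?Q (n - 2) x))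
        + of_real (2 * (real n - real j)) * (of_real (\<psi> (x \<bullet> x)) * (P x * ?Q n x))"
      using homogeneous_polynomial_euler[OF P(1), of x]
      by (simp only: mult_zero_right diff_0_right) (simp add: algebra_simps)
  qed
  finally have key: "(LINT x|lborel. of_real (real n * real (n - 1) * (u \<bullet> u)) * (of_real (\<phi> (x \<bullet> x)) * (P x * ?Q (n - 2) x))
        + of_real (2 * (real n - real j)) * (of_real (\<psi> (x \<bullet> x)) * (P x * ?Q n x))) = 0" .
  have Pc: "continuous_on UNIV P" by (rule axis_C2D(1)[OF acP])
  have i1: "integrable lborel (\<lambda>x. of_real (\<phi> (x \<bullet> x)) * (P x * ?Q (n - 2) x))"
    by (rule integrable_compact_support[where R = 1]) (use \<phi>(2) far in \<open>auto intro!: continuous_intros \<phi>c Pc\<close>)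
  have i2: "integrable lborel (\<lambda>x. of_real (\<psi> (x \<bullet> x)) * (P x * ?Q n x))"
    by (rule integrable_compact_support[where R = 1]) (use less.prems(2) far in \<open>auto intro!: continuous_intros \<psi>c Pc\<close>)
  have z: "of_real (real n * real (n - 1) * (u \<bullet> u)) * (LINT x|lborel. of_real (\<phi> (x \<bullet> x)) * (P x * ?Q (n - 2) x)) = 0"
  proof (cases "n \<ge> 2")
    case True
    \<comment> \<open>The induction hypothesis asks for a weight continuous on the whole line,
      whereas \<phi> is controlled on nonnegative arguments only.\<close>
    define \<phi>' where "\<phi>' r = \<phi> \<bar>r\<bar>" for r
    have "continuous_on UNIV \<phi>'" unfolding \<phi>'_def[abs_def]
    proof (rule continuous_on_compose2[of "{0..}" \<phi>])
      show "continuous_on {0..} \<phi>"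
        using \<phi>(1) by (intro continuous_at_imp_continuous_on) (auto intro: DERIV_isCont)
    qed (auto intro!: continuous_intros)
    moreover have "\<phi>' r = 0" if "r \<ge> 1" for r using \<phi>(2)[of "\<bar>r\<bar>"] that unfolding \<phi>'_def by simp
    ultimately have "(LINT x|lborel. of_real (\<phi>' (x \<bullet> x)) * (P x * ?Q (n - 2) x)) = 0"
      using True less.prems(3) by (intro less.IH) auto
    then show ?thesis by (simp add: \<phi>'_def)
  next
    case False
    then have "n = 0 \<or> n = 1" by auto
    then show ?thesis by auto
  qed
  have "of_real (2 * (real n - real j)) * (LINT x|lborel. of_real (\<psi> (x \<bullet> x)) * (P x * ?Q n x)) = 0"
    using key z by (subst (asm) Bochner_Integration.integral_add[OF integrable_mult_right[OF i1] integrable_mult_right[OF i2]])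
      (simp only: integral_mult_right_zero add_0_left)
  moreover have "complex_of_real (2 * (real n - real j)) \<noteq> 0" using less.prems(3) by simp
  ultimately show ?case by simp
qed

section \<open>The surface measure of the sphere\<close>

lemma space_sphere_measure [simp]: "space sphere_measure = sphere 0 1"
  by (simp add: sphere_measure_def space_scale_measure space_restrict_space)

lemma sets_sphere_measure: "sets sphere_measure = sets (restrict_space borel (sphere 0 1))"
  by (simp add: sphere_measure_def)

lemma measurable_sphere_continuous:
  fixes f :: "real^3 \<Rightarrow> 'b::topological_space"
  assumes "continuous_on (sphere 0 1) f"
  shows "f \<in> borel_measurable sphere_measure"
  unfolding measurable_cong_sets[OF sets_sphere_measure refl]
  by (rule borel_measurable_continuous_on_restrict[OF assms])

lemma measurable_sgn_punctured_ball:
  "sgn \<in> restrict_space lborel (ball 0 1 - {0}) \<rightarrow>\<^sub>M restrict_space borel (sphere (0::real^3) 1)"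
proof (rule measurable_restrict_space2)
  show "sgn \<in> space (restrict_space lborel (ball 0 1 - {0})) \<rightarrow> sphere (0::real^3) 1"
    by (auto simp: space_restrict_space norm_sgn)
  have "(\<lambda>x::real^3. x /\<^sub>R norm x) \<in> borel_measurable borel" by measurable
  moreover have "(sgn :: real^3 \<Rightarrow> _) = (\<lambda>x. x /\<^sub>R norm x)" by (auto simp: sgn_div_norm)
  ultimately have "(sgn :: real^3 \<Rightarrow> _) \<in> borel_measurable lborel" by simp
  then show "sgn \<in> restrict_space lborel (ball 0 1 - {0::real^3}) \<rightarrow>\<^sub>M borel" by (rule measurable_restrict_space1)
qed

lemma finite_sphere_measure: "finite_measure sphere_measure"
proof
  let ?R = "restrict_space lborel (ball 0 1 - {0::real^3})"
  have "emeasure ?R (space ?R) = emeasure lborel (ball 0 1 - {0::real^3})"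
    by (simp add: emeasure_restrict_space space_restrict_space)
  also have "\<dots> \<le> emeasure lborel (ball (0::real^3) 1)" by (intro emeasure_mono) auto
  also have "\<dots> < \<infinity>" by (rule emeasure_lborel_ball_finite)
  finally have f: "emeasure ?R (space ?R) < \<infinity>" .
  have "sgn -` sphere 0 1 \<inter> space ?R = space ?R"
    by (auto simp: space_restrict_space norm_sgn)
  then have "emeasure sphere_measure (sphere 0 1) = 3 * emeasure ?R (space ?R)"
    unfolding sphere_measure_def emeasure_scale_measure
    by (subst emeasure_distr[OF measurable_sgn_punctured_ball]) (auto simp: sets_restrict_space)
  with f show "emeasure sphere_measure (space sphere_measure) \<noteq> \<infinity>"
    by (auto simp: ennreal_mult_eq_top_iff)
qed

interpretation sphere: finite_measure sphere_measure by (rule finite_sphere_measure)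

lemma integrable_sphere_continuous:
  fixes f :: "real^3 \<Rightarrow> complex"
  assumes "continuous_on (sphere 0 1) f"
  shows "integrable sphere_measure f"
proof -
  have "bounded (f ` sphere 0 1)" by (intro compact_imp_bounded compact_continuous_image assms compact_sphere)
  then obtain B where "\<And>x. x \<in> sphere 0 1 \<Longrightarrow> norm (f x) \<le> B" unfolding bounded_iff by blast
  then show ?thesis
    by (intro sphere.integrable_const_bound[of _ B]) (auto intro: measurable_sphere_continuous assms)
qed

lemma integral_sphere:
  fixes f :: "real^3 \<Rightarrow> complex"
  assumes "f \<in> borel_measurable sphere_measure"
  shows "(LINT \<theta>|sphere_measure. f \<theta>) = 3 * (LINT x|lborel. indicator (ball 0 1 - {0}) x *\<^sub>R f (sgn x))"
proof -
  let ?R = "restrict_space lborel (ball 0 1 - {0::real^3})"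
  let ?D = "distr ?R (restrict_space borel (sphere 0 1)) sgn"
  have f: "f \<in> borel_measurable (restrict_space borel (sphere 0 1))"
    using assms measurable_cong_sets[OF sets_sphere_measure refl] by blast
  have "scale_measure 3 ?D = density ?D (\<lambda>_. ennreal 3)"
    by (rule measure_eqI) (auto simp: emeasure_density nn_integral_cmult_indicator)
  then have "(LINT \<theta>|sphere_measure. f \<theta>) = (LINT \<theta>|density ?D (\<lambda>_. ennreal 3). f \<theta>)"
    unfolding sphere_measure_def by simp
  also have "\<dots> = 3 * (LINT \<theta>|?D. f \<theta>)"
    by (subst integral_density) (use f in \<open>auto simp: scaleR_conv_of_real\<close>)
  also have "(LINT \<theta>|?D. f \<theta>) = (LINT x|?R. f (sgn x))"
    by (rule integral_distr[OF measurable_sgn_punctured_ball f])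
  also have "\<dots> = (LINT x|lborel. indicator (ball 0 1 - {0}) x *\<^sub>R f (sgn x))"
    by (subst integral_restrict_space) auto
  finally show ?thesis .
qed

lemma spherical_harmonic_continuous:
  assumes "spherical_harmonic j Y"
  shows "continuous_on (sphere 0 1) Y"
proof -
  obtain P where P: "homogeneous_polynomial j P" "\<forall>x\<in>sphere 0 1. Y x = P x"
    using assms unfolding spherical_harmonic_def by blast
  have "continuous_on UNIV P" using homogeneous_polynomial_C_k_on[OF P(1), of 0] by (simp add: C_k_on_0_iff)
  then have "continuous_on (sphere 0 1) P" by (rule continuous_on_subset) simp
  then show ?thesis using P(2) continuous_on_cong by blast
qed

text \<open>The radial weights below approximate \<open>norm x powr (- d)\<close> on the unit ball, which turns the
  homogeneous integrand of degree d into one that only depends on \<open>sgn x\<close>.\<close>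

lemma spherical_harmonic_orthogonal:
  assumes Y: "spherical_harmonic j Y" and n: "n < j"
  shows "(LINT \<theta>|sphere_measure. of_real ((\<theta> \<bullet> u) ^ n) * cnj (Y \<theta>)) = 0"
proof -
  obtain P where P: "homogeneous_polynomial j P" "\<And>x. laplacian P x = 0" "\<forall>x\<in>sphere 0 1. Y x = P x"
    using assms unfolding spherical_harmonic_def by blast
  have Pc: "continuous_on UNIV P" using homogeneous_polynomial_C_k_on[OF P(1), of 0] by (simp add: C_k_on_0_iff)
  define G where "G x = P x * of_real ((x \<bullet> u) ^ n)" for x
  define d where "d = j + n"
  have Gc: "continuous_on UNIV G" unfolding G_def[abs_def] by (intro continuous_intros Pc)
  have Gs: "G x = of_real (norm x ^ d) * G (sgn x)" if "x \<noteq> 0" for x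
  proof -
    have x: "x = norm x *\<^sub>R sgn x" using that by (simp add: sgn_div_norm)
    have "G (t *\<^sub>R y) = of_real (t ^ d) * G y" for t y
      unfolding G_def homogeneous_polynomial_scale[OF P(1)] d_def
      by (simp add: power_mult_distrib power_add mult_ac)
    from this[of "norm x" "sgn x"] show ?thesis using x by simp
  qed
  obtain C where C: "C \<ge> 0" "\<And>x. x \<in> sphere 0 1 \<Longrightarrow> norm (G x) \<le> C"
  proof -
    have "bounded (G ` sphere 0 1)"
      by (intro compact_imp_bounded compact_continuous_image compact_sphere continuous_on_subset[OF Gc]) auto
    then obtain C where "\<And>x. x \<in> sphere 0 1 \<Longrightarrow> norm (G x) \<le> C" unfolding bounded_iff by blast
    then show ?thesis using that[of "max 0 C"] by fastforce
  qed
  define \<psi> where "\<psi> l r = min 1 (real (Suc l) * max 0 (1 - r)) / (sqrt \<bar>r\<bar> ^ d + 1 / real (Suc l))" for l :: nat and r :: real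
  have den: "sqrt \<bar>r\<bar> ^ d + 1 / real (Suc l) > 0" for r and l :: nat by (intro add_nonneg_pos) auto
  have \<psi>c: "continuous_on UNIV (\<psi> l)" for l
    unfolding \<psi>_def[abs_def] using den[of _ l] by (intro continuous_intros) (auto simp: less_imp_neq[THEN not_sym] simp del: of_nat_Suc)
  have \<psi>0: "\<psi> l r = 0" if "r \<ge> 1" for l r unfolding \<psi>_def using that by simp
  have z: "(LINT x|lborel. of_real (\<psi> l (x \<bullet> x)) * G x) = 0" for l
    unfolding G_def by (rule solid_harmonic_orthogonal[OF P(1,2) \<psi>c \<psi>0 n])
  have \<psi>b: "0 \<le> \<psi> l r" "\<psi> l r * sqrt \<bar>r\<bar> ^ d \<le> 1" for l r
  proof -
    show "0 \<le> \<psi> l r" unfolding \<psi>_def using den[of r l] by (intro divide_nonneg_pos) auto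
    have "min 1 (real (Suc l) * max 0 (1 - r)) * sqrt \<bar>r\<bar> ^ d \<le> 1 * (sqrt \<bar>r\<bar> ^ d + 1 / real (Suc l))"
      by (intro mult_mono) auto
    then show "\<psi> l r * sqrt \<bar>r\<bar> ^ d \<le> 1"
      unfolding \<psi>_def using den[of r l] by (simp add: pos_divide_le_eq del: of_nat_Suc)
  qed
  have sq: "sqrt \<bar>x \<bullet> x\<bar> = norm x" for x :: "real^3" by (simp add: norm_eq_sqrt_inner)
  have "(\<lambda>l. LINT x|lborel. of_real (\<psi> l (x \<bullet> x)) * G x) \<longlonglongrightarrow> (LINT x|lborel. indicator (ball 0 1 - {0}) x *\<^sub>R G (sgn x))"
  proof (rule integral_dominated_convergence[where w = "\<lambda>x. C * indicator (ball 0 1) x"])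
    show "integrable lborel (\<lambda>x::real^3. C * indicator (ball 0 1) x)"
      by (intro integrable_mult_right integrable_real_indicator) (auto simp: emeasure_lborel_ball_finite[unfolded infinity_ennreal_def])
    have m: "G \<in> borel_measurable borel" using Gc by (rule borel_measurable_continuous_onI)
    have "(\<lambda>x::real^3. x /\<^sub>R norm x) \<in> borel_measurable borel" by measurable
    moreover have "(sgn :: real^3 \<Rightarrow> _) = (\<lambda>x. x /\<^sub>R norm x)" by (auto simp: sgn_div_norm)
    ultimately have "(sgn :: real^3 \<Rightarrow> _) \<in> borel_measurable borel" by simp
    from measurable_compose[OF this m]
    show "(\<lambda>x. indicator (ball 0 1 - {0}) x *\<^sub>R G (sgn x)) \<in> borel_measurable lborel"
      by (intro borel_measurable_scaleR borel_measurable_indicator) (auto simp: comp_def)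
    show "(\<lambda>x. of_real (\<psi> l (x \<bullet> x)) * G x) \<in> borel_measurable lborel" for l
      by (simp, intro borel_measurable_continuous_onI continuous_intros continuous_on_compose2[OF \<psi>c] Gc) auto
    show "AE x in lborel. (\<lambda>l. of_real (\<psi> l (x \<bullet> x)) * G x) \<longlonglongrightarrow> indicator (ball 0 1 - {0}) x *\<^sub>R G (sgn x)"
      using AE_lborel_singleton[of "0::real^3"]
    proof eventually_elim
      case (elim x)
      show ?case
      proof (cases "norm x < 1")
        case True
        have r: "x \<bullet> x < 1" using True by (simp add: power2_norm_eq_inner[symmetric] power_less_one_iff)
        obtain L where L: "1 < real L * (1 - x \<bullet> x)" using reals_Archimedean3[of "1 - x \<bullet> x"] r by auto
        have ev: "\<forall>\<^sub>F l in sequentially. 1 / (norm x ^ d + 1 / real (Suc l)) = \<psi> l (x \<bullet> x)"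
          unfolding eventually_sequentially
        proof (intro exI[of _ L] allI impI)
          fix l assume "L \<le> l"
          then have "real L * (1 - x \<bullet> x) \<le> real (Suc l) * (1 - x \<bullet> x)" using r by (intro mult_right_mono) auto
          moreover have "max 0 (1 - x \<bullet> x) = 1 - x \<bullet> x" using r by simp
          ultimately have "min 1 (real (Suc l) * max 0 (1 - x \<bullet> x)) = 1"
            using L by (simp only:)
          then show "1 / (norm x ^ d + 1 / real (Suc l)) = \<psi> l (x \<bullet> x)" unfolding \<psi>_def sq by simp
        qed
        have "(\<lambda>l. 1 / (norm x ^ d + 1 / real (Suc l))) \<longlonglongrightarrow> 1 / (norm x ^ d + 0)"
          using LIMSEQ_inverse_real_of_nat elim by (intro tendsto_intros) (auto simp: inverse_eq_divide)
        then have "(\<lambda>l. \<psi> l (x \<bullet> x)) \<longlonglongrightarrow> 1 / norm x ^ d"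
          by (subst (asm) tendsto_cong[OF ev]) simp
        then have "(\<lambda>l. of_real (\<psi> l (x \<bullet> x)) * G x) \<longlonglongrightarrow> of_real (1 / norm x ^ d) * G x"
          by (intro tendsto_intros)
        also have "of_real (1 / norm x ^ d) * G x = G (sgn x)"
          using elim by (subst Gs) auto
        finally show ?thesis using True elim by simp
      next
        case False
        then have "x \<bullet> x \<ge> 1" unfolding power2_norm_eq_inner[symmetric] by simp
        then show ?thesis using \<psi>0 False by simp
      qed
    qed
    show "AE x in lborel. norm (of_real (\<psi> l (x \<bullet> x)) * G x) \<le> C * indicator (ball 0 1) x" for l
      using AE_lborel_singleton[of "0::real^3"]
    proof eventually_elim
      case (elim x)
      show ?case
      proof (cases "norm x < 1")
        case True
        have "norm (of_real (\<psi> l (x \<bullet> x)) * G x) = (\<psi> l (x \<bullet> x) * norm x ^ d) * norm (G (sgn x))"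
          using elim \<psi>b(1)[of l "x \<bullet> x"] by (subst Gs) (auto simp: norm_mult norm_power)
        also have "\<dots> \<le> 1 * C"
          using \<psi>b[of l "x \<bullet> x"] elim unfolding sq by (intro mult_mono C) (auto simp: norm_sgn)
        finally show ?thesis using True by simp
      next
        case False
        then have "x \<bullet> x \<ge> 1" unfolding power2_norm_eq_inner[symmetric] by simp
        then show ?thesis using \<psi>0 False by simp
      qed
    qed
  qed
  then have "(LINT x|lborel. indicator (ball 0 1 - {0}) x *\<^sub>R G (sgn x)) = 0"
    unfolding z by (simp add: LIMSEQ_const_iff)
  then have "(LINT \<theta>|sphere_measure. G \<theta>) = 0"
    by (subst integral_sphere) (auto intro!: measurable_sphere_continuous continuous_on_subset[OF Gc])
  \<comment> \<open>The powers of the inner product are real, so conjugation moves the harmonic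
    polynomial to the conjugate position required in the claim.\<close>
  then have "cnj (LINT \<theta>|sphere_measure. G \<theta>) = 0" by simp
  also have "cnj (LINT \<theta>|sphere_measure. G \<theta>) = (LINT \<theta>|sphere_measure. cnj (G \<theta>))" by simp
  also have "\<dots> = (LINT \<theta>|sphere_measure. of_real ((\<theta> \<bullet> u) ^ n) * cnj (Y \<theta>))"
    by (rule Bochner_Integration.integral_cong) (use P(3) in \<open>auto simp: G_def\<close>)
  finally show ?thesis .
qed

section \<open>Approximation of powers by polynomials of lower degree\<close>

text \<open>These are the Chebyshev polynomials, obtained from cos((k+2)x) = 2 cos(x) cos((k+1)x) -
  cos(kx).\<close>

lemma cos_multiple_poly: "\<exists>p :: real poly. degree p \<le> k \<and> (\<forall>x. cos (real k * x) = poly p (cos x))"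
proof (induction k rule: induct_nat_012)
  case 0
  show ?case by (intro exI[of _ 1]) auto
next
  case 1
  show ?case by (intro exI[of _ "[:0, 1:]"]) auto
next
  case (ge2 k)
  then obtain p q where p: "degree p \<le> k" "\<And>x. cos (real k * x) = poly p (cos x)"
    and q: "degree q \<le> Suc k" "\<And>x. cos (real (Suc k) * x) = poly q (cos x)" by blast
  have "cos (real (Suc (Suc k)) * x) = poly ([:0, 2:] * q - p) (cos x)" for x
  proof -
    have "cos (real (Suc (Suc k)) * x) + cos (real k * x) = 2 * cos x * cos (real (Suc k) * x)"
      using cos_times_cos[of "real (Suc k) * x" x] by (simp add: algebra_simps)
    then have "cos (real (Suc (Suc k)) * x) = 2 * cos x * cos (real (Suc k) * x) - cos (real k * x)" by linarith
    also have "\<dots> = 2 * cos x * poly q (cos x) - poly p (cos x)" by (simp only: p(2) q(2))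
    finally show ?thesis by (simp add: algebra_simps)
  qed
  moreover have "degree ([:0, 2:] * q - p) \<le> Suc (Suc k)"
  proof (rule degree_diff_le)
    show "degree ([:0, 2:] * q) \<le> Suc (Suc k)"
      using degree_mult_le[of "[:0, 2:]" q] q(1) by simp
  qed (use p in simp)
  ultimately show ?case by blast
qed

lemma cos_power_expansion:
  "cos x ^ n = (\<Sum>k\<le>n. real (n choose k) / 2 ^ n * cos (real_of_int (2 * int k - int n) * x))"
proof -
  have "complex_of_real (2 * cos x) ^ n = (cis x + cis (- x)) ^ n"
    by (simp add: cis.ctr complex_eq_iff)
  also have "\<dots> = (\<Sum>k\<le>n. of_nat (n choose k) * cis x ^ k * cis (- x) ^ (n - k))" by (rule binomial_ring)
  also have "\<dots> = (\<Sum>k\<le>n. of_nat (n choose k) * cis (real_of_int (2 * int k - int n) * x))"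
  proof (intro sum.cong refl)
    fix k assume "k \<in> {..n}"
    then have e: "real k * x + real (n - k) * (- x) = real_of_int (2 * int k - int n) * x"
      by (simp add: of_nat_diff algebra_simps)
    have "cis x ^ k * cis (- x) ^ (n - k) = cis (real k * x + real (n - k) * (- x))"
      unfolding Complex.DeMoivre Complex.cis_mult by (rule refl)
    then have "cis x ^ k * cis (- x) ^ (n - k) = cis (real_of_int (2 * int k - int n) * x)"
      by (simp only: e)
    then show "of_nat (n choose k) * cis x ^ k * cis (- x) ^ (n - k) = of_nat (n choose k) * cis (real_of_int (2 * int k - int n) * x)"
      by (simp add: mult.assoc)
  qed
  finally have "Re (complex_of_real (2 * cos x) ^ n) = Re (\<Sum>k\<le>n. of_nat (n choose k) * cis (real_of_int (2 * int k - int n) * x))" by simp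
  then have "2 ^ n * cos x ^ n = (\<Sum>k\<le>n. real (n choose k) * cos (real_of_int (2 * int k - int n) * x))"
    by (simp add: Re_power_real power_mult_distrib flip: of_real_power of_real_mult)
  then have "cos x ^ n = (\<Sum>k\<le>n. real (n choose k) * cos (real_of_int (2 * int k - int n) * x)) / 2 ^ n"
    by (simp add: field_simps)
  then show ?thesis by (simp add: sum_divide_distrib)
qed

text \<open>Since j \<le> n, the condition forces k \<ge> j or n - k \<ge> j. For k \<ge> j one
  inserts the factor (k choose j) \<ge> 1 and rewrites the product as (n choose j) times (n-j choose
  k-j); these sum to (n choose j) 2^(n-j). The other tail is the mirror image, whence the factor
  2.\<close>

lemma binomial_outer_sum:
  assumes "j \<le> n"
  shows "(\<Sum>k | k \<le> n \<and> int j \<le> \<bar>2 * int k - int n\<bar>. real (n choose k)) \<le> 2 * real (n choose j) * 2 ^ (n - j)"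
proof -
  define g where "g k = (if j \<le> k then real (n choose j) * real ((n - j) choose (k - j)) else 0)" for k
  have le: "real (n choose k) \<le> g k" if "j \<le> k" "k \<le> n" for k
  proof -
    have "(n choose k) * 1 \<le> (n choose k) * (k choose j)" using that by (intro mult_left_mono) (auto simp: Suc_le_eq)
    also have "\<dots> = (n choose j) * ((n - j) choose (k - j))" using that by (rule choose_mult)
    finally have "real ((n choose k) * 1) \<le> real ((n choose j) * ((n - j) choose (k - j)))" by (rule of_nat_mono)
    then show ?thesis unfolding g_def using that by simp
  qed
  have g0: "g k \<ge> 0" for k unfolding g_def by simp
  have gs: "(\<Sum>k\<le>n. g k) = real (n choose j) * 2 ^ (n - j)"
  proof -
    have "(\<Sum>k\<le>n. g k) = (\<Sum>k\<in>{j..n}. g k)"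
      by (rule sum.mono_neutral_right) (auto simp: g_def)
    also have "\<dots> = (\<Sum>k\<in>{j..n}. real (n choose j) * real ((n - j) choose (k - j)))"
      by (intro sum.cong) (auto simp: g_def)
    also have "\<dots> = (\<Sum>k\<le>n - j. real (n choose j) * real ((n - j) choose k))"
      by (rule sum.reindex_bij_witness[of _ "\<lambda>k. k + j" "\<lambda>k. k - j"]) (use assms in auto)
    also have "\<dots> = real (n choose j) * real (\<Sum>k\<le>n - j. (n - j) choose k)"
      by (simp add: sum_distrib_left)
    finally show ?thesis by (simp add: choose_row_sum)
  qed
  have "(\<Sum>k | k \<le> n \<and> int j \<le> \<bar>2 * int k - int n\<bar>. real (n choose k)) \<le> (\<Sum>k | k \<le> n \<and> int j \<le> \<bar>2 * int k - int n\<bar>. g k + g (n - k))"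
  proof (rule sum_mono)
    fix k assume "k \<in> {k. k \<le> n \<and> int j \<le> \<bar>2 * int k - int n\<bar>}"
    then have k: "k \<le> n" "j \<le> k \<or> j \<le> n - k" using assms by auto
    then show "real (n choose k) \<le> g k + g (n - k)"
      using le[of k] le[of "n - k"] g0[of k] g0[of "n - k"] binomial_symmetric[of k n] by fastforce
  qed
  also have "\<dots> \<le> (\<Sum>k\<le>n. g k + g (n - k))"
    by (rule sum_mono2) (auto simp: g0 add_nonneg_nonneg)
  also have "\<dots> = (\<Sum>k\<le>n. g k) + (\<Sum>k\<le>n. g (n - k))" by (rule sum.distrib)
  also have "(\<Sum>k\<le>n. g (n - k)) = (\<Sum>k\<le>n. g k)"
    by (rule sum.reindex_bij_witness[of _ "\<lambda>k. n - k" "\<lambda>k. n - k"]) auto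
  finally show ?thesis unfolding gs by simp
qed

text \<open>Expand t^n with t = cos x into cosines of multiple angles and keep the frequencies below
  j, which form a polynomial of degree below j. The omitted coefficients add up to an outer binomial
  sum divided by 2^n. The resulting factor 2^(-j) is the source of \<open>(Z / 2) ^ j\<close> in
  \<open>moment_bound\<close>.\<close>

lemma power_approximation:
  assumes "j \<le> n"
  obtains p :: "real poly" where "p = 0 \<or> degree p < j"
    "\<And>t. \<bar>t\<bar> \<le> 1 \<Longrightarrow> \<bar>t ^ n - poly p t\<bar> \<le> 2 * real (n choose j) / 2 ^ j"
proof -
  define m where "m k = nat \<bar>2 * int k - int n\<bar>" for k
  obtain q :: "nat \<Rightarrow> real poly" where q: "\<And>k. degree (q k) \<le> k" "\<And>k x. cos (real k * x) = poly (q k) (cos x)"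
    using cos_multiple_poly by metis
  define L where "L = {k. k \<le> n \<and> \<not> int j \<le> \<bar>2 * int k - int n\<bar>}"
  define H where "H = {k. k \<le> n \<and> int j \<le> \<bar>2 * int k - int n\<bar>}"
  have fin: "finite L" "finite H" "L \<inter> H = {}" "{..n} = L \<union> H" unfolding L_def H_def by auto
  define p where "p = (\<Sum>k\<in>L. smult (real (n choose k) / 2 ^ n) (q (m k)))"
  show ?thesis
  proof (rule that)
    \<comment> \<open>For j = 0 no frequency is kept and p is the zero polynomial, whose degree 0 is
      not below j; hence the disjunction.\<close>
    show "p = 0 \<or> degree p < j"
    proof (cases "j = 0")
      case True
      then have "L = {}" unfolding L_def by auto
      then show ?thesis unfolding p_def by simp
    next
      case False
      have "degree p < j" unfolding p_def
      proof (rule degree_sum_less)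
        fix k assume "k \<in> L"
        then have "m k < j" unfolding L_def m_def by auto
        then show "degree (smult (real (n choose k) / 2 ^ n) (q (m k))) < j"
          using q(1)[of "m k"] degree_smult_le[of "real (n choose k) / 2 ^ n" "q (m k)"] by linarith
      qed (use False in simp)
      then show ?thesis ..
    qed
    fix t :: real assume t: "\<bar>t\<bar> \<le> 1"
    define x where "x = arccos t"
    have x: "cos x = t" unfolding x_def using t by (simp add: cos_arccos_abs)
    have cm: "cos (real_of_int (2 * int k - int n) * x) = poly (q (m k)) t" for k
    proof -
      have "cos (real (m k) * x) = cos (real_of_int (2 * int k - int n) * x)"
      proof (cases "2 * int k - int n \<ge> 0")
        case False
        then have "real (m k) * x = - (real_of_int (2 * int k - int n) * x)" unfolding m_def by (simp add: algebra_simps)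
        then show ?thesis by (simp only: cos_minus)
      qed (simp add: m_def)
      then show ?thesis using q(2)[of "m k" x] x by simp
    qed
    have "t ^ n = (\<Sum>k\<in>L. real (n choose k) / 2 ^ n * poly (q (m k)) t) + (\<Sum>k\<in>H. real (n choose k) / 2 ^ n * cos (real_of_int (2 * int k - int n) * x))"
      unfolding x[symmetric] cos_power_expansion fin(4) sum.union_disjoint[OF fin(1,2,3)] by (simp only: cm x)
    also have "(\<Sum>k\<in>L. real (n choose k) / 2 ^ n * poly (q (m k)) t) = poly p t"
      unfolding p_def poly_sum by simp
    finally have "\<bar>t ^ n - poly p t\<bar> = \<bar>\<Sum>k\<in>H. real (n choose k) / 2 ^ n * cos (real_of_int (2 * int k - int n) * x)\<bar>" by simp
    also have "\<dots> \<le> (\<Sum>k\<in>H. real (n choose k) / 2 ^ n)"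
    proof (rule order_trans[OF sum_abs sum_mono])
      fix k
      have "\<bar>real (n choose k) / 2 ^ n * cos (real_of_int (2 * int k - int n) * x)\<bar> \<le> real (n choose k) / 2 ^ n * 1"
        unfolding abs_mult by (intro mult_mono) auto
      then show "\<bar>real (n choose k) / 2 ^ n * cos (real_of_int (2 * int k - int n) * x)\<bar> \<le> real (n choose k) / 2 ^ n" by simp
    qed
    also have "\<dots> = (\<Sum>k\<in>H. real (n choose k)) / 2 ^ n" by (simp add: sum_divide_distrib)
    also have "\<dots> \<le> 2 * real (n choose j) * 2 ^ (n - j) / 2 ^ n"
      using binomial_outer_sum[OF assms] unfolding H_def by (intro divide_right_mono) auto
    also have "\<dots> = 2 * real (n choose j) / 2 ^ j"
      using assms by (simp add: power_diff)
    finally show "\<bar>t ^ n - poly p t\<bar> \<le> 2 * real (n choose j) / 2 ^ j" .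
  qed
qed

section \<open>Decay of the harmonic moments of plane waves\<close>

definition plane_moment :: "(real^3 \<Rightarrow> complex) \<Rightarrow> complex \<Rightarrow> real^3 \<Rightarrow> complex" where
  "plane_moment Y \<tau> y = (LINT \<theta>|sphere_measure. exp (\<i> * \<tau> * complex_of_real (\<theta> \<bullet> y)) * cnj (Y \<theta>))"

text \<open>By the Funk-Hecke formula the moment of a plane wave is a multiple of the spherical
  Bessel function of order j, which has size Z^j / (2j+1)!!. As (2j+1)!! equals 2^j j! up to a
  polynomial factor in j, this majorant is exponentially sharp in j for fixed Z.\<close>

definition moment_bound :: "real \<Rightarrow> nat \<Rightarrow> real" where
  "moment_bound Z j = 2 * (Z / 2) ^ j / fact j * exp Z"

lemma moment_bound_nonneg: "Z \<ge> 0 \<Longrightarrow> moment_bound Z j \<ge> 0"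
  by (simp add: moment_bound_def)

lemma moment_bound_mono: "0 \<le> Z \<Longrightarrow> Z \<le> Z' \<Longrightarrow> moment_bound Z j \<le> moment_bound Z' j"
  unfolding moment_bound_def by (intro mult_mono divide_right_mono mult_left_mono power_mono) auto

text \<open>A polynomial of degree below j in the inner product integrates to 0 against a harmonic
  of degree j, so t^n may be replaced by its error of approximation on [-1, 1]; what remains is that
  error times the L1 norm of Y.\<close>

lemma harmonic_moment_bound:
  assumes Y: "spherical_harmonic j Y" and u: "norm u \<le> 1"
    and A: "(LINT \<theta>|sphere_measure. norm (Y \<theta>)) \<le> A"
  shows "norm (LINT \<theta>|sphere_measure. of_real ((\<theta> \<bullet> u) ^ n) * cnj (Y \<theta>))
    \<le> (if j \<le> n then 2 * real (n choose j) / 2 ^ j * A else 0)"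
proof (cases "j \<le> n")
  case False
  then show ?thesis using spherical_harmonic_orthogonal[OF Y, of n u] by simp
next
  case True
  obtain p :: "real poly" where p: "p = 0 \<or> degree p < j"
    "\<And>t. \<bar>t\<bar> \<le> 1 \<Longrightarrow> \<bar>t ^ n - poly p t\<bar> \<le> 2 * real (n choose j) / 2 ^ j"
    using power_approximation[OF True] by blast
  note Yc = spherical_harmonic_continuous[OF Y]
  have int: "integrable sphere_measure (\<lambda>\<theta>. of_real (h (\<theta> \<bullet> u)) * cnj (Y \<theta>))" if "continuous_on UNIV h" for h :: "real \<Rightarrow> real"
    by (rule integrable_sphere_continuous)
      (intro continuous_intros Yc continuous_on_compose2[OF that], auto)
  have pz: "(LINT \<theta>|sphere_measure. of_real (poly p (\<theta> \<bullet> u)) * cnj (Y \<theta>)) = 0"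
  proof (cases "p = 0")
    case False
    then have dp: "degree p < j" using p(1) by simp
    have "(LINT \<theta>|sphere_measure. of_real (poly p (\<theta> \<bullet> u)) * cnj (Y \<theta>)) =
      (LINT \<theta>|sphere_measure. (\<Sum>i\<le>degree p. of_real (coeff p i) * (of_real ((\<theta> \<bullet> u) ^ i) * cnj (Y \<theta>))))"
      by (simp add: poly_altdef sum_distrib_right mult.assoc)
    also have "\<dots> = (\<Sum>i\<le>degree p. LINT \<theta>|sphere_measure. of_real (coeff p i) * (of_real ((\<theta> \<bullet> u) ^ i) * cnj (Y \<theta>)))"
      by (rule Bochner_Integration.integral_sum) (auto intro!: integrable_mult_right int continuous_intros simp del: of_real_power)
    also have "\<dots> = 0"
      using spherical_harmonic_orthogonal[OF Y, of _ u] dp by (auto intro!: sum.neutral simp del: of_real_power)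
    finally show ?thesis .
  qed simp
  have "(LINT \<theta>|sphere_measure. of_real ((\<theta> \<bullet> u) ^ n) * cnj (Y \<theta>)) =
      (LINT \<theta>|sphere_measure. of_real ((\<theta> \<bullet> u) ^ n) * cnj (Y \<theta>) - of_real (poly p (\<theta> \<bullet> u)) * cnj (Y \<theta>))"
    by (subst Bochner_Integration.integral_diff) (auto intro!: int[where h = "\<lambda>t. t ^ n", simplified] int continuous_intros simp: pz)
  also have "norm \<dots> \<le> (LINT \<theta>|sphere_measure. 2 * real (n choose j) / 2 ^ j * norm (Y \<theta>))"
  proof (rule Bochner_Integration.integral_norm_bound_integral)
    show "integrable sphere_measure (\<lambda>\<theta>. of_real ((\<theta> \<bullet> u) ^ n) * cnj (Y \<theta>) - of_real (poly p (\<theta> \<bullet> u)) * cnj (Y \<theta>))"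
      by (intro Bochner_Integration.integrable_diff int continuous_intros)
    show "integrable sphere_measure (\<lambda>\<theta>. 2 * real (n choose j) / 2 ^ j * norm (Y \<theta>))"
      by (intro integrable_mult_right integrable_norm integrable_sphere_continuous Yc)
    fix \<theta> assume "\<theta> \<in> space sphere_measure"
    then have "norm \<theta> = 1" by simp
    then have "\<bar>\<theta> \<bullet> u\<bar> \<le> 1" using Cauchy_Schwarz_ineq2[of \<theta> u] u by simp
    from p(2)[OF this] have "norm (complex_of_real ((\<theta> \<bullet> u) ^ n - poly p (\<theta> \<bullet> u))) * norm (cnj (Y \<theta>)) \<le> 2 * real (n choose j) / 2 ^ j * norm (Y \<theta>)"
      by (intro mult_mono) (auto simp only: norm_of_real complex_mod_cnj norm_ge_zero)
    then show "norm (of_real ((\<theta> \<bullet> u) ^ n) * cnj (Y \<theta>) - of_real (poly p (\<theta> \<bullet> u)) * cnj (Y \<theta>)) \<le> 2 * real (n choose j) / 2 ^ j * norm (Y \<theta>)"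
      by (simp only: norm_mult[symmetric] of_real_diff left_diff_distrib)
  qed
  also have "\<dots> = 2 * real (n choose j) / 2 ^ j * (LINT \<theta>|sphere_measure. norm (Y \<theta>))"
    by (rule integral_mult_right_zero)
  also have "\<dots> \<le> 2 * real (n choose j) / 2 ^ j * A" using A by (intro mult_left_mono) auto
  finally show ?thesis using True by simp
qed

text \<open>Expand the exponential and integrate term by term. The terms with n < j vanish, and the
  bounds of the others sum in closed form to \<open>moment_bound\<close>.\<close>

lemma plane_moment_bound:
  assumes Y: "spherical_harmonic j Y" and A: "(LINT \<theta>|sphere_measure. norm (Y \<theta>)) \<le> A"
  shows "norm (plane_moment Y \<tau> y) \<le> A * moment_bound (norm \<tau> * norm y) j"
proof -
  define u where "u = sgn y"
  define r where "r = norm y"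
  define Z where "Z = norm \<tau> * r"
  have yu: "y = r *\<^sub>R u" unfolding r_def u_def by (cases "y = 0") (auto simp: sgn_div_norm)
  have u: "norm u \<le> 1" unfolding u_def by (simp add: norm_sgn)
  have Z: "Z \<ge> 0" unfolding Z_def r_def by simp
  have A0: "A \<ge> 0" using A order_trans[OF _ A] Bochner_Integration.integral_nonneg[of sphere_measure "\<lambda>\<theta>. norm (Y \<theta>)"] by simp
  note Yc = spherical_harmonic_continuous[OF Y]
  let ?f = "\<lambda>n \<theta>. (\<i> * \<tau> * of_real r) ^ n / fact n * (of_real ((\<theta> \<bullet> u) ^ n) * cnj (Y \<theta>))"
  define M where "M n = (LINT \<theta>|sphere_measure. of_real ((\<theta> \<bullet> u) ^ n) * cnj (Y \<theta>))" for n
  have ai: "integrable sphere_measure (\<lambda>\<theta>. of_real ((\<theta> \<bullet> u) ^ n) * cnj (Y \<theta>))" for n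
    by (rule integrable_sphere_continuous) (intro continuous_intros Yc)
  have nY: "integrable sphere_measure (\<lambda>\<theta>. norm (Y \<theta>))"
    by (intro integrable_norm integrable_sphere_continuous Yc)
  have nf: "norm (?f n \<theta>) = Z ^ n / fact n * (\<bar>\<theta> \<bullet> u\<bar> ^ n * norm (Y \<theta>))" for n \<theta>
    unfolding Z_def r_def by (simp add: norm_mult norm_divide norm_power power_mult_distrib power_abs)
  have tu: "\<bar>\<theta> \<bullet> u\<bar> \<le> 1" if "\<theta> \<in> space sphere_measure" for \<theta>
  proof -
    have "\<bar>\<theta> \<bullet> u\<bar> \<le> norm \<theta> * norm u" by (rule Cauchy_Schwarz_ineq2)
    then show ?thesis using that u by simp
  qed
  have fb: "norm (?f n \<theta>) \<le> Z ^ n / fact n * norm (Y \<theta>)" if "\<theta> \<in> space sphere_measure" for n \<theta>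
  proof -
    have "\<bar>\<theta> \<bullet> u\<bar> ^ n * norm (Y \<theta>) \<le> 1 * norm (Y \<theta>)"
      using tu[OF that] by (intro mult_right_mono power_le_one) auto
    then show ?thesis unfolding nf using Z by (intro mult_left_mono) auto
  qed
  have sZ: "summable (\<lambda>n. Z ^ n / fact n)"
    using summable_exp[of Z] by (simp add: field_simps)
  have "(\<lambda>n. LINT \<theta>|sphere_measure. ?f n \<theta>) sums (LINT \<theta>|sphere_measure. (\<Sum>n. ?f n \<theta>))"
  proof (rule sums_integral)
    show "integrable sphere_measure (?f n)" for n by (rule integrable_mult_right[OF ai])
    show "AE \<theta> in sphere_measure. summable (\<lambda>n. norm (?f n \<theta>))"
    proof (intro AE_I2)
      fix \<theta> assume t: "\<theta> \<in> space sphere_measure"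
      show "summable (\<lambda>n. norm (?f n \<theta>))"
        by (rule summable_comparison_test'[OF summable_mult2[OF sZ, of "norm (Y \<theta>)"], of 0]) (use fb[OF t] in simp)
    qed
    show "summable (\<lambda>n. LINT \<theta>|sphere_measure. norm (?f n \<theta>))"
    proof (rule summable_comparison_test'[OF summable_mult2[OF sZ, of "LINT \<theta>|sphere_measure. norm (Y \<theta>)"], of 0])
      fix n
      have "(LINT \<theta>|sphere_measure. norm (?f n \<theta>)) \<le> (LINT \<theta>|sphere_measure. Z ^ n / fact n * norm (Y \<theta>))"
        by (intro integral_mono integrable_norm integrable_mult_right ai nY fb) auto
      also have "\<dots> = Z ^ n / fact n * (LINT \<theta>|sphere_measure. norm (Y \<theta>))" by (rule integral_mult_right_zero)
      finally show "norm (LINT \<theta>|sphere_measure. norm (?f n \<theta>)) \<le> Z ^ n / fact n * (LINT \<theta>|sphere_measure. norm (Y \<theta>))"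
        using Bochner_Integration.integral_nonneg[of sphere_measure "\<lambda>\<theta>. norm (?f n \<theta>)"] by simp
    qed
  qed
  also have "(LINT \<theta>|sphere_measure. (\<Sum>n. ?f n \<theta>)) = plane_moment Y \<tau> y"
    unfolding plane_moment_def
  proof (rule Bochner_Integration.integral_cong[OF refl])
    fix \<theta>
    have "(\<lambda>n. (\<i> * \<tau> * of_real r * of_real (\<theta> \<bullet> u)) ^ n /\<^sub>R fact n) sums exp (\<i> * \<tau> * of_real r * of_real (\<theta> \<bullet> u))"
      by (rule exp_converges)
    then have "(\<lambda>n. (\<i> * \<tau> * of_real r * of_real (\<theta> \<bullet> u)) ^ n /\<^sub>R fact n * cnj (Y \<theta>)) sums (exp (\<i> * \<tau> * of_real r * of_real (\<theta> \<bullet> u)) * cnj (Y \<theta>))"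
      by (rule sums_mult2)
    moreover have "(\<i> * \<tau> * of_real r * of_real (\<theta> \<bullet> u)) ^ n /\<^sub>R fact n * cnj (Y \<theta>) = ?f n \<theta>" for n
      by (simp add: power_mult_distrib scaleR_conv_of_real divide_inverse mult_ac)
    moreover have "\<i> * \<tau> * of_real r * of_real (\<theta> \<bullet> u) = \<i> * \<tau> * complex_of_real (\<theta> \<bullet> y)"
      by (subst yu) simp
    ultimately show "(\<Sum>n. ?f n \<theta>) = exp (\<i> * \<tau> * complex_of_real (\<theta> \<bullet> y)) * cnj (Y \<theta>)"
      by (simp only: sums_unique[symmetric])
  qed
  also have "(\<lambda>n. LINT \<theta>|sphere_measure. ?f n \<theta>) = (\<lambda>n. (\<i> * \<tau> * of_real r) ^ n / fact n * M n)"
    unfolding M_def by (simp only: integral_mult_right_zero)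
  finally have sums: "(\<lambda>n. (\<i> * \<tau> * of_real r) ^ n / fact n * M n) sums plane_moment Y \<tau> y" .
  \<comment> \<open>Shifted by j this is an exponential series, since (n+j choose j) / (n+j)! = 1 /
    (j! n!).\<close>
  define b where "b n = (if j \<le> n then Z ^ n / fact n * (2 * real (n choose j) / 2 ^ j * A) else 0)" for n
  have bs: "b sums (A * moment_bound Z j)"
  proof -
    have "b (n + j) = A * (2 * (Z / 2) ^ j / fact j) * (Z ^ n /\<^sub>R fact n)" for n
    proof -
      have "real ((n + j) choose j) = fact (n + j) / (fact j * fact n)"
        using binomial_fact[of j "n + j", where 'a = real] by simp
      then show ?thesis unfolding b_def by (simp add: power_add power_divide field_simps)
    qed
    moreover have "(\<lambda>n. A * (2 * (Z / 2) ^ j / fact j) * (Z ^ n /\<^sub>R fact n)) sums (A * (2 * (Z / 2) ^ j / fact j) * exp Z)"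
      by (intro sums_mult exp_converges)
    ultimately have "(\<lambda>n. b (n + j)) sums (A * moment_bound Z j)"
      unfolding moment_bound_def by (simp add: mult_ac)
    moreover have "(\<Sum>i<j. b i) = 0" by (rule sum.neutral) (auto simp: b_def)
    ultimately show ?thesis by (simp add: sums_iff_shift)
  qed
  have le: "norm ((\<i> * \<tau> * of_real r) ^ n / fact n * M n) \<le> b n" for n
  proof -
    have "norm ((\<i> * \<tau> * of_real r) ^ n / fact n * M n) = Z ^ n / fact n * norm (M n)"
      unfolding Z_def r_def by (simp add: norm_mult norm_divide norm_power)
    also have "\<dots> \<le> Z ^ n / fact n * (if j \<le> n then 2 * real (n choose j) / 2 ^ j * A else 0)"
      unfolding M_def using Z by (intro mult_left_mono harmonic_moment_bound[OF Y u A]) auto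
    finally show ?thesis unfolding b_def by (cases "j \<le> n") (simp_all only: if_True if_False mult_zero_right)
  qed
  have sn: "summable (\<lambda>n. norm ((\<i> * \<tau> * of_real r) ^ n / fact n * M n))"
    by (rule summable_comparison_test'[OF sums_summable[OF bs], of 0]) (use le in simp)
  have "norm (plane_moment Y \<tau> y) = norm (\<Sum>n. (\<i> * \<tau> * of_real r) ^ n / fact n * M n)"
    using sums_unique[OF sums] by simp
  also have "\<dots> \<le> (\<Sum>n. norm ((\<i> * \<tau> * of_real r) ^ n / fact n * M n))" by (rule summable_norm[OF sn])
  also have "\<dots> \<le> (\<Sum>n. b n)" by (rule suminf_le[OF le sn sums_summable[OF bs]])
  also have "\<dots> = A * moment_bound Z j" using sums_unique[OF bs] by simp
  finally show ?thesis unfolding Z_def r_def .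
qed

section \<open>Fourier coefficients of the scattering amplitude\<close>

lemma measurable_pair_continuous:
  fixes f :: "'a::second_countable_topology \<times> 'b::second_countable_topology \<Rightarrow> 'c::topological_space"
  assumes f: "continuous_on (A \<times> B) f"
    and M: "sets M = sets (restrict_space borel A)" and N: "sets N = sets (restrict_space borel B)"
  shows "f \<in> borel_measurable (M \<Otimes>\<^sub>M N)"
proof -
  have spM: "space M = A" "space N = B"
    using sets_eq_imp_space_eq[OF M] sets_eq_imp_space_eq[OF N] by (simp_all add: space_restrict_space)
  have "(\<lambda>x. x) \<in> measurable M borel" "(\<lambda>x. x) \<in> measurable N borel"
    unfolding measurable_cong_sets[OF M refl] measurable_cong_sets[OF N refl] by (auto intro: measurable_restrict_space1)
  then have "(\<lambda>p. (fst p, snd p)) \<in> measurable (M \<Otimes>\<^sub>M N) (borel \<Otimes>\<^sub>M borel)"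
    by (intro measurable_Pair measurable_compose[OF measurable_fst] measurable_compose[OF measurable_snd])
  then have "(\<lambda>p. p) \<in> measurable (M \<Otimes>\<^sub>M N) borel" by (simp add: borel_prod)
  then have "(\<lambda>p. p) \<in> measurable (M \<Otimes>\<^sub>M N) (restrict_space borel (A \<times> B))"
    by (intro measurable_restrict_space2) (auto simp: space_pair_measure spM)
  from measurable_compose[OF this borel_measurable_continuous_on_restrict[OF f]] show ?thesis by simp
qed

lemma sets_unit_ball: "sets unit_ball = sets (restrict_space borel (ball 0 1))"
  by (simp add: unit_ball_def sets_restrict_space)

lemma fubini_bounded:
  fixes f :: "'a \<Rightarrow> 'b \<Rightarrow> complex"
  assumes M: "finite_measure M" and N: "finite_measure N"
    and f: "(\<lambda>p. f (fst p) (snd p)) \<in> borel_measurable (M \<Otimes>\<^sub>M N)"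
    and b: "\<And>x y. x \<in> space M \<Longrightarrow> y \<in> space N \<Longrightarrow> norm (f x y) \<le> B"
  shows "integrable (M \<Otimes>\<^sub>M N) (\<lambda>p. f (fst p) (snd p))"
    and "(LINT x|M. LINT y|N. f x y) = (LINT y|N. LINT x|M. f x y)"
    and "(LINT p|(M \<Otimes>\<^sub>M N). f (fst p) (snd p)) = (LINT x|M. LINT y|N. f x y)"
proof -
  interpret M: finite_measure M by fact
  interpret N: finite_measure N by fact
  interpret P: pair_sigma_finite M N ..
  interpret PF: finite_measure "M \<Otimes>\<^sub>M N" by (rule finite_measure_pair_measure[OF N M])
  show i: "integrable (M \<Otimes>\<^sub>M N) (\<lambda>p. f (fst p) (snd p))"
    by (rule PF.integrable_const_bound[of _ B]) (use f b in \<open>auto simp: space_pair_measure\<close>)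
  then have i': "integrable (M \<Otimes>\<^sub>M N) (case_prod f)" by (simp add: case_prod_beta')
  show "(LINT x|M. LINT y|N. f x y) = (LINT y|N. LINT x|M. f x y)"
    by (rule P.Fubini_integral[OF i', symmetric])
  show "(LINT p|(M \<Otimes>\<^sub>M N). f (fst p) (snd p)) = (LINT x|M. LINT y|N. f x y)"
    using P.integral_fst'[OF i] by simp
qed

lemma exp_strip_inner_bound:
  fixes x y :: "real^3"
  assumes "\<tau> \<in> strip" "norm x \<le> 1" "norm y \<le> 1"
  shows "norm (exp (\<i> * \<tau> * complex_of_real (x \<bullet> y))) \<le> 2"
proof (rule exp_strip_bound[OF assms(1)])
  have "\<bar>x \<bullet> y\<bar> \<le> norm x * norm y" by (rule Cauchy_Schwarz_ineq2)
  also have "\<dots> \<le> 1 * 1" using assms by (intro mult_mono) auto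
  finally show "\<bar>x \<bullet> y\<bar> \<le> 1" by simp
qed

lemma minus_strip: "\<tau> \<in> strip \<Longrightarrow> - \<tau> \<in> strip"
  by (simp add: strip_def)

lemma plane_moment_holomorphic:
  assumes Y: "continuous_on (sphere 0 1) Y" and y: "norm y \<le> 1"
  shows "(\<lambda>\<tau>. plane_moment Y \<tau> y) holomorphic_on strip"
proof -
  obtain C where C: "\<And>x. x \<in> sphere 0 1 \<Longrightarrow> norm (Y x) \<le> C"
    using compact_imp_bounded[OF compact_continuous_image[OF Y compact_sphere]] unfolding bounded_iff by blast
  show ?thesis
    unfolding plane_moment_def
  proof (rule holomorphic_on_integral_bounded[where B = "2 * C"])
    fix \<tau> assume "\<tau> \<in> strip"
    show "(\<lambda>\<theta>. exp (\<i> * \<tau> * complex_of_real (\<theta> \<bullet> y)) * cnj (Y \<theta>)) \<in> borel_measurable sphere_measure"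
      by (intro measurable_sphere_continuous continuous_intros Y)
  next
    fix \<tau> \<theta> assume "\<tau> \<in> strip" "\<theta> \<in> space sphere_measure"
    then show "norm (exp (\<i> * \<tau> * complex_of_real (\<theta> \<bullet> y)) * cnj (Y \<theta>)) \<le> 2 * C"
      unfolding norm_mult using C[of \<theta>] y by (intro mult_mono exp_strip_inner_bound) auto
  qed (auto intro!: holomorphic_intros open_strip finite_sphere_measure)
qed

lemma plane_moment_bounded_continuous:
  assumes Y: "continuous_on (sphere 0 1) Y" and \<tau>: "\<tau> \<in> strip"
  shows "continuous_on (cball 0 1) (plane_moment Y \<tau>)"
proof -
  obtain C where C: "\<And>x. x \<in> sphere 0 1 \<Longrightarrow> norm (Y x) \<le> C"
    using compact_imp_bounded[OF compact_continuous_image[OF Y compact_sphere]] unfolding bounded_iff by blast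
  have "continuous_on (cball 0 1) (\<lambda>y. plane_moment Y \<tau> y)"
    unfolding plane_moment_def
  proof (rule continuous_on_integral_bounded[where B = "2 * C"])
    fix y :: "real^3" assume y: "y \<in> cball 0 1"
    show "(\<lambda>\<theta>. exp (\<i> * \<tau> * complex_of_real (\<theta> \<bullet> y)) * cnj (Y \<theta>)) \<in> borel_measurable sphere_measure"
      by (intro measurable_sphere_continuous continuous_intros Y)
    fix \<theta> assume "\<theta> \<in> space sphere_measure"
    then show "norm (exp (\<i> * \<tau> * complex_of_real (\<theta> \<bullet> y)) * cnj (Y \<theta>)) \<le> 2 * C"
      unfolding norm_mult using C[of \<theta>] y \<tau> by (intro mult_mono exp_strip_inner_bound) auto
  qed (auto intro!: continuous_intros finite_sphere_measure)
  then show ?thesis .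
qed

section \<open>Harmonic components of the wave and of the amplitude\<close>

context weak_potential begin

text \<open>The source v psi projected onto one harmonic of the incident direction. Projecting
  before estimating makes the incident field a \<open>plane_moment\<close>, whose decay in the
  degree is then passed on to the solution.\<close>

definition harmonic_wave :: "(real^3 \<Rightarrow> complex) \<Rightarrow> complex \<Rightarrow> real^3 \<Rightarrow> complex" where
  "harmonic_wave Y \<tau> x = (LINT \<theta>|sphere_measure. born_sum \<tau> \<theta> x * cnj (Y \<theta>))"

text \<open>The coefficient of the amplitude with both angular integrals carried out inside the
  integral over y. This form is visibly holomorphic in \<tau> and shows the decay in both degrees as
  a product.\<close>

definition amp_coeff :: "(real^3 \<Rightarrow> complex) \<Rightarrow> (real^3 \<Rightarrow> complex) \<Rightarrow> complex \<Rightarrow> complex" where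
  "amp_coeff Y1 Y2 \<tau> = newton_const / (2 * pi\<^sup>2) *
     (LINT y|unit_ball. plane_moment Y2 (- \<tau>) y * harmonic_wave Y1 \<tau> y)"

context
  fixes Y1 :: "real^3 \<Rightarrow> complex" and j1 :: nat and A :: real
  assumes Y1: "spherical_harmonic j1 Y1" and A1: "(LINT \<theta>|sphere_measure. norm (Y1 \<theta>)) \<le> A"
begin

lemma Y1_cont: "continuous_on (sphere 0 1) Y1" by (rule spherical_harmonic_continuous[OF Y1])

lemma Y1_bound: obtains C where "C \<ge> 0" "\<And>x. x \<in> sphere 0 1 \<Longrightarrow> norm (Y1 x) \<le> C"
proof -
  obtain C where C: "\<And>x. x \<in> sphere 0 1 \<Longrightarrow> norm (Y1 x) \<le> C"
    using compact_imp_bounded[OF compact_continuous_image[OF Y1_cont compact_sphere]] unfolding bounded_iff by blast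
  have "norm (Y1 x) \<le> max 0 C" if "x \<in> sphere 0 1" for x using C[OF that] by simp
  then show ?thesis using that[of "max 0 C"] by simp
qed

lemma A_nonneg: "A \<ge> 0"
  using order_trans[OF Bochner_Integration.integral_nonneg[of sphere_measure "\<lambda>\<theta>. norm (Y1 \<theta>)"] A1] by simp

lemma born_sum_continuous_pair:
  assumes "\<tau> \<in> strip"
  shows "continuous_on (sphere 0 1 \<times> UNIV) (\<lambda>p. born_sum \<tau> (fst p) (snd p))"
proof -
  have "continuous_on (sphere 0 1 \<times> UNIV) (\<lambda>p. (\<lambda>(\<tau>, \<theta>, x). born_sum \<tau> \<theta> x) (\<tau>, fst p, snd p))"
    by (rule continuous_on_compose2[OF born_sum_continuous]) (use assms in \<open>auto intro!: continuous_intros\<close>)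
  then show ?thesis by (simp add: case_prod_beta')
qed

lemma born_sum_continuous_theta:
  assumes "\<tau> \<in> strip"
  shows "continuous_on (sphere 0 1) (\<lambda>\<theta>. born_sum \<tau> \<theta> x)"
proof -
  have "continuous_on (sphere 0 1) (\<lambda>\<theta>. (\<lambda>p. born_sum \<tau> (fst p) (snd p)) (\<theta>, x))"
    by (rule continuous_on_compose2[OF born_sum_continuous_pair[OF assms]]) (auto intro!: continuous_intros)
  then show ?thesis by simp
qed

text \<open>A crude bound without decay in the degree, which makes the supremum finite that is
  estimated in \<open>harmonic_wave_bound\<close>.\<close>

lemma harmonic_wave_norm_le:
  assumes "\<tau> \<in> strip"
  shows "norm (harmonic_wave Y1 \<tau> x) \<le> 4 * N * A"
proof -
  have "norm (harmonic_wave Y1 \<tau> x) \<le> (LINT \<theta>|sphere_measure. 4 * N * norm (Y1 \<theta>))"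
    unfolding harmonic_wave_def
  proof (rule Bochner_Integration.integral_norm_bound_integral)
    show "integrable sphere_measure (\<lambda>\<theta>. born_sum \<tau> \<theta> x * cnj (Y1 \<theta>))"
      by (intro integrable_sphere_continuous continuous_intros Y1_cont born_sum_continuous_theta assms)
    show "integrable sphere_measure (\<lambda>\<theta>. 4 * N * norm (Y1 \<theta>))"
      by (intro integrable_mult_right integrable_norm integrable_sphere_continuous Y1_cont)
    fix \<theta> assume "\<theta> \<in> space sphere_measure"
    then show "norm (born_sum \<tau> \<theta> x * cnj (Y1 \<theta>)) \<le> 4 * N * norm (Y1 \<theta>)"
      unfolding norm_mult using born_sum_bound[OF assms, of \<theta> x] by (simp add: mult_right_mono)
  qed
  also have "\<dots> = 4 * N * (LINT \<theta>|sphere_measure. norm (Y1 \<theta>))" by (rule integral_mult_right_zero)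
  also have "\<dots> \<le> 4 * N * A" using A1 N_nonneg by (intro mult_left_mono) auto
  finally show ?thesis .
qed

lemma harmonic_wave_supp: "1/2 \<le> norm x \<Longrightarrow> harmonic_wave Y1 \<tau> x = 0"
  unfolding harmonic_wave_def by (simp add: born_sum_supp)

lemma harmonic_wave_continuous:
  assumes "\<tau> \<in> strip"
  shows "continuous_on UNIV (harmonic_wave Y1 \<tau>)"
proof -
  obtain C where C: "C \<ge> 0" "\<And>x. x \<in> sphere 0 1 \<Longrightarrow> norm (Y1 x) \<le> C" using Y1_bound by blast
  have "continuous_on UNIV (\<lambda>x. LINT \<theta>|sphere_measure. born_sum \<tau> \<theta> x * cnj (Y1 \<theta>))"
  proof (rule continuous_on_integral_bounded[where B = "4 * N * C"])
    fix x :: "real^3"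
    show "(\<lambda>\<theta>. born_sum \<tau> \<theta> x * cnj (Y1 \<theta>)) \<in> borel_measurable sphere_measure"
      by (intro measurable_sphere_continuous continuous_intros Y1_cont born_sum_continuous_theta assms)
    fix \<theta> assume "\<theta> \<in> space sphere_measure"
    then show "norm (born_sum \<tau> \<theta> x * cnj (Y1 \<theta>)) \<le> 4 * N * C"
      unfolding norm_mult using C(2)[of \<theta>] N_nonneg by (intro mult_mono born_sum_bound assms) auto
  next
    fix \<theta> assume "\<theta> \<in> space sphere_measure"
    then show "continuous_on UNIV (\<lambda>x. born_sum \<tau> \<theta> x * cnj (Y1 \<theta>))"
      by (intro continuous_intros born_sum_continuous_x assms) auto
  qed (rule finite_sphere_measure)
  then show ?thesis unfolding harmonic_wave_def[abs_def] .
qed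

lemma harmonic_wave_holomorphic: "(\<lambda>\<tau>. harmonic_wave Y1 \<tau> x) holomorphic_on strip"
proof -
  obtain C where C: "C \<ge> 0" "\<And>x. x \<in> sphere 0 1 \<Longrightarrow> norm (Y1 x) \<le> C" using Y1_bound by blast
  show ?thesis
    unfolding harmonic_wave_def
  proof (rule holomorphic_on_integral_bounded[where B = "4 * N * C"])
    fix \<tau> assume t: "\<tau> \<in> strip"
    then show "(\<lambda>\<theta>. born_sum \<tau> \<theta> x * cnj (Y1 \<theta>)) \<in> borel_measurable sphere_measure"
      by (intro measurable_sphere_continuous continuous_intros Y1_cont born_sum_continuous_theta)
    fix \<theta> assume "\<theta> \<in> space sphere_measure"
    then show "norm (born_sum \<tau> \<theta> x * cnj (Y1 \<theta>)) \<le> 4 * N * C"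
      unfolding norm_mult using C(2)[of \<theta>] N_nonneg t by (intro mult_mono born_sum_bound) auto
  next
    fix \<theta> assume "\<theta> \<in> space sphere_measure"
    then show "(\<lambda>\<tau>. born_sum \<tau> \<theta> x * cnj (Y1 \<theta>)) holomorphic_on strip"
      by (intro holomorphic_intros born_sum_holomorphic) auto
  qed (auto intro: open_strip finite_sphere_measure)
qed

text \<open>The integral operator of the Lippmann-Schwinger equation does not act on the incident
  direction, so integrating that direction against a harmonic preserves the equation and only
  replaces the incident plane wave by its moment.\<close>

lemma harmonic_wave_equation:
  assumes \<tau>: "\<tau> \<in> strip"
  shows "harmonic_wave Y1 \<tau> x = v x * (plane_moment Y1 \<tau> x -
    newton_const * (LINT z|newton_measure. exp (\<i> * \<tau> * norm z) * harmonic_wave Y1 \<tau> (x - z)))"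
proof -
  obtain C where C: "C \<ge> 0" "\<And>x. x \<in> sphere 0 1 \<Longrightarrow> norm (Y1 x) \<le> C" using Y1_bound by blast
  let ?e = "\<lambda>\<theta>. exp (\<i> * \<tau> * complex_of_real (\<theta> \<bullet> x)) * cnj (Y1 \<theta>)"
  let ?f = "\<lambda>\<theta> z. exp (\<i> * \<tau> * complex_of_real (norm z)) * born_sum \<tau> \<theta> (x - z) * cnj (Y1 \<theta>)"
  have cp: "continuous_on (sphere 0 1 \<times> ball 0 1) (\<lambda>p. ?f (fst p) (snd p))"
  proof -
    have "continuous_on (sphere 0 1 \<times> ball 0 1) (\<lambda>p. (\<lambda>p. born_sum \<tau> (fst p) (snd p)) (fst p, x - snd p))"
      by (rule continuous_on_compose2[OF born_sum_continuous_pair[OF \<tau>]]) (auto intro!: continuous_intros)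
    then have c1: "continuous_on (sphere 0 1 \<times> ball 0 1) (\<lambda>p. born_sum \<tau> (fst p) (x - snd p))" by simp
    have c2: "continuous_on (sphere 0 1 \<times> ball (0::real^3) 1) (\<lambda>p. cnj (Y1 (fst p)))"
      by (intro continuous_intros continuous_on_compose2[OF Y1_cont]) auto
    show ?thesis
      by (rule continuous_on_mult[OF continuous_on_mult[OF _ c1] c2]) (intro continuous_intros)
  qed
  have fm: "(\<lambda>p. ?f (fst p) (snd p)) \<in> borel_measurable (sphere_measure \<Otimes>\<^sub>M newton_measure)"
    by (rule measurable_pair_continuous[OF cp sets_sphere_measure sets_newton_measure])
  have fb: "norm (?f \<theta> z) \<le> 2 * (4 * N) * C" if "\<theta> \<in> space sphere_measure" "z \<in> space newton_measure" for \<theta> z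
    unfolding norm_mult using that C(2)[of \<theta>] N_nonneg \<tau> by (intro mult_mono born_sum_bound exp_strip_bound) auto
  note fub = fubini_bounded[OF finite_sphere_measure finite_newton_measure fm fb]
  interpret P: pair_sigma_finite sphere_measure newton_measure ..
  have gi: "integrable sphere_measure (\<lambda>\<theta>. LINT z|newton_measure. ?f \<theta> z)"
    using P.integrable_fst'[OF fub(1)] by simp
  have ei: "integrable sphere_measure ?e"
    by (intro integrable_sphere_continuous continuous_intros Y1_cont)
  have "harmonic_wave Y1 \<tau> x = (LINT \<theta>|sphere_measure. v x * ?e \<theta> - newton_const * v x * (LINT z|newton_measure. ?f \<theta> z))"
    unfolding harmonic_wave_def
  proof (rule Bochner_Integration.integral_cong[OF refl])
    fix \<theta> assume "\<theta> \<in> space sphere_measure"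
    then have t: "\<theta> \<in> sphere 0 1" by simp
    have e: "(LINT z|newton_measure. ?f \<theta> z) = (LINT z|newton_measure. exp (\<i> * \<tau> * complex_of_real (norm z)) * born_sum \<tau> \<theta> (x - z)) * cnj (Y1 \<theta>)"
      by (rule integral_mult_left_zero)
    show "born_sum \<tau> \<theta> x * cnj (Y1 \<theta>) = v x * ?e \<theta> - newton_const * v x * (LINT z|newton_measure. ?f \<theta> z)"
      unfolding e by (subst born_sum_equation[OF \<tau> t]) (simp add: algebra_simps)
  qed
  also have "\<dots> = v x * (LINT \<theta>|sphere_measure. ?e \<theta>) - newton_const * v x * (LINT \<theta>|sphere_measure. LINT z|newton_measure. ?f \<theta> z)"
    by (subst Bochner_Integration.integral_diff[OF integrable_mult_right[OF ei] integrable_mult_right[OF gi]]) (simp only: integral_mult_right_zero)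
  also have "(LINT \<theta>|sphere_measure. LINT z|newton_measure. ?f \<theta> z) = (LINT z|newton_measure. LINT \<theta>|sphere_measure. ?f \<theta> z)"
    by (rule fub(2))
  also have "\<dots> = (LINT z|newton_measure. exp (\<i> * \<tau> * norm z) * harmonic_wave Y1 \<tau> (x - z))"
    unfolding harmonic_wave_def by (simp only: mult.assoc integral_mult_right_zero)
  finally show ?thesis unfolding plane_moment_def by (simp add: algebra_simps)
qed

text \<open>For the supremum S the equation yields S \<le> N P + S/2, where P bounds the incident
  moment, so the scattered part is absorbed. In this way the decay of the moment holds for the full
  Born series at the price of a factor 2. The argument |\<tau>|/2 is due to the support in the ball
  of radius 1/2.\<close>

lemma harmonic_wave_bound:
  assumes \<tau>: "\<tau> \<in> strip"
  shows "norm (harmonic_wave Y1 \<tau> x) \<le> 2 * N * (A * moment_bound (norm \<tau> / 2) j1)"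
proof -
  define S where "S = (SUP x. norm (harmonic_wave Y1 \<tau> x))"
  have bdd: "bdd_above (range (\<lambda>x. norm (harmonic_wave Y1 \<tau> x)))"
    using harmonic_wave_norm_le[OF \<tau>] by (auto intro!: bdd_aboveI)
  have le: "norm (harmonic_wave Y1 \<tau> x) \<le> S" for x unfolding S_def by (rule cSUP_upper[OF _ bdd]) simp
  have S0: "S \<ge> 0" using le[of 0] norm_ge_zero order_trans by blast
  let ?P = "A * moment_bound (norm \<tau> / 2) j1"
  have P0: "?P \<ge> 0" using A_nonneg by (intro mult_nonneg_nonneg moment_bound_nonneg) auto
  have "norm (harmonic_wave Y1 \<tau> x) \<le> N * ?P + S / 2" for x
  proof (cases "norm x < 1/2")
    case False
    then show ?thesis using harmonic_wave_supp[of x \<tau>] N_nonneg P0 S0 by simp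
  next
    case True
    have "norm (plane_moment Y1 \<tau> x) \<le> A * moment_bound (norm \<tau> * norm x) j1"
      by (rule plane_moment_bound[OF Y1 A1])
    also have "\<dots> \<le> ?P"
      using True A_nonneg mult_left_mono[of "norm x" "1/2" "norm \<tau>"] by (intro mult_left_mono moment_bound_mono) auto
    finally have p: "norm (plane_moment Y1 \<tau> x) \<le> ?P" .
    have "norm (exp (\<i> * \<tau> * norm z) * harmonic_wave Y1 \<tau> (x - z)) \<le> 2 * S" if "norm z < 1" for z
      unfolding norm_mult using that \<tau> by (intro mult_mono le exp_strip_bound) auto
    then have q: "norm (LINT z|newton_measure. exp (\<i> * \<tau> * norm z) * harmonic_wave Y1 \<tau> (x - z)) \<le> 2 * S * newton_mass"
      by (rule newton_integral_bound) (use S0 in auto)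
    have "norm (harmonic_wave Y1 \<tau> x) \<le> \<bar>v x\<bar> * (norm (plane_moment Y1 \<tau> x) +
       norm (newton_const * (LINT z|newton_measure. exp (\<i> * \<tau> * norm z) * harmonic_wave Y1 \<tau> (x - z))))"
      by (subst harmonic_wave_equation[OF \<tau>], subst norm_mult) (intro mult_mono norm_triangle_ineq4, auto)
    also have "\<dots> \<le> N * (?P + newton_const * (2 * S * newton_mass))"
      using newton_const_pos unfolding norm_mult
      by (intro mult_mono add_mono v_bound p q) (auto simp: N_nonneg intro!: add_nonneg_nonneg mult_nonneg_nonneg q)
    also have "\<dots> = N * ?P + (4 * newton_const * newton_mass * N) * (S / 2)" by (simp add: algebra_simps)
    also have "\<dots> \<le> N * ?P + 1 * (S / 2)" using N_small S0 by (intro add_left_mono mult_right_mono) auto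
    finally show ?thesis by simp
  qed
  then have "S \<le> N * ?P + S / 2" unfolding S_def by (intro cSUP_least) auto
  then have "S \<le> 2 * N * ?P" by simp
  then show ?thesis using le[of x] by linarith
qed

end

context
  fixes Y1 Y2 :: "real^3 \<Rightarrow> complex" and j1 j2 :: nat and A :: real
  assumes Y1: "spherical_harmonic j1 Y1" and A1: "(LINT \<theta>|sphere_measure. norm (Y1 \<theta>)) \<le> A"
    and Y2: "spherical_harmonic j2 Y2" and A2: "(LINT \<theta>|sphere_measure. norm (Y2 \<theta>)) \<le> A"
begin

lemmas Yc1 = spherical_harmonic_continuous[OF Y1]
lemmas Yc2 = spherical_harmonic_continuous[OF Y2]
lemmas hw_cont = harmonic_wave_continuous[OF Y1 A1]
lemmas hw_supp = harmonic_wave_supp[OF Y1 A1]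

lemma amp_coeff_integrand_bound:
  assumes "\<tau> \<in> strip" "norm y < 1"
  shows "norm (plane_moment Y2 (- \<tau>) y * harmonic_wave Y1 \<tau> y) \<le>
    A * moment_bound (norm \<tau> / 2) j2 * (2 * N * (A * moment_bound (norm \<tau> / 2) j1))"
proof -
  have A0: "A \<ge> 0" by (rule A_nonneg[OF Y1 A1])
  show ?thesis
  proof (cases "norm y < 1/2")
    case True
    have "norm (plane_moment Y2 (- \<tau>) y) \<le> A * moment_bound (norm (- \<tau>) * norm y) j2"
      by (rule plane_moment_bound[OF Y2 A2])
    also have "\<dots> \<le> A * moment_bound (norm \<tau> / 2) j2"
      using True A0 mult_left_mono[of "norm y" "1/2" "norm \<tau>"] by (intro mult_left_mono moment_bound_mono) auto
    finally show ?thesis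
      unfolding norm_mult using A0
      by (intro mult_mono harmonic_wave_bound[OF Y1 A1 assms(1)] mult_nonneg_nonneg moment_bound_nonneg) auto
  next
    case False
    then have "harmonic_wave Y1 \<tau> y = 0" using hw_supp[of y \<tau>] by simp
    then show ?thesis using A0 N_nonneg by (auto intro!: mult_nonneg_nonneg moment_bound_nonneg)
  qed
qed

lemma amp_coeff_integrand_continuous:
  assumes "\<tau> \<in> strip"
  shows "continuous_on (ball 0 1) (\<lambda>y. plane_moment Y2 (- \<tau>) y * harmonic_wave Y1 \<tau> y)"
proof -
  have "continuous_on (ball 0 1) (plane_moment Y2 (- \<tau>))"
    by (rule continuous_on_subset[OF plane_moment_bounded_continuous[OF Yc2 minus_strip[OF assms]]]) auto
  moreover have "continuous_on (ball 0 1) (harmonic_wave Y1 \<tau>)"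
    by (rule continuous_on_subset[OF hw_cont[OF assms]]) auto
  ultimately show ?thesis by (rule continuous_on_mult)
qed

lemma measurable_unit_ball_continuous:
  fixes f :: "real^3 \<Rightarrow> complex"
  assumes "continuous_on (ball 0 1) f"
  shows "f \<in> borel_measurable unit_ball"
  unfolding measurable_cong_sets[OF sets_unit_ball refl]
  by (rule borel_measurable_continuous_on_restrict[OF assms])

text \<open>The moment of the outgoing wave supplies the decay in the second degree, the harmonic
  wave that in the first; both only matter on the support of the potential, where |y| < 1/2.\<close>

lemma amp_coeff_bound:
  assumes \<tau>: "\<tau> \<in> strip"
  shows "norm (amp_coeff Y1 Y2 \<tau>) \<le> newton_const / (2 * pi\<^sup>2) * (measure unit_ball (ball 0 1) *
    (2 * N * A\<^sup>2)) * (moment_bound (norm \<tau> / 2) j1 * moment_bound (norm \<tau> / 2) j2)"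
proof -
  let ?B = "A * moment_bound (norm \<tau> / 2) j2 * (2 * N * (A * moment_bound (norm \<tau> / 2) j1))"
  have i: "integrable unit_ball (\<lambda>y. plane_moment Y2 (- \<tau>) y * harmonic_wave Y1 \<tau> y)"
    by (rule unit_ball.integrable_const_bound[of _ ?B])
      (use amp_coeff_integrand_bound[OF \<tau>] measurable_unit_ball_continuous[OF amp_coeff_integrand_continuous[OF \<tau>]] in auto)
  have "norm (LINT y|unit_ball. plane_moment Y2 (- \<tau>) y * harmonic_wave Y1 \<tau> y) \<le> (LINT y|unit_ball. ?B)"
    by (rule Bochner_Integration.integral_norm_bound_integral[OF i]) (use amp_coeff_integrand_bound[OF \<tau>] in auto)
  also have "\<dots> = measure unit_ball (ball 0 1) * ?B" by simp
  finally have "norm (amp_coeff Y1 Y2 \<tau>) \<le> newton_const / (2 * pi\<^sup>2) * (measure unit_ball (ball 0 1) * ?B)"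
    unfolding amp_coeff_def norm_mult using newton_const_pos by (intro mult_mono) (auto simp: norm_divide norm_mult norm_power)
  then show ?thesis by (simp add: power2_eq_square mult_ac)
qed

lemma amp_coeff_holomorphic: "amp_coeff Y1 Y2 holomorphic_on strip"
proof -
  obtain C where C: "\<And>x. x \<in> sphere 0 1 \<Longrightarrow> norm (Y2 x) \<le> C"
    using compact_imp_bounded[OF compact_continuous_image[OF Yc2 compact_sphere]] unfolding bounded_iff by blast
  have pb: "norm (plane_moment Y2 (- \<tau>) y) \<le> 2 * A" if \<tau>: "\<tau> \<in> strip" and y: "norm y < 1" for \<tau> y
  proof -
    have "norm (plane_moment Y2 (- \<tau>) y) \<le> (LINT \<theta>|sphere_measure. 2 * norm (Y2 \<theta>))"
      unfolding plane_moment_def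
    proof (rule Bochner_Integration.integral_norm_bound_integral)
      show "integrable sphere_measure (\<lambda>\<theta>. exp (\<i> * - \<tau> * complex_of_real (\<theta> \<bullet> y)) * cnj (Y2 \<theta>))"
        by (intro integrable_sphere_continuous continuous_intros Yc2)
      show "integrable sphere_measure (\<lambda>\<theta>. 2 * norm (Y2 \<theta>))"
        by (intro integrable_mult_right integrable_norm integrable_sphere_continuous Yc2)
      fix \<theta> assume "\<theta> \<in> space sphere_measure"
      then show "norm (exp (\<i> * - \<tau> * complex_of_real (\<theta> \<bullet> y)) * cnj (Y2 \<theta>)) \<le> 2 * norm (Y2 \<theta>)"
        unfolding norm_mult complex_mod_cnj using y by (intro mult_right_mono exp_strip_inner_bound minus_strip[OF \<tau>]) auto
    qed
    also have "\<dots> = 2 * (LINT \<theta>|sphere_measure. norm (Y2 \<theta>))" by (rule integral_mult_right_zero)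
    finally show ?thesis using A2 by linarith
  qed
  have "(\<lambda>\<tau>. LINT y|unit_ball. plane_moment Y2 (- \<tau>) y * harmonic_wave Y1 \<tau> y) holomorphic_on strip"
  proof (rule holomorphic_on_integral_bounded[where B = "2 * A * (4 * N * A)"])
    fix \<tau> assume \<tau>: "\<tau> \<in> strip"
    show "(\<lambda>y. plane_moment Y2 (- \<tau>) y * harmonic_wave Y1 \<tau> y) \<in> borel_measurable unit_ball"
      by (rule measurable_unit_ball_continuous[OF amp_coeff_integrand_continuous[OF \<tau>]])
    fix y assume "y \<in> space unit_ball"
    then show "norm (plane_moment Y2 (- \<tau>) y * harmonic_wave Y1 \<tau> y) \<le> 2 * A * (4 * N * A)"
      unfolding norm_mult using \<tau> A_nonneg[OF Y1 A1] by (intro mult_mono pb harmonic_wave_norm_le[OF Y1 A1]) auto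
  next
    fix y assume "y \<in> space unit_ball"
    then have "norm y \<le> 1" by simp
    from plane_moment_holomorphic[OF Yc2 this]
    have "(\<lambda>\<tau>. plane_moment Y2 \<tau> y) \<circ> uminus holomorphic_on strip"
      by (rule holomorphic_on_compose_gen[rotated]) (auto intro!: holomorphic_intros minus_strip)
    then show "(\<lambda>\<tau>. plane_moment Y2 (- \<tau>) y * harmonic_wave Y1 \<tau> y) holomorphic_on strip"
      by (intro holomorphic_on_mult harmonic_wave_holomorphic[OF Y1 A1]) (simp add: o_def)
  qed (auto intro: open_strip finite_unit_ball)
  then show ?thesis unfolding amp_coeff_def[abs_def] by (intro holomorphic_intros)
qed

text \<open>Fubini twice: over \<omega> and y for fixed \<theta>, which produces the moment at
  -\<tau> from the outgoing phase, then over \<theta> and y.\<close>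

lemma far_field_coeff:
  assumes \<tau>: "\<tau> \<in> strip"
  shows "(LINT p|(sphere_measure \<Otimes>\<^sub>M sphere_measure). far_field \<tau> (fst p) (snd p) * cnj (Y1 (fst p)) * cnj (Y2 (snd p))) = amp_coeff Y1 Y2 \<tau>"
proof -
  obtain C1 where C1: "C1 \<ge> 0" "\<And>x. x \<in> sphere 0 1 \<Longrightarrow> norm (Y1 x) \<le> C1" using Y1_bound[OF Y1 A1] by blast
  obtain C2 where C2: "C2 \<ge> 0" "\<And>x. x \<in> sphere 0 1 \<Longrightarrow> norm (Y2 x) \<le> C2" using Y1_bound[OF Y2 A2] by blast
  let ?k = "complex_of_real (newton_const / (2 * pi\<^sup>2))"
  let ?e = "\<lambda>(\<omega>::real^3) y. exp (- \<i> * \<tau> * complex_of_real (\<omega> \<bullet> y))"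
  have eb: "norm (?e \<omega> y) \<le> 2" if "norm \<omega> = 1" "norm y < 1" for \<omega> y :: "real^3"
    using exp_strip_inner_bound[OF minus_strip[OF \<tau>], of \<omega> y] that by simp
  have fc: "continuous_on (sphere 0 1 \<times> sphere 0 1) (\<lambda>p. far_field \<tau> (fst p) (snd p))"
  proof -
    have "continuous_on (sphere 0 1 \<times> sphere 0 1) (\<lambda>p. (\<lambda>(\<tau>, \<theta>, \<omega>). far_field \<tau> \<theta> \<omega>) (\<tau>, fst p, snd p))"
      by (rule continuous_on_compose2[OF far_field_continuous]) (use \<tau> in \<open>auto intro!: continuous_intros\<close>)
    then show ?thesis by (simp add: case_prod_beta')
  qed
  have Yc: "continuous_on (sphere 0 1 \<times> sphere (0::real^3) 1) (\<lambda>p. Y1 (fst p))" "continuous_on (sphere (0::real^3) 1 \<times> sphere 0 1) (\<lambda>p. Y2 (snd p))"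
    by (rule continuous_on_compose2[OF Yc1], auto intro!: continuous_intros continuous_on_compose2[OF Yc2])
  have gc: "continuous_on (sphere 0 1 \<times> sphere 0 1) (\<lambda>p. far_field \<tau> (fst p) (snd p) * cnj (Y1 (fst p)) * cnj (Y2 (snd p)))"
    by (intro continuous_intros fc Yc)
  have "bounded ((\<lambda>p. far_field \<tau> (fst p) (snd p) * cnj (Y1 (fst p)) * cnj (Y2 (snd p))) ` (sphere 0 1 \<times> sphere 0 1))"
    by (intro compact_imp_bounded compact_continuous_image gc compact_Times compact_sphere)
  then obtain B where B: "\<And>p. p \<in> sphere 0 1 \<times> sphere 0 1 \<Longrightarrow> norm (far_field \<tau> (fst p) (snd p) * cnj (Y1 (fst p)) * cnj (Y2 (snd p))) \<le> B"
    unfolding bounded_iff by blast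
  have B': "norm (far_field \<tau> \<theta> \<omega> * cnj (Y1 \<theta>) * cnj (Y2 \<omega>)) \<le> B" if "\<theta> \<in> space sphere_measure" "\<omega> \<in> space sphere_measure" for \<theta> \<omega>
    using B[of "(\<theta>, \<omega>)"] that by simp
  have "(LINT p|(sphere_measure \<Otimes>\<^sub>M sphere_measure). far_field \<tau> (fst p) (snd p) * cnj (Y1 (fst p)) * cnj (Y2 (snd p)))
    = (LINT \<theta>|sphere_measure. LINT \<omega>|sphere_measure. far_field \<tau> \<theta> \<omega> * cnj (Y1 \<theta>) * cnj (Y2 \<omega>))"
    by (rule fubini_bounded(3)[OF finite_sphere_measure finite_sphere_measure
        measurable_pair_continuous[OF gc sets_sphere_measure sets_sphere_measure] B'])
  also have "\<dots> = (LINT \<theta>|sphere_measure. ?k * (LINT y|unit_ball. plane_moment Y2 (- \<tau>) y * born_sum \<tau> \<theta> y * cnj (Y1 \<theta>)))"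
  proof (rule Bochner_Integration.integral_cong[OF refl])
    fix \<theta> assume "\<theta> \<in> space sphere_measure"
    then have t: "\<theta> \<in> sphere 0 1" by simp
    let ?h = "\<lambda>\<omega> y. ?e \<omega> y * born_sum \<tau> \<theta> y * cnj (Y1 \<theta>) * cnj (Y2 \<omega>)"
    have hc: "continuous_on (sphere 0 1 \<times> ball 0 1) (\<lambda>p. ?h (fst p) (snd p))"
      by (intro continuous_intros continuous_on_compose2[OF born_sum_continuous_x[OF \<tau> t]] continuous_on_compose2[OF Yc2]) auto
    have hb: "norm (?h \<omega> y) \<le> 2 * (4 * N) * C1 * C2" if "\<omega> \<in> space sphere_measure" "y \<in> space unit_ball" for \<omega> y
      unfolding norm_mult complex_mod_cnj
      using that C1 C2 t N_nonneg by (intro mult_mono eb born_sum_bound[OF \<tau> t]) auto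
    note fub = fubini_bounded[OF finite_sphere_measure finite_unit_ball measurable_pair_continuous[OF hc sets_sphere_measure sets_unit_ball] hb]
    have "(LINT \<omega>|sphere_measure. far_field \<tau> \<theta> \<omega> * cnj (Y1 \<theta>) * cnj (Y2 \<omega>)) = (LINT \<omega>|sphere_measure. ?k * (LINT y|unit_ball. ?h \<omega> y))"
      unfolding far_field_def by (simp only: mult.assoc integral_mult_left_zero[symmetric])
    also have "\<dots> = ?k * (LINT \<omega>|sphere_measure. LINT y|unit_ball. ?h \<omega> y)"
      by (rule integral_mult_right_zero)
    also have "(LINT \<omega>|sphere_measure. LINT y|unit_ball. ?h \<omega> y) = (LINT y|unit_ball. LINT \<omega>|sphere_measure. ?h \<omega> y)"
      by (rule fub(2))
    also have "(LINT y|unit_ball. LINT \<omega>|sphere_measure. ?h \<omega> y) = (LINT y|unit_ball. plane_moment Y2 (- \<tau>) y * born_sum \<tau> \<theta> y * cnj (Y1 \<theta>))"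
    proof (rule Bochner_Integration.integral_cong[OF refl])
      fix y
      have "(LINT \<omega>|sphere_measure. ?h \<omega> y) = (LINT \<omega>|sphere_measure. exp (\<i> * - \<tau> * complex_of_real (\<omega> \<bullet> y)) * cnj (Y2 \<omega>) * (born_sum \<tau> \<theta> y * cnj (Y1 \<theta>)))"
        by (simp add: mult_ac)
      also have "\<dots> = plane_moment Y2 (- \<tau>) y * (born_sum \<tau> \<theta> y * cnj (Y1 \<theta>))"
        unfolding plane_moment_def by (rule integral_mult_left_zero)
      finally show "(LINT \<omega>|sphere_measure. ?h \<omega> y) = plane_moment Y2 (- \<tau>) y * born_sum \<tau> \<theta> y * cnj (Y1 \<theta>)"
        by (simp only: mult.assoc)
    qed
    finally show "(LINT \<omega>|sphere_measure. far_field \<tau> \<theta> \<omega> * cnj (Y1 \<theta>) * cnj (Y2 \<omega>)) =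
      ?k * (LINT y|unit_ball. plane_moment Y2 (- \<tau>) y * born_sum \<tau> \<theta> y * cnj (Y1 \<theta>))" .
  qed
  also have "\<dots> = ?k * (LINT y|unit_ball. LINT \<theta>|sphere_measure. plane_moment Y2 (- \<tau>) y * born_sum \<tau> \<theta> y * cnj (Y1 \<theta>))"
  proof -
    let ?h = "\<lambda>\<theta> y. plane_moment Y2 (- \<tau>) y * born_sum \<tau> \<theta> y * cnj (Y1 \<theta>)"
    have pc: "continuous_on (cball 0 1) (plane_moment Y2 (- \<tau>))"
      by (rule plane_moment_bounded_continuous[OF Yc2 minus_strip[OF \<tau>]])
    obtain D where D: "\<And>y. y \<in> cball 0 1 \<Longrightarrow> norm (plane_moment Y2 (- \<tau>) y) \<le> D"
      using compact_imp_bounded[OF compact_continuous_image[OF pc compact_cball]] unfolding bounded_iff by blast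
    have D0: "D \<ge> 0" by (rule order_trans[OF norm_ge_zero D[of 0]]) simp
    have pc': "continuous_on (sphere (0::real^3) 1 \<times> ball 0 1) (\<lambda>p. plane_moment Y2 (- \<tau>) (snd p))"
      by (rule continuous_on_compose2[OF pc]) (auto intro!: continuous_intros)
    have bc': "continuous_on (sphere 0 1 \<times> ball 0 1) (\<lambda>p. born_sum \<tau> (fst p) (snd p))"
      by (rule continuous_on_subset[OF born_sum_continuous_pair[OF Y1 A1 \<tau>]]) auto
    have Yc': "continuous_on (sphere 0 1 \<times> ball (0::real^3) 1) (\<lambda>p. Y1 (fst p))"
      by (rule continuous_on_compose2[OF Yc1]) (auto intro!: continuous_intros)
    have hc: "continuous_on (sphere 0 1 \<times> ball 0 1) (\<lambda>p. ?h (fst p) (snd p))"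
      by (rule continuous_on_mult[OF continuous_on_mult[OF pc' bc'] continuous_on_cnj[OF Yc']])
    have hb: "norm (?h \<theta> y) \<le> D * (4 * N) * C1" if "\<theta> \<in> space sphere_measure" "y \<in> space unit_ball" for \<theta> y
      unfolding norm_mult complex_mod_cnj
      using that C1 D[of y] D0 N_nonneg by (intro mult_mono born_sum_bound[OF \<tau>]) auto
    note fub = fubini_bounded[OF finite_sphere_measure finite_unit_ball measurable_pair_continuous[OF hc sets_sphere_measure sets_unit_ball] hb]
    have "(LINT \<theta>|sphere_measure. ?k * (LINT y|unit_ball. ?h \<theta> y)) = ?k * (LINT \<theta>|sphere_measure. LINT y|unit_ball. ?h \<theta> y)"
      by (rule integral_mult_right_zero)
    also have "(LINT \<theta>|sphere_measure. LINT y|unit_ball. ?h \<theta> y) = (LINT y|unit_ball. LINT \<theta>|sphere_measure. ?h \<theta> y)"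
      by (rule fub(2))
    finally show ?thesis .
  qed
  also have "\<dots> = amp_coeff Y1 Y2 \<tau>"
    unfolding amp_coeff_def harmonic_wave_def by (simp only: mult.assoc integral_mult_right_zero)
  finally show ?thesis .
qed

end

end

section \<open>Sums of small bumps\<close>

lemma pos_part_power_derivative:
  assumes "m \<ge> 1"
  shows "((\<lambda>r. max 0 r ^ Suc m) has_real_derivative real (Suc m) * max 0 r ^ m) (at (r::real))"
proof (cases r "0::real" rule: linorder_cases)
  case less
  have "((\<lambda>r. 0) has_real_derivative real (Suc m) * max 0 r ^ m) (at r)" using less assms by (simp add: max_def power_0_left)
  then show ?thesis
    by (rule has_field_derivative_transform_within_open[of _ _ _ "{..<0}"]) (use less in auto)
next
  case greater
  have "((\<lambda>r. r ^ Suc m) has_real_derivative real (Suc m) * max 0 r ^ m) (at r)"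
    using DERIV_pow[of "Suc m" r] greater by simp
  then show ?thesis
    by (rule has_field_derivative_transform_within_open[of _ _ _ "{0<..}"]) (use greater in auto)
next
  case equal
  \<comment> \<open>At the kink the quotient is at most |y|^m, which tends to 0 because m \<ge>
    1.\<close>
  have "((\<lambda>y. (max 0 y ^ Suc m - max 0 0 ^ Suc m) / (y - 0)) \<longlongrightarrow> 0) (at (0::real))"
  proof (rule Lim_null_comparison)
    show "\<forall>\<^sub>F y in at 0. norm ((max 0 y ^ Suc m - max 0 0 ^ Suc m) / (y - 0)) \<le> \<bar>y\<bar> ^ m"
      by (auto intro!: always_eventually simp: max_def abs_mult power_abs)
    have "((\<lambda>y::real. \<bar>y\<bar> ^ m) \<longlongrightarrow> \<bar>0\<bar> ^ m) (at 0)" by (intro tendsto_intros)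
    moreover have "\<bar>0::real\<bar> ^ m = 0" using assms by simp
    ultimately show "((\<lambda>y::real. \<bar>y\<bar> ^ m) \<longlongrightarrow> 0) (at 0)" by (simp only:)
  qed
  then show ?thesis using equal assms by (simp add: has_field_derivative_iff power_0_left)
qed

text \<open>A bump of finite smoothness n - 1: its first derivatives are again lower bumps times
  coordinates, which makes every smoothness statement a short induction. The exponent is later the
  integer part of m plus 2.\<close>

definition bump :: "nat \<Rightarrow> real^3 \<Rightarrow> real" where
  "bump n x = max 0 (1 - x \<bullet> x) ^ n"

lemma bump_has_derivative:
  assumes "m \<ge> 1"
  shows "(bump (Suc m) has_derivative (\<lambda>h. - 2 * real (Suc m) * bump m x * (x \<bullet> h))) (at x)"
proof -
  have "((\<lambda>x. 1 - x \<bullet> x) has_derivative (\<lambda>h. - (2 * (x \<bullet> h)))) (at x)" for x :: "real^3"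
    by (auto intro!: derivative_eq_intros simp: inner_commute)
  from has_derivative_compose[OF this pos_part_power_derivative[OF assms, unfolded has_field_derivative_def]]
  have "((\<lambda>x. max 0 (1 - x \<bullet> x) ^ Suc m) has_derivative (\<lambda>h. real (Suc m) * max 0 (1 - x \<bullet> x) ^ m * (- (2 * (x \<bullet> h))))) (at x)" .
  moreover have "(\<lambda>h. real (Suc m) * max 0 (1 - x \<bullet> x) ^ m * (- (2 * (x \<bullet> h)))) = (\<lambda>h. - 2 * real (Suc m) * bump m x * (x \<bullet> h))"
    unfolding bump_def by (simp add: fun_eq_iff algebra_simps)
  ultimately show ?thesis unfolding bump_def[abs_def] by (simp only:)
qed

lemma bump_continuous: "continuous_on UNIV (bump n)"
  unfolding bump_def[abs_def] by (intro continuous_intros)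

lemma bump_C_k_on: "k < n \<Longrightarrow> C_k_on k UNIV (bump n)"
proof (induction k arbitrary: n)
  case 0
  show ?case using bump_continuous by (simp add: C_k_on_0_iff)
next
  case (Suc k)
  then obtain m where m: "n = Suc m" "m \<ge> 1" "k < m" by (cases n) auto
  show ?case unfolding m(1)
  proof (rule C_k_on_SucI[OF bump_has_derivative[OF m(2)]])
    fix i
    have "C_k_on k UNIV (\<lambda>x. - 2 * real (Suc m) * bump m x * (of_real (x $ i)))"
      by (intro C_k_on_mult C_k_on_const Suc.IH m C_k_on_component)
    then show "C_k_on k UNIV (\<lambda>x. - 2 * real (Suc m) * bump m x * (x \<bullet> axis i 1))"
      by (simp add: inner_axis)
  qed
qed

lemma frechet_derivative_cong_open:
  assumes "open S" "x \<in> S" "\<And>y. y \<in> S \<Longrightarrow> f y = g y"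
  shows "frechet_derivative f (at x) = frechet_derivative g (at x)"
proof -
  have "(f has_derivative D) (at x) \<longleftrightarrow> (g has_derivative D) (at x)" for D
    using has_derivative_transform_within_open[of f D x UNIV S g]
      has_derivative_transform_within_open[of g D x UNIV S f] assms by auto
  then show ?thesis unfolding frechet_derivative_def by simp
qed

lemma iter_partial_cong_open:
  assumes "open S" "\<And>y. y \<in> S \<Longrightarrow> f y = g y"
  shows "x \<in> S \<Longrightarrow> iter_partial is f x = iter_partial is g x"
proof (induction "is" arbitrary: x)
  case (Cons i "is")
  then show ?case
    unfolding iter_partial.simps partial_deriv_def by (subst frechet_derivative_cong_open[OF assms(1) Cons.prems Cons.IH]) auto
qed (use assms in auto)

lemma iter_partial_const_zero: "iter_partial is (\<lambda>x. 0) = (\<lambda>x. 0)"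
proof (induction "is")
  case (Cons i "is")
  have "frechet_derivative (\<lambda>x. 0) (at x) = (\<lambda>h. 0)" for x :: "real^3"
    by (rule frechet_derivative_at[symmetric]) simp
  then show ?case using Cons by (simp add: partial_deriv_def[abs_def])
qed simp

lemma iter_partial_bump_support:
  assumes "length is < n" "1 \<le> norm x"
  shows "iter_partial is (bump n) x = 0"
proof -
  have c: "continuous_on UNIV (iter_partial is (bump n))"
    using bump_C_k_on[OF assms(1)] unfolding C_k_on_def by simp
  have n: "n \<ge> 1" using assms(1) by simp
  have "iter_partial is (bump n) y = 0" if "y \<in> - cball 0 1" for y
  proof -
    have "iter_partial is (bump n) y = iter_partial is (\<lambda>x. 0) y"
    proof (rule iter_partial_cong_open[of "- cball 0 1"])
      fix z :: "real^3" assume "z \<in> - cball 0 1"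
      then have "1 < z \<bullet> z" by (simp add: power2_norm_eq_inner[symmetric] one_less_power)
      then show "bump n z = 0" using n unfolding bump_def by simp
    qed (use that in auto)
    then show ?thesis by (simp add: iter_partial_const_zero)
  qed
  then have "- cball 0 1 \<subseteq> {y. iter_partial is (bump n) y = 0}" by auto
  moreover have "closed {y. iter_partial is (bump n) y = 0}"
    by (intro closed_Collect_eq c continuous_intros)
  \<comment> \<open>Continuity extends the vanishing from the exterior of the ball to the unit
    sphere itself.\<close>
  ultimately have "closure (- cball (0::real^3) 1) \<subseteq> {y. iter_partial is (bump n) y = 0}"
    by (rule closure_minimal)
  moreover have "x \<in> closure (- cball 0 1)"
    using assms(2) by (simp add: closure_complement)
  ultimately show ?thesis by blast
qed

lemma frechet_derivative_partials:
  fixes f :: "real^3 \<Rightarrow> real"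
  assumes "f differentiable (at x)"
  shows "frechet_derivative f (at x) h = (\<Sum>i\<in>UNIV. h $ i * partial_deriv i f x)"
proof -
  interpret D: bounded_linear "frechet_derivative f (at x)"
    using has_derivative_frechet[OF assms] by (rule has_derivative_bounded_linear)
  have "h = (\<Sum>i\<in>UNIV. (h $ i) *\<^sub>R axis i 1)"
    by (simp add: vec_eq_iff axis_def if_distrib cong: if_cong)
  then have "frechet_derivative f (at x) h = frechet_derivative f (at x) (\<Sum>i\<in>UNIV. (h $ i) *\<^sub>R axis i 1)" by (rule arg_cong)
  also have "\<dots> = (\<Sum>i\<in>UNIV. (h $ i) *\<^sub>R frechet_derivative f (at x) (axis i 1))" by (simp only: D.sum D.scaleR)
  finally show ?thesis by (simp add: partial_deriv_def)
qed

text \<open>The exponent k + 2 leaves one continuous derivative beyond order k. Its bound B gives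
  the derivatives up to order k a Lipschitz constant 3 B, one B for each coordinate.\<close>

lemma bump_bounds:
  obtains B where "B \<ge> 0" "\<And>is x. length is \<le> Suc k \<Longrightarrow> \<bar>iter_partial is (bump (k + 2)) x\<bar> \<le> B"
    "\<And>is x y. length is \<le> k \<Longrightarrow> \<bar>iter_partial is (bump (k + 2)) x - iter_partial is (bump (k + 2)) y\<bar> \<le> 3 * B * dist x y"
proof -
  let ?F = "{is :: 3 list. length is \<le> Suc k}"
  have ck: "C_k_on (Suc k) UNIV (bump (k + 2))" by (rule bump_C_k_on) simp
  have fin: "finite ?F" using finite_lists_length_le[of "UNIV :: 3 set" "Suc k"] by simp
  have "\<exists>B. \<forall>x. \<bar>iter_partial is (bump (k + 2)) x\<bar> \<le> B" if "is \<in> ?F" for "is"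
  proof -
    have c: "continuous_on UNIV (iter_partial is (bump (k + 2)))" using ck that unfolding C_k_on_def by simp
    have sp: "iter_partial is (bump (k + 2)) x = 0" if "1 < norm x" for x
      using iter_partial_bump_support[of "is" "k + 2" x] \<open>is \<in> ?F\<close> that by simp
    obtain B where "\<And>x. norm (iter_partial is (bump (k + 2)) x) \<le> B"
      using compact_support_bounded[OF c sp] by blast
    then show ?thesis by auto
  qed
  then obtain C where C: "\<And>is x. is \<in> ?F \<Longrightarrow> \<bar>iter_partial is (bump (k + 2)) x\<bar> \<le> C is" by metis
  define B where "B = (\<Sum>is\<in>?F. \<bar>C is\<bar>)"
  have B: "\<bar>iter_partial is (bump (k + 2)) x\<bar> \<le> B" if "length is \<le> Suc k" for "is" x
  proof -
    have "\<bar>iter_partial is (bump (k + 2)) x\<bar> \<le> \<bar>C is\<bar>" using C[of "is" x] that by simp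
    also have "\<dots> \<le> B" unfolding B_def using that by (intro member_le_sum fin) auto
    finally show ?thesis .
  qed
  have B0: "B \<ge> 0" unfolding B_def by (intro sum_nonneg) auto
  have "\<bar>iter_partial is (bump (k + 2)) x - iter_partial is (bump (k + 2)) y\<bar> \<le> 3 * B * dist x y" if "length is \<le> k" for "is" x y
  proof -
    have d: "iter_partial is (bump (k + 2)) differentiable (at z)" for z using ck that unfolding C_k_on_def by simp
    have "norm (iter_partial is (bump (k + 2)) x - iter_partial is (bump (k + 2)) y) \<le> 3 * B * norm (x - y)"
    proof (rule differentiable_bound[of UNIV _ "\<lambda>z. frechet_derivative (iter_partial is (bump (k + 2))) (at z)"])
      show "(iter_partial is (bump (k + 2)) has_derivative frechet_derivative (iter_partial is (bump (k + 2))) (at z)) (at z within UNIV)" for z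
        using has_derivative_frechet[OF d] by simp
      show "onorm (frechet_derivative (iter_partial is (bump (k + 2))) (at z)) \<le> 3 * B" for z
      proof (rule onorm_le)
        fix h :: "real^3"
        have "norm (frechet_derivative (iter_partial is (bump (k + 2))) (at z) h) = \<bar>\<Sum>i\<in>UNIV. h $ i * iter_partial (i # is) (bump (k + 2)) z\<bar>"
          unfolding frechet_derivative_partials[OF d] by simp
        also have "\<dots> \<le> (\<Sum>i\<in>(UNIV::3 set). norm h * B)"
        proof (rule order_trans[OF sum_abs sum_mono])
          fix i :: 3
          show "\<bar>h $ i * iter_partial (i # is) (bump (k + 2)) z\<bar> \<le> norm h * B"
            unfolding abs_mult using that by (intro mult_mono component_le_norm_cart B) auto
        qed
        also have "\<dots> = 3 * B * norm h" by simp
        finally show "norm (frechet_derivative (iter_partial is (bump (k + 2))) (at z) h) \<le> 3 * B * norm h" .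
      qed
    qed auto
    then show ?thesis by (simp add: dist_norm)
  qed
  then show ?thesis using that B0 B by blast
qed

section \<open>The grid of cells and potentials made of disjoint bumps\<close>

definition cell_centre :: "nat \<times> nat \<times> nat \<Rightarrow> real^3" where
  "cell_centre c = (\<chi> i. if i = 1 then 2 * real (fst c) else if i = 2 then 2 * real (fst (snd c)) else 2 * real (snd (snd c)))"

lemma cell_centre_component:
  "cell_centre c $ 1 = 2 * real (fst c)" "cell_centre c $ 2 = 2 * real (fst (snd c))" "cell_centre c $ 3 = 2 * real (snd (snd c))"
  by (auto simp: cell_centre_def)

text \<open>The centres have even integer coordinates, so the unit balls carrying the bumps are
  pairwise disjoint.\<close>

lemma cell_centre_separated:
  assumes "c \<noteq> d"
  shows "2 \<le> norm (cell_centre c - cell_centre d)"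
proof -
  have "\<exists>i. 2 \<le> \<bar>(cell_centre c - cell_centre d) $ i\<bar>"
  proof (cases "fst c = fst d")
    case False
    then show ?thesis by (intro exI[of _ 1]) (auto simp: cell_centre_component)
  next
    case True
    show ?thesis
    proof (cases "fst (snd c) = fst (snd d)")
      case False
      then show ?thesis by (intro exI[of _ 2]) (auto simp: cell_centre_component)
    next
      case T: True
      then have "snd (snd c) \<noteq> snd (snd d)" using True assms by (auto simp: prod_eq_iff)
      then show ?thesis by (intro exI[of _ 3]) (auto simp: cell_centre_component)
    qed
  qed
  then obtain i where "2 \<le> \<bar>(cell_centre c - cell_centre d) $ i\<bar>" by blast
  from order_trans[OF this component_le_norm_cart] show ?thesis .
qed

lemma cell_unique:
  assumes "norm (x - cell_centre c) < 1" "norm (x - cell_centre d) < 1"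
  shows "c = d"
proof (rule ccontr)
  assume "c \<noteq> d"
  have "norm (cell_centre c - cell_centre d) \<le> norm (x - cell_centre c) + norm (x - cell_centre d)"
    using norm_triangle_ineq4[of "x - cell_centre d" "x - cell_centre c"] by simp
  then show False using assms cell_centre_separated[OF \<open>c \<noteq> d\<close>] by linarith
qed

text \<open>The set A codes one bit for each cell; a chosen cell carries a bump of height \<epsilon>
  and radius 1/l.\<close>

definition bump_sum :: "nat \<Rightarrow> real \<Rightarrow> real \<Rightarrow> (nat \<times> nat \<times> nat) set \<Rightarrow> real^3 \<Rightarrow> real" where
  "bump_sum n \<epsilon> l A x = (\<Sum>c\<in>A. \<epsilon> * bump n (l *\<^sub>R x - cell_centre c))"

lemma iter_partial_bump_sum:
  assumes "length is < n"
  shows "iter_partial is (bump_sum n \<epsilon> l A) = (\<lambda>x. \<Sum>c\<in>A. \<epsilon> * l ^ length is * iter_partial is (bump n) (l *\<^sub>R x - cell_centre c))"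
  using assms
proof (induction "is")
  case Nil
  show ?case by (simp add: bump_sum_def[abs_def])
next
  case (Cons i "is")
  have d: "iter_partial is (bump n) differentiable (at z)" for z
    using bump_C_k_on[of "Suc (length is)" n] Cons.prems unfolding C_k_on_def by simp
  let ?D = "\<lambda>z. frechet_derivative (iter_partial is (bump n)) (at z)"
  have "((\<lambda>x. \<Sum>c\<in>A. \<epsilon> * l ^ length is * iter_partial is (bump n) (l *\<^sub>R x - cell_centre c)) has_derivative
     (\<lambda>h. \<Sum>c\<in>A. \<epsilon> * l ^ length is * ?D (l *\<^sub>R x - cell_centre c) (l *\<^sub>R h))) (at x)" for x
  proof (intro has_derivative_sum has_derivative_mult_right)
    fix c
    have "((\<lambda>x. l *\<^sub>R x - cell_centre c) has_derivative (\<lambda>h. l *\<^sub>R h)) (at x)"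
      by (auto intro!: derivative_eq_intros)
    from has_derivative_compose[OF this has_derivative_frechet[OF d]]
    show "((\<lambda>x. iter_partial is (bump n) (l *\<^sub>R x - cell_centre c)) has_derivative (\<lambda>h. ?D (l *\<^sub>R x - cell_centre c) (l *\<^sub>R h))) (at x)" .
  qed
  from frechet_derivative_at[OF this]
  have fd: "frechet_derivative (\<lambda>x. \<Sum>c\<in>A. \<epsilon> * l ^ length is * iter_partial is (bump n) (l *\<^sub>R x - cell_centre c)) (at x)
    = (\<lambda>h. \<Sum>c\<in>A. \<epsilon> * l ^ length is * ?D (l *\<^sub>R x - cell_centre c) (l *\<^sub>R h))" for x by (rule sym)
  have lin: "?D z (l *\<^sub>R h) = l * ?D z h" for z h
    using linear_scale[OF bounded_linear.linear[OF has_derivative_bounded_linear[OF has_derivative_frechet[OF d]]]] by simp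
  have "iter_partial (i # is) (bump_sum n \<epsilon> l A) = partial_deriv i (\<lambda>x. \<Sum>c\<in>A. \<epsilon> * l ^ length is * iter_partial is (bump n) (l *\<^sub>R x - cell_centre c))"
    using Cons by simp
  also have "\<dots> = (\<lambda>x. \<Sum>c\<in>A. \<epsilon> * l ^ length (i # is) * iter_partial (i # is) (bump n) (l *\<^sub>R x - cell_centre c))"
    unfolding partial_deriv_def[abs_def] iter_partial.simps fd lin by (simp add: mult_ac)
  finally show ?case .
qed

lemma bump_sum_C_k_on:
  assumes "k < n" "finite A"
  shows "C_k_on k UNIV (bump_sum n \<epsilon> l A)"
  unfolding C_k_on_def
proof (intro conjI allI impI ballI)
  note ck = bump_C_k_on[OF assms(1)]
  have eq: "iter_partial is (bump_sum n \<epsilon> l A) = (\<lambda>x. \<Sum>c\<in>A. \<epsilon> * l ^ length is * iter_partial is (bump n) (l *\<^sub>R x - cell_centre c))"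
    if "length is \<le> k" for "is"
    by (rule iter_partial_bump_sum) (use that assms in simp)
  show "continuous_on UNIV (iter_partial is (bump_sum n \<epsilon> l A))" if "length is \<le> k" for "is"
  proof -
    have "continuous_on UNIV (iter_partial is (bump n))" using ck that unfolding C_k_on_def by simp
    then have "continuous_on UNIV (\<lambda>x. iter_partial is (bump n) (l *\<^sub>R x - cell_centre c))" for c
      by (rule continuous_on_compose2) (auto intro!: continuous_intros)
    then show ?thesis unfolding eq[OF that] by (intro continuous_on_sum continuous_on_mult continuous_on_const)
  qed
  show "iter_partial is (bump_sum n \<epsilon> l A) differentiable (at x)" if "length is < k" for "is" x
  proof -
    have d: "iter_partial is (bump n) differentiable (at z)" for z using ck that unfolding C_k_on_def by simp
    have "(\<lambda>x. iter_partial is (bump n) (l *\<^sub>R x - cell_centre c)) differentiable (at x)" for c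
    proof -
      have "((\<lambda>x. l *\<^sub>R x - cell_centre c) has_derivative (\<lambda>h. l *\<^sub>R h)) (at x)"
        by (auto intro!: derivative_eq_intros)
      from has_derivative_compose[OF this has_derivative_frechet[OF d]] show ?thesis unfolding differentiable_def by blast
    qed
    then show ?thesis unfolding eq[OF less_imp_le[OF that]]
      by (intro differentiable_sum differentiable_mult differentiable_const assms(2)) auto
  qed
qed

lemma sum_single_cell:
  fixes g :: "real^3 \<Rightarrow> real"
  assumes fin: "finite A" and g: "\<And>y. 1 \<le> norm y \<Longrightarrow> g y = 0" "\<And>y. \<bar>g y\<bar> \<le> B"
  shows "\<bar>\<Sum>c\<in>A. g (y - cell_centre c)\<bar> \<le> B"
proof (cases "\<exists>c\<in>A. norm (y - cell_centre c) < 1")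
  case True
  then obtain c where c: "c \<in> A" "norm (y - cell_centre c) < 1" by blast
  have "(\<Sum>c\<in>A. g (y - cell_centre c)) = (\<Sum>d\<in>{c}. g (y - cell_centre d))"
  proof (rule sum.mono_neutral_right[OF fin])
    show "\<forall>d\<in>A - {c}. g (y - cell_centre d) = 0"
    proof
      fix d assume "d \<in> A - {c}"
      then have "\<not> norm (y - cell_centre d) < 1" using cell_unique[OF c(2), of d] by auto
      then show "g (y - cell_centre d) = 0" by (intro g(1)) simp
    qed
  qed (use c in auto)
  then show ?thesis using g(2) by simp
next
  case False
  then have "\<forall>c\<in>A. g (y - cell_centre c) = 0" by (auto simp: not_less intro!: g(1))
  then have "(\<Sum>c\<in>A. g (y - cell_centre c)) = 0" by (rule sum.neutral)
  then show ?thesis using order_trans[OF abs_ge_zero g(2)] by simp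
qed

text \<open>At most one cell is felt at x and at most one at y, so at most two terms survive and the
  bound does not depend on the number of cells.\<close>

lemma sum_cells_difference:
  fixes g :: "real^3 \<Rightarrow> real"
  assumes fin: "finite A" and g: "\<And>y. 1 \<le> norm y \<Longrightarrow> g y = 0"
    and D: "\<And>c. \<bar>g (x - cell_centre c) - g (y - cell_centre c)\<bar> \<le> D"
  shows "\<bar>(\<Sum>c\<in>A. g (x - cell_centre c)) - (\<Sum>c\<in>A. g (y - cell_centre c))\<bar> \<le> 2 * D"
proof -
  have D0: "D \<ge> 0" using order_trans[OF abs_ge_zero D] .
  let ?S = "{c \<in> A. norm (x - cell_centre c) < 1} \<union> {c \<in> A. norm (y - cell_centre c) < 1}"
  have card1: "card {c \<in> A. norm (z - cell_centre c) < 1} \<le> 1" for z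
  proof -
    have "c = d" if "c \<in> {c \<in> A. norm (z - cell_centre c) < 1}" "d \<in> {c \<in> A. norm (z - cell_centre c) < 1}" for c d
      using cell_unique[of z c d] that by simp
    then show ?thesis using card_le_Suc0_iff_eq[of "{c \<in> A. norm (z - cell_centre c) < 1}"] fin by auto
  qed
  have "(\<Sum>c\<in>A. g (x - cell_centre c)) - (\<Sum>c\<in>A. g (y - cell_centre c)) = (\<Sum>c\<in>A. g (x - cell_centre c) - g (y - cell_centre c))"
    by (rule sum_subtractf[symmetric])
  also have "\<dots> = (\<Sum>c\<in>?S. g (x - cell_centre c) - g (y - cell_centre c))"
    by (rule sum.mono_neutral_right[OF fin]) (use g in \<open>auto simp: not_less\<close>)
  also have "\<bar>\<dots>\<bar> \<le> (\<Sum>c\<in>?S. D)" by (rule order_trans[OF sum_abs sum_mono[OF D]])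
  also have "\<dots> = real (card ?S) * D" by simp
  also have "\<dots> \<le> 2 * D"
    using card_Un_le[of "{c \<in> A. norm (x - cell_centre c) < 1}" "{c \<in> A. norm (y - cell_centre c) < 1}"] card1[of x] card1[of y] D0
    by (intro mult_right_mono) auto
  finally show ?thesis .
qed

text \<open>Interpolation between boundedness and Lipschitz continuity, the source of the Hoelder
  estimate for the bumps.\<close>

lemma min_le_powr:
  fixes t \<gamma> :: real
  assumes "0 \<le> t" "0 < \<gamma>" "\<gamma> \<le> 1"
  shows "min 1 t \<le> t powr \<gamma>"
proof (cases "t \<le> 1")
  case True
  show ?thesis
  proof (cases "t = 0")
    case False
    have "t powr 1 \<le> t powr \<gamma>" using powr_mono'[of \<gamma> 1 t] True assms by simp
    then show ?thesis using True assms by simp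
  qed simp
next
  case False
  then have "1 \<le> t powr \<gamma>" using assms by (intro ge_one_powr_ge_zero) auto
  then show ?thesis using False by simp
qed

text \<open>Each derivative costs a factor l, and the Hoelder quotient of order \<gamma> costs
  l^\<gamma>; together at most l^m. The constant depends neither on A nor on S because the bumps
  have disjoint supports.\<close>

lemma bump_sum_C_m_norm:
  assumes m: "m > 0"
  obtains B where "B > 0"
    "\<And>\<epsilon> l A. finite A \<Longrightarrow> \<epsilon> \<ge> 0 \<Longrightarrow> l \<ge> 1 \<Longrightarrow>
      C_m_norm m S (bump_sum (nat \<lfloor>m\<rfloor> + 2) \<epsilon> l A) \<le> ennreal (B * (\<epsilon> * l powr m))"
proof -
  define k where "k = nat \<lfloor>m\<rfloor>"
  define \<gamma> where "\<gamma> = frac m"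
  have mk: "m = real k + \<gamma>" unfolding k_def \<gamma>_def frac_def using m by simp
  have \<gamma>: "0 \<le> \<gamma>" "\<gamma> < 1" unfolding \<gamma>_def by (auto simp: frac_lt_1)
  let ?b = "bump (k + 2)"
  obtain B where B: "B \<ge> 0" "\<And>is x. length is \<le> Suc k \<Longrightarrow> \<bar>iter_partial is ?b x\<bar> \<le> B"
    "\<And>is x y. length is \<le> k \<Longrightarrow> \<bar>iter_partial is ?b x - iter_partial is ?b y\<bar> \<le> 3 * B * dist x y"
    using bump_bounds[of k] by blast
  \<comment> \<open>7 = 1 + 6: one B for the supremum of the derivatives and 6 B for the Hoelder
    part, namely 3 B for one bump, doubled by the two cells involved. The added 1 makes the constant
    positive.\<close>
  show ?thesis
  proof (rule that[of "7 * B + 1"])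
    show "7 * B + 1 > 0" using B by simp
    fix \<epsilon> l :: real and A :: "(nat \<times> nat \<times> nat) set"
    assume A: "finite A" and e: "\<epsilon> \<ge> 0" and l: "l \<ge> 1"
    let ?w = "bump_sum (k + 2) \<epsilon> l A"
    let ?X = "\<epsilon> * l powr m"
    have X0: "?X \<ge> 0" using e by simp
    have ip: "iter_partial is ?w x = \<epsilon> * l ^ length is * (\<Sum>c\<in>A. iter_partial is ?b (l *\<^sub>R x - cell_centre c))" if "length is \<le> k" for "is" x
      using that by (subst iter_partial_bump_sum) (auto simp: sum_distrib_left)
    have sup: "\<bar>iter_partial is ?w x\<bar> \<le> B * ?X" if "length is \<le> k" for "is" x
    proof -
      have "\<bar>iter_partial is ?w x\<bar> = \<epsilon> * l ^ length is * \<bar>\<Sum>c\<in>A. iter_partial is ?b (l *\<^sub>R x - cell_centre c)\<bar>"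
        unfolding ip[OF that] abs_mult using e l by simp
      also have "\<dots> \<le> \<epsilon> * l powr m * B"
      proof (intro mult_mono sum_single_cell A)
        show "l ^ length is \<le> l powr m"
          using that l mk \<gamma> by (subst powr_realpow[symmetric]) (auto intro!: powr_mono)
        show "iter_partial is ?b y = 0" if "1 \<le> norm y" for y
          using iter_partial_bump_support[of "is" "k + 2" y] that \<open>length is \<le> k\<close> by simp
      qed (use e l B that in auto)
      finally show ?thesis by (simp add: mult_ac)
    qed
    have hoelder: "\<bar>iter_partial is ?w x - iter_partial is ?w y\<bar> / dist x y powr \<gamma> \<le> 6 * B * ?X"
      if "length is = k" "x \<noteq> y" "\<gamma> > 0" for "is" x y
    proof -
      let ?g = "iter_partial is ?b"
      define t where "t = l * dist x y"
      have t: "t > 0" unfolding t_def using l that by simp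
      have D: "\<bar>?g (l *\<^sub>R x - cell_centre c) - ?g (l *\<^sub>R y - cell_centre c)\<bar> \<le> 3 * B * t powr \<gamma>" for c
      proof -
        have "\<bar>?g (l *\<^sub>R x - cell_centre c) - ?g (l *\<^sub>R y - cell_centre c)\<bar> \<le> 3 * B * dist (l *\<^sub>R x - cell_centre c) (l *\<^sub>R y - cell_centre c)"
          using that by (intro B) auto
        also have "dist (l *\<^sub>R x - cell_centre c) (l *\<^sub>R y - cell_centre c) = t"
          unfolding t_def dist_norm using l by (simp flip: scaleR_diff_right)
        finally have 1: "\<bar>?g (l *\<^sub>R x - cell_centre c) - ?g (l *\<^sub>R y - cell_centre c)\<bar> \<le> 3 * B * t" .
        have "\<bar>?g (l *\<^sub>R x - cell_centre c) - ?g (l *\<^sub>R y - cell_centre c)\<bar> \<le> B + B"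
          using that by (intro order_trans[OF abs_triangle_ineq4] add_mono B) auto
        then have 2: "\<bar>?g (l *\<^sub>R x - cell_centre c) - ?g (l *\<^sub>R y - cell_centre c)\<bar> \<le> 3 * B * 1" using B(1) by linarith
        have "\<bar>?g (l *\<^sub>R x - cell_centre c) - ?g (l *\<^sub>R y - cell_centre c)\<bar> \<le> 3 * B * min 1 t"
          using 1 2 by (simp add: min_def)
        also have "\<dots> \<le> 3 * B * t powr \<gamma>"
          using B(1) t \<gamma> that by (intro mult_left_mono min_le_powr) auto
        finally show ?thesis .
      qed
      have "\<bar>iter_partial is ?w x - iter_partial is ?w y\<bar> = \<epsilon> * l ^ k *
         \<bar>(\<Sum>c\<in>A. ?g (l *\<^sub>R x - cell_centre c)) - (\<Sum>c\<in>A. ?g (l *\<^sub>R y - cell_centre c))\<bar>"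
      proof -
        have "iter_partial is ?w x - iter_partial is ?w y = \<epsilon> * l ^ k *
          ((\<Sum>c\<in>A. ?g (l *\<^sub>R x - cell_centre c)) - (\<Sum>c\<in>A. ?g (l *\<^sub>R y - cell_centre c)))"
          using ip[of "is" x] ip[of "is" y] that by (simp only: right_diff_distrib order_refl)
        then show ?thesis using e l by (simp add: abs_mult)
      qed
      also have "\<dots> \<le> \<epsilon> * l ^ k * (2 * (3 * B * t powr \<gamma>))"
      proof (intro mult_left_mono sum_cells_difference A D)
        show "?g y = 0" if "1 \<le> norm y" for y
          using iter_partial_bump_support[of "is" "k + 2" y] that \<open>length is = k\<close> by simp
      qed (use e l in auto)
      also have "t powr \<gamma> = l powr \<gamma> * dist x y powr \<gamma>" unfolding t_def using l by (simp add: powr_mult)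
      also have "\<epsilon> * l ^ k * (2 * (3 * B * (l powr \<gamma> * dist x y powr \<gamma>))) = 6 * B * (\<epsilon> * (l powr real k * l powr \<gamma>)) * dist x y powr \<gamma>"
        using l by (simp add: powr_realpow mult_ac)
      also have "l powr real k * l powr \<gamma> = l powr m" unfolding mk by (simp add: powr_add)
      finally show ?thesis using that by (simp add: pos_divide_le_eq)
    qed
    have "C_m_norm m S ?w \<le> ennreal (B * ?X) + ennreal (6 * B * ?X)"
      unfolding C_m_norm_def k_def[symmetric] \<gamma>_def[symmetric]
    proof (rule add_mono)
      show "(SUP is\<in>{is. length is \<le> k}. SUP x\<in>S. ennreal \<bar>iter_partial is ?w x\<bar>) \<le> ennreal (B * ?X)"
        by (intro SUP_least ennreal_leI sup) simp
      show "(if \<gamma> = 0 then 0 else SUP is\<in>{is. length is = k}. SUP (x, y)\<in>{(x, y). x \<in> S \<and> y \<in> S \<and> x \<noteq> y}.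
             ennreal (\<bar>iter_partial is ?w x - iter_partial is ?w y\<bar> / dist x y powr \<gamma>)) \<le> ennreal (6 * B * ?X)"
      proof (cases "\<gamma> = 0")
        case False
        have "(case p of (x, y) \<Rightarrow> ennreal (\<bar>iter_partial is ?w x - iter_partial is ?w y\<bar> / dist x y powr \<gamma>)) \<le> ennreal (6 * B * ?X)"
          if "is \<in> {is. length is = k}" "p \<in> {(x, y). x \<in> S \<and> y \<in> S \<and> x \<noteq> y}" for "is" p
        proof -
          obtain x y where p: "p = (x, y)" by (cases p)
          show ?thesis unfolding p prod.case
            by (intro ennreal_leI hoelder) (use that False \<gamma>(1) p in auto)
        qed
        then show ?thesis using False by (simp only: if_False) (intro SUP_least, simp)
      qed simp
    qed
    also have "\<dots> = ennreal (7 * B * ?X)"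
      using B(1) X0 by (subst ennreal_plus[symmetric]) (auto simp: algebra_simps)
    also have "\<dots> \<le> ennreal ((7 * B + 1) * ?X)" using X0 by (intro ennreal_leI mult_right_mono) auto
    finally show "C_m_norm m S (bump_sum (nat \<lfloor>m\<rfloor> + 2) \<epsilon> l A) \<le> ennreal ((7 * B + 1) * (\<epsilon> * l powr m))"
      unfolding k_def .
  qed
qed

lemma bump_values: "0 \<le> bump n x" "bump n x \<le> 1" "n \<ge> 1 \<Longrightarrow> 1 \<le> norm x \<Longrightarrow> bump n x = 0" "bump n 0 = 1"
proof -
  show "0 \<le> bump n x" unfolding bump_def by simp
  show "bump n x \<le> 1" unfolding bump_def by (rule power_le_one) simp_all
  show "bump n 0 = 1" unfolding bump_def by simp
  assume "n \<ge> 1" "1 \<le> norm x"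
  have "1 \<le> x \<bullet> x" unfolding power2_norm_eq_inner[symmetric] using \<open>1 \<le> norm x\<close> by (rule one_le_power)
  then have "max 0 (1 - x \<bullet> x) = 0" by simp
  then show "bump n x = 0" unfolding bump_def using \<open>n \<ge> 1\<close> by simp
qed

lemma bump_sum_le:
  assumes "finite A" "\<epsilon> \<ge> 0" "n \<ge> 1"
  shows "\<bar>bump_sum n \<epsilon> l A x\<bar> \<le> \<epsilon>"
proof -
  have "\<bar>\<Sum>c\<in>A. bump n (l *\<^sub>R x - cell_centre c)\<bar> \<le> 1"
    by (rule sum_single_cell) (use assms bump_values in auto)
  then have "\<epsilon> * \<bar>\<Sum>c\<in>A. bump n (l *\<^sub>R x - cell_centre c)\<bar> \<le> \<epsilon> * 1" using assms by (intro mult_left_mono)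
  moreover have "\<bar>bump_sum n \<epsilon> l A x\<bar> = \<epsilon> * \<bar>\<Sum>c\<in>A. bump n (l *\<^sub>R x - cell_centre c)\<bar>"
    unfolding bump_sum_def sum_distrib_left[symmetric] abs_mult using assms(2) by simp
  ultimately show ?thesis by simp
qed

lemma bump_sum_at_centre:
  assumes "finite A" "n \<ge> 1" "l > 0"
  shows "bump_sum n \<epsilon> l A ((1 / l) *\<^sub>R cell_centre c) = (if c \<in> A then \<epsilon> else 0)"
proof -
  have "bump n (cell_centre c - cell_centre d) = (if d = c then 1 else 0)" for d
  proof (cases "d = c")
    case False
    then have "1 \<le> norm (cell_centre c - cell_centre d)" using cell_centre_separated[of c d] by simp
    with False show ?thesis using bump_values(3)[OF assms(2)] by simp
  qed (simp add: bump_values(4))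
  then have "bump_sum n \<epsilon> l A ((1 / l) *\<^sub>R cell_centre c) = (\<Sum>d\<in>A. if d = c then \<epsilon> else 0)"
    unfolding bump_sum_def using assms(3) by (intro sum.cong refl) simp
  then show ?thesis using assms(1) by simp
qed

lemma cell_centre_norm:
  assumes "c \<in> {..<M} \<times> {..<M} \<times> {..<M}"
  shows "norm (cell_centre c) \<le> 6 * real M"
proof -
  have "norm (cell_centre c) \<le> (\<Sum>i\<in>UNIV. \<bar>cell_centre c $ i\<bar>)" by (rule norm_le_l1_cart)
  also have "\<dots> = 2 * real (fst c) + 2 * real (fst (snd c)) + 2 * real (snd (snd c))"
    by (simp add: sum_3 cell_centre_component)
  also have "\<dots> \<le> 6 * real M"
  proof -
    have "fst c < M" "fst (snd c) < M" "snd (snd c) < M" using assms by auto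
    then have "real (fst c) \<le> real M" "real (fst (snd c)) \<le> real M" "real (snd (snd c)) \<le> real M" by simp_all
    then show ?thesis by linarith
  qed
  finally show ?thesis .
qed

text \<open>With l = 16 M the centres lie within 6/16 of the origin and the bumps have radius at
  most 1/16, so everything stays inside radius 7/16 < 1/2.\<close>

lemma bump_sum_supp:
  assumes A: "A \<subseteq> {..<M} \<times> {..<M} \<times> {..<M}" and M: "M \<ge> 1" and n: "n \<ge> 1" and x: "7/16 \<le> norm x"
  shows "bump_sum n \<epsilon> (16 * real M) A x = 0"
  unfolding bump_sum_def
proof (intro sum.neutral ballI)
  fix c assume "c \<in> A"
  have "7 * real M \<le> norm ((16 * real M) *\<^sub>R x)" using x M by simp
  moreover have "norm (cell_centre c) \<le> 6 * real M" using \<open>c \<in> A\<close> A by (intro cell_centre_norm) auto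
  ultimately have "1 \<le> norm ((16 * real M) *\<^sub>R x - cell_centre c)"
    using norm_triangle_ineq2[of "(16 * real M) *\<^sub>R x" "cell_centre c"] M by linarith
  then show "\<epsilon> * bump n ((16 * real M) *\<^sub>R x - cell_centre c) = 0" using bump_values(3) n by simp
qed

section \<open>Adding functions that are smooth on an open set\<close>

lemma iter_partial_add:
  assumes "open D" "C_k_on k D f" "C_k_on k D g" "length is \<le> k" "x \<in> D"
  shows "iter_partial is (\<lambda>x. f x + g x) x = iter_partial is f x + iter_partial is g x"
  using assms(4,5)
proof (induction "is" arbitrary: x)
  case (Cons i "is")
  have d: "iter_partial is f differentiable (at x)" "iter_partial is g differentiable (at x)"
    using assms(2,3) Cons.prems unfolding C_k_on_def by auto
  have "frechet_derivative (iter_partial is (\<lambda>x. f x + g x)) (at x) = frechet_derivative (\<lambda>x. iter_partial is f x + iter_partial is g x) (at x)"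
    by (rule frechet_derivative_cong_open[OF assms(1) Cons.prems(2)]) (use Cons in auto)
  also have "\<dots> = (\<lambda>h. frechet_derivative (iter_partial is f) (at x) h + frechet_derivative (iter_partial is g) (at x) h)"
    by (rule frechet_derivative_at[symmetric]) (intro has_derivative_add has_derivative_frechet d)
  finally show ?case by (simp add: partial_deriv_def)
qed simp

text \<open>A version relative to D, since the given potential is known to be smooth on the ball
  only. Derivatives at points of an open set depend on the values there alone.\<close>

lemma C_k_on_add_open:
  assumes D: "open D" and f: "C_k_on k D f" and g: "C_k_on k D g"
  shows "C_k_on k D (\<lambda>x. f x + g x)"
  unfolding C_k_on_def
proof (intro conjI allI impI ballI)
  show "iter_partial is (\<lambda>x. f x + g x) differentiable (at x)" if "length is < k" "x \<in> D" for "is" x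
  proof -
    have "iter_partial is f differentiable (at x)" "iter_partial is g differentiable (at x)"
      using f g that unfolding C_k_on_def by auto
    then obtain F where "((\<lambda>x. iter_partial is f x + iter_partial is g x) has_derivative F) (at x)"
      using differentiable_add unfolding differentiable_def by blast
    then have "(iter_partial is (\<lambda>x. f x + g x) has_derivative F) (at x)"
      by (rule has_derivative_transform_within_open[OF _ D that(2)]) (use iter_partial_add[OF D f g] that in auto)
    then show ?thesis unfolding differentiable_def by blast
  qed
  show "continuous_on D (iter_partial is (\<lambda>x. f x + g x))" if "length is \<le> k" for "is"
  proof -
    have "continuous_on D (\<lambda>x. iter_partial is f x + iter_partial is g x)"
      using f g that unfolding C_k_on_def by (intro continuous_intros) auto
    then show ?thesis by (rule continuous_on_eq) (use iter_partial_add[OF D f g] that in auto)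
  qed
qed

lemma C_m_norm_add:
  assumes D: "open D" and f: "C_k_on (nat \<lfloor>m\<rfloor>) D f" and g: "C_k_on (nat \<lfloor>m\<rfloor>) D g"
  shows "C_m_norm m D (\<lambda>x. f x + g x) \<le> C_m_norm m D f + C_m_norm m D g"
proof -
  define k where "k = nat \<lfloor>m\<rfloor>"
  note ip = iter_partial_add[OF D f g, folded k_def]
  define S where "S h = (SUP is\<in>{is. length is \<le> k}. SUP x\<in>D. ennreal \<bar>iter_partial is h x\<bar>)" for h :: "real^3 \<Rightarrow> real"
  define P where "P = {(x, y). x \<in> D \<and> y \<in> D \<and> x \<noteq> y}"
  define q where "q is h p = ennreal (\<bar>iter_partial is h (fst p) - iter_partial is h (snd p)\<bar> / dist (fst p) (snd p) powr frac m)" for "is" and h :: "real^3 \<Rightarrow> real" and p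
  define T where "T h = (SUP is\<in>{is. length is = k}. SUP p\<in>P. q is h p)" for h
  have C: "C_m_norm m D h = S h + (if frac m = 0 then 0 else T h)" for h
    unfolding C_m_norm_def S_def T_def P_def q_def k_def by (simp add: case_prod_beta')
  have "S (\<lambda>x. f x + g x) \<le> S f + S g"
    unfolding S_def
  proof (intro SUP_least)
    fix "is" x assume i: "is \<in> {is :: 3 list. length is \<le> k}" and x: "x \<in> D"
    have "ennreal \<bar>iter_partial is (\<lambda>x. f x + g x) x\<bar> \<le> ennreal \<bar>iter_partial is f x\<bar> + ennreal \<bar>iter_partial is g x\<bar>"
      using i x by (subst ip) (auto simp flip: ennreal_plus intro!: ennreal_leI abs_triangle_ineq)
    also have "\<dots> \<le> (SUP is\<in>{is. length is \<le> k}. SUP x\<in>D. ennreal \<bar>iter_partial is f x\<bar>) + (SUP is\<in>{is. length is \<le> k}. SUP x\<in>D. ennreal \<bar>iter_partial is g x\<bar>)"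
      using i x by (intro add_mono SUP_upper2[of "is"] SUP_upper) auto
    finally show "ennreal \<bar>iter_partial is (\<lambda>x. f x + g x) x\<bar> \<le> \<dots>" .
  qed
  moreover have "T (\<lambda>x. f x + g x) \<le> T f + T g"
    unfolding T_def
  proof (intro SUP_least)
    fix "is" p assume i: "is \<in> {is :: 3 list. length is = k}" and p: "p \<in> P"
    have "q is (\<lambda>x. f x + g x) p \<le> q is f p + q is g p"
    proof -
      have pd: "fst p \<in> D" "snd p \<in> D" using p unfolding P_def by auto
      have "\<bar>iter_partial is (\<lambda>x. f x + g x) (fst p) - iter_partial is (\<lambda>x. f x + g x) (snd p)\<bar>
        \<le> \<bar>iter_partial is f (fst p) - iter_partial is f (snd p)\<bar> + \<bar>iter_partial is g (fst p) - iter_partial is g (snd p)\<bar>"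
        using i pd by (simp add: ip)
      then have "\<bar>iter_partial is (\<lambda>x. f x + g x) (fst p) - iter_partial is (\<lambda>x. f x + g x) (snd p)\<bar> / dist (fst p) (snd p) powr frac m
        \<le> \<bar>iter_partial is f (fst p) - iter_partial is f (snd p)\<bar> / dist (fst p) (snd p) powr frac m + \<bar>iter_partial is g (fst p) - iter_partial is g (snd p)\<bar> / dist (fst p) (snd p) powr frac m"
        unfolding add_divide_distrib[symmetric] by (rule divide_right_mono) simp
      then show ?thesis unfolding q_def by (simp flip: ennreal_plus add: ennreal_leI)
    qed
    also have "\<dots> \<le> (SUP is\<in>{is. length is = k}. SUP p\<in>P. q is f p) + (SUP is\<in>{is. length is = k}. SUP p\<in>P. q is g p)"
      using i p by (intro add_mono SUP_upper2[of "is"] SUP_upper) auto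
    finally show "q is (\<lambda>x. f x + g x) p \<le> \<dots>" .
  qed
  ultimately have "S (\<lambda>x. f x + g x) + T (\<lambda>x. f x + g x) \<le> (S f + S g) + (T f + T g)" by (rule add_mono)
  then have "S (\<lambda>x. f x + g x) + T (\<lambda>x. f x + g x) \<le> (S f + T f) + (S g + T g)" by (simp only: ac_simps)
  with \<open>S (\<lambda>x. f x + g x) \<le> S f + S g\<close> show ?thesis unfolding C by (cases "frac m = 0") simp_all
qed

text \<open>The bound holds almost everywhere, and by continuity it holds on a closed set; a closed
  set that contains almost every point of an open set contains all of it.\<close>

lemma continuous_le_Linf_norm:
  assumes f: "continuous_on UNIV f" and x: "x \<in> ball 0 1"
  shows "ereal \<bar>f x\<bar> \<le> Linf_norm (ball 0 1) f"
proof -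
  have "AE x in lebesgue_on (ball 0 1). ereal \<bar>f x\<bar> \<le> Linf_norm (ball 0 1) f"
    unfolding Linf_norm_def by (rule esssup_AE)
  then have "AE x\<in>ball 0 1 in lebesgue. x \<in> {x. ereal \<bar>f x\<bar> \<le> Linf_norm (ball 0 1) f}"
    by (subst (asm) AE_restrict_space_iff) auto
  moreover have "closed {x. ereal \<bar>f x\<bar> \<le> Linf_norm (ball 0 1) f}"
    by (intro closed_Collect_le continuous_intros f)
  ultimately have "x \<in> {x. ereal \<bar>f x\<bar> \<le> Linf_norm (ball 0 1) f}"
    using mem_closed_if_AE_lebesgue_open[of "ball 0 1" "{x. ereal \<bar>f x\<bar> \<le> Linf_norm (ball 0 1) f}" x] x by auto
  then show ?thesis by simp
qed

lemma Linf_norm_le: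
  assumes f: "continuous_on UNIV f" and b: "\<And>x. \<bar>f x\<bar> \<le> c"
  shows "Linf_norm (ball 0 1) f \<le> ereal c"
  unfolding Linf_norm_def
proof (rule esssup_I)
  have "(\<lambda>x. ereal \<bar>f x\<bar>) \<in> borel_measurable lborel"
    using f by (intro borel_measurable_ereal) (auto intro!: borel_measurable_continuous_onI continuous_intros)
  then show "(\<lambda>x. ereal \<bar>f x\<bar>) \<in> borel_measurable (lebesgue_on (ball 0 1))"
    by (intro measurable_restrict_space1 measurable_completion)
qed (use b in auto)

section \<open>The weighted norm\<close>

text \<open>A single term of the exponential series. It takes the place of Stirling's formula when
  the factorial meets the weight.\<close>

lemma power_div_fact_le_exp:
  fixes x :: real
  assumes "x \<ge> 0"
  shows "x ^ n / fact n \<le> exp x"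
proof -
  have "(\<lambda>n. x ^ n /\<^sub>R fact n) sums exp x" by (rule exp_converges)
  then have s: "(\<lambda>n. x ^ n / fact n) sums exp x" by (simp add: divide_inverse mult.commute)
  have "sum (\<lambda>n. x ^ n / fact n) {n} \<le> (\<Sum>n. x ^ n / fact n)"
    by (rule sum_le_suminf[OF sums_summable[OF s]]) (use assms in auto)
  then show ?thesis using sums_unique[OF s] by simp
qed

text \<open>Any power of the degree is absorbed by worsening the ratio from 5/7 to 6/7.\<close>

lemma powr_times_geometric_bounded:
  fixes p :: real
  obtains K where "K > 0" "\<And>j. real (2 * j + 1) powr p * (5/7) ^ j \<le> K * (6/7) ^ j"
proof -
  define P where "P = nat \<lceil>\<bar>p\<bar>\<rceil>"
  \<comment> \<open>Chosen so that exp(d (2j + 1)) is exp(d) times (6/5)^j, and (6/5)(5/7) =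
    6/7.\<close>
  define d :: real where "d = ln (6/5) / 2"
  have d: "d > 0" unfolding d_def by simp
  define K where "K = fact P / d ^ P * exp d"
  have "real (2 * j + 1) powr p * (5/7) ^ j \<le> K * (6/7) ^ j" for j
  proof -
    define y where "y = real (2 * j + 1)"
    have y: "y \<ge> 1" unfolding y_def by simp
    have "p \<le> real P" unfolding P_def by linarith
    then have "y powr p \<le> y powr real P" using y by (intro powr_mono) auto
    also have "\<dots> = y ^ P" using y by (simp add: powr_realpow)
    also have "\<dots> \<le> fact P / d ^ P * exp (d * y)"
    proof -
      have "(d * y) ^ P / fact P \<le> exp (d * y)" using d y by (intro power_div_fact_le_exp) auto
      then show ?thesis using d by (simp add: power_mult_distrib field_simps)
    qed
    also have "exp (d * y) = exp d * (6/5) ^ j"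
    proof -
      have "d * y = d + real j * ln (6/5)" unfolding y_def d_def by (simp add: algebra_simps)
      then have "exp (d * y) = exp d * exp (real j * ln (6/5))" by (simp only: exp_add)
      also have "exp (real j * ln (6/5)) = (6/5 :: real) ^ j" by (simp add: exp_of_nat_mult)
      finally show ?thesis .
    qed
    finally have "y powr p * (5/7) ^ j \<le> (fact P / d ^ P * (exp d * (6/5) ^ j)) * (5/7) ^ j"
      by (intro mult_right_mono) auto
    also have "\<dots> = K * ((6/5) ^ j * (5/7) ^ j)" unfolding K_def by (simp only: mult_ac)
    also have "(6/5) ^ j * (5/7) ^ j = (6/7 :: real) ^ j" unfolding power_mult_distrib[symmetric] by simp
    finally show ?thesis unfolding y_def .
  qed
  moreover have "K > 0" unfolding K_def using d by simp
  ultimately show ?thesis using that by blast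
qed

text \<open>Here the factorial decay beats the weight. With y = 2j + 1 the weight and the moment
  combine to (y/2)^j / j! times ((c+\<rho>)/(2 e s))^j. The first factor is at most exp(y/2), that
  is exp(1/2) e^j, so the ratio is (c+\<rho>)/(2s), which lies near 1/2 for small \<rho>. The extra
  factor 2j + 1 provides for the number of harmonics of degree j.\<close>

lemma weighted_moment_bound:
  fixes s\<^sub>1 s\<^sub>2 \<sigma> \<rho> :: real
  assumes s: "0 < s\<^sub>1" "s\<^sub>1 \<le> s\<^sub>2" and \<rho>: "0 < \<rho>" "\<rho> \<le> s\<^sub>1 / 4"
  obtains K where "K > 0" "\<And>c s j. c \<in> {s\<^sub>1..s\<^sub>2} \<Longrightarrow> s \<in> {s\<^sub>1..s\<^sub>2} \<Longrightarrow> \<bar>s - c\<bar> \<le> \<rho> / 2 \<Longrightarrow>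
    real (2 * j + 1) * ((real (2 * j + 1) / (exp 1 * s)) powr (real j + \<sigma>) * moment_bound ((c + \<rho>) / 2) j) \<le> K * (6/7) ^ j"
proof -
  obtain K0 where K0: "K0 > 0" "\<And>j. real (2 * j + 1) powr (\<bar>\<sigma>\<bar> + 1) * (5/7) ^ j \<le> K0 * (6/7) ^ j"
    using powr_times_geometric_bounded by blast
  define C1 where "C1 = exp (\<bar>\<sigma>\<bar> * (1 + \<bar>ln s\<^sub>1\<bar> + \<bar>ln s\<^sub>2\<bar>))"
  define C2 where "C2 = 2 * exp (1/2) * exp ((s\<^sub>2 + \<rho>) / 2)"
  have C: "C1 > 0" "C2 > 0" unfolding C1_def C2_def by auto
  show ?thesis
  proof (rule that[of "C1 * C2 * K0"])
    show "C1 * C2 * K0 > 0" using C K0 by simp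
    fix c s :: real and j :: nat
    assume c: "c \<in> {s\<^sub>1..s\<^sub>2}" and ss: "s \<in> {s\<^sub>1..s\<^sub>2}" and sc: "\<bar>s - c\<bar> \<le> \<rho> / 2"
    have s0: "s > 0" "c > 0" using ss c s by auto
    define y where "y = real (2 * j + 1)"
    have y: "y \<ge> 1" unfolding y_def by simp
    have w1: "(y / (exp 1 * s)) powr (real j + \<sigma>) = (y / (exp 1 * s)) ^ j * (y / (exp 1 * s)) powr \<sigma>"
      using y s0 by (simp add: powr_add powr_realpow)
    have w2: "(y / (exp 1 * s)) powr \<sigma> \<le> y powr \<bar>\<sigma>\<bar> * C1"
    proof -
      have "(y / (exp 1 * s)) powr \<sigma> = y powr \<sigma> * (exp 1 * s) powr (- \<sigma>)"
      proof -
        have "(y / (exp 1 * s)) powr \<sigma> = y powr \<sigma> / (exp 1 * s) powr \<sigma>" by (rule powr_divide)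
        then show ?thesis by (simp only: powr_minus divide_inverse)
      qed
      also have "\<dots> \<le> y powr \<bar>\<sigma>\<bar> * C1"
      proof (intro mult_mono)
        show "y powr \<sigma> \<le> y powr \<bar>\<sigma>\<bar>" using y by (intro powr_mono) auto
        have "ln (exp 1 * s) = 1 + ln s" using s0 by (simp add: ln_mult)
        then have "(exp 1 * s) powr (- \<sigma>) = exp (- \<sigma> * (1 + ln s))" using s0 by (simp add: powr_def)
        also have "\<dots> \<le> exp (\<bar>\<sigma>\<bar> * (1 + \<bar>ln s\<^sub>1\<bar> + \<bar>ln s\<^sub>2\<bar>))"
        proof -
          have "ln s\<^sub>1 \<le> ln s" "ln s \<le> ln s\<^sub>2" using ss s by auto
          then have "\<bar>1 + ln s\<bar> \<le> 1 + \<bar>ln s\<^sub>1\<bar> + \<bar>ln s\<^sub>2\<bar>" by linarith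
          then have "\<bar>- \<sigma> * (1 + ln s)\<bar> \<le> \<bar>\<sigma>\<bar> * (1 + \<bar>ln s\<^sub>1\<bar> + \<bar>ln s\<^sub>2\<bar>)"
            unfolding abs_mult abs_minus_cancel by (intro mult_left_mono) auto
          then show ?thesis unfolding exp_le_cancel_iff by linarith
        qed
        finally show "(exp 1 * s) powr (- \<sigma>) \<le> C1" unfolding C1_def .
      qed auto
      finally show ?thesis .
    qed
    have w3: "(y / (exp 1 * s)) ^ j * moment_bound ((c + \<rho>) / 2) j \<le> C2 * (5/7) ^ j"
    proof -
      have "(y / (exp 1 * s)) ^ j * moment_bound ((c + \<rho>) / 2) j =
        2 * exp ((c + \<rho>) / 2) * ((y / 2) ^ j / fact j) * ((c + \<rho>) / (2 * exp 1 * s)) ^ j"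
        unfolding moment_bound_def by (simp add: power_divide power_mult_distrib field_simps flip: power_mult_distrib)
      also have "\<dots> \<le> 2 * exp ((s\<^sub>2 + \<rho>) / 2) * exp (y / 2) * ((c + \<rho>) / (2 * exp 1 * s)) ^ j"
        using c y s0 \<rho> by (intro mult_mono power_div_fact_le_exp) auto
      also have "exp (y / 2) = exp (1/2) * exp 1 ^ j"
      proof -
        have "y / 2 = 1/2 + real j * 1" unfolding y_def by simp
        then have "exp (y / 2) = exp (1/2) * exp (real j * 1)" by (simp only: exp_add)
        then show ?thesis by (simp only: exp_of_nat_mult)
      qed
      also have "2 * exp ((s\<^sub>2 + \<rho>) / 2) * (exp (1/2) * exp 1 ^ j) * ((c + \<rho>) / (2 * exp 1 * s)) ^ j =
         C2 * (exp 1 * ((c + \<rho>) / (2 * exp 1 * s))) ^ j"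
        unfolding C2_def power_mult_distrib by (simp only: mult_ac)
      also have "exp 1 * ((c + \<rho>) / (2 * exp 1 * s)) = (c + \<rho>) / (2 * s)" by simp
      also have "C2 * ((c + \<rho>) / (2 * s)) ^ j \<le> C2 * (5/7) ^ j"
      proof -
        \<comment> \<open>Here \<rho> \<le> c/4 and s \<ge> c - \<rho>/2 \<ge> 7c/8, so the ratio
          (c+\<rho>)/(2s) is at most (5/4)/(7/4) = 5/7.\<close>
        have "c - s \<le> \<rho> / 2" using sc by linarith
    moreover have "\<rho> \<le> c / 4" using \<rho> c by simp
    ultimately have "(c + \<rho>) * 7 \<le> 5 * (2 * s)" by (simp add: algebra_simps)
        then have "(c + \<rho>) / (2 * s) \<le> 5/7" using s0 by (simp add: field_simps)
        then show ?thesis using C s0 \<rho> by (intro mult_left_mono power_mono) auto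
      qed
      finally show ?thesis .
    qed
    have "y * ((y / (exp 1 * s)) powr (real j + \<sigma>) * moment_bound ((c + \<rho>) / 2) j)
      = y * (y / (exp 1 * s)) powr \<sigma> * ((y / (exp 1 * s)) ^ j * moment_bound ((c + \<rho>) / 2) j)"
      unfolding w1 by (simp only: mult_ac)
    also have "\<dots> \<le> y * (y powr \<bar>\<sigma>\<bar> * C1) * (C2 * (5/7) ^ j)"
    proof (rule mult_mono)
      show "y * (y / (exp 1 * s)) powr \<sigma> \<le> y * (y powr \<bar>\<sigma>\<bar> * C1)" using w2 y by (intro mult_left_mono) auto
      show "0 \<le> y * (y powr \<bar>\<sigma>\<bar> * C1)" using y C by simp
      have "0 \<le> moment_bound ((c + \<rho>) / 2) j" by (rule moment_bound_nonneg) (use s0 \<rho> in simp)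
      then show "0 \<le> (y / (exp 1 * s)) ^ j * moment_bound ((c + \<rho>) / 2) j" using y s0 by simp
    qed (rule w3)
    also have "\<dots> = C1 * C2 * (y powr (\<bar>\<sigma>\<bar> + 1) * (5/7) ^ j)" using y by (simp add: powr_add)
    also have "\<dots> \<le> C1 * C2 * (K0 * (6/7) ^ j)" using K0(2)[of j] C unfolding y_def by (intro mult_left_mono) auto
    finally show "real (2 * j + 1) * ((real (2 * j + 1) / (exp 1 * s)) powr (real j + \<sigma>) * moment_bound ((c + \<rho>) / 2) j) \<le> C1 * C2 * K0 * (6/7) ^ j"
      unfolding y_def by (simp only: mult_ac)
  qed
qed

text \<open>The 2j + 1 indices of each degree cancel the denominators, and two geometric series
  remain. Since the terms are nonnegative it suffices to bound finite sums, and these are enlarged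
  to boxes.\<close>

lemma harmonic_index_sum_bound:
  fixes w :: "nat \<times> nat \<times> nat \<times> nat \<Rightarrow> real" and E r :: real
  assumes r: "0 \<le> r" "r < 1" and E: "E \<ge> 0"
    and w: "\<And>j1 p1 j2 p2. p1 \<in> {1..2*j1+1} \<Longrightarrow> p2 \<in> {1..2*j2+1} \<Longrightarrow>
      0 \<le> w (j1, p1, j2, p2) \<and> w (j1, p1, j2, p2) \<le> E * (r ^ j1 / real (2*j1+1) * (r ^ j2 / real (2*j2+1)))"
  defines "J \<equiv> {(j1, p1, j2, p2). p1 \<in> {1..2*j1+1} \<and> p2 \<in> {1..2*j2+1}}"
  shows "w summable_on J" "infsum w J \<le> E * (1 / (1 - r))\<^sup>2"
proof -
  have geo: "(\<Sum>j<m. r ^ j) \<le> 1 / (1 - r)" for m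
  proof -
    have "(\<Sum>j<m. r ^ j) \<le> (\<Sum>j. r ^ j)" using r by (intro sum_le_suminf summable_geometric) auto
    then show ?thesis using r by (simp add: suminf_geometric)
  qed
  have fin: "sum w F \<le> E * (1 / (1 - r))\<^sup>2" if F: "finite F" "F \<subseteq> J" for F
  proof -
    \<comment> \<open>One more than every degree occurring in F.\<close>
    define m where "m = Suc (Max (insert 0 ((\<lambda>(j1, p1, j2, p2). max j1 j2) ` F)))"
    define Bx where "Bx = (SIGMA j1:{..<m}. SIGMA p1:{1..2*j1+1}. SIGMA j2:{..<m}. {1..2*j2+1})"
    have FB: "F \<subseteq> Bx"
    proof
      fix x assume x: "x \<in> F"
      obtain j1 p1 j2 p2 where q: "x = (j1, p1, j2, p2)" by (cases x)
      have "max j1 j2 \<le> Max (insert 0 ((\<lambda>(j1, p1, j2, p2). max j1 j2) ` F))"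
        using F(1) x q by (intro Max_ge) (auto intro!: rev_image_eqI)
      then have "j1 < m" "j2 < m" unfolding m_def by auto
      then show "x \<in> Bx" using F(2) x q unfolding Bx_def J_def by auto
    qed
    have Bf: "finite Bx" unfolding Bx_def by (intro finite_SigmaI) auto
    have "sum w F \<le> sum w Bx"
      by (rule sum_mono2[OF Bf FB]) (use w in \<open>auto simp: Bx_def\<close>)
    also have "\<dots> \<le> (\<Sum>(j1, p1, j2, p2)\<in>Bx. E * (r ^ j1 / real (2*j1+1) * (r ^ j2 / real (2*j2+1))))"
      by (rule sum_mono) (use w in \<open>auto simp: Bx_def\<close>)
    also have "\<dots> = (\<Sum>j1<m. \<Sum>p1\<in>{1..2*j1+1}. \<Sum>j2<m. \<Sum>p2\<in>{1..2*j2+1}. E * (r ^ j1 / real (2*j1+1) * (r ^ j2 / real (2*j2+1))))"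
      unfolding Bx_def by (subst sum.Sigma[symmetric], auto)+
    also have "\<dots> = (\<Sum>j1<m. \<Sum>j2<m. E * (r ^ j1 * r ^ j2))"
    proof (rule sum.cong[OF refl])
      fix j1
      have "(\<Sum>p2\<in>{1..2*j2+1}. E * (r ^ j1 / real (2*j1+1) * (r ^ j2 / real (2*j2+1)))) = E * (r ^ j1 / real (2*j1+1) * r ^ j2)" for j2
        by simp
      then have "(\<Sum>p1\<in>{1..2*j1+1}. \<Sum>j2<m. \<Sum>p2\<in>{1..2*j2+1}. E * (r ^ j1 / real (2*j1+1) * (r ^ j2 / real (2*j2+1))))
        = real (2*j1+1) * (\<Sum>j2<m. E * (r ^ j1 / real (2*j1+1) * r ^ j2))" by simp
      also have "\<dots> = (\<Sum>j2<m. E * (r ^ j1 * r ^ j2))"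
        unfolding sum_distrib_left by (intro sum.cong) auto
      finally show "(\<Sum>p1\<in>{1..2*j1+1}. \<Sum>j2<m. \<Sum>p2\<in>{1..2*j2+1}. E * (r ^ j1 / real (2*j1+1) * (r ^ j2 / real (2*j2+1))))
        = (\<Sum>j2<m. E * (r ^ j1 * r ^ j2))" .
    qed
    also have "\<dots> = E * (\<Sum>i<m. \<Sum>j<m. r ^ i * r ^ j)" by (simp only: sum_distrib_left)
    also have "\<dots> = E * ((\<Sum>j<m. r ^ j) * (\<Sum>j<m. r ^ j))" by (simp only: sum_product)
    also have "\<dots> \<le> E * (1 / (1 - r) * (1 / (1 - r)))"
      using geo[of m] r E by (intro mult_left_mono mult_mono sum_nonneg) auto
    finally show ?thesis by (simp add: power2_eq_square)
  qed
  show s: "w summable_on J"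
  proof (rule nonneg_bdd_above_summable_on)
    show "w x \<ge> 0" if "x \<in> J" for x using w that unfolding J_def by auto
    show "bdd_above (sum w ` {F. F \<subseteq> J \<and> finite F})" using fin by (intro bdd_aboveI2) auto
  qed
  show "infsum w J \<le> E * (1 / (1 - r))\<^sup>2" by (rule infsum_le_finite_sums[OF s fin])
qed

text \<open>Continuity on the compact product of spheres provides measurability and square
  integrability; the coefficient bound provides summability. If any of these failed,
  \<open>amp_norm\<close> would be infinite.\<close>

lemma amp_norm_le:
  fixes r E s :: real
  assumes r: "0 \<le> r" "r < 1" and E: "E \<ge> 0" and s: "s > 0"
    and g: "continuous_on (sphere 0 1 \<times> sphere 0 1) (\<lambda>p. g (fst p) (snd p))"
    and c: "\<And>j1 p1 j2 p2. p1 \<in> {1..2*j1+1} \<Longrightarrow> p2 \<in> {1..2*j2+1} \<Longrightarrow>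
      ((real (2*j1+1) / (exp 1 * s)) powr (real j1 + \<sigma>\<^sub>1) * (real (2*j2+1) / (exp 1 * s)) powr (real j2 + \<sigma>\<^sub>2) *
         cmod (sph_coeff Y g j1 p1 j2 p2))\<^sup>2 \<le> E * (r ^ j1 / real (2*j1+1) * (r ^ j2 / real (2*j2+1)))"
  shows "amp_norm Y \<sigma>\<^sub>1 \<sigma>\<^sub>2 s g \<le> ennreal (sqrt (E * (1 / (1 - r))\<^sup>2))"
proof -
  let ?J = "{(j1, p1, j2, p2). p1 \<in> {1..2*j1+1} \<and> p2 \<in> {1..2*j2+1}}"
  define w where "w = (\<lambda>(j\<^sub>1, p\<^sub>1, j\<^sub>2, p\<^sub>2).
                 (real (2*j\<^sub>1+1) / (exp 1 * s)) powr (2 * real j\<^sub>1 + 2 * \<sigma>\<^sub>1) *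
                 (real (2*j\<^sub>2+1) / (exp 1 * s)) powr (2 * real j\<^sub>2 + 2 * \<sigma>\<^sub>2) *
                 (cmod (sph_coeff Y g j\<^sub>1 p\<^sub>1 j\<^sub>2 p\<^sub>2))\<^sup>2)"
  have sq: "x powr (2 * a + 2 * b) = (x powr (a + b))\<^sup>2" for x a b :: real
    unfolding power2_eq_square powr_add[symmetric] by (rule arg_cong[of _ _ "(powr) x"]) simp
  have wc: "0 \<le> w (j1, p1, j2, p2) \<and> w (j1, p1, j2, p2) \<le> E * (r ^ j1 / real (2*j1+1) * (r ^ j2 / real (2*j2+1)))"
    if "p1 \<in> {1..2*j1+1}" "p2 \<in> {1..2*j2+1}" for j1 p1 j2 p2
    using c[OF that] unfolding w_def prod.case sq power_mult_distrib by simp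
  note S = harmonic_index_sum_bound[OF r E, of w, OF wc]
  have gm: "(\<lambda>p. g (fst p) (snd p)) \<in> borel_measurable (sphere_measure \<Otimes>\<^sub>M sphere_measure)"
    by (rule measurable_pair_continuous[OF g sets_sphere_measure sets_sphere_measure])
  have "bounded ((\<lambda>p. g (fst p) (snd p)) ` (sphere 0 1 \<times> sphere 0 1))"
    by (intro compact_imp_bounded compact_continuous_image g compact_Times compact_sphere)
  then obtain B where B: "\<And>p. p \<in> sphere 0 1 \<times> sphere 0 1 \<Longrightarrow> norm (g (fst p) (snd p)) \<le> B"
    unfolding bounded_iff by blast
  interpret PF: finite_measure "sphere_measure \<Otimes>\<^sub>M sphere_measure"
    by (rule finite_measure_pair_measure[OF finite_sphere_measure finite_sphere_measure])
  have gi: "integrable (sphere_measure \<Otimes>\<^sub>M sphere_measure) (\<lambda>p. (cmod (g (fst p) (snd p)))\<^sup>2)"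
  proof (rule PF.integrable_const_bound[of _ "B\<^sup>2"])
    show "AE p in sphere_measure \<Otimes>\<^sub>M sphere_measure. norm ((cmod (g (fst p) (snd p)))\<^sup>2) \<le> B\<^sup>2"
      by (intro AE_I2) (use B in \<open>auto simp: space_pair_measure intro!: power_mono\<close>)
    show "(\<lambda>p. (cmod (g (fst p) (snd p)))\<^sup>2) \<in> borel_measurable (sphere_measure \<Otimes>\<^sub>M sphere_measure)"
      using gm by measurable
  qed
  have "case_prod g \<in> borel_measurable (sphere_measure \<Otimes>\<^sub>M sphere_measure)"
    "integrable (sphere_measure \<Otimes>\<^sub>M sphere_measure) (\<lambda>(\<theta>, \<omega>). (cmod (g \<theta> \<omega>))\<^sup>2)"
    using gm gi by (simp_all add: case_prod_beta')
  then have "amp_norm Y \<sigma>\<^sub>1 \<sigma>\<^sub>2 s g = ennreal (sqrt (infsum w ?J))"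
    unfolding amp_norm_def Let_def using S(1) unfolding w_def[symmetric] by simp
  also have "\<dots> \<le> ennreal (sqrt (E * (1 / (1 - r))\<^sup>2))"
    by (intro ennreal_leI real_sqrt_le_mono S(2))
  finally show ?thesis .
qed

section \<open>Pigeonhole on rounded Taylor coefficients\<close>

text \<open>On the disc of half the radius the Taylor terms carry a factor 2^(-l). The first n terms
  agree up to 2/2^n on the scale of Cauchy's inequality, and their differences sum to at most
  4b/2^n; the remaining terms are at most 2b 2^(-l) by Cauchy's inequality and also sum to 4b/2^n.
  So n coefficients with n bits each give an accuracy of order 2^(-n).\<close>

lemma holomorphic_close_of_taylor_close:
  fixes f g :: "complex \<Rightarrow> complex"
  assumes hol: "f holomorphic_on S" "g holomorphic_on S" and S: "cball c \<rho> \<subseteq> S" and \<rho>: "\<rho> > 0" and b: "b > 0"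
    and fb: "\<And>z. z \<in> cball c \<rho> \<Longrightarrow> norm (f z) \<le> b" and gb: "\<And>z. z \<in> cball c \<rho> \<Longrightarrow> norm (g z) \<le> b"
    and close: "\<And>l. l < n \<Longrightarrow> norm ((deriv ^^ l) f c / fact l * of_real (\<rho> ^ l / b) - (deriv ^^ l) g c / fact l * of_real (\<rho> ^ l / b)) \<le> 2 / 2 ^ n"
    and z: "norm (z - c) \<le> \<rho> / 2"
  shows "norm (f z - g z) \<le> 8 * b / 2 ^ n"
proof -
  define d where "d l = ((deriv ^^ l) f c - (deriv ^^ l) g c) / fact l" for l
  have zb: "z \<in> ball c \<rho>" using z \<rho> by (simp add: dist_norm norm_minus_commute)
  have hb: "f holomorphic_on ball c \<rho>" "g holomorphic_on ball c \<rho>"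
    using hol holomorphic_on_subset S ball_subset_cball by blast+
  have "(\<lambda>l. (deriv ^^ l) f c / fact l * (z - c) ^ l - (deriv ^^ l) g c / fact l * (z - c) ^ l) sums (f z - g z)"
    by (intro sums_diff holomorphic_power_series[OF hb(1) zb] holomorphic_power_series[OF hb(2) zb])
  then have sums: "(\<lambda>l. d l * (z - c) ^ l) sums (f z - g z)"
    unfolding d_def by (simp add: diff_divide_distrib left_diff_distrib)
  have cauchy: "norm ((deriv ^^ l) h c) \<le> fact l * b / \<rho> ^ l" if "h holomorphic_on S" "\<And>z. z \<in> cball c \<rho> \<Longrightarrow> norm (h z) \<le> b" for h l
  proof (rule Cauchy_inequality)
    show "h holomorphic_on ball c \<rho>" using that(1) holomorphic_on_subset S ball_subset_cball by blast
    show "continuous_on (cball c \<rho>) h" using that(1) holomorphic_on_imp_continuous_on continuous_on_subset S by blast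
    show "norm (h x) \<le> b" if "norm (c - x) = \<rho>" for x using that \<open>\<And>z. z \<in> cball c \<rho> \<Longrightarrow> norm (h z) \<le> b\<close> by (simp add: dist_norm)
  qed (rule \<rho>)
  have all: "norm (d l) \<le> 2 * (b / \<rho> ^ l)" for l
  proof -
    have "norm (d l) \<le> (norm ((deriv ^^ l) f c) + norm ((deriv ^^ l) g c)) / fact l"
      unfolding d_def norm_divide by (simp add: divide_right_mono norm_triangle_ineq4)
    also have "\<dots> \<le> (fact l * b / \<rho> ^ l + fact l * b / \<rho> ^ l) / fact l"
      by (intro divide_right_mono add_mono cauchy hol fb gb) auto
    also have "\<dots> = 2 * (b / \<rho> ^ l)" by simp
    finally show ?thesis .
  qed
  have low: "norm (d l) \<le> 2 / 2 ^ n * (b / \<rho> ^ l)" if "l < n" for l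
  proof -
    have "norm (d l * of_real (\<rho> ^ l / b)) \<le> 2 / 2 ^ n"
      using close[OF that] unfolding d_def by (simp add: diff_divide_distrib left_diff_distrib)
    then have "norm (d l) * (\<rho> ^ l / b) \<le> 2 / 2 ^ n" using \<rho> b by (simp add: norm_mult norm_divide norm_power)
    then show ?thesis using \<rho> b by (simp add: field_simps)
  qed
  define u where "u l = (if l < n then 2 / 2 ^ n * b * (1/2) ^ l else 2 * b * (1/2) ^ l)" for l :: nat
  have tm: "norm (d l * (z - c) ^ l) \<le> u l" for l
  proof -
    have p: "norm ((z - c) ^ l) \<le> \<rho> ^ l * (1/2) ^ l"
      unfolding norm_power power_mult_distrib[symmetric] using z by (intro power_mono) auto
    show ?thesis
    proof (cases "l < n")
      case True
      have "norm (d l * (z - c) ^ l) \<le> (2 / 2 ^ n * (b / \<rho> ^ l)) * (\<rho> ^ l * (1/2) ^ l)"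
        unfolding norm_mult using low[OF True] p \<rho> b by (intro mult_mono) auto
      then show ?thesis using True \<rho> unfolding u_def by simp
    next
      case False
      have "norm (d l * (z - c) ^ l) \<le> (2 * (b / \<rho> ^ l)) * (\<rho> ^ l * (1/2) ^ l)"
        unfolding norm_mult using all[of l] p \<rho> b by (intro mult_mono) auto
      then show ?thesis using False \<rho> unfolding u_def by simp
    qed
  qed
  have us: "u sums ((\<Sum>l<n. u l) + 4 * b / 2 ^ n)"
  proof -
    have "u (l + n) = 2 * b * (1/2) ^ n * (1/2) ^ l" for l unfolding u_def by (simp add: power_add)
    moreover have "(\<lambda>l. 2 * b * (1/2) ^ n * (1/2) ^ l) sums (2 * b * (1/2) ^ n * (1 / (1 - 1/2)))"
      by (intro sums_mult geometric_sums) simp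
    ultimately have "(\<lambda>l. u (l + n)) sums (4 * b / 2 ^ n)" by (simp add: power_one_over)
    then show ?thesis by (simp add: sums_iff_shift add.commute)
  qed
  have "(\<Sum>l<n. u l) = 2 / 2 ^ n * b * (\<Sum>l<n. (1/2) ^ l)" unfolding u_def by (simp add: sum_distrib_left)
  also have "\<dots> \<le> 2 / 2 ^ n * b * 2"
  proof -
    have "(\<Sum>l<n. (1/2::real) ^ l) \<le> (\<Sum>l. (1/2) ^ l)" by (intro sum_le_suminf summable_geometric) auto
    then have "(\<Sum>l<n. (1/2::real) ^ l) \<le> 2" by (simp add: suminf_geometric)
    then show ?thesis using b by (intro mult_left_mono) auto
  qed
  finally have uf: "(\<Sum>l<n. u l) \<le> 4 * b / 2 ^ n" by simp
  have sn: "summable (\<lambda>l. norm (d l * (z - c) ^ l))"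
    by (rule summable_comparison_test'[OF sums_summable[OF us], of 0]) (use tm in simp)
  have "norm (f z - g z) \<le> (\<Sum>l. norm (d l * (z - c) ^ l))"
    using summable_norm[OF sn] sums_unique[OF sums] by simp
  also have "\<dots> \<le> (\<Sum>l. u l)" by (rule suminf_le[OF tm sn sums_summable[OF us]])
  also have "\<dots> = (\<Sum>l<n. u l) + 4 * b / 2 ^ n" using sums_unique[OF us] by simp
  finally show ?thesis using uf by simp
qed

text \<open>Real and imaginary parts are rounded down to multiples of 2^(-n), of which [-1, 1]
  contains 2^(n+1) + 1; complex numbers give the square. Equal roundings mean that each part differs
  by at most 2^(-n).\<close>

lemma pigeonhole_rounding:
  fixes t :: "'a \<Rightarrow> 'i \<Rightarrow> complex"
  assumes fin: "finite I" and t: "\<And>a i. a \<in> X \<Longrightarrow> i \<in> I \<Longrightarrow> norm (t a i) \<le> 1"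
    and card: "(((2 ^ Suc n + 1)\<^sup>2) ^ card I :: nat) < card X"
  obtains a a' where "a \<in> X" "a' \<in> X" "a \<noteq> a'" "\<And>i. i \<in> I \<Longrightarrow> norm (t a i - t a' i) \<le> 2 / 2 ^ n"
proof -
  define R where "R = {- (2 ^ n) .. 2 ^ n :: int}"
  define q where "q z = (\<lfloor>2 ^ n * Re z\<rfloor>, \<lfloor>2 ^ n * Im z\<rfloor>)" for z
  define Q where "Q a = (\<lambda>i\<in>I. q (t a i))" for a
  have fl: "\<lfloor>2 ^ n * x\<rfloor> \<in> R" if "\<bar>x\<bar> \<le> 1" for x :: real
  proof -
    have "2 ^ n * (- 1) \<le> 2 ^ n * x" "2 ^ n * x \<le> 2 ^ n * 1" using that by (intro mult_left_mono; auto)+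
    then have "- (2 ^ n) \<le> 2 ^ n * x" "2 ^ n * x \<le> 2 ^ n" by simp_all
    then have "- (2 ^ n) \<le> \<lfloor>2 ^ n * x\<rfloor>" "\<lfloor>2 ^ n * x\<rfloor> \<le> \<lfloor>(2::real) ^ n\<rfloor>"
      by (simp add: le_floor_iff, intro floor_mono)
    then show ?thesis unfolding R_def by simp
  qed
  have img: "Q ` X \<subseteq> PiE I (\<lambda>_. R \<times> R)"
  proof
    fix y assume "y \<in> Q ` X"
    then obtain a where a: "a \<in> X" "y = Q a" by blast
    have "q (t a i) \<in> R \<times> R" if "i \<in> I" for i
      unfolding q_def using fl abs_Re_le_cmod[of "t a i"] abs_Im_le_cmod[of "t a i"] t[OF a(1) that] by auto
    then show "y \<in> PiE I (\<lambda>_. R \<times> R)" unfolding a(2) Q_def by (auto simp: PiE_iff)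
  qed
  have fR: "finite R" "card R = 2 ^ Suc n + 1"
  proof -
    show "finite R" unfolding R_def by simp
    have "nat (2 ^ n - - (2 ^ n) + 1 :: int) = 2 ^ Suc n + 1" by (simp add: nat_add_distrib nat_mult_distrib nat_power_eq)
    then show "card R = 2 ^ Suc n + 1" unfolding R_def by simp
  qed
  have fP: "finite (PiE I (\<lambda>_. R \<times> R))" using fin fR by (intro finite_PiE) auto
  have "card (Q ` X) \<le> card (PiE I (\<lambda>_. R \<times> R))" by (rule card_mono[OF fP img])
  also have "\<dots> = ((2 ^ Suc n + 1)\<^sup>2) ^ card I"
    using fin fR by (simp add: card_PiE card_cartesian_product power2_eq_square)
  also have "\<dots> < card X" by (rule card)
  finally have "\<not> inj_on Q X" by (rule pigeonhole)
  then obtain a a' where a: "a \<in> X" "a' \<in> X" "a \<noteq> a'" "Q a = Q a'" unfolding inj_on_def by blast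
  have "norm (t a i - t a' i) \<le> 2 / 2 ^ n" if i: "i \<in> I" for i
  proof -
    have "q (t a i) = q (t a' i)" using fun_cong[OF a(4), of i] i unfolding Q_def by simp
    then have e: "\<lfloor>2 ^ n * Re (t a i)\<rfloor> = \<lfloor>2 ^ n * Re (t a' i)\<rfloor>" "\<lfloor>2 ^ n * Im (t a i)\<rfloor> = \<lfloor>2 ^ n * Im (t a' i)\<rfloor>"
      unfolding q_def by auto
    have fd: "\<bar>x - y\<bar> \<le> 1 / 2 ^ n" if "\<lfloor>2 ^ n * x\<rfloor> = \<lfloor>2 ^ n * y\<rfloor>" for x y :: real
    proof -
      have "\<bar>2 ^ n * x - 2 ^ n * y\<bar> \<le> 1" using that by linarith
      then have "2 ^ n * \<bar>x - y\<bar> \<le> 1" by (simp add: abs_mult flip: right_diff_distrib)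
      then show ?thesis by (simp add: field_simps)
    qed
    have "norm (t a i - t a' i) \<le> \<bar>Re (t a i - t a' i)\<bar> + \<bar>Im (t a i - t a' i)\<bar>" by (rule cmod_le)
    also have "\<dots> \<le> 1 / 2 ^ n + 1 / 2 ^ n" using fd[OF e(1)] fd[OF e(2)] by (intro add_mono) auto
    finally show ?thesis by simp
  qed
  then show ?thesis using that a by blast
qed

section \<open>Instability\<close>

text \<open>The ball and the complement of the support are open and cover the space; v is continuous
  on the first and zero on the second.\<close>

lemma C_0_supp_continuous:
  fixes v :: "real^3 \<Rightarrow> real"
  assumes "continuous_on (ball 0 1) v" "supp v \<subseteq> ball 0 (1/2)"
  shows "continuous_on UNIV v" "\<And>x. 1/2 \<le> norm x \<Longrightarrow> v x = 0"
proof -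
  have z: "v x = 0" if "x \<in> - supp v" for x
    using that closure_subset[of "{x. v x \<noteq> 0}"] unfolding supp_def by blast
  show "v x = 0" if "1/2 \<le> norm x" for x using assms(2) that by (intro z) force
  have "continuous_on (- supp v) v"
    by (rule continuous_on_eq[of _ "\<lambda>_. 0"]) (use z in auto)
  moreover have "open (- supp v)" unfolding supp_def by (simp add: open_Compl)
  ultimately have "continuous_on (ball 0 1 \<union> - supp v) v"
    using assms(1) by (intro continuous_on_open_Un) auto
  moreover have "ball 0 1 \<union> - supp v = UNIV"
    using assms(2) by force
  ultimately show "continuous_on UNIV v" by simp
qed

text \<open>From |Y| \<le> (|Y|^2 + 1)/2; the bound is the same for all harmonics of the basis,
  which keeps the constants of the amplitude estimates independent of the degree.\<close>

lemma orthonormal_L1_bound: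
  assumes "spherical_harmonic j Y" "(LINT x|sphere_measure. Y x * cnj (Y x)) = 1"
  shows "(LINT x|sphere_measure. norm (Y x)) \<le> (1 + measure sphere_measure (sphere 0 1)) / 2"
proof -
  note Yc = spherical_harmonic_continuous[OF assms(1)]
  have "(LINT x|sphere_measure. Y x * cnj (Y x)) = (LINT x|sphere_measure. complex_of_real ((norm (Y x))\<^sup>2))"
    by (simp add: complex_norm_square del: of_real_power)
  also have "\<dots> = complex_of_real (LINT x|sphere_measure. (norm (Y x))\<^sup>2)" by (rule integral_complex_of_real)
  finally have "complex_of_real (LINT x|sphere_measure. (norm (Y x))\<^sup>2) = complex_of_real 1" using assms(2) by simp
  then have one: "(LINT x|sphere_measure. (norm (Y x))\<^sup>2) = 1" by (simp only: of_real_eq_iff)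
  have i1: "integrable sphere_measure (\<lambda>x. norm (Y x))"
    by (intro integrable_norm integrable_sphere_continuous Yc)
  \<comment> \<open>The integral is 1, while a function that is not integrable has integral
    0.\<close>
  have i2: "integrable sphere_measure (\<lambda>x. (norm (Y x))\<^sup>2)"
    using one not_integrable_integral_eq by fastforce
  have "(LINT x|sphere_measure. norm (Y x)) \<le> (LINT x|sphere_measure. ((norm (Y x))\<^sup>2 + 1) / 2)"
  proof (rule integral_mono[OF i1])
    show "integrable sphere_measure (\<lambda>x. ((norm (Y x))\<^sup>2 + 1) / 2)" using i2 by simp
    show "norm (Y x) \<le> ((norm (Y x))\<^sup>2 + 1) / 2" for x
      using zero_le_power2[of "norm (Y x) - 1"] by (simp add: power2_eq_square algebra_simps)
  qed
  also have "\<dots> = (1 + measure sphere_measure (sphere 0 1)) / 2"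
    using one i2 by simp
  finally show ?thesis .
qed

lemma sum_odd_numbers: "(\<Sum>j<n. 2 * j + 1) = n\<^sup>2" for n :: nat
  by (induction n) (auto simp: power2_eq_square)

lemma sph_coeff_far_field_diff:
  assumes v1: "weak_potential v1 N" and v2: "weak_potential v2 N"
    and h1: "spherical_harmonic j1 (Y j1 p1)" and h2: "spherical_harmonic j2 (Y j2 p2)"
  shows "sph_coeff Y (\<lambda>\<theta> \<omega>. weak_potential.far_field v1 (of_real s) \<theta> \<omega> - weak_potential.far_field v2 (of_real s) \<theta> \<omega>) j1 p1 j2 p2
    = weak_potential.amp_coeff v1 (Y j1 p1) (Y j2 p2) (of_real s) - weak_potential.amp_coeff v2 (Y j1 p1) (Y j2 p2) (of_real s)"
    and "continuous_on (sphere 0 1 \<times> sphere 0 1) (\<lambda>p. weak_potential.far_field v1 (of_real s) (fst p) (snd p) - weak_potential.far_field v2 (of_real s) (fst p) (snd p))"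
proof -
  note Yc1 = spherical_harmonic_continuous[OF h1] and Yc2 = spherical_harmonic_continuous[OF h2]
  have strip: "complex_of_real s \<in> strip" by (simp add: strip_def)
  interpret PF: finite_measure "sphere_measure \<Otimes>\<^sub>M sphere_measure"
    by (rule finite_measure_pair_measure[OF finite_sphere_measure finite_sphere_measure])
  have fc: "continuous_on (sphere 0 1 \<times> sphere 0 1) (\<lambda>p. weak_potential.far_field v (of_real s) (fst p) (snd p))"
    if "weak_potential v N" for v
  proof -
    have "continuous_on (sphere 0 1 \<times> sphere 0 1) (\<lambda>p. (\<lambda>(\<tau>, \<theta>, \<omega>). weak_potential.far_field v \<tau> \<theta> \<omega>) (of_real s, fst p, snd p))"
      by (rule continuous_on_compose2[OF weak_potential.far_field_continuous[OF that]]) (use strip in \<open>auto intro!: continuous_intros\<close>)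
    then show ?thesis by (simp add: case_prod_beta')
  qed
  show "continuous_on (sphere 0 1 \<times> sphere 0 1) (\<lambda>p. weak_potential.far_field v1 (of_real s) (fst p) (snd p) - weak_potential.far_field v2 (of_real s) (fst p) (snd p))"
    by (intro continuous_intros fc v1 v2)
  let ?G = "\<lambda>v p. weak_potential.far_field v (of_real s) (fst p) (snd p) * cnj (Y j1 p1 (fst p)) * cnj (Y j2 p2 (snd p))"
  have gi: "integrable (sphere_measure \<Otimes>\<^sub>M sphere_measure) (?G v)" if v: "weak_potential v N" for v
  proof -
    have c1: "continuous_on (sphere 0 1 \<times> sphere (0::real^3) 1) (\<lambda>p. Y j1 p1 (fst p))"
      by (rule continuous_on_compose2[OF Yc1]) (auto intro!: continuous_intros)
    have c2: "continuous_on (sphere (0::real^3) 1 \<times> sphere 0 1) (\<lambda>p. Y j2 p2 (snd p))"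
      by (rule continuous_on_compose2[OF Yc2]) (auto intro!: continuous_intros)
    have c: "continuous_on (sphere 0 1 \<times> sphere 0 1) (?G v)"
      by (intro continuous_on_mult continuous_on_cnj fc v c1 c2)
    have "bounded (?G v ` (sphere 0 1 \<times> sphere 0 1))"
      by (intro compact_imp_bounded compact_continuous_image c compact_Times compact_sphere)
    then obtain B where "\<And>p. p \<in> sphere 0 1 \<times> sphere 0 1 \<Longrightarrow> norm (?G v p) \<le> B"
      unfolding bounded_iff by blast
    then show ?thesis
      by (intro PF.integrable_const_bound[of _ B] measurable_pair_continuous[OF c sets_sphere_measure sets_sphere_measure])
        (auto simp: space_pair_measure)
  qed
  define A where "A = max (LINT \<theta>|sphere_measure. norm (Y j1 p1 \<theta>)) (LINT \<theta>|sphere_measure. norm (Y j2 p2 \<theta>))"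
  have A: "(LINT \<theta>|sphere_measure. norm (Y j1 p1 \<theta>)) \<le> A" "(LINT \<theta>|sphere_measure. norm (Y j2 p2 \<theta>)) \<le> A"
    unfolding A_def by auto
  have co: "(LINT p|(sphere_measure \<Otimes>\<^sub>M sphere_measure). ?G v p) = weak_potential.amp_coeff v (Y j1 p1) (Y j2 p2) (of_real s)"
    if "weak_potential v N" for v
    by (rule weak_potential.far_field_coeff[OF that h1 A(1) h2 A(2) strip])
  have "sph_coeff Y (\<lambda>\<theta> \<omega>. weak_potential.far_field v1 (of_real s) \<theta> \<omega> - weak_potential.far_field v2 (of_real s) \<theta> \<omega>) j1 p1 j2 p2
    = (LINT p|(sphere_measure \<Otimes>\<^sub>M sphere_measure). ?G v1 p - ?G v2 p)"
    unfolding sph_coeff_def case_prod_beta' by (simp only: left_diff_distrib)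
  also have "\<dots> = weak_potential.amp_coeff v1 (Y j1 p1) (Y j2 p2) (of_real s) - weak_potential.amp_coeff v2 (Y j1 p1) (Y j2 p2) (of_real s)"
    by (subst Bochner_Integration.integral_diff[OF gi[OF v1] gi[OF v2]]) (simp only: co[OF v1] co[OF v2])
  finally show "sph_coeff Y (\<lambda>\<theta> \<omega>. weak_potential.far_field v1 (of_real s) \<theta> \<omega> - weak_potential.far_field v2 (of_real s) \<theta> \<omega>) j1 p1 j2 p2
    = weak_potential.amp_coeff v1 (Y j1 p1) (Y j2 p2) (of_real s) - weak_potential.amp_coeff v2 (Y j1 p1) (Y j2 p2) (of_real s)" .
qed

text \<open>The number n plays three parts at once: cut-off for both degrees, number of Taylor
  coefficients at each centre and number of bits. The constants D and L are fixed before the family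
  of potentials, so that the family may be chosen afterwards in dependence on them; L is the number
  of centres.\<close>

lemma amplitude_pigeonhole:
  fixes s\<^sub>1 s\<^sub>2 \<sigma>\<^sub>1 \<sigma>\<^sub>2 :: real and Y :: "nat \<Rightarrow> nat \<Rightarrow> real^3 \<Rightarrow> complex"
  assumes s: "0 < s\<^sub>1" "s\<^sub>1 \<le> s\<^sub>2" and Y: "spherical_harmonic_basis Y"
  obtains D :: real and L :: nat where "D > 0"
    "\<And>N (X :: 'a set) (v :: 'a \<Rightarrow> real^3 \<Rightarrow> real) n. N \<le> 1 \<Longrightarrow> (\<And>a. a \<in> X \<Longrightarrow> weak_potential (v a) N) \<Longrightarrow>
       (((2 ^ Suc n + 1)\<^sup>2) ^ (L * n ^ 5) :: nat) < card X \<Longrightarrow>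
       \<exists>a\<in>X. \<exists>a'\<in>X. a \<noteq> a' \<and> (\<forall>s\<in>{s\<^sub>1..s\<^sub>2}. amp_norm Y \<sigma>\<^sub>1 \<sigma>\<^sub>2 s
         (\<lambda>\<theta> \<omega>. weak_potential.far_field (v a) (of_real s) \<theta> \<omega> - weak_potential.far_field (v a') (of_real s) \<theta> \<omega>)
         \<le> ennreal (sqrt (D * (6/7) ^ n)))"
proof -
  \<comment> \<open>The bound by a quarter of the left endpoint yields the ratio 5/7, and the bound
    1/4 keeps the closed discs inside the strip.\<close>
  define \<rho> where "\<rho> = min (s\<^sub>1 / 4) (1/4)"
  have \<rho>: "0 < \<rho>" "\<rho> \<le> s\<^sub>1 / 4" "\<rho> < 1/2" unfolding \<rho>_def using s by auto
  have harm: "spherical_harmonic j (Y j p)" if "p \<in> {1..2*j+1}" for j p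
    using Y that unfolding spherical_harmonic_basis_def by blast
  define A where "A = (1 + measure sphere_measure (sphere 0 1)) / 2"
  have A: "(LINT x|sphere_measure. norm (Y j p x)) \<le> A" if "p \<in> {1..2*j+1}" for j p
  proof -
    have "(LINT x|sphere_measure. Y j p x * cnj (Y j p x)) = 1"
      using Y that unfolding spherical_harmonic_basis_def by auto
    then show ?thesis unfolding A_def by (rule orthonormal_L1_bound[OF harm[OF that]])
  qed
  \<comment> \<open>The covering discs have half the radius of the discs carrying the Taylor
    expansions, which gives the factor 2^(-l) in the l-th Taylor term.\<close>
  obtain Ce where Ce: "Ce \<subseteq> {s\<^sub>1..s\<^sub>2}" "finite Ce" "{s\<^sub>1..s\<^sub>2} \<subseteq> (\<Union>c\<in>Ce. ball c (\<rho> / 2))"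
  proof (rule compactE_image[of "{s\<^sub>1..s\<^sub>2}" "{s\<^sub>1..s\<^sub>2}" "\<lambda>c. ball c (\<rho> / 2)"])
    show "{s\<^sub>1..s\<^sub>2} \<subseteq> (\<Union>c\<in>{s\<^sub>1..s\<^sub>2}. ball c (\<rho> / 2))" using \<rho>(1) by force
  qed auto
  obtain K1 where K1: "K1 > 0" "\<And>c s j. c \<in> {s\<^sub>1..s\<^sub>2} \<Longrightarrow> s \<in> {s\<^sub>1..s\<^sub>2} \<Longrightarrow> \<bar>s - c\<bar> \<le> \<rho> / 2 \<Longrightarrow>
    real (2 * j + 1) * ((real (2 * j + 1) / (exp 1 * s)) powr (real j + \<sigma>\<^sub>1) * moment_bound ((c + \<rho>) / 2) j) \<le> K1 * (6/7) ^ j"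
    using weighted_moment_bound[OF s \<rho>(1,2), of \<sigma>\<^sub>1] by blast
  obtain K2 where K2: "K2 > 0" "\<And>c s j. c \<in> {s\<^sub>1..s\<^sub>2} \<Longrightarrow> s \<in> {s\<^sub>1..s\<^sub>2} \<Longrightarrow> \<bar>s - c\<bar> \<le> \<rho> / 2 \<Longrightarrow>
    real (2 * j + 1) * ((real (2 * j + 1) / (exp 1 * s)) powr (real j + \<sigma>\<^sub>2) * moment_bound ((c + \<rho>) / 2) j) \<le> K2 * (6/7) ^ j"
    using weighted_moment_bound[OF s \<rho>(1,2), of \<sigma>\<^sub>2] by blast
  \<comment> \<open>The constant of \<open>amp_coeff_bound\<close> at N = 1, with 1 added to make it
    positive.\<close>
  define C0 where "C0 = newton_const / (2 * pi\<^sup>2) * (measure unit_ball (ball 0 1) * (2 * A\<^sup>2)) + 1"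
  have C0: "C0 > 0" unfolding C0_def using newton_const_pos by (intro add_nonneg_pos) auto
  \<comment> \<open>The 8 is the constant in the comparison of holomorphic functions by their Taylor
    coefficients; the square is due to the squared terms of the norm.\<close>
  define E where "E = (8 * C0 * K1 * K2)\<^sup>2"
  have E: "E > 0" unfolding E_def using C0 K1 K2 by simp
  \<comment> \<open>49 is the square of 1/(1 - 6/7), from the two geometric series.\<close>
  define D where "D = E * 49"
  define bnd where "bnd c j1 j2 = C0 * (moment_bound ((c + \<rho>) / 2) j1 * moment_bound ((c + \<rho>) / 2) j2)" for c :: real and j1 j2 :: nat
  have mbpos: "moment_bound Z j > 0" if "Z > 0" for Z j unfolding moment_bound_def using that by simp
  have bpos: "bnd c j1 j2 > 0" if "c \<in> {s\<^sub>1..s\<^sub>2}" for c j1 j2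
    unfolding bnd_def using that s \<rho> C0 by (intro mult_pos_pos mbpos) auto
  have cstrip: "cball (complex_of_real c) \<rho> \<subseteq> strip" for c
  proof
    fix z assume "z \<in> cball (complex_of_real c) \<rho>"
    then have "\<bar>Im (complex_of_real c - z)\<bar> \<le> \<rho>" using abs_Im_le_cmod[of "complex_of_real c - z"] by (simp add: dist_norm)
    then show "z \<in> strip" using \<rho> by (simp add: strip_def)
  qed
  have ab: "norm (weak_potential.amp_coeff v (Y j1 p1) (Y j2 p2) z) \<le> bnd c j1 j2"
    if v: "weak_potential v N" and N: "N \<le> 1" and c: "c \<in> {s\<^sub>1..s\<^sub>2}" and z: "z \<in> cball (complex_of_real c) \<rho>"
      and p: "p1 \<in> {1..2*j1+1}" "p2 \<in> {1..2*j2+1}" for v N c z j1 p1 j2 p2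
  proof -
    have zn: "norm z / 2 \<le> (c + \<rho>) / 2"
    proof -
      have "norm z \<le> norm (complex_of_real c) + norm (z - complex_of_real c)" using norm_triangle_ineq[of "complex_of_real c" "z - complex_of_real c"] by simp
      then show ?thesis using z c s by (simp add: dist_norm norm_minus_commute)
    qed
    have mm: "moment_bound (norm z / 2) j1 * moment_bound (norm z / 2) j2 \<le> moment_bound ((c + \<rho>) / 2) j1 * moment_bound ((c + \<rho>) / 2) j2"
      using zn c s \<rho> by (intro mult_mono moment_bound_mono moment_bound_nonneg) auto
    have N0: "0 \<le> N" by (rule weak_potential.N_nonneg[OF v])
    have "norm (weak_potential.amp_coeff v (Y j1 p1) (Y j2 p2) z) \<le> newton_const / (2 * pi\<^sup>2) * (measure unit_ball (ball 0 1) *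
      (2 * N * A\<^sup>2)) * (moment_bound (norm z / 2) j1 * moment_bound (norm z / 2) j2)"
      by (rule weak_potential.amp_coeff_bound[OF v harm[OF p(1)] A[OF p(1)] harm[OF p(2)] A[OF p(2)]]) (use z cstrip in blast)
    also have "\<dots> \<le> C0 * (moment_bound ((c + \<rho>) / 2) j1 * moment_bound ((c + \<rho>) / 2) j2)"
    proof (rule mult_mono[OF _ mm])
      have "newton_const / (2 * pi\<^sup>2) * (measure unit_ball (ball 0 1) * (2 * N * A\<^sup>2)) \<le> newton_const / (2 * pi\<^sup>2) * (measure unit_ball (ball 0 1) * (2 * 1 * A\<^sup>2))"
        using newton_const_pos N by (intro mult_left_mono mult_right_mono) auto
      then show "newton_const / (2 * pi\<^sup>2) * (measure unit_ball (ball 0 1) * (2 * N * A\<^sup>2)) \<le> C0" unfolding C0_def by simp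
    qed (use C0 in \<open>auto intro!: mult_nonneg_nonneg moment_bound_nonneg\<close>)
    finally show ?thesis unfolding bnd_def .
  qed
  show ?thesis
  proof (rule that[of D "card Ce"])
    show "D > 0" unfolding D_def using E by simp
    fix N :: real and X :: "'a set" and v :: "'a \<Rightarrow> real^3 \<Rightarrow> real" and n :: nat
    assume N: "N \<le> 1" and wp: "\<And>a. a \<in> X \<Longrightarrow> weak_potential (v a) N"
      and card: "(((2 ^ Suc n + 1)\<^sup>2) ^ (card Ce * n ^ 5) :: nat) < card X"
    let ?a = "\<lambda>a j1 p1 j2 p2. weak_potential.amp_coeff (v a) (Y j1 p1) (Y j2 p2)"
    define I where "I = Ce \<times> (SIGMA j1:{..<n}. {1..2*j1+1}) \<times> (SIGMA j2:{..<n}. {1..2*j2+1}) \<times> {..<n}"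
    \<comment> \<open>The Taylor coefficients are rescaled so that Cauchy's inequality bounds all of
      them by 1. The rounding is thereby relative to the natural size of each coefficient, which
      depends on the degrees.\<close>
    define t where "t a = (\<lambda>(c, (j1, p1), (j2, p2), l). (deriv ^^ l) (?a a j1 p1 j2 p2) (of_real c) / fact l * of_real (\<rho> ^ l / bnd c j1 j2))" for a
    have cS: "card (SIGMA j:{..<n}. {1..2*j+1}) = n\<^sup>2"
      by (subst card_SigmaI) (auto simp: sum_odd_numbers[symmetric])
    have cI: "card I = card Ce * n ^ 5"
      unfolding I_def card_cartesian_product cS by (simp add: power2_eq_square eval_nat_numeral)
    have fI: "finite I" unfolding I_def using Ce(2) by auto
    have hol: "?a a j1 p1 j2 p2 holomorphic_on strip" if "a \<in> X" "p1 \<in> {1..2*j1+1}" "p2 \<in> {1..2*j2+1}" for a j1 p1 j2 p2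
      by (rule weak_potential.amp_coeff_holomorphic[OF wp[OF that(1)] harm[OF that(2)] A[OF that(2)] harm[OF that(3)] A[OF that(3)]])
    have tb: "norm (t a i) \<le> 1" if a: "a \<in> X" and i: "i \<in> I" for a i
    proof -
      obtain c j1 p1 j2 p2 l where q: "i = (c, (j1, p1), (j2, p2), l)" by (cases i) auto
      have c: "c \<in> {s\<^sub>1..s\<^sub>2}" and p: "p1 \<in> {1..2*j1+1}" "p2 \<in> {1..2*j2+1}" using i Ce(1) unfolding I_def q by auto
      have "norm ((deriv ^^ l) (?a a j1 p1 j2 p2) (of_real c)) \<le> fact l * bnd c j1 j2 / \<rho> ^ l"
      proof (rule Cauchy_inequality)
        show "?a a j1 p1 j2 p2 holomorphic_on ball (of_real c) \<rho>"
          by (rule holomorphic_on_subset[OF hol[OF a p]]) (use cstrip ball_subset_cball in blast)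
        show "continuous_on (cball (of_real c) \<rho>) (?a a j1 p1 j2 p2)"
          by (rule continuous_on_subset[OF holomorphic_on_imp_continuous_on[OF hol[OF a p]] cstrip])
        show "norm (?a a j1 p1 j2 p2 x) \<le> bnd c j1 j2" if "norm (of_real c - x) = \<rho>" for x
          by (rule ab[OF wp[OF a] N c _ p]) (use that in \<open>simp add: dist_norm\<close>)
      qed (rule \<rho>(1))
      then have "norm ((deriv ^^ l) (?a a j1 p1 j2 p2) (of_real c)) * (\<rho> ^ l / bnd c j1 j2) / fact l \<le> (fact l * bnd c j1 j2 / \<rho> ^ l) * (\<rho> ^ l / bnd c j1 j2) / fact l"
        using bpos[OF c, of j1 j2] \<rho>(1) by (intro divide_right_mono mult_right_mono) auto
      then show ?thesis
        unfolding t_def q prod.case using bpos[OF c, of j1 j2] \<rho>(1) by (simp add: norm_mult norm_divide norm_power mult.commute[of "fact l"])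
    qed
    obtain a a' where aa: "a \<in> X" "a' \<in> X" "a \<noteq> a'" and close: "\<And>i. i \<in> I \<Longrightarrow> norm (t a i - t a' i) \<le> 2 / 2 ^ n"
      using pigeonhole_rounding[of I X t n] fI tb card unfolding cI by blast
    have "amp_norm Y \<sigma>\<^sub>1 \<sigma>\<^sub>2 s (\<lambda>\<theta> \<omega>. weak_potential.far_field (v a) (of_real s) \<theta> \<omega> - weak_potential.far_field (v a') (of_real s) \<theta> \<omega>)
         \<le> ennreal (sqrt (D * (6/7) ^ n))" if ss: "s \<in> {s\<^sub>1..s\<^sub>2}" for s
    proof -
      have s0: "s > 0" using ss s by simp
      from ss Ce(3) have "s \<in> (\<Union>c\<in>Ce. ball c (\<rho> / 2))" by blast
      then obtain c where cc: "c \<in> Ce" and "s \<in> ball c (\<rho> / 2)" by blast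
      then have "\<bar>s - c\<bar> \<le> \<rho> / 2" by (simp add: dist_real_def abs_minus_commute)
      note c = cc this
      have c': "c \<in> {s\<^sub>1..s\<^sub>2}" using c Ce(1) by blast
      have sc: "norm (complex_of_real s - of_real c) \<le> \<rho> / 2" using c(2) by (simp flip: of_real_diff)
      have sball: "complex_of_real s \<in> cball (of_real c) \<rho>" using sc \<rho>(1) by (simp add: dist_norm norm_minus_commute)
      let ?d = "\<lambda>j1 p1 j2 p2. ?a a j1 p1 j2 p2 (of_real s) - ?a a' j1 p1 j2 p2 (of_real s)"
      \<comment> \<open>In low degrees the shared rounded coefficients gain 2^(-n). In all others
        only the trivial bound is available and the gain must come from the degree itself.\<close>
      define \<eta> where "\<eta> j1 j2 = (if j1 < n \<and> j2 < n then 1 / 2 ^ n else 1 :: real)" for j1 j2 :: nat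
      have \<eta>0: "\<eta> j1 j2 \<ge> 0" for j1 j2 unfolding \<eta>_def by simp
      have dle: "norm (?d j1 p1 j2 p2) \<le> 8 * bnd c j1 j2 * \<eta> j1 j2" if p: "p1 \<in> {1..2*j1+1}" "p2 \<in> {1..2*j2+1}" for j1 p1 j2 p2
      proof (cases "j1 < n \<and> j2 < n")
        case True
        have "norm (?d j1 p1 j2 p2) \<le> 8 * bnd c j1 j2 / 2 ^ n"
        proof (rule holomorphic_close_of_taylor_close[OF hol[OF aa(1) p] hol[OF aa(2) p] cstrip \<rho>(1) bpos[OF c'] _ _ _ sc])
          show "norm (?a a j1 p1 j2 p2 z) \<le> bnd c j1 j2" if "z \<in> cball (of_real c) \<rho>" for z
            by (rule ab[OF wp[OF aa(1)] N c' that p])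
          show "norm (?a a' j1 p1 j2 p2 z) \<le> bnd c j1 j2" if "z \<in> cball (of_real c) \<rho>" for z
            by (rule ab[OF wp[OF aa(2)] N c' that p])
          fix l assume "l < n"
          then have "(c, (j1, p1), (j2, p2), l) \<in> I" unfolding I_def using c True p by auto
          from close[OF this] show "norm ((deriv ^^ l) (?a a j1 p1 j2 p2) (of_real c) / fact l * of_real (\<rho> ^ l / bnd c j1 j2) -
            (deriv ^^ l) (?a a' j1 p1 j2 p2) (of_real c) / fact l * of_real (\<rho> ^ l / bnd c j1 j2)) \<le> 2 / 2 ^ n"
            unfolding t_def prod.case .
        qed
        then show ?thesis using True unfolding \<eta>_def by simp
      next
        case False
        have "norm (?d j1 p1 j2 p2) \<le> bnd c j1 j2 + bnd c j1 j2"
          by (intro order_trans[OF norm_triangle_ineq4] add_mono ab[OF wp[OF aa(1)] N c' sball p] ab[OF wp[OF aa(2)] N c' sball p])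
        then show ?thesis using False bpos[OF c', of j1 j2] unfolding \<eta>_def by (simp only: if_False)
      qed
      have key: "((real (2*j1+1) / (exp 1 * s)) powr (real j1 + \<sigma>\<^sub>1) * (real (2*j2+1) / (exp 1 * s)) powr (real j2 + \<sigma>\<^sub>2) *
         norm (?d j1 p1 j2 p2))\<^sup>2 \<le> E * (6/7) ^ n * ((6/7) ^ j1 / real (2*j1+1) * ((6/7) ^ j2 / real (2*j2+1)))"
        if p: "p1 \<in> {1..2*j1+1}" "p2 \<in> {1..2*j2+1}" for j1 p1 j2 p2
      proof -
        define y1 where "y1 = real (2*j1+1)"
        define y2 where "y2 = real (2*j2+1)"
        define W1 where "W1 = (y1 / (exp 1 * s)) powr (real j1 + \<sigma>\<^sub>1)"
        define W2 where "W2 = (y2 / (exp 1 * s)) powr (real j2 + \<sigma>\<^sub>2)"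
        define m1 where "m1 = moment_bound ((c + \<rho>) / 2) j1"
        define m2 where "m2 = moment_bound ((c + \<rho>) / 2) j2"
        have y: "y1 \<ge> 1" "y2 \<ge> 1" unfolding y1_def y2_def by auto
        have W: "W1 \<ge> 0" "W2 \<ge> 0" unfolding W1_def W2_def by auto
        have m: "m1 > 0" "m2 > 0" unfolding m1_def m2_def using c' s \<rho> by (intro mbpos; simp)+
        have a1: "W1 * m1 \<le> K1 * (6/7) ^ j1 / y1"
          using K1(2)[OF c' ss c(2), of j1] y unfolding W1_def m1_def y1_def[symmetric] by (simp add: pos_le_divide_eq mult.commute)
        have a2: "W2 * m2 \<le> K2 * (6/7) ^ j2 / y2"
          using K2(2)[OF c' ss c(2), of j2] y unfolding W2_def m2_def y2_def[symmetric] by (simp add: pos_le_divide_eq mult.commute)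
        have "W1 * W2 * norm (?d j1 p1 j2 p2) \<le> W1 * W2 * (8 * bnd c j1 j2 * \<eta> j1 j2)"
          using dle[OF p] W by (intro mult_left_mono) auto
        also have "\<dots> = 8 * C0 * \<eta> j1 j2 * ((W1 * m1) * (W2 * m2))"
          unfolding bnd_def m1_def[symmetric] m2_def[symmetric] by (simp only: mult_ac)
        also have "\<dots> \<le> 8 * C0 * \<eta> j1 j2 * ((K1 * (6/7) ^ j1 / y1) * (K2 * (6/7) ^ j2 / y2))"
          using a1 a2 C0 \<eta>0 W m K1(1) y by (intro mult_left_mono mult_mono) auto
        also have "\<dots> = (8 * C0 * K1 * K2) * (\<eta> j1 j2 * (6/7) ^ (j1 + j2)) / (y1 * y2)"
          by (simp add: power_add)
        finally have le: "W1 * W2 * norm (?d j1 p1 j2 p2) \<le> (8 * C0 * K1 * K2) * (\<eta> j1 j2 * (6/7) ^ (j1 + j2)) / (y1 * y2)" .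
        have "(W1 * W2 * norm (?d j1 p1 j2 p2))\<^sup>2 \<le> ((8 * C0 * K1 * K2) * (\<eta> j1 j2 * (6/7) ^ (j1 + j2)) / (y1 * y2))\<^sup>2"
          using le W by (intro power_mono) auto
        also have "\<dots> = E * (\<eta> j1 j2 * (6/7) ^ (j1 + j2))\<^sup>2 / (y1 * y2)\<^sup>2"
          unfolding E_def by (simp only: power_divide power_mult_distrib)
        \<comment> \<open>The square provides (6/7)^(j1+j2) twice. One copy is kept for the
          summation over the degrees. The factor (6/7)^n comes from the other copy if one of the
          degrees is at least n, and from 4^(-n) otherwise. Likewise one factor y1 y2 of the
          denominator suffices for the summation.\<close>
        also have "\<dots> \<le> E * ((6/7) ^ n * (6/7) ^ (j1 + j2)) / (y1 * y2)"
        proof (intro frac_le mult_left_mono)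
          show "(\<eta> j1 j2 * (6/7) ^ (j1 + j2))\<^sup>2 \<le> (6/7) ^ n * (6/7) ^ (j1 + j2)"
          proof (cases "j1 < n \<and> j2 < n")
            case True
            have "(1 / 2 ^ n)\<^sup>2 \<le> (6/7 :: real) ^ n"
            proof -
              have "(1 / 2 ^ n)\<^sup>2 = ((1/4) ^ n :: real)" by (simp add: power_one_over power2_eq_square power_mult_distrib[symmetric])
              also have "\<dots> \<le> (6/7) ^ n" by (intro power_mono) auto
              finally show ?thesis .
            qed
            moreover have "((6/7 :: real) ^ (j1 + j2))\<^sup>2 \<le> (6/7) ^ (j1 + j2) * 1"
              unfolding power2_eq_square by (intro mult_left_mono power_le_one) auto
            ultimately have "(1 / 2 ^ n)\<^sup>2 * ((6/7 :: real) ^ (j1 + j2))\<^sup>2 \<le> (6/7) ^ n * ((6/7) ^ (j1 + j2) * 1)"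
              by (intro mult_mono) auto
            then show ?thesis using True unfolding \<eta>_def power_mult_distrib by simp
          next
            case False
            then have "n \<le> j1 + j2" by auto
            then have "(6/7 :: real) ^ (j1 + j2) \<le> (6/7) ^ n" by (intro power_decreasing) auto
            then have "(6/7 :: real) ^ (j1 + j2) * (6/7) ^ (j1 + j2) \<le> (6/7) ^ n * (6/7) ^ (j1 + j2)" by (intro mult_right_mono) auto
            moreover have "\<eta> j1 j2 = 1" unfolding \<eta>_def using False by (rule if_not_P)
            ultimately show ?thesis by (simp add: power2_eq_square)
          qed
          show "y1 * y2 \<le> (y1 * y2)\<^sup>2"
          proof -
            have "1 * 1 \<le> y1 * y2" using y by (intro mult_mono) auto
            then show ?thesis unfolding power2_eq_square by (intro mult_le_cancel_left1[THEN iffD2]) auto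
          qed
        qed (use E y in auto)
        finally show ?thesis
          unfolding W1_def W2_def y1_def y2_def by (simp add: power_add mult_ac)
      qed
      have "amp_norm Y \<sigma>\<^sub>1 \<sigma>\<^sub>2 s (\<lambda>\<theta> \<omega>. weak_potential.far_field (v a) (of_real s) \<theta> \<omega> - weak_potential.far_field (v a') (of_real s) \<theta> \<omega>)
         \<le> ennreal (sqrt (E * (6/7) ^ n * (1 / (1 - 6/7))\<^sup>2))"
      proof (rule amp_norm_le[OF _ _ _ s0])
        \<comment> \<open>The continuity statement is instantiated with the harmonic of degree 0 on
          both spheres; any pair from the basis would serve.\<close>
        have h0: "spherical_harmonic 0 (Y 0 1)" by (rule harm) simp
        show "continuous_on (sphere 0 1 \<times> sphere 0 1) (\<lambda>p. weak_potential.far_field (v a) (of_real s) (fst p) (snd p) - weak_potential.far_field (v a') (of_real s) (fst p) (snd p))"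
          by (rule sph_coeff_far_field_diff(2)[where Y = Y, OF wp[OF aa(1)] wp[OF aa(2)] h0 h0])
        fix j1 p1 j2 p2 :: nat assume p: "p1 \<in> {1..2*j1+1}" "p2 \<in> {1..2*j2+1}"
        show "((real (2*j1+1) / (exp 1 * s)) powr (real j1 + \<sigma>\<^sub>1) * (real (2*j2+1) / (exp 1 * s)) powr (real j2 + \<sigma>\<^sub>2) *
         cmod (sph_coeff Y (\<lambda>\<theta> \<omega>. weak_potential.far_field (v a) (of_real s) \<theta> \<omega> - weak_potential.far_field (v a') (of_real s) \<theta> \<omega>) j1 p1 j2 p2))\<^sup>2
         \<le> E * (6/7) ^ n * ((6/7) ^ j1 / real (2*j1+1) * ((6/7) ^ j2 / real (2*j2+1)))"
          unfolding sph_coeff_far_field_diff(1)[where Y = Y, OF wp[OF aa(1)] wp[OF aa(2)] harm[OF p(1)] harm[OF p(2)]] by (rule key[OF p])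
      qed (use E in auto)
      also have "E * (6/7) ^ n * (1 / (1 - 6/7))\<^sup>2 = D * (6/7) ^ n" unfolding D_def by (simp add: power2_eq_square)
      finally show ?thesis .
    qed
    then show "\<exists>a\<in>X. \<exists>a'\<in>X. a \<noteq> a' \<and> (\<forall>s\<in>{s\<^sub>1..s\<^sub>2}. amp_norm Y \<sigma>\<^sub>1 \<sigma>\<^sub>2 s
         (\<lambda>\<theta> \<omega>. weak_potential.far_field (v a) (of_real s) \<theta> \<omega> - weak_potential.far_field (v a') (of_real s) \<theta> \<omega>)
         \<le> ennreal (sqrt (D * (6/7) ^ n)))" using aa by blast
  qed
qed

text \<open>Take n about C X with X = \<open>\<epsilon> powr (- 1 / \<alpha>)\<close>, and M the
  integer part of \<open>\<epsilon> powr (- 1 / m)\<close>. The rounded data take at most 6 L n^6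
  bits, the cells offer M^3 bits, and the quotient of M^3 by X^6 is of order
  \<open>\<epsilon> powr (- \<delta>)\<close> with \<delta> > 0, so small \<epsilon> beats every
  constant.\<close>

lemma entropy_parameters:
  fixes m \<alpha> D N\<^sub>0 :: real and L :: nat
  assumes m: "m > 0" "\<alpha> > 2 * m" and D: "D > 0" and N0: "N\<^sub>0 > 0"
  obtains N where "0 < N" "N \<le> N\<^sub>0"
    "\<And>\<epsilon>. 0 < \<epsilon> \<Longrightarrow> \<epsilon> < N \<Longrightarrow> \<exists>n M. 1 \<le> M \<and> real M \<le> \<epsilon> powr (- 1 / m) \<and>
       sqrt (D * (6/7) ^ n) \<le> exp (- (\<epsilon> powr (- 1 / \<alpha>))) \<and>
       (((2 ^ Suc n + 1)\<^sup>2) ^ (L * n ^ 5) :: nat) < 2 ^ (M ^ 3)"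
proof -
  define \<delta> where "\<delta> = 3 / m - 6 / \<alpha>"
  have \<delta>: "\<delta> > 0" unfolding \<delta>_def using m by (simp add: field_simps)
  \<comment> \<open>This choice gives n ln(7/6) \<ge> (2 + |ln D|) X, hence D (6/7)^n \<le>
    exp(-2X), the square of the required bound.\<close>
  define C where "C = (2 + \<bar>ln D\<bar>) / ln (7/6)"
  have l76: "ln (7/6 :: real) > 0" by simp
  have C: "C > 0" unfolding C_def using l76 by (intro divide_pos_pos) auto
  \<comment> \<open>48 = 6 * 8: the 6 counts the bits of each rounded number relative to n, the 8
    comes from cubing Z/2 \<le> M. The sixth power bounds n^6 by that of (C + 1) X.\<close>
  define Q where "Q = 48 * (real L + 1) * (C + 1) ^ 6"
  have Q: "Q > 0" unfolding Q_def using C by simp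
  \<comment> \<open>The third bound on \<epsilon> is the requirement
    \<open>Q < \<epsilon> powr (- \<delta>)\<close> solved for \<epsilon>; \<epsilon> < 1 makes the
    negative powers at least 1.\<close>
  show ?thesis
  proof (rule that[of "min (min N\<^sub>0 1) (Q powr (- 1 / \<delta>))"])
    show "0 < min (min N\<^sub>0 1) (Q powr (- 1 / \<delta>))" using N0 Q by simp
    fix \<epsilon> :: real assume e0: "0 < \<epsilon>" and e: "\<epsilon> < min (min N\<^sub>0 1) (Q powr (- 1 / \<delta>))"
    define X where "X = \<epsilon> powr (- 1 / \<alpha>)"
    define Z where "Z = \<epsilon> powr (- 1 / m)"
    have ge1: "1 \<le> \<epsilon> powr (- 1 / y)" if "y > 0" for y
    proof -
      have "1 powr (1 / y) \<le> (1 / \<epsilon>) powr (1 / y)" using e e0 that by (intro powr_mono2) auto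
      also have "\<dots> = \<epsilon> powr (- 1 / y)" using e0 by (simp add: powr_divide powr_minus_divide)
      finally show ?thesis by simp
    qed
    have X: "X \<ge> 1" and Z: "Z \<ge> 1" unfolding X_def Z_def by (rule ge1; use m in simp)+
    define n where "n = nat \<lceil>C * X\<rceil>"
    define M where "M = nat \<lfloor>Z\<rfloor>"
    have CX: "C * X > 0" using C X by simp
    have n1: "n \<ge> 1" unfolding n_def using CX by linarith
    have nl: "C * X \<le> real n" unfolding n_def using CX by linarith
    have nu: "real n \<le> (C + 1) * X"
    proof -
      have "real n \<le> C * X + 1" unfolding n_def using CX by linarith
      then show ?thesis using X by (simp add: algebra_simps)
    qed
    have M1: "M \<ge> 1" and MZ: "real M \<le> Z" and "Z < real M + 1"
      unfolding M_def using Z by linarith+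
    then have Ml: "Z / 2 \<le> real M" by linarith
    have small: "sqrt (D * (6/7) ^ n) \<le> exp (- X)"
    proof -
      have "(2 + \<bar>ln D\<bar>) * X = C * X * ln (7/6)" unfolding C_def using l76 by simp
      also have "\<dots> \<le> real n * ln (7/6)" using nl l76 by (intro mult_right_mono) auto
      finally have 1: "(2 + \<bar>ln D\<bar>) * X \<le> real n * ln (7/6)" .
      have "\<bar>ln D\<bar> * 1 \<le> \<bar>ln D\<bar> * X" using X by (intro mult_left_mono) auto
      then have 2: "ln D - real n * ln (7/6) \<le> - (2 * X)" using 1 by (simp add: algebra_simps)
      have "(6/7 :: real) ^ n = exp (- (real n * ln (7/6)))"
      proof -
        have "(7/6 :: real) ^ n = exp (real n * ln (7/6))" by (simp only: exp_of_nat_mult) simp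
        moreover have "(6/7 :: real) ^ n = inverse ((7/6) ^ n)" using power_inverse[of "7/6 :: real" n] by simp
        ultimately show ?thesis by (simp only: exp_minus)
      qed
      moreover have "exp (ln D - real n * ln (7/6)) = exp (ln D) * exp (- (real n * ln (7/6)))" by (simp flip: exp_add)
      ultimately have "D * (6/7) ^ n = exp (ln D - real n * ln (7/6))" using D by simp
      also have "\<dots> \<le> exp (- (2 * X))" using 2 by simp
      also have "\<dots> = (exp (- X))\<^sup>2" using exp_double[of "- X"] by simp
      finally show ?thesis by (intro real_le_lsqrt) auto
    qed
    have big: "6 * real L * real n ^ 6 < real M ^ 3"
    proof -
      have "\<epsilon> powr \<delta> < (Q powr (- 1 / \<delta>)) powr \<delta>" using e e0 \<delta> by (intro powr_less_mono2) auto
      also have "\<dots> = 1 / Q" unfolding powr_powr using \<delta> Q by (simp add: powr_minus_divide)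
      finally have "Q < \<epsilon> powr (- \<delta>)" using Q e0 by (simp add: powr_minus_divide field_simps)
      then have "Q * X ^ 6 < \<epsilon> powr (- \<delta>) * X ^ 6" using X by (intro mult_strict_right_mono) auto
      also have "\<dots> = Z ^ 3"
      proof -
        have "X ^ 6 = \<epsilon> powr (6 * (- 1 / \<alpha>))" unfolding X_def using e0 powr_power[of \<epsilon> "- 1 / \<alpha>" 6] by (simp add: mult.commute)
        moreover have "Z ^ 3 = \<epsilon> powr (3 * (- 1 / m))" unfolding Z_def using e0 powr_power[of \<epsilon> "- 1 / m" 3] by (simp add: mult.commute)
        moreover have "- \<delta> + 6 * (- 1 / \<alpha>) = 3 * (- 1 / m)" unfolding \<delta>_def by simp
        ultimately show ?thesis by (simp only: powr_add[symmetric])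
      qed
      also have "\<dots> = 8 * (Z / 2) ^ 3" by (simp add: power_divide)
      also have "\<dots> \<le> 8 * real M ^ 3" using Ml Z by (intro mult_left_mono power_mono) auto
      finally have 1: "Q * X ^ 6 < 8 * real M ^ 3" .
      have "6 * real L * real n ^ 6 \<le> 6 * (real L + 1) * ((C + 1) * X) ^ 6"
        using nu by (intro mult_mono power_mono) auto
      also have "\<dots> = Q * X ^ 6 / 8" unfolding Q_def by (simp add: power_mult_distrib)
      finally show ?thesis using 1 by simp
    qed
    have count: "(((2 ^ Suc n + 1)\<^sup>2) ^ (L * n ^ 5) :: nat) < 2 ^ (M ^ 3)"
    proof -
      \<comment> \<open>Each real part takes at most 2^(n+2) values, which is at most 2^(3n) because
        n \<ge> 1.\<close>
      have "(2 :: nat) ^ Suc n + 1 \<le> 2 ^ (n + 2)" by simp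
      also have "\<dots> \<le> 2 ^ (3 * n)" using n1 by (intro power_increasing) auto
      finally have "((2 ^ Suc n + 1)\<^sup>2 :: nat) ^ (L * n ^ 5) \<le> ((2 ^ (3 * n))\<^sup>2) ^ (L * n ^ 5)"
        by (intro power_mono) auto
      also have "\<dots> = 2 ^ (3 * n * 2 * (L * n ^ 5))" by (simp only: power_mult)
      also have "3 * n * 2 * (L * n ^ 5) = 6 * L * n ^ 6" using power_Suc[of n 5] by simp
      also have "(2 :: nat) ^ (6 * L * n ^ 6) < 2 ^ (M ^ 3)"
      proof (rule power_strict_increasing)
        have "real (6 * L * n ^ 6) < real (M ^ 3)" using big by simp
        then show "6 * L * n ^ 6 < M ^ 3" by (simp only: of_nat_less_iff)
      qed simp
      finally show ?thesis .
    qed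
    show "\<exists>n M. 1 \<le> M \<and> real M \<le> \<epsilon> powr (- 1 / m) \<and>
       sqrt (D * (6/7) ^ n) \<le> exp (- (\<epsilon> powr (- 1 / \<alpha>))) \<and>
       (((2 ^ Suc n + 1)\<^sup>2) ^ (L * n ^ 5) :: nat) < 2 ^ (M ^ 3)"
      using M1 MZ small count unfolding X_def Z_def by blast
  qed auto
qed

text \<open>Both potentials are members of one finite family of perturbations of the given one.
  Smoothness, support, distance to the given potential and mutual separation hold for any two
  distinct members; only the closeness of the amplitudes requires the pair to be selected.\<close>

theorem theorem2p2:
  fixes s\<^sub>1 s\<^sub>2 m \<alpha> \<sigma>\<^sub>1 \<sigma>\<^sub>2 :: real
    and Y :: "nat \<Rightarrow> nat \<Rightarrow> real^3 \<Rightarrow> complex"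
  assumes "0 < s\<^sub>1" and "s\<^sub>1 \<le> s\<^sub>2" and "m > 0" and "\<alpha> > 2 * m"
    and "spherical_harmonic_basis Y"
  shows "\<exists>\<beta>>0. \<exists>N>0. \<forall>v\<^sub>0 \<in> C_m m (ball 0 1).
           Linf_norm (ball 0 1) v\<^sub>0 \<le> ereal N \<longrightarrow> supp v\<^sub>0 \<subseteq> ball 0 (1/2) \<longrightarrow>
           (\<forall>\<epsilon>\<in>{0<..<N}.
              \<exists>v\<^sub>1 \<in> C_m m (ball 0 1). \<exists>v\<^sub>2 \<in> C_m m (ball 0 1).
                supp v\<^sub>1 \<subseteq> ball 0 (1/2) \<and> supp v\<^sub>2 \<subseteq> ball 0 (1/2) \<and>
                (\<exists>f\<^sub>1 f\<^sub>2.
                   scattering_amplitude v\<^sub>1 f\<^sub>1 \<and> scattering_amplitude v\<^sub>2 f\<^sub>2 \<and>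
                   (SUP s\<in>{s\<^sub>1..s\<^sub>2}. amp_norm Y \<sigma>\<^sub>1 \<sigma>\<^sub>2 s (\<lambda>\<theta> \<omega>. f\<^sub>1 \<theta> \<omega> s - f\<^sub>2 \<theta> \<omega> s))
                     \<le> ennreal (exp (- (\<epsilon> powr (- 1 / \<alpha>))))) \<and>
                Linf_norm (ball 0 1) (\<lambda>x. v\<^sub>1 x - v\<^sub>2 x) \<ge> ereal \<epsilon> \<and>
                (\<forall>v\<in>{v\<^sub>1, v\<^sub>2}.
                   Linf_norm (ball 0 1) (\<lambda>x. v x - v\<^sub>0 x) \<le> ereal \<epsilon> \<and>
                   C_m_norm m (ball 0 1) (\<lambda>x. v x - v\<^sub>0 x) \<le> ennreal \<beta>))"
proof (rule amplitude_pigeonhole[where 'a = "(nat \<times> nat \<times> nat) set", OF assms(1,2,5), of \<sigma>\<^sub>1 \<sigma>\<^sub>2])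
  fix D :: real and L :: nat
  assume D: "D > 0" and pigeon: "\<And>N (X :: (nat \<times> nat \<times> nat) set set) v n.
       N \<le> 1 \<Longrightarrow> (\<And>A. A \<in> X \<Longrightarrow> weak_potential (v A) N) \<Longrightarrow>
       (((2 ^ Suc n + 1)\<^sup>2) ^ (L * n ^ 5) :: nat) < card X \<Longrightarrow>
       \<exists>A\<in>X. \<exists>A'\<in>X. A \<noteq> A' \<and> (\<forall>s\<in>{s\<^sub>1..s\<^sub>2}. amp_norm Y \<sigma>\<^sub>1 \<sigma>\<^sub>2 s
         (\<lambda>\<theta> \<omega>. weak_potential.far_field (v A) (of_real s) \<theta> \<omega> - weak_potential.far_field (v A') (of_real s) \<theta> \<omega>)
         \<le> ennreal (sqrt (D * (6/7) ^ n)))"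
  define k where "k = nat \<lfloor>m\<rfloor>"
  obtain B where B: "B > 0" and Bn: "\<And>\<epsilon> l A. finite A \<Longrightarrow> \<epsilon> \<ge> 0 \<Longrightarrow> l \<ge> 1 \<Longrightarrow>
      C_m_norm m (ball 0 1) (bump_sum (k + 2) \<epsilon> l A) \<le> ennreal (B * (\<epsilon> * l powr m))"
    using bump_sum_C_m_norm[OF assms(3), of "ball 0 1"] unfolding k_def by blast
  \<comment> \<open>The bumps are scaled by l = 16 M and \<epsilon> M^m is at most 1, which leaves
    the factor 16^m.\<close>
  define \<beta> where "\<beta> = B * 16 powr m"
  define K where "K = newton_const * newton_mass"
  have K: "K \<ge> 0" unfolding K_def newton_mass_def using newton_const_pos by simp
  \<comment> \<open>The given potential and the bumps are each bounded by N, so the family is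
    bounded by 2N. The bound 1/2 gives 2N \<le> 1, and 1/(8(K+1)) gives the contraction condition of
    \<open>weak_potential\<close> for 2N.\<close>
  define N\<^sub>0 where "N\<^sub>0 = min (1/2) (1 / (8 * (K + 1)))"
  have N0: "N\<^sub>0 > 0" unfolding N\<^sub>0_def using K by simp
  obtain N where N: "0 < N" "N \<le> N\<^sub>0" and par: "\<And>\<epsilon>. 0 < \<epsilon> \<Longrightarrow> \<epsilon> < N \<Longrightarrow> \<exists>n M. 1 \<le> M \<and> real M \<le> \<epsilon> powr (- 1 / m) \<and>
       sqrt (D * (6/7) ^ n) \<le> exp (- (\<epsilon> powr (- 1 / \<alpha>))) \<and>
       (((2 ^ Suc n + 1)\<^sup>2) ^ (L * n ^ 5) :: nat) < 2 ^ (M ^ 3)"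
    using entropy_parameters[OF assms(3,4) D N0, of L] by blast
  have N1: "2 * N \<le> 1" using N unfolding N\<^sub>0_def by simp
  have Nsmall: "4 * newton_const * newton_mass * (2 * N) \<le> 1"
  proof -
    have "8 * K * N \<le> 8 * (K + 1) * N\<^sub>0" using K N by (intro mult_mono) auto
    also have "\<dots> \<le> 8 * (K + 1) * (1 / (8 * (K + 1)))" unfolding N\<^sub>0_def using K by (intro mult_left_mono) auto
    also have "\<dots> = 1" using K by simp
    finally show ?thesis unfolding K_def by (simp only: mult_ac)
  qed
  have "\<exists>v\<^sub>1 \<in> C_m m (ball 0 1). \<exists>v\<^sub>2 \<in> C_m m (ball 0 1).
      supp v\<^sub>1 \<subseteq> ball 0 (1/2) \<and> supp v\<^sub>2 \<subseteq> ball 0 (1/2) \<and>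
      (\<exists>f\<^sub>1 f\<^sub>2. scattering_amplitude v\<^sub>1 f\<^sub>1 \<and> scattering_amplitude v\<^sub>2 f\<^sub>2 \<and>
        (SUP s\<in>{s\<^sub>1..s\<^sub>2}. amp_norm Y \<sigma>\<^sub>1 \<sigma>\<^sub>2 s (\<lambda>\<theta> \<omega>. f\<^sub>1 \<theta> \<omega> s - f\<^sub>2 \<theta> \<omega> s))
          \<le> ennreal (exp (- (\<epsilon> powr (- 1 / \<alpha>))))) \<and>
      Linf_norm (ball 0 1) (\<lambda>x. v\<^sub>1 x - v\<^sub>2 x) \<ge> ereal \<epsilon> \<and>
      (\<forall>v\<in>{v\<^sub>1, v\<^sub>2}. Linf_norm (ball 0 1) (\<lambda>x. v x - v\<^sub>0 x) \<le> ereal \<epsilon> \<and>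
         C_m_norm m (ball 0 1) (\<lambda>x. v x - v\<^sub>0 x) \<le> ennreal \<beta>)"
    if v0: "v\<^sub>0 \<in> C_m m (ball 0 1)" "Linf_norm (ball 0 1) v\<^sub>0 \<le> ereal N" "supp v\<^sub>0 \<subseteq> ball 0 (1/2)"
      and eps: "\<epsilon> \<in> {0<..<N}" for v\<^sub>0 \<epsilon>
  proof -
    have e: "0 < \<epsilon>" "\<epsilon> < N" using eps by auto
    obtain n M where M: "1 \<le> M" "real M \<le> \<epsilon> powr (- 1 / m)"
      and nsm: "sqrt (D * (6/7) ^ n) \<le> exp (- (\<epsilon> powr (- 1 / \<alpha>)))"
      and count: "(((2 ^ Suc n + 1)\<^sup>2) ^ (L * n ^ 5) :: nat) < 2 ^ (M ^ 3)"
      using par[OF e] by blast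
    \<comment> \<open>The M^3 cells; the family is indexed by their subsets.\<close>
    define U where "U = {..<M} \<times> {..<M} \<times> {..<M}"
    have cU: "card (Pow U) = 2 ^ (M ^ 3)"
      unfolding U_def by (simp add: card_Pow card_cartesian_product power3_eq_cube)
    have fin: "finite A" if "A \<in> Pow U" for A using that unfolding U_def by (auto intro: finite_subset)
    define w where "w = bump_sum (k + 2) \<epsilon> (16 * real M)"
    define v where "v A = (\<lambda>x. v\<^sub>0 x + w A x)" for A
    have C0: "C_k_on k (ball 0 1) v\<^sub>0" "C_m_norm m (ball 0 1) v\<^sub>0 < \<infinity>" using v0(1) unfolding C_m_def k_def by auto
    have v0c: "continuous_on UNIV v\<^sub>0" and v0z: "\<And>x. 1/2 \<le> norm x \<Longrightarrow> v\<^sub>0 x = 0"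
      using C_0_supp_continuous[OF _ v0(3)] C_k_on_mono[OF C0(1), of 0] by (auto simp: C_k_on_0_iff)
    have v0b: "\<bar>v\<^sub>0 x\<bar> \<le> N" for x
    proof (cases "norm x < 1/2")
      case True
      then have "ereal \<bar>v\<^sub>0 x\<bar> \<le> ereal N" using order_trans[OF continuous_le_Linf_norm[OF v0c, of x] v0(2)] by simp
      then show ?thesis by simp
    next
      case False
      then show ?thesis using v0z[of x] N(1) by simp
    qed
    have wC: "C_k_on k UNIV (w A)" if "A \<in> Pow U" for A unfolding w_def by (rule bump_sum_C_k_on) (use fin[OF that] in auto)
    have wc: "continuous_on UNIV (w A)" if "A \<in> Pow U" for A
      using C_k_on_mono[OF wC[OF that], of 0] by (simp add: C_k_on_0_iff)
    have wb: "\<bar>w A x\<bar> \<le> \<epsilon>" if "A \<in> Pow U" for A x unfolding w_def by (rule bump_sum_le) (use fin[OF that] e in auto)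
    have wz: "w A x = 0" if "A \<in> Pow U" "7/16 \<le> norm x" for A x
      unfolding w_def by (rule bump_sum_supp) (use that M in \<open>auto simp: U_def\<close>)
    have wn: "C_m_norm m (ball 0 1) (w A) \<le> ennreal \<beta>" if "A \<in> Pow U" for A
    proof -
      have "C_m_norm m (ball 0 1) (w A) \<le> ennreal (B * (\<epsilon> * (16 * real M) powr m))"
        unfolding w_def by (rule Bn) (use fin[OF that] e M in auto)
      also have "\<dots> \<le> ennreal \<beta>"
      proof (rule ennreal_leI)
        \<comment> \<open>The upper bound on M balances height against mesh: the bumps are just
          small enough in the supremum norm for their m-th derivatives to stay bounded.\<close>
        have "\<epsilon> * real M powr m \<le> \<epsilon> * (\<epsilon> powr (- 1 / m)) powr m"
          using M assms(3) e by (intro mult_left_mono powr_mono2) auto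
        also have "\<dots> = 1" unfolding powr_powr using assms(3) e by (simp add: powr_minus_divide)
        finally have "B * 16 powr m * (\<epsilon> * real M powr m) \<le> B * 16 powr m * 1" using B by (intro mult_left_mono) auto
        then show "B * (\<epsilon> * (16 * real M) powr m) \<le> \<beta>" unfolding \<beta>_def by (simp add: powr_mult mult_ac)
      qed
      finally show ?thesis .
    qed
    have vw: "weak_potential (v A) (2 * N)" if A: "A \<in> Pow U" for A
    proof
      show "continuous_on UNIV (v A)" unfolding v_def by (intro continuous_intros v0c wc[OF A])
      show "v A x = 0" if "1/2 \<le> norm x" for x unfolding v_def using v0z[OF that] wz[OF A, of x] that by simp
      show "\<bar>v A x\<bar> \<le> 2 * N" for x unfolding v_def using v0b[of x] wb[OF A, of x] e by linarith
    qed (rule Nsmall)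
    have vC: "v A \<in> C_m m (ball 0 1)" if A: "A \<in> Pow U" for A
    proof -
      have wb: "C_k_on k (ball 0 1) (w A)" using wC[OF A] unfolding C_k_on_def by (auto intro: continuous_on_subset)
      have "C_m_norm m (ball 0 1) (v A) \<le> C_m_norm m (ball 0 1) v\<^sub>0 + C_m_norm m (ball 0 1) (w A)"
        unfolding v_def by (rule C_m_norm_add) (use C0(1) wb in \<open>auto simp: k_def\<close>)
      also have "\<dots> < \<infinity>" using C0(2) le_less_trans[OF wn[OF A] ennreal_less_top] by simp
      finally show ?thesis unfolding C_m_def using C_k_on_add_open[OF open_ball C0(1) wb] by (simp add: v_def k_def)
    qed
    have vs: "supp (v A) \<subseteq> ball 0 (1/2)" if A: "A \<in> Pow U" for A
    proof -
      \<comment> \<open>The bumps lie in the closed ball of radius 7/16, so taking the closure in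
        the support does not leave the open ball of radius 1/2.\<close>
      have "{x. v A x \<noteq> 0} \<subseteq> supp v\<^sub>0 \<union> cball 0 (7/16)"
      proof
        fix x assume "x \<in> {x. v A x \<noteq> 0}"
        then have "v\<^sub>0 x \<noteq> 0 \<or> norm x < 7/16" using wz[OF A, of x] unfolding v_def by fastforce
        then show "x \<in> supp v\<^sub>0 \<union> cball 0 (7/16)" using closure_subset[of "{x. v\<^sub>0 x \<noteq> 0}"] unfolding supp_def by auto
      qed
      moreover have "closed (supp v\<^sub>0 \<union> cball 0 (7/16))" unfolding supp_def by auto
      ultimately have "supp (v A) \<subseteq> supp v\<^sub>0 \<union> cball 0 (7/16)" unfolding supp_def[of "v A"] by (rule closure_minimal)
      moreover have "cball (0::real^3) (7/16) \<subseteq> ball 0 (1/2)" by auto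
      ultimately show ?thesis using v0(3) by blast
    qed
    \<comment> \<open>There are more subsets of the cells than values of the rounded data.\<close>
    have "\<exists>A\<in>Pow U. \<exists>A'\<in>Pow U. A \<noteq> A' \<and> (\<forall>s\<in>{s\<^sub>1..s\<^sub>2}. amp_norm Y \<sigma>\<^sub>1 \<sigma>\<^sub>2 s
         (\<lambda>\<theta> \<omega>. weak_potential.far_field (v A) (of_real s) \<theta> \<omega> - weak_potential.far_field (v A') (of_real s) \<theta> \<omega>)
         \<le> ennreal (sqrt (D * (6/7) ^ n)))"
      by (rule pigeon[OF N1 vw]) (use count cU in auto)
    then obtain A A' where A: "A \<in> Pow U" "A' \<in> Pow U" "A \<noteq> A'"
      and close: "\<And>s. s \<in> {s\<^sub>1..s\<^sub>2} \<Longrightarrow> amp_norm Y \<sigma>\<^sub>1 \<sigma>\<^sub>2 s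
         (\<lambda>\<theta> \<omega>. weak_potential.far_field (v A) (of_real s) \<theta> \<omega> - weak_potential.far_field (v A') (of_real s) \<theta> \<omega>)
         \<le> ennreal (sqrt (D * (6/7) ^ n))" by (elim bexE conjE) simp
    define f where "f A = (\<lambda>\<theta> \<omega> s. weak_potential.far_field (v A) (complex_of_real s) \<theta> \<omega>)" for A
    have sc: "scattering_amplitude (v A) (f A)" if "A \<in> Pow U" for A
      unfolding f_def by (rule weak_potential.scattering_amplitude_far_field[OF vw[OF that]])
    have sup: "(SUP s\<in>{s\<^sub>1..s\<^sub>2}. amp_norm Y \<sigma>\<^sub>1 \<sigma>\<^sub>2 s (\<lambda>\<theta> \<omega>. f A \<theta> \<omega> s - f A' \<theta> \<omega> s))
          \<le> ennreal (exp (- (\<epsilon> powr (- 1 / \<alpha>))))"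
      unfolding f_def by (intro SUP_least order_trans[OF close ennreal_leI[OF nsm]])
    have diff: "ereal \<epsilon> \<le> Linf_norm (ball 0 1) (\<lambda>x. v A x - v A' x)"
    proof -
      \<comment> \<open>At the centre of a cell belonging to exactly one of the two sets, one bump
        sum is \<epsilon> and the other 0; this single point bounds the essential supremum from
        below because the difference is continuous.\<close>
      obtain c where c: "(c \<in> A) \<noteq> (c \<in> A')" using A(3) by blast
      then have cU': "c \<in> {..<M} \<times> {..<M} \<times> {..<M}" using A unfolding U_def by blast
      define x where "x = (1 / (16 * real M)) *\<^sub>R cell_centre c"
      have "norm x \<le> 6/16" unfolding x_def using cell_centre_norm[OF cU'] M by (simp add: field_simps)
      then have x: "x \<in> ball 0 1" by simp
      have wx: "w A x = (if c \<in> A then \<epsilon> else 0)" if "A \<in> Pow U" for A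
        unfolding w_def x_def by (rule bump_sum_at_centre) (use fin[OF that] M in auto)
      have "\<bar>v A x - v A' x\<bar> = \<epsilon>" unfolding v_def using wx[OF A(1)] wx[OF A(2)] c e by (auto split: if_splits)
      moreover have "continuous_on UNIV (\<lambda>x. v A x - v A' x)" unfolding v_def by (intro continuous_intros v0c wc A)
      ultimately show ?thesis using continuous_le_Linf_norm[OF _ x, of "\<lambda>x. v A x - v A' x"] by simp
    qed
    have near: "Linf_norm (ball 0 1) (\<lambda>x. v A x - v\<^sub>0 x) \<le> ereal \<epsilon> \<and> C_m_norm m (ball 0 1) (\<lambda>x. v A x - v\<^sub>0 x) \<le> ennreal \<beta>"
      if "A \<in> Pow U" for A
    proof -
      have "(\<lambda>x. v A x - v\<^sub>0 x) = w A" unfolding v_def by simp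
      then show ?thesis using Linf_norm_le[OF wc[OF that] wb[OF that]] wn[OF that] by simp
    qed
    have "\<forall>u\<in>{v A, v A'}. Linf_norm (ball 0 1) (\<lambda>x. u x - v\<^sub>0 x) \<le> ereal \<epsilon> \<and>
         C_m_norm m (ball 0 1) (\<lambda>x. u x - v\<^sub>0 x) \<le> ennreal \<beta>" using near[OF A(1)] near[OF A(2)] by blast
    then show ?thesis
      by (intro bexI[OF _ vC[OF A(1)]] bexI[OF _ vC[OF A(2)]] conjI vs A(1) A(2) exI[of _ "f A"] exI[of _ "f A'"] sc sup diff)
  qed
  moreover have "\<beta> > 0" unfolding \<beta>_def using B by simp
  ultimately show ?thesis using N(1) by (intro exI[of _ \<beta>] exI[of _ N] conjI ballI impI)
qed

end
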